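(* Let $\mathbb P$ be an invariant ergodic probability measure for the Teichmüller flow on a connected component $\mathcal H$ of a stratum of area-one abelian differentials. For $\mathbb P$-almost every $\mathbf X\in\mathcal H$ there exists a dense set $T_{atom}\subset\mathbb R$ such that if $\tau\in T_{atom}$, then for any $\Phi^+\in\mathfrak B^+(\mathbf X)$, $\Phi^+\ne0$, the measure $\mathfrak m[\Phi^+,\tau]$ admits atoms.
   Context: Abelian differentials and flows. Let $\rho\ge 2$. An abelian differential $\mathbf X=(M,\omega)$ is a compact Riemann surface $M$ of genus $\rho$ with a nonzero holomorphic one-form $\omega$, normalized by $\nu(M)=1$, where $\nu=\frac{i}{2}\,\omega\wedge\overline\omega$. The vertical flow $h_t^+$ is the unit-speed flow along which $\Re\omega=0$ and $\Im\omega$ increases; the horizontal flow $h_t^-$ is the unit-speed flow along which $\Im\omega=0$ and $\Re\omega$ increases. They are defined as long as the orbit does not meet a zero of $\omega$; all conditions are understood where the flow arcs are defined. For $t_1,t_2>0$ the set $\Pi(x,t_1,t_2)=\{h^+_{\tau_1}h^-_{\tau_2}x:\ 0\le\tau_1<t_1,\ 0\le\tau_2<t_2\}$ is an admissible rectangle if it is embedded and its closure contains no zeros of $\omega$. Cocycles. $\mathfrak B^+(\mathbf X)$ is the space of real-valued functions $\Phi^+(x,t)$, $x\in M,t\in\mathbb R$, with: (1) $\Phi^+(x,t+s)=\Phi^+(x,t)+\Phi^+(h_t^+x,s)$; (2) there are $t_0>0,\theta>0$ with $|\Phi^+(x,t)|\le|t|^\theta$ for all $x$ and $|t|<t_0$;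 (3) $\Phi^+(x,t_1)=\Phi^+(h^-_{t_2}x,t_1)$ whenever $\Pi(x,t_1,t_2)$ is admissible. Distributions. For $\Phi^+\in\mathfrak B^+(\mathbf X)$, $\mathfrak m[\Phi^+,\tau]$ is the distribution of the real-valued random variable $\Phi^+(x,\tau)/\sqrt{Var_\nu\Phi^+(x,\tau)}$, with $x$ distributed according to $\nu$, where $Var_\nu$ is the variance with respect to $\nu$. Moduli space. For $\kappa=(\kappa_1,\dots,\kappa_\sigma)$, $\sum\kappa_i=2\rho-2$, $\mathcal M_\kappa$ is the moduli space of area-one abelian differentials with zeros of orders $\kappa_i$; $\mathcal H$ is a connected component. The Teichmüller flow is $\mathbf g_s(M,\omega)=(M,e^s\Re\omega+ie^{-s}\Im\omega)$ (with the complex structure making the new form holomorphic). *)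

theory Defs
  imports
    "HOL-Probability.Probability"
    "HOL-Complex_Analysis.Complex_Analysis"
    "HOL-Homology.Homology"
    "HOL-Algebra.Free_Abelian_Groups"
begin

section \<open>Riemann surfaces with a holomorphic one-form\<close>

text \<open>
  A chart is a pair of a domain and a coordinate function; values of the coordinate
  outside the domain are irrelevant. A one-form is given by its coefficients: in the
  chart \<open>c\<close> with coordinate \<open>z\<close>, the form \<open>\<omega>\<close> is \<open>coef X c z dz\<close>.
\<close>

type_synonym 'a chart = "'a set \<times> ('a \<Rightarrow> complex)"

record 'a surface_form =
  surf :: "'a topology"
  charts :: "'a chart set"
  coef :: "'a chart \<Rightarrow> complex \<Rightarrow> complex"

abbreviation dom_of :: "'a chart \<Rightarrow> 'a set" where "dom_of c \<equiv> fst c"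
abbreviation coord :: "'a chart \<Rightarrow> 'a \<Rightarrow> complex" where "coord c \<equiv> snd c"

definition param :: "'a chart \<Rightarrow> complex \<Rightarrow> 'a" where
  "param c = inv_into (dom_of c) (coord c)"

definition is_chart :: "'a topology \<Rightarrow> 'a chart \<Rightarrow> bool" where
  "is_chart T c \<longleftrightarrow>
     openin T (dom_of c) \<and> open (coord c ` dom_of c) \<and>
     homeomorphic_map (subtopology T (dom_of c)) (top_of_set (coord c ` dom_of c)) (coord c)"

definition compact_riemann_surface :: "'a topology \<Rightarrow> 'a chart set \<Rightarrow> bool" where
  "compact_riemann_surface T A \<longleftrightarrow>
     Hausdorff_space T \<and> connected_space T \<and> compact_space T \<and>
     (\<forall>c\<in>A. is_chart T c) \<and> (\<Union>c\<in>A. dom_of c) = topspace T \<and>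
     (\<forall>c\<in>A. \<forall>d\<in>A. (coord d \<circ> param c) holomorphic_on (coord c ` (dom_of c \<inter> dom_of d)))"

text \<open>\<open>H\<^sub>1(M; \<int>)\<close> is free abelian of rank twice the genus.\<close>

definition has_genus :: "'a topology \<Rightarrow> nat \<Rightarrow> bool" where
  "has_genus T \<rho> \<longleftrightarrow> homology_group 1 T \<cong> free_Abelian_group {..<2 * \<rho>}"

definition holomorphic_form :: "'a surface_form \<Rightarrow> bool" where
  "holomorphic_form X \<longleftrightarrow>
     (\<forall>c\<in>charts X. coef X c holomorphic_on (coord c ` dom_of c)) \<and>
     (\<forall>c\<in>charts X. \<forall>d\<in>charts X. \<forall>z\<in>coord c ` (dom_of c \<inter> dom_of d).
        coef X c z = coef X d ((coord d \<circ> param c) z) * deriv (coord d \<circ> param c) z)"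

definition nonzero_form :: "'a surface_form \<Rightarrow> bool" where
  "nonzero_form X \<longleftrightarrow> (\<exists>c\<in>charts X. \<exists>p\<in>dom_of c. coef X c (coord c p) \<noteq> 0)"

definition form_zeros :: "'a surface_form \<Rightarrow> 'a set" where
  "form_zeros X = {p \<in> topspace (surf X). \<exists>c\<in>charts X. p \<in> dom_of c \<and> coef X c (coord c p) = 0}"

text \<open>
  The area \<open>\<nu> = (i/2) \<omega> \<and> cnj \<omega>\<close>, as a Borel measure: if \<open>\<omega> = f dz\<close> and \<open>z = x + iy\<close>
  in a chart, then \<open>\<nu> = |f|\<^sup>2 dx dy\<close> there.
\<close>

definition area_measure :: "'a surface_form \<Rightarrow> 'a measure" where
  "area_measure X = (THE \<nu>.
     space \<nu> = topspace (surf X) \<and>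
     sets \<nu> = sigma_sets (topspace (surf X)) {U. openin (surf X) U} \<and>
     (\<forall>c\<in>charts X. \<forall>A\<in>sets \<nu>. A \<subseteq> dom_of c \<longrightarrow>
        emeasure \<nu> A =
          (\<integral>\<^sup>+ z. ennreal ((cmod (coef X c z))\<^sup>2) * indicator (coord c ` A) z \<partial>lborel)))"

definition abelian_differential :: "nat \<Rightarrow> 'a surface_form \<Rightarrow> bool" where
  "abelian_differential \<rho> X \<longleftrightarrow>
     compact_riemann_surface (surf X) (charts X) \<and> has_genus (surf X) \<rho> \<and>
     holomorphic_form X \<and> nonzero_form X \<and>
     emeasure (area_measure X) (topspace (surf X)) = 1"

text \<open>\<open>local_primitive X U F\<close>: the function \<open>F\<close> is holomorphic on the open set \<open>U\<close> and \<open>dF = \<omega>\<close> there.\<close>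

definition local_primitive :: "'a surface_form \<Rightarrow> 'a set \<Rightarrow> ('a \<Rightarrow> complex) \<Rightarrow> bool" where
  "local_primitive X U F \<longleftrightarrow>
     openin (surf X) U \<and>
     (\<forall>c\<in>charts X. \<forall>p\<in>U \<inter> dom_of c.
        ((F \<circ> param c) has_field_derivative coef X c (coord c p)) (at (coord c p)))"

section \<open>Vertical and horizontal flow, admissible rectangles\<close>

text \<open>
  \<open>flow_arc X v t \<gamma>\<close>: on the segment between \<open>0\<close> and \<open>t\<close> (\<open>t\<close> may be negative) the curve \<open>\<gamma>\<close>
  avoids the zeros of \<open>\<omega>\<close> and satisfies \<open>\<omega>(\<gamma>') = v\<close>. For \<open>v = i\<close> this says \<open>Re \<omega>(\<gamma>') = 0\<close>,
  \<open>Im \<omega>(\<gamma>') = 1\<close> (vertical flow), for \<open>v = 1\<close> it says \<open>Im \<omega>(\<gamma>') = 0\<close>, \<open>Re \<omega>(\<gamma>') = 1\<close>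
  (horizontal flow).
\<close>

definition flow_arc :: "'a surface_form \<Rightarrow> complex \<Rightarrow> real \<Rightarrow> (real \<Rightarrow> 'a) \<Rightarrow> bool" where
  "flow_arc X v t \<gamma> \<longleftrightarrow>
     continuous_map (top_of_set (closed_segment 0 t)) (surf X) \<gamma> \<and>
     (\<forall>s\<in>closed_segment 0 t. \<gamma> s \<notin> form_zeros X \<and>
        (\<forall>c\<in>charts X. \<gamma> s \<in> dom_of c \<longrightarrow>
           (\<exists>w. ((coord c \<circ> \<gamma>) has_vector_derivative w) (at s within closed_segment 0 t) \<and>
                coef X c (coord c (\<gamma> s)) * w = v)))"

definition flow_defined :: "'a surface_form \<Rightarrow> complex \<Rightarrow> real \<Rightarrow> 'a \<Rightarrow> bool" where
  "flow_defined X v t x \<longleftrightarrow> (\<exists>\<gamma>. flow_arc X v t \<gamma> \<and> \<gamma> 0 = x)"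

definition flow :: "'a surface_form \<Rightarrow> complex \<Rightarrow> real \<Rightarrow> 'a \<Rightarrow> 'a" where
  "flow X v t x = (THE y. \<exists>\<gamma>. flow_arc X v t \<gamma> \<and> \<gamma> 0 = x \<and> \<gamma> t = y)"

abbreviation vflow_defined :: "'a surface_form \<Rightarrow> real \<Rightarrow> 'a \<Rightarrow> bool" where
  "vflow_defined X \<equiv> flow_defined X \<i>"
abbreviation vflow :: "'a surface_form \<Rightarrow> real \<Rightarrow> 'a \<Rightarrow> 'a" where
  "vflow X \<equiv> flow X \<i>"
abbreviation hflow_defined :: "'a surface_form \<Rightarrow> real \<Rightarrow> 'a \<Rightarrow> bool" where
  "hflow_defined X \<equiv> flow_defined X 1"
abbreviation hflow :: "'a surface_form \<Rightarrow> real \<Rightarrow> 'a \<Rightarrow> 'a" where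
  "hflow X \<equiv> flow X 1"

definition rect_map :: "'a surface_form \<Rightarrow> 'a \<Rightarrow> real \<times> real \<Rightarrow> 'a" where
  "rect_map X x = (\<lambda>(a, b). vflow X a (hflow X b x))"

definition rectangle :: "'a surface_form \<Rightarrow> 'a \<Rightarrow> real \<Rightarrow> real \<Rightarrow> 'a set" where
  "rectangle X x t\<^sub>1 t\<^sub>2 = rect_map X x ` ({0..<t\<^sub>1} \<times> {0..<t\<^sub>2})"

definition admissible :: "'a surface_form \<Rightarrow> 'a \<Rightarrow> real \<Rightarrow> real \<Rightarrow> bool" where
  "admissible X x t\<^sub>1 t\<^sub>2 \<longleftrightarrow>
     0 < t\<^sub>1 \<and> 0 < t\<^sub>2 \<and>
     (\<forall>b\<in>{0..<t\<^sub>2}. hflow_defined X b x \<and> (\<forall>a\<in>{0..<t\<^sub>1}. vflow_defined X a (hflow X b x))) \<and>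
     inj_on (rect_map X x) ({0..<t\<^sub>1} \<times> {0..<t\<^sub>2}) \<and>
     (surf X) closure_of (rectangle X x t\<^sub>1 t\<^sub>2) \<inter> form_zeros X = {}"

section \<open>Hoelder cocycles and their normalized distributions\<close>

text \<open>
  A cocycle is a function of those pairs \<open>(x, t)\<close> for which the vertical flow arc of length \<open>t\<close>
  from \<open>x\<close> is defined. It is extended by \<open>0\<close> to all other pairs, so that equality of
  cocycles is equality of functions.
\<close>

definition cocycles_plus :: "'a surface_form \<Rightarrow> ('a \<Rightarrow> real \<Rightarrow> real) set" where
  "cocycles_plus X = {\<Phi>.
     (\<forall>x t. \<not> vflow_defined X t x \<longrightarrow> \<Phi> x t = 0) \<and>
     (\<forall>x t s. vflow_defined X t x \<and> vflow_defined X s (vflow X t x) \<longrightarrow>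
        \<Phi> x (t + s) = \<Phi> x t + \<Phi> (vflow X t x) s) \<and>
     (\<exists>t\<^sub>0>0. \<exists>\<theta>>0. \<forall>x t. \<bar>t\<bar> < t\<^sub>0 \<and> vflow_defined X t x \<longrightarrow> \<bar>\<Phi> x t\<bar> \<le> \<bar>t\<bar> powr \<theta>) \<and>
     (\<forall>x t\<^sub>1 t\<^sub>2. admissible X x t\<^sub>1 t\<^sub>2 \<and> vflow_defined X t\<^sub>1 x \<and>
        hflow_defined X t\<^sub>2 x \<and> vflow_defined X t\<^sub>1 (hflow X t\<^sub>2 x) \<longrightarrow>
        \<Phi> x t\<^sub>1 = \<Phi> (hflow X t\<^sub>2 x) t\<^sub>1)}"

text \<open>
  If the variance vanishes, division by zero makes the normalized variable identically \<open>0\<close>.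
\<close>

definition normalized_distribution ::
    "'a surface_form \<Rightarrow> ('a \<Rightarrow> real \<Rightarrow> real) \<Rightarrow> real \<Rightarrow> real measure" where
  "normalized_distribution X \<Phi> \<tau> =
     distr (area_measure X) borel
       (\<lambda>x. \<Phi> x \<tau> / sqrt (prob_space.variance (area_measure X) (\<lambda>y. \<Phi> y \<tau>)))"

definition admits_atoms :: "real measure \<Rightarrow> bool" where
  "admits_atoms \<mu> \<longleftrightarrow> (\<exists>a. emeasure \<mu> {a} > 0)"

section \<open>Moduli space\<close>

definition form_isomorphic :: "'a surface_form \<Rightarrow> 'a surface_form \<Rightarrow> bool" where
  "form_isomorphic X Y \<longleftrightarrow> (\<exists>f. homeomorphic_map (surf X) (surf Y) f \<and>
     (\<forall>c\<in>charts X. \<forall>d\<in>charts Y.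
        (coord d \<circ> f \<circ> param c) holomorphic_on (coord c ` {p \<in> dom_of c. f p \<in> dom_of d}) \<and>
        (\<forall>z\<in>coord c ` {p \<in> dom_of c. f p \<in> dom_of d}.
           coef Y d ((coord d \<circ> f \<circ> param c) z) * deriv (coord d \<circ> f \<circ> param c) z = coef X c z)))"

definition has_zero_orders :: "'a surface_form \<Rightarrow> nat list \<Rightarrow> bool" where
  "has_zero_orders X \<kappa> \<longleftrightarrow>
     (\<exists>p. bij_betw p {..<length \<kappa>} (form_zeros X) \<and>
        (\<forall>i<length \<kappa>. \<forall>c\<in>charts X. p i \<in> dom_of c \<longrightarrow>
           zorder (coef X c) (coord c (p i)) = int (\<kappa> ! i)))"

text \<open>
  The points of the moduli space are isomorphism classes. As a compact Riemann surface has
  the cardinality of the continuum, every class is represented on subsets of any type \<open>'a\<close>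
  of at least that cardinality.
\<close>

definition iso_class :: "nat \<Rightarrow> 'a surface_form \<Rightarrow> 'a surface_form set" where
  "iso_class \<rho> X = {Y. abelian_differential \<rho> Y \<and> form_isomorphic X Y}"

definition stratum :: "nat \<Rightarrow> nat list \<Rightarrow> 'a surface_form set set" where
  "stratum \<rho> \<kappa> = {iso_class \<rho> X | X. abelian_differential \<rho> X \<and> has_zero_orders X \<kappa>}"

text \<open>
  The usual topology of the stratum. \<open>Y\<close> is \<open>\<epsilon>\<close>-near to \<open>X\<close> if there is a homeomorphism \<open>f\<close> of
  the surfaces, mapping zeros to zeros, such that \<open>|f\<^sup>* \<omega>\<^sub>Y - \<omega>\<^sub>X| \<le> \<epsilon> |\<omega>\<^sub>X|\<close> away from the zeros.
  The inequality is written in the integrated form, i.e. \<open>G \<circ> f - F\<close> is \<open>\<epsilon>\<close>-Lipschitz with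
  respect to \<open>F\<close> for local primitives \<open>F\<close> and \<open>G\<close> of \<open>\<omega>\<^sub>X\<close> and \<open>\<omega>\<^sub>Y\<close>; this makes sense for
  \<open>f\<close> that are only Lipschitz, such as maps that are affine on the triangles of a geodesic
  triangulation with vertices at the zeros. These neighbourhoods induce the same topology as
  the period coordinates: moving the periods slightly moves the triangulation by such an \<open>f\<close>;
  conversely, for small \<open>\<epsilon>\<close> the forms \<open>\<omega>\<^sub>X + t (f\<^sup>* \<omega>\<^sub>Y - \<omega>\<^sub>X)\<close>, \<open>0 \<le> t \<le> 1\<close>, are a path from
  \<open>X\<close> to \<open>Y\<close> inside one period chart, along which the relative periods change by \<open>O(\<epsilon>)\<close>.
\<close>

definition form_near :: "real \<Rightarrow> 'a surface_form \<Rightarrow> 'a surface_form \<Rightarrow> bool" where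
  "form_near \<epsilon> X Y \<longleftrightarrow> (\<exists>f. homeomorphic_map (surf X) (surf Y) f \<and>
     f ` form_zeros X = form_zeros Y \<and>
     (\<forall>p\<in>topspace (surf X) - form_zeros X. \<exists>U V F G.
        p \<in> U \<and> local_primitive X U F \<and> f ` U \<subseteq> V \<and> local_primitive Y V G \<and>
        (\<forall>q\<in>U. \<forall>r\<in>U.
           cmod ((G (f q) - G (f r)) - (F q - F r)) \<le> \<epsilon> * cmod (F q - F r))))"

definition class_near :: "real \<Rightarrow> 'a surface_form set \<Rightarrow> 'a surface_form set \<Rightarrow> bool" where
  "class_near \<epsilon> C D \<longleftrightarrow> (\<exists>X\<in>C. \<exists>Y\<in>D. form_near \<epsilon> X Y)"

definition stratum_open :: "nat \<Rightarrow> nat list \<Rightarrow> 'a surface_form set set \<Rightarrow> bool" where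
  "stratum_open \<rho> \<kappa> \<U> \<longleftrightarrow> \<U> \<subseteq> stratum \<rho> \<kappa> \<and>
     (\<forall>C\<in>\<U>. \<exists>\<epsilon>>0. \<forall>D\<in>stratum \<rho> \<kappa>. class_near \<epsilon> C D \<longrightarrow> D \<in> \<U>)"

definition stratum_topology :: "nat \<Rightarrow> nat list \<Rightarrow> 'a surface_form set topology" where
  "stratum_topology \<rho> \<kappa> = topology (stratum_open \<rho> \<kappa>)"

lemma form_near_mono:
  assumes "form_near \<delta> X Y" and "\<delta> \<le> \<epsilon>"
  shows "form_near \<epsilon> X Y"
proof -
  have *: "a \<le> \<epsilon> * cmod z" if "a \<le> \<delta> * cmod z" for a z
    using that mult_right_mono[OF assms(2) norm_ge_zero[of z]] by linarith
  show ?thesis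
    using assms(1) unfolding form_near_def by (meson *)
qed

lemma class_near_mono: "class_near \<delta> C D \<Longrightarrow> \<delta> \<le> \<epsilon> \<Longrightarrow> class_near \<epsilon> C D"
  unfolding class_near_def using form_near_mono by blast

lemma istopology_stratum_open: "istopology (stratum_open \<rho> \<kappa>)"
proof -
  have "stratum_open \<rho> \<kappa> (S \<inter> T)" if S: "stratum_open \<rho> \<kappa> S" and T: "stratum_open \<rho> \<kappa> T"
    for S T :: "'a surface_form set set"
    unfolding stratum_open_def
  proof (intro conjI ballI)
    show "S \<inter> T \<subseteq> stratum \<rho> \<kappa>"
      using S unfolding stratum_open_def by blast
    fix C assume "C \<in> S \<inter> T"
    then obtain d e where "d > 0" "e > 0"
      and "\<forall>D\<in>stratum \<rho> \<kappa>. class_near d C D \<longrightarrow> D \<in> S"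
      and "\<forall>D\<in>stratum \<rho> \<kappa>. class_near e C D \<longrightarrow> D \<in> T"
      using S T unfolding stratum_open_def by blast
    then have "min d e > 0" "\<forall>D\<in>stratum \<rho> \<kappa>. class_near (min d e) C D \<longrightarrow> D \<in> S \<inter> T"
      using class_near_mono[of "min d e" C _ d] class_near_mono[of "min d e" C _ e] by auto
    then show "\<exists>\<epsilon>>0. \<forall>D\<in>stratum \<rho> \<kappa>. class_near \<epsilon> C D \<longrightarrow> D \<in> S \<inter> T"
      by blast
  qed
  moreover have "stratum_open \<rho> \<kappa> (\<Union>\<K>)" if "\<forall>K\<in>\<K>. stratum_open \<rho> \<kappa> K"
    for \<K> :: "'a surface_form set set set"
    using that unfolding stratum_open_def by (meson Union_iff Union_least)
  ultimately show ?thesis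
    unfolding istopology_def by blast
qed

lemma openin_stratum_topology: "openin (stratum_topology \<rho> \<kappa>) = stratum_open \<rho> \<kappa>"
  unfolding stratum_topology_def by (rule topology_inverse'[OF istopology_stratum_open])

section \<open>Teichmueller flow and its invariant measures\<close>

text \<open>
  \<open>Y = (M, e\<^sup>s Re \<omega> + i e\<^bsup>-s\<^esup> Im \<omega>)\<close>, stated for local primitives: \<open>\<omega> = dF\<close> implies
  \<open>\<omega>\<^sub>Y = d(e\<^sup>s Re F + i e\<^bsup>-s\<^esup> Im F)\<close>. The underlying topological surface is the same, and the
  charts of \<open>Y\<close> are those of a complex structure for which the new form is holomorphic.
\<close>

definition teich_stretch :: "real \<Rightarrow> complex \<Rightarrow> complex" where
  "teich_stretch s z = Complex (exp s * Re z) (exp (- s) * Im z)"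

definition teich_deformation :: "real \<Rightarrow> 'a surface_form \<Rightarrow> 'a surface_form \<Rightarrow> bool" where
  "teich_deformation s X Y \<longleftrightarrow> surf Y = surf X \<and>
     (\<forall>U F. local_primitive X U F \<longrightarrow> local_primitive Y U (teich_stretch s \<circ> F))"

definition teich_flow :: "nat \<Rightarrow> real \<Rightarrow> 'a surface_form set \<Rightarrow> 'a surface_form set" where
  "teich_flow \<rho> s C = {Y. abelian_differential \<rho> Y \<and> (\<exists>X\<in>C. teich_deformation s X Y)}"

definition invariant_ergodic :: "'b measure \<Rightarrow> (real \<Rightarrow> 'b \<Rightarrow> 'b) \<Rightarrow> bool" where
  "invariant_ergodic P g \<longleftrightarrow>
     (\<forall>s. g s \<in> measurable P P \<and> distr P P (g s) = P) \<and>
     (\<forall>A\<in>sets P. (\<forall>s. g s -` A \<inter> space P = A) \<longrightarrow> emeasure P A = 0 \<or> emeasure P A = 1)"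

definition borel_probability_on :: "'b topology \<Rightarrow> 'b measure \<Rightarrow> bool" where
  "borel_probability_on T P \<longleftrightarrow>
     prob_space P \<and> space P = topspace T \<and> sets P = sigma_sets (topspace T) {U. openin T U}"

end

theory Submission
  imports Defs
begin

text \<open>
  If a horizontal arc joins \<open>x\<close> to \<open>h\<^sup>+\<^sub>\<tau> x\<close>, then the additivity of a cocycle \<open>\<Phi>\<close> and its holonomy
  invariance along this arc and along the vertical arc show that \<open>\<Phi>(y, \<tau>)\<close> does not depend on
  \<open>y\<close> near \<open>x\<close>; as open sets have positive area, the distribution of \<open>\<Phi>(\<cdot>, \<tau>)\<close> has an atom. If
  every horizontal leaf is dense and some vertical leaf is infinite, such \<open>\<tau>\<close> are dense: the
  horizontal leaf of \<open>x\<close> meets the vertical leaf of \<open>x\<close> near \<open>h\<^sup>+\<^sub>\<tau> x\<close> for any given \<open>\<tau>\<close>.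

  Both conditions follow from the absence of degenerate leaves (closed leaves and saddle
  connections) in the two directions. The Teichmueller flow contracts the length of a degenerate
  leaf to \<open>0\<close> in one of the two time directions, whereas this length is bounded below near every
  point of the stratum. By Poincare recurrence almost no form has a degenerate leaf.
\<close>

section \<open>Charts and local primitives\<close>

text \<open>Flows, rectangles and saddle connections are all expressed by developments of plane
  sets. A development is determined on a connected set by one value and extends from a compact
  convex set to a neighbourhood; this stands in for the theory of differential equations, and strips
  may overlap themselves.

  The obstacle is a zero of the form, where no flat coordinate exists and leaves stop. It is met by
  compact sublevel sets of |F - F p| for a primitive F: a path on which F changes little is trapped.
  This carries the recurrence of leaves to regular points, the finiteness behind minimality (an
  argument of Keane's type at the edge of an invariant open set) and the lower bound for lengths.

  That bound has to survive a homeomorphism which distorts increments of primitives, since this is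
  how the topology of the stratum is given. Tolerance 1/4 leaves a net movement of at least 2/3 of
  the length, which a short degenerate leaf cannot have.

  The area is a definite description, so it has to be constructed before open sets can be shown to
  have positive area.\<close>

locale riemann_form =
  fixes X :: "'a surface_form"
  assumes crs: "compact_riemann_surface (surf X) (charts X)"
    and holo: "holomorphic_form X"
begin

lemma Hausdorff: "Hausdorff_space (surf X)" and conn: "connected_space (surf X)"
  and comp: "compact_space (surf X)"
  and charts_cover: "(\<Union>c\<in>charts X. dom_of c) = topspace (surf X)"
  using crs unfolding compact_riemann_surface_def by auto

lemma chart_openin: "c \<in> charts X \<Longrightarrow> openin (surf X) (dom_of c)"
  and chart_open_image: "c \<in> charts X \<Longrightarrow> open (coord c ` dom_of c)"
  and chart_homeo: "c \<in> charts X \<Longrightarrow>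
    homeomorphic_map (subtopology (surf X) (dom_of c)) (top_of_set (coord c ` dom_of c)) (coord c)"
  using crs unfolding compact_riemann_surface_def is_chart_def by auto

lemma chart_topspace: "c \<in> charts X \<Longrightarrow> topspace (subtopology (surf X) (dom_of c)) = dom_of c"
  using openin_subset[OF chart_openin, of c] by (simp add: inf.absorb2)

lemma chart_inj: "c \<in> charts X \<Longrightarrow> inj_on (coord c) (dom_of c)"
  using homeomorphic_imp_injective_map[OF chart_homeo] chart_topspace by metis

lemma param_coord [simp]: "c \<in> charts X \<Longrightarrow> p \<in> dom_of c \<Longrightarrow> param c (coord c p) = p"
  using chart_inj unfolding param_def by simp

lemma coord_param [simp]:
  "z \<in> coord c ` dom_of c \<Longrightarrow> coord c (param c z) = z"
  unfolding param_def by (rule f_inv_into_f)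

lemma param_in: "z \<in> coord c ` dom_of c \<Longrightarrow> param c z \<in> dom_of c"
  unfolding param_def by (rule inv_into_into)

lemma chart_exists:
  assumes "p \<in> topspace (surf X)" obtains c where "c \<in> charts X" "p \<in> dom_of c"
  using charts_cover assms by blast

lemma coord_open_map:
  assumes "c \<in> charts X" "openin (surf X) U" "U \<subseteq> dom_of c"
  shows "open (coord c ` U)"
proof -
  have "openin (subtopology (surf X) (dom_of c)) U"
    using assms by (simp add: openin_open_subtopology[OF chart_openin])
  then have "openin (top_of_set (coord c ` dom_of c)) (coord c ` U)"
    using homeomorphic_imp_open_map[OF chart_homeo[OF assms(1)]] by (simp add: open_map_def)
  then show ?thesis
    using chart_open_image[OF assms(1)] openin_open_trans by blast
qed

lemma coord_preimage_open:
  assumes "c \<in> charts X" "open W"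
  shows "openin (surf X) {p \<in> dom_of c. coord c p \<in> W}"
proof -
  have "continuous_map (subtopology (surf X) (dom_of c)) (top_of_set (coord c ` dom_of c)) (coord c)"
    using homeomorphic_imp_continuous_map[OF chart_homeo[OF assms(1)]] .
  then have "continuous_map (subtopology (surf X) (dom_of c)) euclidean (coord c)"
    by (simp add: continuous_map_in_subtopology)
  then have "openin (subtopology (surf X) (dom_of c)) {p \<in> dom_of c. coord c p \<in> W}"
    using assms(2) openin_continuous_map_preimage chart_topspace[OF assms(1)] by fastforce
  then show ?thesis
    using chart_openin[OF assms(1)] openin_trans_full by blast
qed

lemma param_image:
  assumes "c \<in> charts X" "W \<subseteq> coord c ` dom_of c"
  shows "param c ` W = {p \<in> dom_of c. coord c p \<in> W}"
proof safe
  fix z assume "z \<in> W"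
  with assms(2) have "z \<in> coord c ` dom_of c" by blast
  from param_in[OF this] coord_param[OF this] \<open>z \<in> W\<close>
  show "param c z \<in> dom_of c" "coord c (param c z) \<in> W" by simp_all
next
  fix p assume "p \<in> dom_of c" "coord c p \<in> W"
  then show "p \<in> param c ` W" using param_coord[OF assms(1)] by (metis imageI)
qed

lemma param_open_map:
  assumes "c \<in> charts X" "open W" "W \<subseteq> coord c ` dom_of c"
  shows "openin (surf X) (param c ` W)"
  using coord_preimage_open[OF assms(1,2)] param_image[OF assms(1,3)] by simp

lemma transition_holo:
  "c \<in> charts X \<Longrightarrow> d \<in> charts X \<Longrightarrow>
    (coord d \<circ> param c) holomorphic_on coord c ` (dom_of c \<inter> dom_of d)"
  using crs unfolding compact_riemann_surface_def by auto

lemma overlap_open: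
  "c \<in> charts X \<Longrightarrow> d \<in> charts X \<Longrightarrow> open (coord c ` (dom_of c \<inter> dom_of d))"
  by (rule coord_open_map) (auto intro: chart_openin)

lemma coef_transition:
  assumes "c \<in> charts X" "d \<in> charts X" "p \<in> dom_of c" "p \<in> dom_of d"
  shows "coef X c (coord c p) = coef X d (coord d p) * deriv (coord d \<circ> param c) (coord c p)"
proof -
  have "coord c p \<in> coord c ` (dom_of c \<inter> dom_of d)" using assms by blast
  moreover have "\<forall>z\<in>coord c ` (dom_of c \<inter> dom_of d).
      coef X c z = coef X d ((coord d \<circ> param c) z) * deriv (coord d \<circ> param c) z"
    using holo assms unfolding holomorphic_form_def by blast
  ultimately show ?thesis using assms by auto
qed

lemma transition_deriv:
  assumes "c \<in> charts X" "d \<in> charts X" "p \<in> dom_of c" "p \<in> dom_of d"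
  shows "((coord d \<circ> param c) has_field_derivative deriv (coord d \<circ> param c) (coord c p)) (at (coord c p))"
  using assms transition_holo[of c d] overlap_open[of c d]
  by (intro holomorphic_derivI[of _ "coord c ` (dom_of c \<inter> dom_of d)"]) auto

lemma form_zeros_iff:
  assumes "c \<in> charts X" "p \<in> dom_of c"
  shows "p \<in> form_zeros X \<longleftrightarrow> coef X c (coord c p) = 0"
proof
  assume "p \<in> form_zeros X"
  then obtain d where "d \<in> charts X" "p \<in> dom_of d" "coef X d (coord d p) = 0"
    unfolding form_zeros_def by blast
  then show "coef X c (coord c p) = 0" using coef_transition[OF assms(1) _ assms(2)] by simp
next
  assume "coef X c (coord c p) = 0"
  then show "p \<in> form_zeros X"
    using assms chart_openin openin_subset unfolding form_zeros_def by fast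
qed

lemma coef_holo: "c \<in> charts X \<Longrightarrow> coef X c holomorphic_on coord c ` dom_of c"
  using holo unfolding holomorphic_form_def by blast

text \<open>The transformation law of the coefficients matches the chain rule, so a primitive of the
  coefficient in one chart passes the test of \<open>local_primitive\<close> in all the
  others.\<close>

lemma chart_primitive:
  assumes c: "c \<in> charts X" and "open N" "N \<subseteq> coord c ` dom_of c"
    and F: "\<And>z. z \<in> N \<Longrightarrow> (F has_field_derivative coef X c z) (at z)"
  shows "local_primitive X (param c ` N) (F \<circ> coord c)"
  unfolding local_primitive_def
proof (intro conjI ballI)
  show "openin (surf X) (param c ` N)" using param_open_map assms by blast
  fix d p assume d: "d \<in> charts X" and p: "p \<in> param c ` N \<inter> dom_of d"
  have p1: "p \<in> dom_of c" "coord c p \<in> N" using p param_image[OF c assms(3)] by auto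
  have *: "((coord c \<circ> param d) has_field_derivative deriv (coord c \<circ> param d) (coord d p)) (at (coord d p))"
    using transition_deriv d c p p1 by blast
  have "(F has_field_derivative coef X c (coord c p)) (at ((coord c \<circ> param d) (coord d p)))"
    using F[OF p1(2)] d p by simp
  from DERIV_chain[OF this *]
  show "((F \<circ> coord c \<circ> param d) has_field_derivative coef X d (coord d p)) (at (coord d p))"
    using coef_transition[of d c p] c d p p1 by (simp add: o_assoc)
qed

lemma lp_openin: "local_primitive X U F \<Longrightarrow> openin (surf X) U"
  unfolding local_primitive_def by blast

lemma lp_subset: "local_primitive X U F \<Longrightarrow> openin (surf X) V \<Longrightarrow> V \<subseteq> U \<Longrightarrow> local_primitive X V F"
  unfolding local_primitive_def by blast

lemma lp_preimage_open:
  assumes "local_primitive X U F" and W: "open W"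
  shows "openin (surf X) {p \<in> U. F p \<in> W}"
proof (subst openin_subopen, safe)
  have U: "openin (surf X) U" using lp_openin assms by blast
  fix p assume p: "p \<in> U" "F p \<in> W"
  then obtain c where c: "c \<in> charts X" "p \<in> dom_of c" using chart_exists openin_subset[OF U] by blast
  let ?O = "coord c ` (U \<inter> dom_of c)"
  have O: "open ?O" using coord_open_map[OF c(1)] openin_Int[OF U chart_openin[OF c(1)]] by simp
  have "((F \<circ> param c) has_field_derivative coef X c z) (at z)" if z: "z \<in> ?O" for z
  proof -
    obtain q where "q \<in> U \<inter> dom_of c" "z = coord c q" using z by blast
    then show ?thesis using assms c unfolding local_primitive_def by auto
  qed
  then have "(F \<circ> param c) holomorphic_on ?O" using holomorphic_on_open[OF O] by blast
  then have "continuous_on ?O (F \<circ> param c)" by (rule holomorphic_on_imp_continuous_on)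
  then have o: "open {z \<in> ?O. (F \<circ> param c) z \<in> W}"
    using continuous_open_preimage[OF _ O W] by (simp add: vimage_def Int_def)
  have "param c ` {z \<in> ?O. (F \<circ> param c) z \<in> W} \<subseteq> {p \<in> U. F p \<in> W}" using c by auto
  moreover have "coord c p \<in> {z \<in> ?O. (F \<circ> param c) z \<in> W}" using p c by simp
  then have "p \<in> param c ` {z \<in> ?O. (F \<circ> param c) z \<in> W}"
    using imageI[of "coord c p" _ "param c"] param_coord[OF c] by simp
  moreover have "openin (surf X) (param c ` {z \<in> ?O. (F \<circ> param c) z \<in> W})"
    by (rule param_open_map[OF c(1) o]) blast
  ultimately show "\<exists>T. openin (surf X) T \<and> p \<in> T \<and> T \<subseteq> {p \<in> U. F p \<in> W}" by blast
qed

text \<open>In a chart the difference has derivative zero on a disc. Statements about increments of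
  a primitive thus do not depend on which primitive is chosen.\<close>

lemma lp_diff_const:
  assumes F: "local_primitive X U F" and G: "local_primitive X V G" and p: "p \<in> U" "p \<in> V"
  obtains N where "openin (surf X) N" "p \<in> N" "N \<subseteq> U" "N \<subseteq> V"
    "\<And>q. q \<in> N \<Longrightarrow> F q - F p = G q - G p"
proof -
  have UV: "openin (surf X) U" "openin (surf X) V" using lp_openin F G by auto
  then obtain c where c: "c \<in> charts X" "p \<in> dom_of c" using chart_exists openin_subset[OF UV(1)] p by blast
  let ?O = "coord c ` (U \<inter> V \<inter> dom_of c)"
  have "open ?O" by (rule coord_open_map[OF c(1)]) (auto intro!: openin_Int UV chart_openin c)
  moreover have "coord c p \<in> ?O" using p c by blast
  ultimately obtain r where r: "r > 0" "ball (coord c p) r \<subseteq> ?O" by (meson openE)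
  have z: "((\<lambda>z. (F \<circ> param c) z - (G \<circ> param c) z) has_field_derivative 0) (at z)"
    if z: "z \<in> ball (coord c p) r" for z
  proof -
    obtain q where "q \<in> U \<inter> V \<inter> dom_of c" "z = coord c q" using subsetD[OF r(2) z] by blast
    then have "((F \<circ> param c) has_field_derivative coef X c z) (at z)"
       "((G \<circ> param c) has_field_derivative coef X c z) (at z)"
      using F G c unfolding local_primitive_def by auto
    from DERIV_diff[OF this] show ?thesis by simp
  qed
  let ?N = "param c ` ball (coord c p) r"
  have sub: "ball (coord c p) r \<subseteq> coord c ` dom_of c" using r by blast
  show ?thesis
  proof
    show "openin (surf X) ?N" using param_open_map[OF c(1) _ sub] by simp
    show "p \<in> ?N" using r(1) imageI[of "coord c p" "ball (coord c p) r" "param c"] param_coord[OF c] by simp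
    show "?N \<subseteq> U" "?N \<subseteq> V" using r(2) c by auto
    fix q assume "q \<in> ?N"
    then have q: "q \<in> dom_of c" "coord c q \<in> ball (coord c p) r" using param_image[OF c(1) sub] by auto
    have "((\<lambda>z. (F \<circ> param c) z - (G \<circ> param c) z) has_field_derivative 0) (at z within ball (coord c p) r)"
      if "z \<in> ball (coord c p) r" for z using z[OF that] by (rule has_field_derivative_at_within)
    from has_field_derivative_zero_constant[OF convex_ball this]
    have "\<exists>k. \<forall>z\<in>ball (coord c p) r. (F \<circ> param c) z - (G \<circ> param c) z = k" by simp
    then obtain k where "\<forall>z\<in>ball (coord c p) r. (F \<circ> param c) z - (G \<circ> param c) z = k" ..
    from this[rule_format, of "coord c p"] this[rule_format, of "coord c q"]
    have "F p - G p = k" "F q - G q = k" using q r c by simp_all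
    then show "F q - F p = G q - G p" by (simp add: algebra_simps)
  qed
qed

lemma chart_disc_primitive:
  assumes c: "c \<in> charts X" "p \<in> dom_of c"
  obtains r F where "r > 0" "ball (coord c p) r \<subseteq> coord c ` dom_of c" "F (coord c p) = 0"
    "\<And>z. z \<in> ball (coord c p) r \<Longrightarrow> (F has_field_derivative coef X c z) (at z)"
proof -
  obtain r where r: "r > 0" "ball (coord c p) r \<subseteq> coord c ` dom_of c"
    using chart_open_image[OF c(1)] c(2) by (meson imageI openE)
  then have "coef X c holomorphic_on ball (coord c p) r" using coef_holo[OF c(1)] holomorphic_on_subset by blast
  then obtain F where F: "\<And>z. z \<in> ball (coord c p) r \<Longrightarrow> (F has_field_derivative coef X c z) (at z within ball (coord c p) r)"
    using holomorphic_convex_primitive'[of "ball (coord c p) r" "coef X c"] by auto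
  then have "(F has_field_derivative coef X c z) (at z)" if "z \<in> ball (coord c p) r" for z
    using that at_within_open[of z "ball (coord c p) r"] by (metis open_ball)
  then have "((\<lambda>z. F z - F (coord c p)) has_field_derivative coef X c z) (at z)" if "z \<in> ball (coord c p) r" for z
    using that by (auto intro!: derivative_eq_intros)
  with r show ?thesis by (intro that[of r "\<lambda>z. F z - F (coord c p)"]) auto
qed

lemma lp_exists:
  assumes "p \<in> topspace (surf X)"
  obtains U F where "local_primitive X U F" "p \<in> U"
proof -
  obtain c where c: "c \<in> charts X" "p \<in> dom_of c" using chart_exists assms by blast
  obtain r F where rF: "r > 0" "ball (coord c p) r \<subseteq> coord c ` dom_of c"
    "\<And>z. z \<in> ball (coord c p) r \<Longrightarrow> (F has_field_derivative coef X c z) (at z)"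
    using chart_disc_primitive[OF c] by metis
  have "p \<in> param c ` ball (coord c p) r"
    using rF c by (auto simp: image_iff intro!: bexI[of _ "coord c p"])
  then show ?thesis using that chart_primitive[OF c(1) _ rF(2,3)] by blast
qed

text \<open>The natural coordinate of a translation surface at a regular point: \<psi> inverts a
  primitive, so the form becomes dz.\<close>

definition flat_disc :: "'a \<Rightarrow> real \<Rightarrow> (complex \<Rightarrow> 'a) \<Rightarrow> ('a \<Rightarrow> complex) \<Rightarrow> bool" where
  "flat_disc p r \<psi> F \<longleftrightarrow> r > 0 \<and> \<psi> 0 = p \<and> local_primitive X (\<psi> ` ball 0 r) F \<and>
     (\<forall>z\<in>ball 0 r. F (\<psi> z) = z \<and> \<psi> z \<notin> form_zeros X)"

text \<open>At a regular point the primitive has nonzero derivative and hence a holomorphic local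
  inverse. The derivative of that inverse in the chart is recorded because \<open>flow_arc\<close>
  speaks of velocities in charts.\<close>

lemma flat_disc_exists_chart:
  assumes c: "c \<in> charts X" "p \<in> dom_of c" and p: "p \<notin> form_zeros X"
  obtains r \<psi> F where "flat_disc p r \<psi> F" "\<psi> ` ball 0 r \<subseteq> dom_of c"
    "((coord c \<circ> \<psi>) has_field_derivative 1 / coef X c (coord c p)) (at 0)"
proof -
  define z0 where "z0 = coord c p"
  obtain r0 F where rF: "r0 > 0" "ball z0 r0 \<subseteq> coord c ` dom_of c" "F z0 = 0"
    and F: "\<And>z. z \<in> ball z0 r0 \<Longrightarrow> (F has_field_derivative coef X c z) (at z)"
    using chart_disc_primitive[OF c] unfolding z0_def by metis
  have Fh: "F holomorphic_on ball z0 r0" using F holomorphic_on_open by blast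
  have dF: "deriv F z = coef X c z" if "z \<in> ball z0 r0" for z using F that DERIV_imp_deriv by blast
  have f0: "coef X c z0 \<noteq> 0" using p form_zeros_iff[OF c] z0_def by simp
  obtain r1 where r1: "0 < r1" "ball z0 r1 \<subseteq> ball z0 r0" "inj_on F (ball z0 r1)"
    using has_complex_derivative_locally_injective[OF Fh, of z0] rF(1) dF[of z0] f0 by auto
  have Fh1: "F holomorphic_on ball z0 r1" using Fh r1 holomorphic_on_subset by blast
  obtain g where g: "g holomorphic_on F ` ball z0 r1"
    "\<And>z. z \<in> ball z0 r1 \<Longrightarrow> deriv F z * deriv g (F z) = 1"
    "\<And>z. z \<in> ball z0 r1 \<Longrightarrow> g (F z) = z"
    using holomorphic_has_inverse[OF Fh1 open_ball r1(3)] by metis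
  have opF: "open (F ` ball z0 r1)" using open_mapping_thm3[OF Fh1 open_ball r1(3)] .
  moreover have "0 \<in> F ` ball z0 r1" using rF(3) r1(1) by (metis centre_in_ball imageI)
  ultimately obtain r where r: "r > 0" "ball 0 r \<subseteq> F ` ball z0 r1" by (meson openE)
  define N where "N = g ` ball 0 r"
  have Fg: "F (g w) = w" "g w \<in> ball z0 r1" if "w \<in> ball 0 r" for w using r(2) that g(3) by auto
  have N1: "N \<subseteq> ball z0 r1" using Fg N_def by auto
  have "N = {z \<in> ball z0 r1. F z \<in> ball 0 r}" unfolding N_def
  proof safe
    fix z assume "z \<in> ball z0 r1" "F z \<in> ball 0 r"
    then show "z \<in> g ` ball 0 r" using g(3) by (metis imageI)
  qed (use Fg in auto)
  moreover have "open (ball z0 r1 \<inter> F -` ball 0 r)"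
    using continuous_open_preimage[OF holomorphic_on_imp_continuous_on[OF Fh1] open_ball open_ball] .
  ultimately have N: "open N" by (simp add: vimage_def Int_def)
  have N2: "N \<subseteq> coord c ` dom_of c" using N1 r1 rF by blast
  define \<psi> where "\<psi> = param c \<circ> g"
  have im: "\<psi> ` ball 0 r = param c ` N" unfolding \<psi>_def N_def by (simp add: image_comp)
  have g0: "g 0 = z0" using g(3)[of z0] rF(3) r1(1) by simp
  have co: "coord c (\<psi> w) = g w" if "w \<in> ball 0 r" for w
  proof -
    have "g w \<in> coord c ` dom_of c" using N2 that N_def by blast
    then show ?thesis unfolding \<psi>_def o_def by (rule coord_param)
  qed
  show ?thesis
  proof
    show "flat_disc p r \<psi> (F \<circ> coord c)" unfolding flat_disc_def
    proof (intro conjI ballI)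
      show "r > 0" by (rule r)
      show "\<psi> 0 = p" unfolding \<psi>_def using g0 c z0_def by simp
      show "local_primitive X (\<psi> ` ball 0 r) (F \<circ> coord c)"
        unfolding im by (rule chart_primitive[OF c(1) N N2]) (use F N1 r1 in blast)
      fix w assume w: "w \<in> ball (0::complex) r"
      show "(F \<circ> coord c) (\<psi> w) = w" using co[OF w] Fg[OF w] by simp
      have "deriv F (g w) = coef X c (g w)" by (rule dF) (use Fg(2)[OF w] r1(2) in blast)
      then have "coef X c (g w) \<noteq> 0" using g(2)[OF Fg(2)[OF w]] by auto
      moreover have "\<psi> w \<in> dom_of c" unfolding \<psi>_def o_def by (rule param_in) (use N2 w N_def in blast)
      ultimately show "\<psi> w \<notin> form_zeros X" using form_zeros_iff[OF c(1)] co[OF w] by simp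
    qed
    show "\<psi> ` ball 0 r \<subseteq> dom_of c" unfolding im using param_image[OF c(1) N2] by blast
    have gd: "(g has_field_derivative deriv g 0) (at 0)"
      using holomorphic_derivI[OF g(1) opF] r by (metis centre_in_ball subsetD)
    have "deriv g 0 = 1 / coef X c z0" using g(2)[of z0] r1(1) rF(1,3) dF[of z0] f0
      by (simp add: field_simps)
    then have "(g has_field_derivative 1 / coef X c z0) (at 0)" using gd by simp
    then show "((coord c \<circ> \<psi>) has_field_derivative 1 / coef X c (coord c p)) (at 0)"
      unfolding z0_def[symmetric]
      by (rule has_field_derivative_transform_within_open[where S="ball 0 r"]) (use r co in auto)
  qed
qed

end

definition regular_points :: "'a surface_form \<Rightarrow> 'a set" where
  "regular_points X = topspace (surf X) - form_zeros X"

context riemann_form begin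

lemma flat_disc_exists:
  assumes "p \<in> regular_points X"
  obtains r \<psi> F where "flat_disc p r \<psi> F"
proof -
  have p: "p \<in> topspace (surf X)" "p \<notin> form_zeros X" using assms unfolding regular_points_def by auto
  obtain c where "c \<in> charts X" "p \<in> dom_of c" using chart_exists[OF p(1)] .
  from flat_disc_exists_chart[OF this p(2)] show ?thesis using that .
qed

lemma flat_disc_regular:
  assumes "flat_disc p r \<psi> F" "z \<in> ball 0 r"
  shows "\<psi> z \<in> regular_points X"
proof -
  have "openin (surf X) (\<psi> ` ball 0 r)" using assms lp_openin unfolding flat_disc_def by blast
  then have "\<psi> z \<in> topspace (surf X)" using openin_subset assms(2) by blast
  then show ?thesis using assms unfolding flat_disc_def regular_points_def by blast
qed

lemma flat_disc_open:
  assumes "flat_disc p r \<psi> F" "open W" "W \<subseteq> ball 0 r"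
  shows "openin (surf X) (\<psi> ` W)"
proof -
  have "\<psi> ` W = {q \<in> \<psi> ` ball 0 r. F q \<in> W}" using assms unfolding flat_disc_def by auto
  moreover have "local_primitive X (\<psi> ` ball 0 r) F" using assms(1) unfolding flat_disc_def by blast
  ultimately show ?thesis using lp_preimage_open[OF _ assms(2)] by metis
qed

lemma flat_disc_inv: "flat_disc p r \<psi> F \<Longrightarrow> q \<in> \<psi> ` ball 0 r \<Longrightarrow> \<psi> (F q) = q \<and> F q \<in> ball 0 r"
  unfolding flat_disc_def by auto

text \<open>Continuity of \<psi> means that the primitive F maps open sets to open sets, which holds
  because F is injective on the disc and holomorphic in every chart.\<close>

lemma flat_disc_continuous:
  assumes "flat_disc p r \<psi> F"
  shows "continuous_map (top_of_set (ball 0 r)) (surf X) \<psi>"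
proof -
  have "openin (top_of_set (ball 0 r)) {z \<in> ball 0 r. \<psi> z \<in> V}" if V: "openin (surf X) V" for V
  proof -
    have U: "openin (surf X) (\<psi> ` ball 0 r)" using flat_disc_open[OF assms] by simp
    have sub: "V \<inter> \<psi> ` ball 0 r \<subseteq> \<psi> ` ball 0 r" by blast
    have "{z \<in> ball 0 r. \<psi> z \<in> V} = F ` (V \<inter> \<psi> ` ball 0 r)"
      using assms unfolding flat_disc_def by (auto simp: image_iff) force
    moreover have "open (F ` (V \<inter> \<psi> ` ball 0 r))"
    proof (subst open_subopen, safe)
      fix q z assume q: "\<psi> z \<in> V" "z \<in> ball 0 r"
      obtain c where c: "c \<in> charts X" "\<psi> z \<in> dom_of c"
        using chart_exists flat_disc_regular[OF assms q(2)] unfolding regular_points_def by blast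
      let ?A = "V \<inter> \<psi> ` ball 0 r \<inter> dom_of c"
      have A: "openin (surf X) ?A" using V U chart_openin[OF c(1)] by blast
      have o: "open (coord c ` ?A)" using coord_open_map[OF c(1) A] by blast
      have lp: "local_primitive X (\<psi> ` ball 0 r) F" using assms unfolding flat_disc_def by blast
      have pc: "param c (coord c q) = q" if "q \<in> ?A" for q using that c by simp
      have "((F \<circ> param c) has_field_derivative coef X c z) (at z)" if z: "z \<in> coord c ` ?A" for z
        using z lp c unfolding local_primitive_def by blast
      then have h: "(F \<circ> param c) holomorphic_on coord c ` ?A"
        using holomorphic_on_open[OF o] by blast
      have Finj: "inj_on F (\<psi> ` ball 0 r)"
        using assms unfolding flat_disc_def by (intro inj_onI) (metis imageE)
      have inj: "inj_on (F \<circ> param c) (coord c ` ?A)"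
      proof (rule inj_onI)
        fix x y assume "x \<in> coord c ` ?A" "y \<in> coord c ` ?A" and e: "(F \<circ> param c) x = (F \<circ> param c) y"
        then obtain a b where ab: "x = coord c a" "y = coord c b" "a \<in> ?A" "b \<in> ?A" by blast
        then have "F a = F b" using e pc by simp
        then show "x = y" using ab inj_onD[OF Finj, of a b] by blast
      qed
      have "open ((F \<circ> param c) ` coord c ` ?A)" using open_mapping_thm3[OF h o inj] .
      moreover have "(F \<circ> param c) ` coord c ` ?A = F ` ?A"
        unfolding image_comp by (rule image_cong) (use pc in auto)
      ultimately show "\<exists>T. open T \<and> F (\<psi> z) \<in> T \<and> T \<subseteq> F ` (V \<inter> \<psi> ` ball 0 r)"
        using q c by (intro exI[of _ "F ` ?A"]) auto
    qed
    ultimately have "open {z \<in> ball 0 r. \<psi> z \<in> V}" by simp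
    moreover have "{z \<in> ball 0 r. \<psi> z \<in> V} \<subseteq> ball 0 r" by blast
    ultimately show ?thesis using openin_open_eq[of "ball (0::complex) r"] by blast
  qed
  then show ?thesis using flat_disc_regular[OF assms] unfolding continuous_map_def regular_points_def by auto
qed

end

section \<open>Developments\<close>

text \<open>
  A development is a local isometry from a subset of the plane, with the form \<open>dz\<close>, into the
  surface minus the zeros of \<open>\<omega>\<close>.
\<close>

definition dev :: "'a surface_form \<Rightarrow> complex set \<Rightarrow> (complex \<Rightarrow> 'a) \<Rightarrow> bool" where
  "dev X S g \<longleftrightarrow> continuous_map (top_of_set S) (surf X) g \<and> g ` S \<subseteq> regular_points X \<and>
     (\<forall>z\<in>S. \<forall>U F. local_primitive X U F \<and> g z \<in> U \<longrightarrow>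
        (\<forall>\<^sub>F w in at z within S. F (g w) - F (g z) = w - z))"

lemma dev_subset: "dev X S g \<Longrightarrow> T \<subseteq> S \<Longrightarrow> dev X T g"
  unfolding dev_def
  by (meson at_le continuous_map_from_subtopology_mono filter_leD image_mono subset_iff subset_trans)

definition nbhd :: "complex set \<Rightarrow> real \<Rightarrow> complex set" where
  "nbhd K e = {w. \<exists>z\<in>K. dist z w < e}"

lemma open_nbhd: "open (nbhd K e)"
proof -
  have "nbhd K e = (\<Union>z\<in>K. ball z e)" unfolding nbhd_def by auto
  then show ?thesis by auto
qed

lemma convex_nbhd:
  assumes "convex K" shows "convex (nbhd K e)"
proof -
  have "nbhd K e = (\<Union>x\<in>K. \<Union>y\<in>ball 0 e. {x + y})"
  proof safe
    fix w assume "w \<in> nbhd K e"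
    then obtain z where z: "z \<in> K" "dist z w < e" unfolding nbhd_def by blast
    then have "w - z \<in> ball 0 e" "w = z + (w - z)" by (auto simp: dist_norm norm_minus_commute)
    then show "w \<in> (\<Union>x\<in>K. \<Union>y\<in>ball 0 e. {x + y})" using z(1) by blast
  next
    fix x y :: complex assume "x \<in> K" "y \<in> ball 0 e"
    then show "x + y \<in> nbhd K e" unfolding nbhd_def by (auto simp: dist_norm intro!: bexI[of _ x])
  qed
  then show ?thesis using convex_sums[OF assms convex_ball] by metis
qed

lemma subset_nbhd: "0 < e \<Longrightarrow> K \<subseteq> nbhd K e"
  unfolding nbhd_def by force

section \<open>Uniqueness and extension of developments\<close>

context riemann_form begin

lemma top_of_set_preimage_eventually:
  fixes g :: "'b::metric_space \<Rightarrow> 'a"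
  assumes "continuous_map (top_of_set S) (surf X) g" "openin (surf X) U" "z \<in> S" "g z \<in> U"
  shows "\<exists>e>0. \<forall>w\<in>S. dist w z < e \<longrightarrow> g w \<in> U"
proof -
  have "openin (top_of_set S) {w \<in> S. g w \<in> U}"
    using openin_continuous_map_preimage[OF assms(1,2)] by simp
  then obtain T where "open T" "{w \<in> S. g w \<in> U} = S \<inter> T" unfolding openin_open by blast
  moreover from this obtain e where "e > 0" "ball z e \<subseteq> T" using assms(3,4) openE[of T z] by blast
  ultimately show ?thesis by (metis (no_types, lifting) IntI dist_commute mem_Collect_eq mem_ball subsetD)
qed

text \<open>\<open>dev\<close> quantifies over all primitives; a single one at each point suffices,
  as any other has the same increments nearby.\<close>

lemma devI:
  assumes cont: "continuous_map (top_of_set S) (surf X) g" and reg: "g ` S \<subseteq> regular_points X"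
    and loc: "\<And>z. z \<in> S \<Longrightarrow> \<exists>U F. local_primitive X U F \<and> g z \<in> U \<and>
        (\<forall>\<^sub>F w in at z within S. F (g w) - F (g z) = w - z)"
  shows "dev X S g"
  unfolding dev_def
proof (intro conjI ballI allI impI cont reg)
  fix z V G assume z: "z \<in> S" and G: "local_primitive X V G \<and> g z \<in> V"
  from loc[OF z] obtain U F where F: "local_primitive X U F" "g z \<in> U"
    and ev: "\<forall>\<^sub>F w in at z within S. F (g w) - F (g z) = w - z" by blast
  obtain N where N: "openin (surf X) N" "g z \<in> N" "\<And>q. q \<in> N \<Longrightarrow> F q - F (g z) = G q - G (g z)"
    using lp_diff_const[of U F V G "g z"] F G by metis
  obtain e where "e > 0" "\<forall>w\<in>S. dist w z < e \<longrightarrow> g w \<in> N"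
    using top_of_set_preimage_eventually[OF cont N(1) z N(2)] by blast
  then have "\<forall>\<^sub>F w in at z within S. g w \<in> N" unfolding eventually_at by blast
  with ev show "\<forall>\<^sub>F w in at z within S. G (g w) - G (g z) = w - z"
    by eventually_elim (use N in metis)
qed

lemma flat_disc_dev:
  assumes "flat_disc p r \<psi> F" shows "dev X (ball 0 r) \<psi>"
proof (rule devI[OF flat_disc_continuous[OF assms]])
  show "\<psi> ` ball 0 r \<subseteq> regular_points X" using flat_disc_regular[OF assms] by blast
  fix z assume z: "z \<in> ball (0::complex) r"
  have F: "F (\<psi> w) = w" if "w \<in> ball 0 r" for w using assms that unfolding flat_disc_def by blast
  have "\<forall>\<^sub>F w in at z within ball 0 r. F (\<psi> w) - F (\<psi> z) = w - z"
    using F z by (auto simp: eventually_at_topological)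
  then show "\<exists>U F. local_primitive X U F \<and> \<psi> z \<in> U \<and>
      (\<forall>\<^sub>F w in at z within ball 0 r. F (\<psi> w) - F (\<psi> z) = w - z)"
    using assms z unfolding flat_disc_def by blast
qed

lemma dev_regular: "dev X S g \<Longrightarrow> z \<in> S \<Longrightarrow> g z \<in> regular_points X"
  unfolding dev_def by blast

lemma dev_topspace: "dev X S g \<Longrightarrow> z \<in> S \<Longrightarrow> g z \<in> topspace (surf X)"
  unfolding dev_def regular_points_def by blast

text \<open>The flat coordinate at \<open>g z\<close> inverts F, and F (g w) = w - z near z, so the
  development is locally a translate of \<psi>. The comparison of two developments rests on
  this.\<close>

lemma dev_in_disc:
  assumes g: "dev X S g" and z: "z \<in> S" and d: "flat_disc (g z) r \<psi> F"
  obtains e where "e > 0" "e \<le> r" "\<And>w. w \<in> S \<Longrightarrow> dist w z < e \<Longrightarrow> g w = \<psi> (w - z)"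
proof -
  let ?U = "\<psi> ` ball 0 r"
  have lp: "local_primitive X ?U F" and r: "r > 0" and F0: "F (g z) = 0" and gz: "g z \<in> ?U"
  proof -
    show "local_primitive X ?U F" "r > 0" using d unfolding flat_disc_def by auto
    then have 0: "\<psi> 0 = g z" "(0::complex) \<in> ball 0 r" using d unfolding flat_disc_def by auto
    then show "F (g z) = 0" using d unfolding flat_disc_def by metis
    show "g z \<in> ?U" using 0 by (metis imageI)
  qed
  have "\<forall>\<^sub>F w in at z within S. F (g w) - F (g z) = w - z"
    using g z lp gz unfolding dev_def by blast
  then obtain e1 where e1: "e1 > 0" "\<And>w. w \<in> S \<Longrightarrow> w \<noteq> z \<Longrightarrow> dist w z < e1 \<Longrightarrow> F (g w) - F (g z) = w - z"
    unfolding eventually_at by blast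
  obtain e2 where e2: "e2 > 0" "\<And>w. w \<in> S \<Longrightarrow> dist w z < e2 \<Longrightarrow> g w \<in> ?U"
  proof -
    have "continuous_map (top_of_set S) (surf X) g" using g unfolding dev_def by blast
    from top_of_set_preimage_eventually[OF this lp_openin[OF lp] z gz] show ?thesis using that by blast
  qed
  show ?thesis
  proof (rule that[of "min (min e1 e2) r"])
    fix w assume w: "w \<in> S" "dist w z < min (min e1 e2) r"
    have "F (g w) = w - z" using e1(2)[of w] w F0 by (cases "w = z") auto
    then show "g w = \<psi> (w - z)" using flat_disc_inv[OF d e2(2)[of w]] w by simp
  qed (use e1 e2 r in auto)
qed

lemma dev_shift:
  assumes "dev X S g" and T: "\<And>z. z \<in> T \<Longrightarrow> z + a \<in> S"
  shows "dev X T (\<lambda>z. g (z + a))"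
proof -
  have c: "continuous_map (top_of_set T) (top_of_set S) (\<lambda>z. z + a)"
    using T by (auto simp: continuous_map_in_subtopology intro!: continuous_intros)
  have c2: "continuous_map (top_of_set T) (surf X) (\<lambda>z. g (z + a))"
    using continuous_map_compose[OF c] assms(1) unfolding dev_def o_def by blast
  show ?thesis unfolding dev_def
  proof (intro conjI ballI allI impI c2)
    show "(\<lambda>z. g (z + a)) ` T \<subseteq> regular_points X" using assms unfolding dev_def by blast
    fix z U F assume z: "z \<in> T" and U: "local_primitive X U F \<and> g (z + a) \<in> U"
    have "\<forall>\<^sub>F w in at (z + a) within S. F (g w) - F (g (z + a)) = w - (z + a)"
      using assms z U unfolding dev_def by blast
    then obtain d where d: "d > 0" "\<And>w. w \<in> S \<Longrightarrow> w \<noteq> z + a \<Longrightarrow> dist w (z + a) < d \<Longrightarrow> F (g w) - F (g (z + a)) = w - (z + a)"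
      unfolding eventually_at by blast
    show "\<forall>\<^sub>F w in at z within T. F (g (w + a)) - F (g (z + a)) = w - z"
      unfolding eventually_at
    proof (intro exI conjI ballI impI)
      show "d > 0" by fact
      fix w assume "w \<in> T" "w \<noteq> z \<and> dist w z < d"
      then show "F (g (w + a)) - F (g (z + a)) = w - z" using d(2)[of "w + a"] T by simp
    qed
  qed
qed

lemma dev_local:
  assumes "\<And>z. z \<in> S \<Longrightarrow> \<exists>N h. open N \<and> z \<in> N \<and> dev X (S \<inter> N) h \<and> (\<forall>w\<in>S \<inter> N. g w = h w)"
  shows "dev X S g"
proof (rule devI)
  have top: "g z \<in> topspace (surf X) \<and> g z \<in> regular_points X" if z: "z \<in> S" for z
    using assms[OF z] z dev_regular unfolding regular_points_def by fastforce
  then show "g ` S \<subseteq> regular_points X" by blast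
  show "continuous_map (top_of_set S) (surf X) g"
    unfolding continuous_map_def
  proof (intro conjI allI impI)
    show "g \<in> topspace (top_of_set S) \<rightarrow> topspace (surf X)" using top by simp
    fix U assume U: "openin (surf X) U"
    show "openin (top_of_set S) {x \<in> topspace (top_of_set S). g x \<in> U}"
    proof (subst openin_subopen, safe)
      fix z assume "z \<in> topspace (top_of_set S)" and gz: "g z \<in> U"
      then have z: "z \<in> S" by simp
      obtain N h where N: "open N" "z \<in> N" "dev X (S \<inter> N) h" "\<forall>w\<in>S \<inter> N. g w = h w"
        using assms[OF z] by blast
      have "openin (top_of_set (S \<inter> N)) {w \<in> S \<inter> N. h w \<in> U}"
        using openin_continuous_map_preimage[OF _ U, of "top_of_set (S \<inter> N)" h] N(3) unfolding dev_def by simp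
      then have "openin (top_of_set S) {w \<in> S \<inter> N. h w \<in> U}"
        using N(1) by (meson openin_open_Int openin_trans)
      then show "\<exists>T. openin (top_of_set S) T \<and> z \<in> T \<and> T \<subseteq> {x \<in> topspace (top_of_set S). g x \<in> U}"
        using N z gz by (intro exI[of _ "{w \<in> S \<inter> N. h w \<in> U}"]) auto
    qed
  qed
  fix z assume z: "z \<in> S"
  obtain N h where N: "open N" "z \<in> N" "dev X (S \<inter> N) h" "\<forall>w\<in>S \<inter> N. g w = h w"
    using assms[OF z] by blast
  have "h z \<in> topspace (surf X)" using dev_topspace[OF N(3)] z N(2) by blast
  then obtain U F where U: "local_primitive X U F" "h z \<in> U" using lp_exists by blast
  have "\<forall>\<^sub>F w in at z within S \<inter> N. F (h w) - F (h z) = w - z"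
    using N z U unfolding dev_def by blast
  then have "\<forall>\<^sub>F w in at z within S. w \<in> N \<longrightarrow> F (h w) - F (h z) = w - z"
    unfolding eventually_at_filter by (auto elim: eventually_mono)
  moreover have "\<forall>\<^sub>F w in at z within S. w \<in> N"
    using N by (auto simp: eventually_at_topological)
  moreover have "\<forall>\<^sub>F w in at z within S. w \<in> S" by (auto simp: eventually_at_filter)
  ultimately have "\<forall>\<^sub>F w in at z within S. F (g w) - F (g z) = w - z"
    by eventually_elim (use N z in auto)
  moreover have "g z \<in> U" using U N z by auto
  ultimately show "\<exists>U F. local_primitive X U F \<and> g z \<in> U \<and>
      (\<forall>\<^sub>F w in at z within S. F (g w) - F (g z) = w - z)" using U by blast
qed

lemma dev_cong:
  assumes "dev X S g" "\<And>z. z \<in> S \<Longrightarrow> f z = g z" shows "dev X S f"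
  using assms by (intro dev_local) (auto intro!: exI[of _ UNIV] exI[of _ g])

text \<open>An identity theorem that takes the place of uniqueness for the flow equation. Agreement
  is a closed condition because the surface is Hausdorff, and an open one because both maps are
  locally the same translated flat coordinate.\<close>

lemma dev_unique:
  assumes g: "dev X S g" and h: "dev X S h" and S: "connected S" and z0: "z0 \<in> S" "g z0 = h z0"
    and z: "z \<in> S"
  shows "g z = h z"
proof -
  let ?E = "{z \<in> S. g z = h z}"
  have cg: "continuous_map (top_of_set S) (surf X) g" and ch: "continuous_map (top_of_set S) (surf X) h"
    using g h unfolding dev_def by auto
  have "closedin (top_of_set S) ?E"
    using closedin_continuous_maps_eq[OF Hausdorff cg ch] by simp
  moreover have "openin (top_of_set S) ?E"
  proof (subst openin_subopen, safe)
    fix w assume w: "w \<in> S" "g w = h w"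
    obtain r \<psi> F where d: "flat_disc (g w) r \<psi> F" using flat_disc_exists dev_regular[OF g w(1)] by blast
    obtain e1 where e1: "e1 > 0" "\<And>y. y \<in> S \<Longrightarrow> dist y w < e1 \<Longrightarrow> g y = \<psi> (y - w)"
      using dev_in_disc[OF g w(1) d] by metis
    have d': "flat_disc (h w) r \<psi> F" using d w by simp
    obtain e2 where e2: "e2 > 0" "\<And>y. y \<in> S \<Longrightarrow> dist y w < e2 \<Longrightarrow> h y = \<psi> (y - w)"
      using dev_in_disc[OF h w(1) d'] by metis
    show "\<exists>T. openin (top_of_set S) T \<and> w \<in> T \<and> T \<subseteq> ?E"
    proof (intro exI conjI)
      show "openin (top_of_set S) (S \<inter> ball w (min e1 e2))" by (simp add: openin_open_Int)
      show "w \<in> S \<inter> ball w (min e1 e2)" using w e1 e2 by simp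
      show "S \<inter> ball w (min e1 e2) \<subseteq> ?E" using e1(2) e2(2) by (auto simp: dist_commute)
    qed
  qed
  ultimately have "?E = {} \<or> ?E = S" using S unfolding connected_clopen by blast
  then show ?thesis using z0 z by blast
qed

text \<open>A Lebesgue number for the cover of K by flat discs gives one radius for all base points;
  each disc is recentred by a translation. Injectivity is what later makes small rectangles
  embedded.\<close>

lemma dev_uniform_discs:
  assumes K: "compact K" and g: "dev X K g"
  obtains e \<psi> where "e > 0" "\<And>z. z \<in> K \<Longrightarrow> dev X (ball 0 e) (\<psi> z) \<and> \<psi> z 0 = g z"
    "\<And>z. z \<in> K \<Longrightarrow> inj_on (\<psi> z) (ball 0 e)"
proof -
  have "\<exists>d. d > 0 \<and> (\<exists>r \<phi> F. flat_disc (g z) r \<phi> F \<and> 2 * d \<le> r \<and>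
     (\<forall>w\<in>K. dist w z < d \<longrightarrow> g w = \<phi> (w - z)))" if z: "z \<in> K" for z
  proof -
    obtain r \<phi> F where d: "flat_disc (g z) r \<phi> F" using flat_disc_exists dev_regular[OF g z] by blast
    obtain e where e: "e > 0" "e \<le> r" "\<And>w. w \<in> K \<Longrightarrow> dist w z < e \<Longrightarrow> g w = \<phi> (w - z)"
      using dev_in_disc[OF g z d] by metis
    have "\<forall>w\<in>K. dist w z < e / 2 \<longrightarrow> g w = \<phi> (w - z)" using e by auto
    moreover have "e / 2 > 0" "2 * (e / 2) \<le> r" using e by auto
    ultimately show ?thesis using d by blast
  qed
  then obtain \<delta> where \<delta>: "\<And>z. z \<in> K \<Longrightarrow> \<delta> z > 0"
    "\<And>z. z \<in> K \<Longrightarrow> \<exists>r \<phi> F. flat_disc (g z) r \<phi> F \<and> 2 * \<delta> z \<le> r \<and>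
     (\<forall>w\<in>K. dist w z < \<delta> z \<longrightarrow> g w = \<phi> (w - z))" by metis
  have "K \<subseteq> \<Union>((\<lambda>z. ball z (\<delta> z)) ` K)" using \<delta> by force
  then obtain e where e: "e > 0" "\<And>x. x \<in> K \<Longrightarrow> \<exists>G\<in>(\<lambda>z. ball z (\<delta> z)) ` K. ball x e \<subseteq> G"
    using Heine_Borel_lemma[OF K, of "(\<lambda>z. ball z (\<delta> z)) ` K"] by blast
  have "\<exists>\<psi>. dev X (ball 0 e) \<psi> \<and> \<psi> 0 = g x \<and> inj_on \<psi> (ball 0 e)" if x: "x \<in> K" for x
  proof -
    obtain z where z: "z \<in> K" "ball x e \<subseteq> ball z (\<delta> z)" using e(2)[OF x] by blast
    obtain r \<phi> F where d: "flat_disc (g z) r \<phi> F" "2 * \<delta> z \<le> r" "\<forall>w\<in>K. dist w z < \<delta> z \<longrightarrow> g w = \<phi> (w - z)"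
      using \<delta>(2)[OF z(1)] by blast
    have in_ball: "w + (x - z) \<in> ball 0 r" if w: "w \<in> ball 0 e" for w
    proof -
      have "w + x \<in> ball x e" using w by (simp add: dist_norm)
      then have "dist z (w + x) < \<delta> z" using z(2) by auto
      moreover have "\<delta> z > 0" using \<delta>(1) z(1) .
      ultimately show ?thesis using d(2) by (simp add: dist_norm norm_minus_commute algebra_simps)
    qed
    have "x \<in> ball z (\<delta> z)" using z(2) e(1) by (metis centre_in_ball subsetD)
    then have "\<phi> (x - z) = g x" using d(3) x by (simp add: dist_commute)
    moreover have "dev X (ball 0 e) (\<lambda>w. \<phi> (w + (x - z)))"
      using dev_shift[OF flat_disc_dev[OF d(1)]] in_ball by blast
    moreover have "inj_on (\<lambda>w. \<phi> (w + (x - z))) (ball 0 e)"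
    proof (rule inj_onI)
      fix a b assume "a \<in> ball 0 e" "b \<in> ball 0 e" and "\<phi> (a + (x - z)) = \<phi> (b + (x - z))"
      moreover from this(1,2) have "F (\<phi> (a + (x - z))) = a + (x - z)" "F (\<phi> (b + (x - z))) = b + (x - z)"
        using in_ball d(1) unfolding flat_disc_def by blast+
      ultimately have "a + (x - z) = b + (x - z)" by metis
      then show "a = b" by simp
    qed
    ultimately show ?thesis by (intro exI[of _ "\<lambda>w. \<phi> (w + (x - z))"]) simp
  qed
  then obtain \<psi> where "\<And>x. x \<in> K \<Longrightarrow> dev X (ball 0 e) (\<psi> x) \<and> \<psi> x 0 = g x \<and> inj_on (\<psi> x) (ball 0 e)" by metis
  then show ?thesis using that e(1) by blast
qed

text \<open>A point near K is reached through the disc based at its closest point in K. Convexity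
  makes the closest point unique and 1-Lipschitz, so neighbouring points use neighbouring discs, and
  these agree where they overlap.\<close>

lemma dev_extend:
  assumes K: "compact K" "convex K" and g: "dev X K g"
  obtains e h where "e > 0" "dev X (nbhd K e) h" "\<And>z. z \<in> K \<Longrightarrow> h z = g z"
proof (cases "K = {}")
  case True
  have "dev X {} g" unfolding dev_def by (simp add: continuous_map_def)
  then show ?thesis using that[of 1 g] True by (simp add: nbhd_def)
next
  case False
  obtain e \<psi> where e: "e > 0" and dv: "\<And>z. z \<in> K \<Longrightarrow> dev X (ball 0 e) (\<psi> z)" and \<psi>0: "\<And>z. z \<in> K \<Longrightarrow> \<psi> z 0 = g z"
    using dev_uniform_discs[OF K(1) g] by metis
  have cl: "closed K" using K(1) compact_imp_closed by blast
  define c where "c = closest_point K"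
  have cK: "c w \<in> K" for w using closest_point_in_set[OF cl False] c_def by simp
  have cz: "c z = z" if "z \<in> K" for z using closest_point_self[OF that] c_def by simp
  have clip: "dist (c w) (c w') \<le> dist w w'" for w w'
    using closest_point_lipschitz[OF K(2) cl False] c_def by simp
  define h where "h w = \<psi> (c w) (w - c w)" for w
  let ?S = "{w. \<exists>z\<in>K. dist z w < e}"
  have near: "dist (c w) w < e" if "w \<in> ?S" for w
    using that closest_point_le[OF cl] c_def by (smt (verit) dist_commute mem_Collect_eq)
  have "dev X ?S h"
  proof (rule dev_local)
    fix w0 assume w0: "w0 \<in> ?S"
    let ?z = "c w0"
    \<comment> \<open>near \<open>w0\<close>, \<open>h\<close> coincides with the disc development based at the point of \<open>K\<close> closest to \<open>w0\<close>\<close>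
    obtain d where d: "d > 0" "\<And>w. w \<in> K \<Longrightarrow> dist w ?z < d \<Longrightarrow> g w = \<psi> ?z (w - ?z)"
    proof -
      obtain r \<phi> F where fd: "flat_disc (g ?z) r \<phi> F" using flat_disc_exists dev_regular[OF g cK] by blast
      obtain d1 where d1: "d1 > 0" "\<And>w. w \<in> K \<Longrightarrow> dist w ?z < d1 \<Longrightarrow> g w = \<phi> (w - ?z)"
        using dev_in_disc[OF g cK fd] by metis
      have fd': "flat_disc (\<psi> ?z 0) r \<phi> F" using fd \<psi>0[OF cK] by simp
      have 0: "0 \<in> ball (0::complex) e" using e by simp
      obtain d2 where d2: "d2 > 0" "\<And>w. w \<in> ball 0 e \<Longrightarrow> dist w 0 < d2 \<Longrightarrow> \<psi> ?z w = \<phi> (w - 0)"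
        using dev_in_disc[OF dv[OF cK] 0 fd'] by metis
      show ?thesis
        by (rule that[of "min d1 (min d2 e)"]) (use d1 d2 e in \<open>auto simp: dist_norm\<close>)
    qed
    \<comment> \<open>The bound d lets \<open>g (c w)\<close> be read off from the disc at
      \<open>c w0\<close>; the other one keeps w inside that disc and the two base points less than
      e apart.\<close>
    define \<eta> where "\<eta> = min d ((e - dist ?z w0) / 2)"
    have \<eta>: "\<eta> > 0" using d near[OF w0] unfolding \<eta>_def by simp
    have key: "h w = \<psi> ?z (w - ?z)" "w - ?z \<in> ball 0 e" if w: "w \<in> ?S" "w \<in> ball w0 \<eta>" for w
    proof -
      have zz: "dist (c w) ?z < d" "dist (c w) ?z < (e - dist ?z w0) / 2" "dist w w0 < (e - dist ?z w0) / 2"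
        using clip[of w w0] w(2) unfolding \<eta>_def by (auto simp: dist_commute)
      show wz: "w - ?z \<in> ball 0 e"
        using zz(3) dist_triangle[of w ?z w0] near[OF w0] by (simp add: dist_norm norm_minus_commute)
      let ?a = "c w - ?z"
      let ?T = "ball 0 e \<inter> {u. u + ?a \<in> ball 0 e}"
      have T: "convex ?T"
      proof -
        have "norm (- a - u) = norm (u + a)" for a u :: complex
          using norm_minus_cancel[of "u + a"] by (simp add: algebra_simps)
        then have "{u. u + ?a \<in> ball 0 e} = ball (- ?a) e" by (simp add: set_eq_iff dist_norm)
        then show ?thesis using convex_Int[OF convex_ball convex_ball] by metis
      qed
      have 1: "dev X ?T (\<psi> (c w))" using dev_subset[OF dv[OF cK]] by blast
      have 2: "dev X ?T (\<lambda>u. \<psi> ?z (u + ?a))" by (rule dev_shift[OF dv[OF cK]]) simp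
      have a: "norm ?a < e"
        using zz(2) near[OF w0] zero_le_dist[of ?z w0] unfolding dist_norm by argo
      have 3: "0 \<in> ?T" using a e by simp
      have 4: "\<psi> (c w) 0 = \<psi> ?z (0 + ?a)" using \<psi>0[OF cK] d(2)[OF cK zz(1)] by simp
      have 5: "w - c w \<in> ?T" using near[OF w(1)] wz by (simp add: dist_norm norm_minus_commute)
      from dev_unique[OF 1 2 convex_connected[OF T] 3 4 5] show "h w = \<psi> ?z (w - ?z)"
        unfolding h_def by simp
    qed
    have "dev X (?S \<inter> ball w0 \<eta>) (\<lambda>w. \<psi> ?z (w + (- ?z)))"
      by (rule dev_shift[OF dv[OF cK]]) (use key(2) in auto)
    then show "\<exists>N f. open N \<and> w0 \<in> N \<and> dev X (?S \<inter> N) f \<and> (\<forall>w\<in>?S \<inter> N. h w = f w)"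
      using \<eta> key(1) by (intro exI[of _ "ball w0 \<eta>"] exI[of _ "\<lambda>w. \<psi> ?z (w + (- ?z))"]) auto
  qed
  moreover have "h z = g z" if "z \<in> K" for z using cz[OF that] \<psi>0[OF that] unfolding h_def by simp
  ultimately show ?thesis using that e unfolding nbhd_def by blast
qed

lemma dev_open_image:
  assumes g: "dev X S g" and S: "open S" shows "openin (surf X) (g ` S)"
proof (subst openin_subopen, safe)
  fix z assume z: "z \<in> S"
  obtain r \<psi> F where d: "flat_disc (g z) r \<psi> F" using flat_disc_exists dev_regular[OF g z] by blast
  obtain e where e: "e > 0" "e \<le> r" "\<And>w. w \<in> S \<Longrightarrow> dist w z < e \<Longrightarrow> g w = \<psi> (w - z)"
    using dev_in_disc[OF g z d] by metis
  obtain e2 where e2: "e2 > 0" "ball z e2 \<subseteq> S" using S z by (meson openE)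
  let ?W = "ball (0::complex) (min e e2)"
  have "\<psi> w \<in> g ` S" if "w \<in> ?W" for w
  proof -
    have "w + z \<in> ball z e2" using that by (simp add: dist_norm)
    then have "w + z \<in> S" "dist (w + z) z < e" using e2 that by (auto simp: dist_norm)
    from e(3)[OF this] show ?thesis using \<open>w + z \<in> S\<close> by (metis add_diff_cancel_right' imageI)
  qed
  moreover have "openin (surf X) (\<psi> ` ?W)" by (rule flat_disc_open[OF d]) (use e in auto)
  moreover have "g z \<in> \<psi> ` ?W"
    using d e(1) e2(1) unfolding flat_disc_def by (intro rev_image_eqI[of 0]) auto
  ultimately show "\<exists>T. openin (surf X) T \<and> g z \<in> T \<and> T \<subseteq> g ` S"
    by (intro exI[of _ "\<psi> ` ?W"]) blast
qed

end

section \<open>The directional flows\<close>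

lemma segment_param:
  fixes z v :: complex
  assumes "s \<in> closed_segment 0 (t::real)"
  shows "z + of_real s * v \<in> closed_segment z (z + of_real t * v)"
proof -
  obtain u where "0 \<le> u" "u \<le> 1" "s = u * t" using assms by (auto simp: in_segment)
  then show ?thesis by (auto simp: in_segment algebra_simps scaleR_conv_of_real intro!: exI[of _ u])
qed

lemma segment_param_iff:
  fixes z v :: complex
  shows "w \<in> closed_segment z (z + of_real t * v) \<longleftrightarrow> (\<exists>s\<in>closed_segment 0 (t::real). w = z + of_real s * v)"
proof
  assume "w \<in> closed_segment z (z + of_real t * v)"
  then obtain u where u: "0 \<le> u" "u \<le> 1" "w = (1 - u) *\<^sub>R z + u *\<^sub>R (z + of_real t * v)" by (auto simp: in_segment)
  then have "u * t \<in> closed_segment 0 t" "w = z + of_real (u * t) * v"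
    by (auto simp: in_segment algebra_simps scaleR_conv_of_real)
  then show "\<exists>s\<in>closed_segment 0 t. w = z + of_real s * v" by blast
qed (use segment_param in auto)

context riemann_form begin

text \<open>The velocity in a chart is computed from the flat coordinate:
  \<open>coord c \<circ> \<psi>\<close> has derivative 1 / f at 0, which cancels the coefficient f
  in \<omega>(\<gamma>') = v.\<close>

lemma flow_arc_of_dev:
  assumes g: "dev X S g" and S: "closed_segment z (z + of_real t * v) \<subseteq> S"
  shows "flow_arc X v t (\<lambda>s. g (z + of_real s * v))"
  unfolding flow_arc_def
proof (intro conjI ballI impI)
  let ?I = "closed_segment 0 t" and ?\<gamma> = "\<lambda>s. g (z + of_real s * v)"
  have in_S: "z + of_real s * v \<in> S" if "s \<in> ?I" for s using segment_param[OF that] S by blast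
  have "continuous_map (top_of_set ?I) (top_of_set S) (\<lambda>s. z + of_real s * v)"
    using in_S by (auto simp: continuous_map_in_subtopology intro!: continuous_intros)
  from continuous_map_compose[OF this] g
  show "continuous_map (top_of_set ?I) (surf X) ?\<gamma>" unfolding dev_def o_def by blast
  fix s assume s: "s \<in> ?I"
  show ns: "?\<gamma> s \<notin> form_zeros X" using dev_regular[OF g in_S[OF s]] unfolding regular_points_def by blast
  fix c assume c: "c \<in> charts X" "?\<gamma> s \<in> dom_of c"
  define f where "f = coef X c (coord c (?\<gamma> s))"
  have f0: "f \<noteq> 0" using ns form_zeros_iff[OF c] f_def by simp
  obtain r \<psi> F where d: "flat_disc (?\<gamma> s) r \<psi> F"
    and dc: "((coord c \<circ> \<psi>) has_field_derivative 1 / f) (at 0)"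
    using flat_disc_exists_chart[OF c ns] f_def by metis
  obtain e where e: "e > 0" "\<And>w. w \<in> S \<Longrightarrow> dist w (z + of_real s * v) < e \<Longrightarrow> g w = \<psi> (w - (z + of_real s * v))"
    using dev_in_disc[OF g in_S[OF s] d] by metis
  let ?k = "\<lambda>s'. of_real (s' - s) * v"
  have "(?k has_vector_derivative v) (at s within ?I)"
    by (auto intro!: derivative_eq_intros)
  moreover have "((coord c \<circ> \<psi>) has_field_derivative 1 / f) (at (?k s) within ?k ` ?I)"
    using dc has_field_derivative_at_within by fastforce
  ultimately have "((coord c \<circ> \<psi>) \<circ> ?k has_vector_derivative v * (1 / f)) (at s within ?I)"
    by (rule field_vector_diff_chain_within)
  then have 1: "((coord c \<circ> \<psi>) \<circ> ?k has_vector_derivative v * (1 / f)) (at s within ?I)" .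
  have "((\<lambda>s'. of_real s' * v) \<longlongrightarrow> of_real s * v) (at s within ?I)" by (intro tendsto_intros)
  then have "\<forall>\<^sub>F s' in at s within ?I. dist (of_real s' * v) (of_real s * v) < e" using e(1) tendstoD by blast
  then obtain \<delta> where \<delta>: "\<delta> > 0" "\<And>s'. s' \<in> ?I \<Longrightarrow> s' \<noteq> s \<Longrightarrow> dist s' s < \<delta> \<Longrightarrow> dist (of_real s' * v) (of_real s * v) < e"
    unfolding eventually_at by blast
  have "((coord c \<circ> ?\<gamma>) has_vector_derivative v * (1 / f)) (at s within ?I)"
  proof (rule has_vector_derivative_transform_within[OF 1 \<delta>(1) s])
    fix s' assume s': "s' \<in> ?I" "dist s' s < \<delta>"
    then have "dist (of_real s' * v) (of_real s * v) < e" using \<delta>(2)[of s'] e(1) by (cases "s' = s") auto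
    then have "g (z + of_real s' * v) = \<psi> ((z + of_real s' * v) - (z + of_real s * v))"
      using e(2)[OF in_S[OF s'(1)]] by (simp add: dist_norm)
    then show "((coord c \<circ> \<psi>) \<circ> ?k) s' = (coord c \<circ> ?\<gamma>) s'" by (simp add: algebra_simps)
  qed
  then show "\<exists>w. ((coord c \<circ> ?\<gamma>) has_vector_derivative w) (at s within ?I) \<and> coef X c (coord c (?\<gamma> s)) * w = v"
    using f0 f_def by (intro exI[of _ "v * (1 / f)"]) simp
qed

text \<open>Along the arc a primitive F has constant derivative v by the chain rule, so F (\<gamma>
  s) - s v is locally constant, which is the defining property of a development.\<close>

lemma dev_of_flow_arc:
  assumes fa: "flow_arc X v t \<gamma>" and v: "v \<noteq> 0"
  shows "dev X (closed_segment 0 (of_real t * v)) (\<lambda>z. \<gamma> (Re (z / v)))"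
proof -
  let ?I = "closed_segment 0 t" and ?S = "closed_segment 0 (of_real t * v)"
  have cont: "continuous_map (top_of_set ?I) (surf X) \<gamma>" and nz: "\<And>s. s \<in> ?I \<Longrightarrow> \<gamma> s \<notin> form_zeros X"
    and der: "\<And>s c. s \<in> ?I \<Longrightarrow> c \<in> charts X \<Longrightarrow> \<gamma> s \<in> dom_of c \<Longrightarrow>
      \<exists>w. ((coord c \<circ> \<gamma>) has_vector_derivative w) (at s within ?I) \<and> coef X c (coord c (\<gamma> s)) * w = v"
    using fa unfolding flow_arc_def by auto
  have S: "\<exists>s\<in>?I. w = of_real s * v \<and> Re (w / v) = s" if "w \<in> ?S" for w
    using that segment_param_iff[of w 0 t v] v by auto
  have inI: "Re (w / v) \<in> ?I" "w = of_real (Re (w / v)) * v" if "w \<in> ?S" for w using S[OF that] by auto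
  have c1: "continuous_map (top_of_set ?S) (top_of_set ?I) (\<lambda>z. Re (z / v))"
    using inI v by (auto simp: continuous_map_in_subtopology intro!: continuous_intros)
  show ?thesis
  proof (rule devI)
    show "continuous_map (top_of_set ?S) (surf X) (\<lambda>z. \<gamma> (Re (z / v)))"
      using continuous_map_compose[OF c1 cont] unfolding o_def .
    have "\<gamma> s \<in> regular_points X" if "s \<in> ?I" for s
      using nz[OF that] cont that unfolding regular_points_def continuous_map_def by auto
    then show "(\<lambda>z. \<gamma> (Re (z / v))) ` ?S \<subseteq> regular_points X" using inI by blast
    fix z assume z: "z \<in> ?S"
    define s0 where "s0 = Re (z / v)"
    have s0: "s0 \<in> ?I" and zs: "z = of_real s0 * v" using inI[OF z] s0_def by auto
    have "\<gamma> s0 \<in> topspace (surf X)" using cont s0 unfolding continuous_map_def by auto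
    then obtain U F where F: "local_primitive X U F" "\<gamma> s0 \<in> U" using lp_exists by blast
    obtain e where e: "e > 0" "\<And>s. s \<in> ?I \<Longrightarrow> dist s s0 < e \<Longrightarrow> \<gamma> s \<in> U"
      using top_of_set_preimage_eventually[OF cont lp_openin[OF F(1)] s0 F(2)] by blast
    let ?J = "?I \<inter> ball s0 e"
    have J: "convex ?J" by (intro convex_Int convex_ball convex_closed_segment)
    have "((\<lambda>s. F (\<gamma> s) - of_real s * v) has_vector_derivative 0) (at s within ?J)" if s: "s \<in> ?J" for s
    proof -
      have sI: "s \<in> ?I" and sU: "\<gamma> s \<in> U" using s e(2) by (auto simp: dist_commute)
      obtain c where c: "c \<in> charts X" "\<gamma> s \<in> dom_of c"
        using chart_exists openin_subset[OF lp_openin[OF F(1)]] sU by blast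
      obtain w where w: "((coord c \<circ> \<gamma>) has_vector_derivative w) (at s within ?I)" "coef X c (coord c (\<gamma> s)) * w = v"
        using der[OF sI c] by blast
      have "((F \<circ> param c) has_field_derivative coef X c (coord c (\<gamma> s))) (at ((coord c \<circ> \<gamma>) s) within (coord c \<circ> \<gamma>) ` ?I)"
        using F(1) c sU unfolding local_primitive_def by (auto intro: has_field_derivative_at_within)
      from field_vector_diff_chain_within[OF w(1) this]
      have 1: "((F \<circ> param c) \<circ> (coord c \<circ> \<gamma>) has_vector_derivative v) (at s within ?I)"
        using w(2) by (subst (asm) mult.commute) simp
      obtain d where d: "d > 0" "\<And>s'. s' \<in> ?I \<Longrightarrow> dist s' s < d \<Longrightarrow> \<gamma> s' \<in> dom_of c"
        using top_of_set_preimage_eventually[OF cont chart_openin[OF c(1)] sI c(2)] by blast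
      have "((F \<circ> \<gamma>) has_vector_derivative v) (at s within ?I)"
      proof (rule has_vector_derivative_transform_within[OF 1 d(1) sI])
        fix s' assume "s' \<in> ?I" "dist s' s < d"
        then show "((F \<circ> param c) \<circ> (coord c \<circ> \<gamma>)) s' = (F \<circ> \<gamma>) s'" using d(2) c by simp
      qed
      then have "((F \<circ> \<gamma>) has_vector_derivative v) (at s within ?J)"
        by (rule has_vector_derivative_within_subset) blast
      moreover have "((\<lambda>s. of_real s * v) has_vector_derivative v) (at s within ?J)"
        by (auto intro!: derivative_eq_intros)
      ultimately show ?thesis using has_vector_derivative_diff by fastforce
    qed
    from has_vector_derivative_zero_constant[OF J this]
    obtain k where k: "\<And>s. s \<in> ?J \<Longrightarrow> F (\<gamma> s) - of_real s * v = k" by blast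
    have "\<forall>\<^sub>F w in at z within ?S. dist (Re (w / v)) s0 < e"
    proof -
      have "((\<lambda>w. Re (w / v)) \<longlongrightarrow> Re (z / v)) (at z within ?S)" using v by (intro tendsto_intros)
      then show ?thesis using e(1) tendstoD s0_def by blast
    qed
    moreover have "\<forall>\<^sub>F w in at z within ?S. w \<in> ?S" by (auto simp: eventually_at_filter)
    ultimately have "\<forall>\<^sub>F w in at z within ?S. F (\<gamma> (Re (w / v))) - F (\<gamma> (Re (z / v))) = w - z"
    proof eventually_elim
      case (elim w)
      have "F (\<gamma> (Re (w / v))) - of_real (Re (w / v)) * v = k" "F (\<gamma> s0) - of_real s0 * v = k"
        using k[of "Re (w / v)"] k[of s0] elim inI(1)[of w] s0 e(1) by (simp_all add: dist_commute)
      moreover have "of_real (Re (w / v)) * v = w" using inI(2)[of w] elim by simp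
      ultimately show ?case using zs s0_def by (metis (no_types, lifting) add_diff_cancel_left' diff_add_cancel add_diff_eq diff_diff_eq2)
    qed
    then show "\<exists>U F. local_primitive X U F \<and> \<gamma> (Re (z / v)) \<in> U \<and>
       (\<forall>\<^sub>F w in at z within ?S. F (\<gamma> (Re (w / v))) - F (\<gamma> (Re (z / v))) = w - z)"
      using F s0_def by blast
  qed
qed

text \<open>Any competing arc is itself a development of the segment and so coincides with g; this
  evaluates the definite description in \<open>flow\<close>. From here on flows are handled through
  developments.\<close>

lemma flow_dev:
  assumes g: "dev X S g" and S: "closed_segment z (z + of_real t * v) \<subseteq> S" and v: "v \<noteq> 0"
  shows "flow_defined X v t (g z)" "flow X v t (g z) = g (z + of_real t * v)"
proof -
  have fa: "flow_arc X v t (\<lambda>s. g (z + of_real s * v))" by (rule flow_arc_of_dev[OF g S])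
  then show "flow_defined X v t (g z)" unfolding flow_defined_def
    by (intro exI[of _ "\<lambda>s. g (z + of_real s * v)"]) simp
  show "flow X v t (g z) = g (z + of_real t * v)" unfolding flow_def
  proof (rule the_equality)
    show "\<exists>\<gamma>. flow_arc X v t \<gamma> \<and> \<gamma> 0 = g z \<and> \<gamma> t = g (z + of_real t * v)" using fa by (intro exI[of _ "\<lambda>s. g (z + of_real s * v)"]) simp
    fix y assume "\<exists>\<gamma>. flow_arc X v t \<gamma> \<and> \<gamma> 0 = g z \<and> \<gamma> t = y"
    then obtain \<gamma> where \<gamma>: "flow_arc X v t \<gamma>" "\<gamma> 0 = g z" "\<gamma> t = y" by blast
    let ?S = "closed_segment 0 (of_real t * v)"
    have 1: "dev X ?S (\<lambda>z. \<gamma> (Re (z / v)))" by (rule dev_of_flow_arc[OF \<gamma>(1) v])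
    have 2: "dev X ?S (\<lambda>w. g (w + z))"
    proof (rule dev_shift[OF g])
      fix w assume "w \<in> ?S"
      then have "\<exists>s\<in>closed_segment 0 t. w = of_real s * v" using segment_param_iff[of w 0 t v] by simp
      then have "w + z \<in> closed_segment z (z + of_real t * v)"
        using segment_param[of _ t z v] by (auto simp: add.commute)
      then show "w + z \<in> S" using S by blast
    qed
    have "\<gamma> (Re (of_real t * v / v)) = g (of_real t * v + z)"
      by (rule dev_unique[OF 1 2 connected_segment, of 0]) (use \<gamma> in auto)
    then show "y = g (z + of_real t * v)" using v \<gamma>(3) by (simp add: add.commute)
  qed
qed

lemma flow_defined_dev:
  assumes "flow_defined X v t x" "v \<noteq> 0"
  obtains g where "dev X (closed_segment 0 (of_real t * v)) g" "g 0 = x"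
proof -
  obtain \<gamma> where "flow_arc X v t \<gamma>" "\<gamma> 0 = x" using assms unfolding flow_defined_def by blast
  then show ?thesis using that[OF dev_of_flow_arc[OF _ assms(2)]] by simp
qed

end

section \<open>Holonomy invariance of cocycles\<close>

lemma convex_rectangle:
  fixes z :: complex
  assumes S: "convex S" and c: "z \<in> S" "z + of_real b \<in> S" "z + of_real t * \<i> \<in> S" "z + of_real b + of_real t * \<i> \<in> S"
    and xy: "x \<in> closed_segment 0 b" "y \<in> closed_segment 0 t"
  shows "z + of_real x + of_real y * \<i> \<in> S"
proof -
  obtain u where u: "0 \<le> u" "u \<le> 1" "x = u * b" using xy by (auto simp: in_segment)
  obtain v where v: "0 \<le> v" "v \<le> 1" "y = v * t" using xy by (auto simp: in_segment)
  have 1: "(1 - u) *\<^sub>R z + u *\<^sub>R (z + of_real b) \<in> S" using S c u by (auto simp: convex_alt)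
  have 2: "(1 - u) *\<^sub>R (z + of_real t * \<i>) + u *\<^sub>R (z + of_real b + of_real t * \<i>) \<in> S"
    using S c u by (auto simp: convex_alt)
  have "(1 - v) *\<^sub>R ((1 - u) *\<^sub>R z + u *\<^sub>R (z + of_real b)) +
     v *\<^sub>R ((1 - u) *\<^sub>R (z + of_real t * \<i>) + u *\<^sub>R (z + of_real b + of_real t * \<i>)) \<in> S"
    using S 1 2 v by (auto simp: convex_alt)
  then show ?thesis using u v by (simp add: scaleR_conv_of_real algebra_simps)
qed

lemma convex_translate_preimage:
  fixes K :: "complex set"
  assumes "convex K" shows "convex {u. u + w \<in> K}"
proof (rule convexI)
  fix x y :: complex and u v :: real
  assume a: "x \<in> {u. u + w \<in> K}" "y \<in> {u. u + w \<in> K}" "0 \<le> u" "0 \<le> v" "u + v = 1"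
  then have "u *\<^sub>R (x + w) + v *\<^sub>R (y + w) \<in> K" using convexD[OF assms, of "x + w" "y + w" u v] by simp
  moreover have "u *\<^sub>R (x + w) + v *\<^sub>R (y + w) = u *\<^sub>R x + v *\<^sub>R y + w"
    using a(5) by (simp add: scaleR_add_right flip: scaleR_add_left)
  ultimately show "u *\<^sub>R x + v *\<^sub>R y \<in> {u. u + w \<in> K}" by simp
qed

context riemann_form begin

lemma dev_segment_subset:
  assumes "convex S" "z \<in> S" "z + of_real t * v \<in> S" shows "closed_segment z (z + of_real t * v) \<subseteq> S"
  using closed_segment_subset[OF assms(2,3,1)] .

lemma cocycle_add:
  assumes \<Phi>: "\<Phi> \<in> cocycles_plus X" and g: "dev X S g" and S: "convex S"
    and z: "z \<in> S" "z + of_real t * \<i> \<in> S" "z + of_real (t + s) * \<i> \<in> S"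
  shows "\<Phi> (g z) (t + s) = \<Phi> (g z) t + \<Phi> (g (z + of_real t * \<i>)) s"
proof -
  have "vflow_defined X t (g z)" and f: "vflow X t (g z) = g (z + of_real t * \<i>)"
    using flow_dev[OF g dev_segment_subset[OF S z(1,2)]] by auto
  moreover have "z + of_real t * \<i> + of_real s * \<i> \<in> S" using z(3) by (simp add: algebra_simps)
  then have "vflow_defined X s (g (z + of_real t * \<i>))"
    using flow_dev(1)[OF g dev_segment_subset[OF S z(2)]] by simp
  ultimately show ?thesis using \<Phi> unfolding cocycles_plus_def by fastforce
qed

lemma cocycle_zero:
  assumes \<Phi>: "\<Phi> \<in> cocycles_plus X" and g: "dev X S g" and z: "z \<in> S"
  shows "\<Phi> (g z) 0 = 0"
  using cocycle_add[OF \<Phi> dev_subset[OF g, of "{z}"], of z 0 0] z by simp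

text \<open>Where a development is injective, its rectangles are admissible: injectivity gives the
  embedding, and the closure of the half-open rectangle stays in the compact image of the closed
  one, which consists of regular points.\<close>

lemma cocycle_rectangle:
  assumes \<Phi>: "\<Phi> \<in> cocycles_plus X" and g: "dev X S g" and S: "convex S" and inj: "inj_on g S"
    and t: "t\<^sub>1 > 0" "t\<^sub>2 > 0"
    and z: "z \<in> S" "z + of_real t\<^sub>2 \<in> S" "z + of_real t\<^sub>1 * \<i> \<in> S" "z + of_real t\<^sub>2 + of_real t\<^sub>1 * \<i> \<in> S"
  shows "\<Phi> (g z) t\<^sub>1 = \<Phi> (g (z + of_real t\<^sub>2)) t\<^sub>1"
proof -
  have R: "z + of_real x + of_real y * \<i> \<in> S" if "x \<in> {0..t\<^sub>2}" "y \<in> {0..t\<^sub>1}" for x y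
    using convex_rectangle[OF S z, of x y] that t by (simp add: closed_segment_eq_real_ivl)
  have R0: "z + of_real x \<in> S" if "x \<in> {0..t\<^sub>2}" for x using R[OF that, of 0] t by simp
  have h: "hflow_defined X x (g z)" "hflow X x (g z) = g (z + of_real x)" if "x \<in> {0..t\<^sub>2}" for x
    using flow_dev[OF g, of z x 1] dev_segment_subset[OF S z(1), of x 1] R0[OF that] by auto
  have v: "vflow_defined X y (g (z + of_real x))" "vflow X y (g (z + of_real x)) = g (z + of_real x + of_real y * \<i>)"
    if "x \<in> {0..t\<^sub>2}" "y \<in> {0..t\<^sub>1}" for x y
    using flow_dev[OF g dev_segment_subset[OF S R0[OF that(1)] R[OF that]]] by auto
  let ?f = "\<lambda>(a, b). z + of_real b + of_real a * \<i>"
  have rm: "rect_map X (g z) ab = g (?f ab)" if "ab \<in> {0..<t\<^sub>1} \<times> {0..<t\<^sub>2}" for ab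
    using that h v unfolding rect_map_def by auto
  have fS: "?f ab \<in> S" if "ab \<in> {0..t\<^sub>1} \<times> {0..t\<^sub>2}" for ab using R that by auto
  have "admissible X (g z) t\<^sub>1 t\<^sub>2"
    unfolding admissible_def
  proof (intro conjI ballI t)
    fix b assume b: "b \<in> {0..<t\<^sub>2}"
    show "hflow_defined X b (g z)" using h b by simp
    fix a assume "a \<in> {0..<t\<^sub>1}"
    then show "vflow_defined X a (hflow X b (g z))" using h v b by simp
  next
    show "inj_on (rect_map X (g z)) ({0..<t\<^sub>1} \<times> {0..<t\<^sub>2})"
    proof (rule inj_onI)
      fix p q assume p: "p \<in> {0..<t\<^sub>1} \<times> {0..<t\<^sub>2}" and q: "q \<in> {0..<t\<^sub>1} \<times> {0..<t\<^sub>2}"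
        and e: "rect_map X (g z) p = rect_map X (g z) q"
      have "?f p \<in> S" "?f q \<in> S" using fS p q by auto
      moreover have "g (?f p) = g (?f q)" using rm p q e by simp
      ultimately have "?f p = ?f q" using inj by (meson inj_onD)
      then show "p = q" by (auto simp: complex_eq_iff split: prod.splits)
    qed
    let ?K = "?f ` ({0..t\<^sub>1} \<times> {0..t\<^sub>2})"
    have "compact ?K" unfolding case_prod_unfold
      by (intro compact_continuous_image compact_Times continuous_intros) auto
    moreover have dK: "dev X ?K g" by (rule dev_subset[OF g]) (use fS in blast)
    ultimately have "compactin (surf X) (g ` ?K)"
      using image_compactin[of "top_of_set ?K" ?K "surf X" g] unfolding dev_def
      by (simp add: compactin_subtopology)
    then have "closedin (surf X) (g ` ?K)" using Hausdorff compactin_imp_closedin by blast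
    moreover have "rectangle X (g z) t\<^sub>1 t\<^sub>2 \<subseteq> g ` ?K"
    proof
      fix q assume "q \<in> rectangle X (g z) t\<^sub>1 t\<^sub>2"
      then obtain p where p: "p \<in> {0..<t\<^sub>1} \<times> {0..<t\<^sub>2}" "q = rect_map X (g z) p" unfolding rectangle_def by blast
      moreover have "p \<in> {0..t\<^sub>1} \<times> {0..t\<^sub>2}" using p(1) by auto
      ultimately show "q \<in> g ` ?K" using rm by blast
    qed
    ultimately have "(surf X) closure_of rectangle X (g z) t\<^sub>1 t\<^sub>2 \<subseteq> g ` ?K"
      using closure_of_minimal by blast
    moreover have "g ` ?K \<inter> form_zeros X = {}"
      using dev_regular[OF dK] unfolding regular_points_def by blast
    ultimately show "(surf X) closure_of rectangle X (g z) t\<^sub>1 t\<^sub>2 \<inter> form_zeros X = {}" by blast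
  qed
  moreover have "vflow_defined X t\<^sub>1 (g z)" using v(1)[of 0 t\<^sub>1] t by simp
  moreover have "hflow_defined X t\<^sub>2 (g z)" "vflow_defined X t\<^sub>1 (hflow X t\<^sub>2 (g z))"
    using h[of t\<^sub>2] v(1)[of t\<^sub>2 t\<^sub>1] t by auto
  ultimately have "\<Phi> (g z) t\<^sub>1 = \<Phi> (hflow X t\<^sub>2 (g z)) t\<^sub>1"
    using \<Phi> unfolding cocycles_plus_def by blast
  then show ?thesis using h(2)[of t\<^sub>2] t by simp
qed

text \<open>A long rectangle can overlap itself on the surface and is then not admissible. It is cut
  into pieces smaller than a uniform radius on which the local discs are injective.\<close>

lemma cocycle_holonomy_pos:
  assumes \<Phi>: "\<Phi> \<in> cocycles_plus X" and g: "dev X S g" and S: "convex S"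
    and t: "t \<ge> 0" "b \<ge> 0"
    and z: "z \<in> S" "z + of_real b \<in> S" "z + of_real t * \<i> \<in> S" "z + of_real b + of_real t * \<i> \<in> S"
  shows "\<Phi> (g z) t = \<Phi> (g (z + of_real b)) t"
proof -
  define f where "f = (\<lambda>p. z + of_real (fst p) + of_real (snd p) * \<i>)"
  let ?K = "f ` ({0..b} \<times> {0..t})"
  have fK: "z + of_real x + of_real y * \<i> \<in> ?K" if "x \<in> {0..b}" "y \<in> {0..t}" for x y
    using that unfolding f_def by (intro image_eqI[of _ _ "(x, y)"]) auto
  have "?K \<subseteq> S" using convex_rectangle[OF S z] t by (auto simp: f_def closed_segment_eq_real_ivl)
  then have dK: "dev X ?K g" using dev_subset[OF g] by blast
  have K: "compact ?K" unfolding f_def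
    by (intro compact_continuous_image compact_Times continuous_intros) auto
  have cK: "convex ?K"
  proof -
    have eq: "?K = (\<lambda>p. z + p) ` ((\<lambda>p. of_real (fst p) + of_real (snd p) * \<i>) ` ({0..b} \<times> {0..t}))"
      by (simp add: image_image f_def add.assoc)
    have "linear (\<lambda>p::real \<times> real. complex_of_real (fst p) + of_real (snd p) * \<i>)"
      by (rule linearI) (auto simp: algebra_simps scaleR_conv_of_real)
    then have "convex ((\<lambda>p. complex_of_real (fst p) + of_real (snd p) * \<i>) ` ({0..b} \<times> {0..t}))"
      by (rule convex_linear_image) (intro convex_Times convex_real_interval)
    from convex_translation[OF this, of z] show ?thesis unfolding eq .
  qed
  obtain e \<psi> where e: "e > 0" and \<psi>: "\<And>w. w \<in> ?K \<Longrightarrow> dev X (ball 0 e) (\<psi> w) \<and> \<psi> w 0 = g w"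
    "\<And>w. w \<in> ?K \<Longrightarrow> inj_on (\<psi> w) (ball 0 e)"
    using dev_uniform_discs[OF K dK] by metis
  \<comment> \<open>Sides below e / 2 put all four corners within distance e of w, the radius of the
    injective disc.\<close>
  have small: "\<Phi> (g w) t' = \<Phi> (g (w + of_real b')) t'"
    if w: "w = z + of_real x + of_real y * \<i>" and x: "x \<in> {0..b}" "x + b' \<in> {0..b}" and y: "y \<in> {0..t}" "y + t' \<in> {0..t}"
      and b': "0 \<le> b'" "b' < e / 2" and t': "0 \<le> t'" "t' < e / 2" for w x y b' t'
  proof -
    have inK: "w \<in> ?K" "of_real b' + w \<in> ?K" "of_real t' * \<i> + w \<in> ?K" "of_real b' + of_real t' * \<i> + w \<in> ?K"
      using fK[OF x(1) y(1)] fK[OF x(2) y(1)] fK[OF x(1) y(2)] fK[OF x(2) y(2)] w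
      by (simp_all add: algebra_simps)
    have nb: "of_real b' \<in> ball (0::complex) e" "of_real t' * \<i> \<in> ball 0 e" "of_real b' + of_real t' * \<i> \<in> ball 0 e"
      using b' t' e norm_triangle_ineq[of "of_real b'" "of_real t' * \<i>"] by (auto simp: norm_mult)
    let ?T = "ball 0 e \<inter> {u. u + w \<in> ?K}"
    have T: "convex ?T"
      by (intro convex_Int convex_ball convex_translate_preimage cK)
    have "dev X ?T (\<psi> w)" by (rule dev_subset[of X "ball 0 e"]) (use \<psi>(1)[OF inK(1)] in auto)
    moreover have "dev X ?T (\<lambda>u. g (u + w))" by (rule dev_shift[OF dK]) simp
    moreover have "0 \<in> ?T" "\<psi> w 0 = g (0 + w)" using e inK \<psi>(1)[OF inK(1)] by auto
    ultimately have eq: "\<psi> w u = g (u + w)" if "u \<in> ?T" for u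
      using dev_unique[of ?T "\<psi> w" "\<lambda>u. g (u + w)" 0 u] convex_connected[OF T] that by blast
    show ?thesis
    proof (cases "b' = 0 \<or> t' = 0")
      case True
      then show ?thesis using cocycle_zero[OF \<Phi> dK] inK by (auto simp: add.commute)
    next
      case False
      then have "b' > 0" "t' > 0" using b' t' by auto
      then have "\<Phi> (\<psi> w 0) t' = \<Phi> (\<psi> w (0 + of_real b')) t'"
        using cocycle_rectangle[OF \<Phi> conjunct1[OF \<psi>(1)[OF inK(1)]] convex_ball \<psi>(2)[OF inK(1)], of t' b' 0] nb e
        by simp
      then show ?thesis using eq[of 0] eq[of "of_real b'"] inK nb e by (simp add: add.commute)
    qed
  qed
  \<comment> \<open>stack thin strips vertically, then horizontally\<close>
  have vert: "\<Phi> (g (z + of_real x)) y = \<Phi> (g (z + of_real x + of_real b')) y"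
    if x: "x \<in> {0..b}" "x + b' \<in> {0..b}" and b': "0 \<le> b'" "b' < e / 2" and y: "y \<in> {0..t}" "y \<le> real n * (e / 4)" for x b' y n
    using y
  proof (induction n arbitrary: y)
    case 0
    then have "y = 0" by simp
    then show ?case using cocycle_zero[OF \<Phi> dK] fK[of x 0] fK[of "x + b'" 0] x t by (simp add: add.assoc)
  next
    case (Suc n)
    \<comment> \<open>The last strip has height at most e / 4, safely below e / 2; cutting off at 0
      handles a shorter remainder.\<close>
    define y0 where "y0 = max 0 (y - e / 4)"
    have y0: "y0 \<in> {0..t}" "y0 \<le> real n * (e / 4)" "0 \<le> y - y0" "y - y0 < e / 2"
      using Suc.prems e unfolding y0_def by (auto simp: algebra_simps max_def)
    have 1: "\<Phi> (g (z + of_real x')) y = \<Phi> (g (z + of_real x')) y0 + \<Phi> (g (z + of_real x' + of_real y0 * \<i>)) (y - y0)"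
      if "x' \<in> {0..b}" for x'
      using cocycle_add[OF \<Phi> dK cK, of "z + of_real x'" y0 "y - y0"] fK[OF that y0(1)] fK[OF that Suc.prems(1)] fK[OF that, of 0] t
      by simp
    have "\<Phi> (g (z + of_real x + of_real y0 * \<i>)) (y - y0) = \<Phi> (g (z + of_real x + of_real y0 * \<i> + of_real b')) (y - y0)"
      by (rule small[of _ x y0]) (use x b' y0 Suc.prems in auto)
    then show ?case
      using Suc.IH[OF y0(1,2)] 1[OF x(1)] 1[OF x(2)] by (simp add: add.assoc add.commute add.left_commute)
  qed
  obtain n where n: "t \<le> real n * (e / 4)" using e ex_less_of_nat_mult[of "e / 4" t] by (meson less_imp_le zero_less_divide_iff zero_less_numeral)
  have hor: "\<Phi> (g z) t = \<Phi> (g (z + of_real x)) t" if x: "x \<in> {0..b}" "x \<le> real m * (e / 4)" for x m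
    using x
  proof (induction m arbitrary: x)
    case 0
    then show ?case by simp
  next
    case (Suc m)
    define x0 where "x0 = max 0 (x - e / 4)"
    have x0: "x0 \<in> {0..b}" "x0 \<le> real m * (e / 4)" "0 \<le> x - x0" "x - x0 < e / 2"
      using Suc.prems e unfolding x0_def by (auto simp: algebra_simps max_def)
    have "\<Phi> (g (z + of_real x0)) t = \<Phi> (g (z + of_real x0 + of_real (x - x0))) t"
      by (rule vert[OF x0(1) _ x0(3,4) _ n]) (use Suc.prems t in auto)
    then show ?case using Suc.IH[OF x0(1,2)] by (simp add: add.assoc)
  qed
  obtain m where "b \<le> real m * (e / 4)" using e ex_less_of_nat_mult[of "e / 4" b] by (meson less_imp_le zero_less_divide_iff zero_less_numeral)
  then show ?thesis using hor[of b m] t by simp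
qed

lemma cocycle_holonomy:
  assumes \<Phi>: "\<Phi> \<in> cocycles_plus X" and g: "dev X S g" and S: "convex S"
    and z: "z \<in> S" "z + of_real b \<in> S" "z + of_real t * \<i> \<in> S" "z + of_real b + of_real t * \<i> \<in> S"
  shows "\<Phi> (g z) t = \<Phi> (g (z + of_real b)) t"
proof -
  have up: "\<Phi> (g z) t = \<Phi> (g (z + of_real b)) t" if t: "t \<ge> 0"
    and z: "z \<in> S" "z + of_real b \<in> S" "z + of_real t * \<i> \<in> S" "z + of_real b + of_real t * \<i> \<in> S" for z t
  proof (cases "b \<ge> 0")
    case True
    then show ?thesis using cocycle_holonomy_pos[OF \<Phi> g S t True z] by simp
  next
    case False
    then show ?thesis using cocycle_holonomy_pos[OF \<Phi> g S t, of "- b" "z + of_real b"] z by simp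
  qed
  show ?thesis
  proof (cases "t \<ge> 0")
    case True then show ?thesis using up z by blast
  next
    case False
    \<comment> \<open>A downward arc is an upward arc from its other end, with the opposite
      sign.\<close>
    have neg: "\<Phi> (g w) t = - \<Phi> (g (w + of_real t * \<i>)) (- t)" if "w \<in> S" "w + of_real t * \<i> \<in> S" for w
      using cocycle_add[OF \<Phi> g S that, of "- t"] that cocycle_zero[OF \<Phi> g that(1)] by simp
    have "\<Phi> (g (z + of_real t * \<i>)) (- t) = \<Phi> (g (z + of_real t * \<i> + of_real b)) (- t)"
      by (rule up) (use False z in \<open>auto simp: algebra_simps\<close>)
    moreover have "z + of_real t * \<i> + of_real b = z + of_real b + of_real t * \<i>" by simp
    ultimately show ?thesis using neg[of z] neg[of "z + of_real b"] z by simp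
  qed
qed

lemma flow_defined_extend:
  assumes "flow_defined X v t x" "v \<noteq> 0"
  obtains e g where "e > 0" "dev X (nbhd (closed_segment 0 (of_real t * v)) e) g" "g 0 = x"
proof -
  obtain g where g: "dev X (closed_segment 0 (of_real t * v)) g" "g 0 = x" using flow_defined_dev[OF assms] .
  obtain e h where "e > 0" "dev X (nbhd (closed_segment 0 (of_real t * v)) e) h"
    "\<And>z. z \<in> closed_segment 0 (of_real t * v) \<Longrightarrow> h z = g z"
    using dev_extend[OF compact_segment convex_closed_segment g(1)] by metis
  then show ?thesis using that g(2) by auto
qed

lemma ball_segment_nbhd:
  assumes "w \<in> ball 0 e" shows "w \<in> nbhd (closed_segment 0 a) e" "w + a \<in> nbhd (closed_segment 0 a) e"
proof -
  show "w \<in> nbhd (closed_segment 0 a) e" unfolding nbhd_def using assms by (auto intro!: bexI[of _ 0])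
  show "w + a \<in> nbhd (closed_segment 0 a) e" unfolding nbhd_def using assms
    by (auto intro!: bexI[of _ a] simp: dist_norm)
qed

lemma real_imag_in_ball:
  assumes "w \<in> ball 0 e"
  shows "of_real (Re w) \<in> ball (0::complex) e" "of_real (Im w) * \<i> \<in> ball 0 e"
  using assms abs_Re_le_cmod[of w] abs_Im_le_cmod[of w] by (auto simp: norm_mult)

text \<open>There are two ways of climbing along the vertical line over Re w: first by Im w and then
  by \<tau>, or in the reverse order. Moving horizontally from 0 to Re w costs nothing by holonomy,
  so only the two short pieces at the ends remain.\<close>

lemma vertical_change:
  assumes \<Phi>: "\<Phi> \<in> cocycles_plus X" and e: "e > 0" and h: "dev X (nbhd (closed_segment 0 (of_real \<tau> * \<i>)) e) h"
    and w: "w \<in> ball 0 e"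
  shows "\<Phi> (h w) \<tau> = \<Phi> (h 0) \<tau> + \<Phi> (h (of_real (Re w) + of_real \<tau> * \<i>)) (Im w) - \<Phi> (h (of_real (Re w))) (Im w)"
proof -
  let ?S = "nbhd (closed_segment 0 (of_real \<tau> * \<i>)) e" and ?u = "complex_of_real (Re w)"
  have S: "convex ?S" by (simp add: convex_nbhd)
  have weq: "?u + of_real (Im w) * \<i> = w" by (simp add: complex_eq_iff)
  note B = ball_segment_nbhd[OF w] ball_segment_nbhd[OF real_imag_in_ball(1)[OF w]] ball_segment_nbhd[of 0 e]
  have "\<Phi> (h ?u) (Im w + \<tau>) = \<Phi> (h ?u) (Im w) + \<Phi> (h w) \<tau>"
  proof -
    have eq: "?u + of_real (Im w + \<tau>) * \<i> = w + of_real \<tau> * \<i>" using weq by (simp add: algebra_simps)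
    show ?thesis using cocycle_add[OF \<Phi> h S, of ?u "Im w" \<tau>, unfolded eq weq] B by blast
  qed
  moreover have "\<Phi> (h ?u) (\<tau> + Im w) = \<Phi> (h ?u) \<tau> + \<Phi> (h (?u + of_real \<tau> * \<i>)) (Im w)"
  proof -
    have "?u + of_real (\<tau> + Im w) * \<i> = w + of_real \<tau> * \<i>" using weq by (simp add: algebra_simps)
    then show ?thesis using cocycle_add[OF \<Phi> h S, of ?u \<tau> "Im w"] B by simp
  qed
  moreover have "\<Phi> (h 0) \<tau> = \<Phi> (h (0 + ?u)) \<tau>"
    using cocycle_holonomy[OF \<Phi> h S, of 0 "Re w" \<tau>] B e by simp
  ultimately show ?thesis by (simp add: add.commute)
qed

text \<open>The two end pieces in \<open>vertical_change\<close> lie over the two ends of the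
  horizontal arc, so holonomy along that arc makes them cancel. The open set is chosen before the
  cocycle and serves all of them.\<close>

lemma cocycle_constant:
  assumes g: "dev X (closed_segment 0 (of_real \<tau> * \<i>)) g" and k: "dev X (closed_segment 0 (of_real s)) k"
    and ends: "g 0 = k 0" "g (of_real \<tau> * \<i>) = k (of_real s)"
  obtains W where "openin (surf X) W" "W \<noteq> {}"
    "\<And>\<Phi>. \<Phi> \<in> cocycles_plus X \<Longrightarrow> \<exists>c. \<forall>y\<in>W. \<Phi> y \<tau> = c"
proof -
  obtain e1 h1 where h1: "e1 > 0" "dev X (nbhd (closed_segment 0 (of_real \<tau> * \<i>)) e1) h1"
    "\<And>z. z \<in> closed_segment 0 (of_real \<tau> * \<i>) \<Longrightarrow> h1 z = g z"
    using dev_extend[OF compact_segment convex_closed_segment g] by metis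
  obtain e2 h2 where h2: "e2 > 0" "dev X (nbhd (closed_segment 0 (of_real s)) e2) h2"
    "\<And>z. z \<in> closed_segment 0 (of_real s) \<Longrightarrow> h2 z = k z"
    using dev_extend[OF compact_segment convex_closed_segment k] by metis
  define e where "e = min e1 e2"
  have e: "e > 0" "e \<le> e1" "e \<le> e2" using h1 h2 unfolding e_def by auto
  let ?S1 = "nbhd (closed_segment 0 (of_real \<tau> * \<i>)) e" and ?S2 = "nbhd (closed_segment 0 (of_real s)) e"
  have d1: "dev X ?S1 h1" by (rule dev_subset[OF h1(2)]) (use e in \<open>force simp: nbhd_def\<close>)
  have d2: "dev X ?S2 h2" by (rule dev_subset[OF h2(2)]) (use e in \<open>force simp: nbhd_def\<close>)
  have S2: "convex ?S2" by (simp add: convex_nbhd)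
  have b: "dev X (ball 0 e) h1" "dev X (ball 0 e) h2"
    using dev_subset[OF d1] dev_subset[OF d2] ball_segment_nbhd by blast+
  have start: "h1 w = h2 w" if "w \<in> ball 0 e" for w
    by (rule dev_unique[OF b _ _ _ that, of 0]) (use ends h1(3) h2(3) e in auto)
  have b': "dev X (ball 0 e) (\<lambda>w. h1 (w + of_real \<tau> * \<i>))" "dev X (ball 0 e) (\<lambda>w. h2 (w + of_real s))"
    by (rule dev_shift[OF d1] dev_shift[OF d2], use ball_segment_nbhd in blast)+
  have stop: "h1 (w + of_real \<tau> * \<i>) = h2 (w + of_real s)" if "w \<in> ball 0 e" for w
    by (rule dev_unique[OF b' _ _ _ that, of 0]) (use ends h1(3) h2(3) e in auto)
  have const: "\<Phi> (h1 w) \<tau> = \<Phi> (h1 0) \<tau>" if \<Phi>: "\<Phi> \<in> cocycles_plus X" and w: "w \<in> ball 0 e" for \<Phi> w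
  proof -
    let ?u = "complex_of_real (Re w)"
    have weq: "?u + of_real (Im w) * \<i> = w" by (simp add: complex_eq_iff)
    note B = ball_segment_nbhd[OF w, of "of_real s"] ball_segment_nbhd[OF real_imag_in_ball(1)[OF w], of "of_real s"]
    have eq: "?u + of_real s + of_real (Im w) * \<i> = w + of_real s" using weq by (simp add: algebra_simps)
    have "\<Phi> (h2 ?u) (Im w) = \<Phi> (h2 (?u + of_real s)) (Im w)"
      using cocycle_holonomy[OF \<Phi> d2 S2, of ?u s "Im w", unfolded eq weq] B by blast
    then show ?thesis
      using vertical_change[OF \<Phi> e(1) d1 w] start stop real_imag_in_ball(1)[OF w] by simp
  qed
  show ?thesis
  proof
    show "openin (surf X) (h1 ` ball 0 e)" by (rule dev_open_image[OF b(1) open_ball])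
    show "h1 ` ball 0 e \<noteq> {}" using e by simp
    show "\<exists>c. \<forall>y\<in>h1 ` ball 0 e. \<Phi> y \<tau> = c" if "\<Phi> \<in> cocycles_plus X" for \<Phi>
      using const[OF that] by blast
  qed
qed

text \<open>The Hoelder bound makes both end pieces in \<open>vertical_change\<close> smaller than
  \<epsilon> / 2.\<close>

lemma cocycle_continuous:
  assumes \<Phi>: "\<Phi> \<in> cocycles_plus X" and x: "vflow_defined X \<tau> x" and \<epsilon>: "\<epsilon> > 0"
  obtains N where "openin (surf X) N" "x \<in> N" "\<And>y. y \<in> N \<Longrightarrow> vflow_defined X \<tau> y \<and> \<bar>\<Phi> y \<tau> - \<Phi> x \<tau>\<bar> < \<epsilon>"
proof -
  obtain e h where e: "e > 0" and h: "dev X (nbhd (closed_segment 0 (of_real \<tau> * \<i>)) e) h" and h0: "h 0 = x"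
    using flow_defined_extend[OF x] by auto
  let ?S = "nbhd (closed_segment 0 (of_real \<tau> * \<i>)) e"
  have S: "convex ?S" by (simp add: convex_nbhd)
  obtain t0 \<theta> where t0: "t0 > 0" "\<theta> > 0" and hoelder: "\<And>x t. \<bar>t\<bar> < t0 \<Longrightarrow> vflow_defined X t x \<Longrightarrow> \<bar>\<Phi> x t\<bar> \<le> \<bar>t\<bar> powr \<theta>"
    using \<Phi> unfolding cocycles_plus_def by auto
  \<comment> \<open>The last entry solves t powr \<theta> = \<epsilon> / 2.\<close>
  define \<delta> where "\<delta> = min e (min t0 ((\<epsilon> / 2) powr (1 / \<theta>)))"
  have \<delta>: "\<delta> > 0" "\<delta> \<le> e" "\<delta> \<le> t0" using e t0 \<epsilon> unfolding \<delta>_def by auto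
  have small: "\<bar>t\<bar> powr \<theta> < \<epsilon> / 2" if "\<bar>t\<bar> < \<delta>" for t
  proof -
    have "\<bar>t\<bar> powr \<theta> < ((\<epsilon> / 2) powr (1 / \<theta>)) powr \<theta>"
      by (rule powr_less_mono2) (use t0 that \<delta>_def in auto)
    then show ?thesis using \<epsilon> t0 by (simp add: powr_powr)
  qed
  show ?thesis
  proof
    have "dev X (ball 0 \<delta>) h" by (rule dev_subset[OF h]) (use \<delta> ball_segment_nbhd(1)[of _ e] in auto)
    then show "openin (surf X) (h ` ball 0 \<delta>)" by (rule dev_open_image) simp
    show "x \<in> h ` ball 0 \<delta>" using h0 \<delta> by (intro image_eqI[of _ _ 0]) auto
    fix y assume "y \<in> h ` ball 0 \<delta>"
    then obtain w where w: "w \<in> ball 0 \<delta>" "y = h w" by blast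
    have we: "w \<in> ball 0 e" using w \<delta> by simp
    let ?u = "complex_of_real (Re w)"
    have weq: "?u + of_real (Im w) * \<i> = w" by (simp add: complex_eq_iff)
    note B = ball_segment_nbhd[OF we, of "of_real \<tau> * \<i>"] ball_segment_nbhd[OF real_imag_in_ball(1)[OF we], of "of_real \<tau> * \<i>"]
    have "vflow_defined X \<tau> y" unfolding w(2)
      by (rule flow_dev(1)[OF h dev_segment_subset[OF S]]) (use B in auto)
    moreover have "\<bar>Im w\<bar> < \<delta>" using w(1) abs_Im_le_cmod[of w] by simp
    moreover have "vflow_defined X (Im w) (h ?u)"
      by (rule flow_dev(1)[OF h dev_segment_subset[OF S]]) (use B weq in auto)
    moreover have "vflow_defined X (Im w) (h (?u + of_real \<tau> * \<i>))"
    proof (rule flow_dev(1)[OF h dev_segment_subset[OF S]])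
      have "?u + of_real \<tau> * \<i> + of_real (Im w) * \<i> = w + of_real \<tau> * \<i>" using weq by (simp add: algebra_simps)
      then show "?u + of_real \<tau> * \<i> + of_real (Im w) * \<i> \<in> ?S" using B by metis
    qed (use B in auto)
    ultimately have "\<bar>\<Phi> (h ?u) (Im w)\<bar> < \<epsilon> / 2" "\<bar>\<Phi> (h (?u + of_real \<tau> * \<i>)) (Im w)\<bar> < \<epsilon> / 2"
      using hoelder[of "Im w"] small[of "Im w"] \<delta>(3) by fastforce+
    then show "vflow_defined X \<tau> y \<and> \<bar>\<Phi> y \<tau> - \<Phi> x \<tau>\<bar> < \<epsilon>"
      using \<open>vflow_defined X \<tau> y\<close> vertical_change[OF \<Phi> e h we] w(2) h0 by simp
  qed
qed

text \<open>On the open set of points with an arc of length \<tau> the cocycle is continuous. Off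
  this set the convention gives 0, so the preimage of an open set gains the complement exactly when
  that open set contains 0.\<close>

lemma cocycle_measurable:
  assumes \<Phi>: "\<Phi> \<in> cocycles_plus X"
    and M: "space M = topspace (surf X)" "sets M = sigma_sets (topspace (surf X)) {U. openin (surf X) U}"
  shows "(\<lambda>x. \<Phi> x \<tau>) \<in> borel_measurable M"
proof (rule borel_measurableI)
  fix B :: "real set" assume B: "open B"
  have op: "U \<in> sets M" if "openin (surf X) U" for U using M(2) that by auto
  let ?D = "{x \<in> topspace (surf X). vflow_defined X \<tau> x}"
  let ?A = "{x \<in> topspace (surf X). vflow_defined X \<tau> x \<and> \<Phi> x \<tau> \<in> B}"
  have A: "openin (surf X) {x \<in> topspace (surf X). vflow_defined X \<tau> x \<and> \<Phi> x \<tau> \<in> B}" if B: "open B" for B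
  proof (subst openin_subopen, safe)
    fix x assume x: "vflow_defined X \<tau> x" "\<Phi> x \<tau> \<in> B"
    obtain \<epsilon> where \<epsilon>: "\<epsilon> > 0" "ball (\<Phi> x \<tau>) \<epsilon> \<subseteq> B" using B x by (meson openE)
    obtain N where N: "openin (surf X) N" "x \<in> N" "\<And>y. y \<in> N \<Longrightarrow> vflow_defined X \<tau> y \<and> \<bar>\<Phi> y \<tau> - \<Phi> x \<tau>\<bar> < \<epsilon>"
      using cocycle_continuous[OF \<Phi> x(1) \<epsilon>(1)] by metis
    have "\<Phi> y \<tau> \<in> B" if "y \<in> N" for y
      using N(3)[OF that] \<epsilon>(2) by (auto simp: dist_real_def abs_minus_commute)
    then show "\<exists>T. openin (surf X) T \<and> x \<in> T \<and> T \<subseteq> {x \<in> topspace (surf X). vflow_defined X \<tau> x \<and> \<Phi> x \<tau> \<in> B}"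
      using N openin_subset[OF N(1)] by (intro exI[of _ N]) auto
  qed
  have D: "?D \<in> sets M" using op[OF A[OF open_UNIV]] by simp
  have "(\<lambda>x. \<Phi> x \<tau>) -` B \<inter> space M = ?A \<union> (if 0 \<in> B then space M - ?D else {})"
  proof -
    have "\<Phi> x \<tau> = 0" if "\<not> vflow_defined X \<tau> x" for x using \<Phi> that unfolding cocycles_plus_def by blast
    then show ?thesis using M(1) by (auto split: if_splits) metis
  qed
  then show "(\<lambda>x. \<Phi> x \<tau>) -` B \<inter> space M \<in> sets M"
    using op[OF A[OF B]] D by auto
qed

end

section \<open>Leaves\<close>

context riemann_form begin

lemma dev_glue:
  assumes A: "open A" and B: "open B" and K: "K \<subseteq> A \<union> B"
    and g: "dev X (K \<inter> A) g" and h: "dev X (K \<inter> B) h" and eq: "\<And>z. z \<in> K \<inter> A \<inter> B \<Longrightarrow> g z = h z"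
  shows "dev X K (\<lambda>z. if z \<in> A then g z else h z)"
proof (rule dev_local)
  fix z assume z: "z \<in> K"
  show "\<exists>N f. open N \<and> z \<in> N \<and> dev X (K \<inter> N) f \<and> (\<forall>w\<in>K \<inter> N. (if w \<in> A then g w else h w) = f w)"
  proof (cases "z \<in> A")
    case True then show ?thesis using A g by (intro exI[of _ A] exI[of _ g]) auto
  next
    case False then show ?thesis using B h K z eq by (intro exI[of _ B] exI[of _ h]) auto
  qed
qed

lemma flow_defined_subsegment:
  assumes "flow_defined X v t p" "v \<noteq> 0" "s \<in> closed_segment 0 t"
  shows "flow_defined X v s p"
proof -
  obtain g where g: "dev X (closed_segment 0 (of_real t * v)) g" "g 0 = p" using flow_defined_dev[OF assms(1,2)] .
  have "of_real s * v \<in> closed_segment 0 (of_real t * v)" using segment_param[OF assms(3), of 0 v] by simp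
  then have "closed_segment 0 (0 + of_real s * v) \<subseteq> closed_segment 0 (of_real t * v)"
    by (simp add: closed_segment_subset)
  from flow_dev(1)[OF g(1) this assms(2)] g(2) show ?thesis by simp
qed

lemma flow_defined_topspace: "flow_defined X v t p \<Longrightarrow> v \<noteq> 0 \<Longrightarrow> p \<in> regular_points X"
  by (metis dev_regular ends_in_segment(1) flow_defined_dev)

lemma flow_zero: "p \<in> regular_points X \<Longrightarrow> v \<noteq> 0 \<Longrightarrow> flow_defined X v 0 p \<and> flow X v 0 p = p"
proof -
  assume p: "p \<in> regular_points X" and v: "v \<noteq> 0"
  obtain r \<psi> F where d: "flat_disc p r \<psi> F" using flat_disc_exists p by blast
  then have "r > 0" "\<psi> 0 = p" unfolding flat_disc_def by auto
  then show ?thesis using flow_dev[OF flat_disc_dev[OF d], of 0 0 v] v by simp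
qed

text \<open>Each flow time supplies its own development of some unspecified width. Uniqueness makes
  them agree, so the flow itself is a development on the whole interval, open or closed.\<close>

lemma leaf_dev:
  assumes I: "convex I" "0 \<in> I" and v: "v \<noteq> 0" and fd: "\<And>s. s \<in> I \<Longrightarrow> flow_defined X v s p"
  shows "dev X ((\<lambda>s. of_real s * v) ` I) (\<lambda>z. flow X v (Re (z / v)) p)"
proof (rule dev_local)
  fix z assume "z \<in> (\<lambda>s. of_real s * v) ` I"
  then obtain s0 where s0: "s0 \<in> I" "z = of_real s0 * v" by blast
  let ?S = "(\<lambda>s. of_real s * v) ` I"
  obtain e h where e: "e > 0" and h: "dev X (nbhd (closed_segment 0 (of_real s0 * v)) e) h" and h0: "h 0 = p"
    using flow_defined_extend[OF fd[OF s0(1)] v] .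
  let ?N = "nbhd (closed_segment 0 (of_real s0 * v)) e"
  have "flow X v (Re (w / v)) p = h w" if w: "w \<in> ?S" "w \<in> ?N" for w
  proof -
    obtain s where s: "w = of_real s * v" using w by blast
    have "closed_segment 0 (0 + of_real s * v) \<subseteq> ?N"
      using dev_segment_subset[of ?N 0 s v] w s subset_nbhd[OF e, of "closed_segment 0 (of_real s0 * v)"]
      by (auto simp: convex_nbhd)
    from flow_dev(2)[OF h this v] h0 show ?thesis using s v by simp
  qed
  moreover have "z \<in> ?N" using subset_nbhd[OF e] s0 by auto
  ultimately show "\<exists>N f. open N \<and> z \<in> N \<and> dev X (?S \<inter> N) f \<and> (\<forall>w\<in>?S \<inter> N. flow X v (Re (w / v)) p = f w)"
    using dev_subset[OF h] open_nbhd by (intro exI[of _ ?N] exI[of _ h]) auto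
qed

text \<open>Two segments from 0 form an interval whatever the signs of s and t, so the group law
  holds without distinguishing forward from backward motion.\<close>

lemma flow_between:
  assumes "flow_defined X v s p" "flow_defined X v t p" "v \<noteq> 0"
  shows "flow_defined X v (t - s) (flow X v s p)" "flow X v (t - s) (flow X v s p) = flow X v t p"
proof -
  let ?I = "closed_segment 0 s \<union> closed_segment 0 t"
  have I: "convex ?I" "0 \<in> ?I"
    by (auto simp: is_interval_convex_1[symmetric] is_interval_1 closed_segment_eq_real_ivl split: if_splits)
  have "\<And>u. u \<in> ?I \<Longrightarrow> flow_defined X v u p" using flow_defined_subsegment assms by blast
  from leaf_dev[OF I assms(3) this]
  have d: "dev X ((\<lambda>s. of_real s * v) ` ?I) (\<lambda>z. flow X v (Re (z / v)) p)" .
  have c: "convex ((\<lambda>s. of_real s * v) ` ?I)"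
    by (rule convex_linear_image[OF _ I(1)]) (auto intro!: linearI simp: algebra_simps scaleR_conv_of_real)
  have "closed_segment (of_real s * v) (of_real s * v + of_real (t - s) * v) \<subseteq> (\<lambda>s. of_real s * v) ` ?I"
    by (rule dev_segment_subset[OF c]) (auto simp: algebra_simps intro!: imageI)
  from flow_dev[OF d this assms(3)] show "flow_defined X v (t - s) (flow X v s p)" "flow X v (t - s) (flow X v s p) = flow X v t p"
    using assms(3) by (simp_all add: algebra_simps flip: distrib_right)
qed

definition cluster :: "complex set \<Rightarrow> (complex \<Rightarrow> 'a) \<Rightarrow> complex \<Rightarrow> 'a \<Rightarrow> bool" where
  "cluster S g a z \<longleftrightarrow> (\<forall>N e. openin (surf X) N \<and> z \<in> N \<and> e > 0 \<longrightarrow> (\<exists>w\<in>S. dist w a < e \<and> g w \<in> N))"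

text \<open>T is the end of the maximal interval of existence. Compactness gives the leaf a cluster
  point at time T; at a regular point a flat disc would carry the leaf up to and including T, so the
  cluster point is a zero.\<close>

lemma leaf_end:
  assumes p: "p \<in> regular_points X" and v: "v \<noteq> 0" and t: "t \<ge> 0" "\<not> flow_defined X v t p"
  obtains T z where "0 < T" "T \<le> t" "\<And>s. s \<in> {0..<T} \<Longrightarrow> flow_defined X v s p" "\<not> flow_defined X v T p"
    "z \<in> form_zeros X" "\<And>N e. openin (surf X) N \<Longrightarrow> z \<in> N \<Longrightarrow> e > 0 \<Longrightarrow> \<exists>s\<in>{0..<T}. T - s < e \<and> flow X v s p \<in> N"
proof -
  let ?D = "{s. s \<ge> 0 \<and> \<not> flow_defined X v s p}"
  define T where "T = Inf ?D"
  have bdd: "bdd_below ?D" by (intro bdd_belowI[of _ 0]) auto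
  have ne: "t \<in> ?D" using t by blast
  have T0: "T \<ge> 0" unfolding T_def by (rule cInf_greatest) (use ne in auto)
  have Tt: "T \<le> t" unfolding T_def by (rule cInf_lower[OF ne bdd])
  have below: "flow_defined X v s p" if "s \<in> {0..<T}" for s
  proof (rule ccontr)
    assume "\<not> flow_defined X v s p"
    then have "T \<le> s" unfolding T_def using that bdd by (intro cInf_lower) auto
    then show False using that by simp
  qed
  have nT: "\<not> flow_defined X v T p"
  proof
    assume fT: "flow_defined X v T p"
    obtain e h where e: "e > 0" and h: "dev X (nbhd (closed_segment 0 (of_real T * v)) e) h" and h0: "h 0 = p"
      using flow_defined_extend[OF fT v] .
    let ?N = "nbhd (closed_segment 0 (of_real T * v)) e"
    have "flow_defined X v s p" if s: "s \<in> {T..<T + e / norm v}" for s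
    proof -
      have "norm (of_real T * v - of_real s * v) = \<bar>T - s\<bar> * norm v" by (simp add: norm_mult flip: left_diff_distrib of_real_diff)
      also have "\<dots> < e" using s v by (simp add: field_simps)
      finally have "of_real s * v \<in> ?N" unfolding nbhd_def by (auto simp: dist_norm intro!: bexI[of _ "of_real T * v"])
      then have "closed_segment 0 (0 + of_real s * v) \<subseteq> ?N"
        using dev_segment_subset[of ?N 0 s v] subset_nbhd[OF e, of "closed_segment 0 (of_real T * v)"]
        by (auto simp: convex_nbhd)
      from flow_dev(1)[OF h this v] h0 show ?thesis by simp
    qed
    then have "T + e / norm v \<le> s" if "s \<in> ?D" for s
      using that below by (metis (mono_tags, lifting) atLeastLessThan_iff linorder_not_less mem_Collect_eq)
    then have "T + e / norm v \<le> T" using ne T_def cInf_greatest[of ?D "T + e / norm v"] by blast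
    then show False using e v by (simp add: field_simps)
  qed
  have Tpos: "T > 0" using nT flow_zero[OF p v] T0 by (cases "T = 0") auto
  let ?P = "\<lambda>z N e. openin (surf X) N \<and> z \<in> N \<and> e > 0 \<and> (\<forall>s\<in>{0..<T}. T - s < e \<longrightarrow> flow X v s p \<notin> N)"
  have "\<exists>z\<in>topspace (surf X). \<nexists>N e. ?P z N e"
  proof (rule ccontr)
    assume "\<not> ?thesis"
    then obtain N e where Ne: "\<And>z. z \<in> topspace (surf X) \<Longrightarrow> ?P z (N z) (e z)" by metis
    obtain \<F> where \<F>: "finite \<F>" "\<F> \<subseteq> topspace (surf X)" "topspace (surf X) \<subseteq> \<Union>(N ` \<F>)"
    proof -
      have "\<exists>\<G>. finite \<G> \<and> \<G> \<subseteq> N ` topspace (surf X) \<and> topspace (surf X) \<subseteq> \<Union>\<G>"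
      proof -
        have "\<forall>U\<in>N ` topspace (surf X). openin (surf X) U" "topspace (surf X) \<subseteq> \<Union>(N ` topspace (surf X))"
          using Ne by auto
        then show ?thesis using comp unfolding compact_space_alt by meson
      qed
      then show ?thesis using that by (metis finite_subset_image)
    qed
    \<comment> \<open>At times closer than m to T the leaf would avoid every set of the finite
      subcover, although these sets cover the surface. Including T keeps T - m / 2
      nonnegative.\<close>
    define m where "m = Min (insert T (e ` \<F>))"
    have "finite (insert T (e ` \<F>))" using \<F> by simp
    then have m: "m > 0" "m \<le> T" "\<And>z. z \<in> \<F> \<Longrightarrow> m \<le> e z"
      using Ne \<F>(2) Tpos unfolding m_def by (auto simp: subset_iff)
    have s: "T - m / 2 \<in> {0..<T}" using m by auto
    have "flow X v (T - m / 2) p \<in> topspace (surf X)"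
      using flow_defined_topspace[OF flow_between(1)[OF below[OF s] below[OF s] v] v] unfolding regular_points_def by blast
    then obtain z where z: "z \<in> \<F>" "flow X v (T - m / 2) p \<in> N z" using \<F> by blast
    moreover have "T - (T - m / 2) < e z" using m(1) m(3)[OF z(1)] by simp
    ultimately show False using Ne[of z] s \<F>(2) by blast
  qed
  then obtain z where z: "z \<in> topspace (surf X)" "\<nexists>N e. ?P z N e" by blast
  have "z \<in> form_zeros X"
  proof (rule ccontr)
    assume "z \<notin> form_zeros X"
    then have "z \<in> regular_points X" using z unfolding regular_points_def by blast
    then obtain r \<psi> F where d: "flat_disc z r \<psi> F" using flat_disc_exists by blast
    have r: "r > 0" and \<psi>0: "\<psi> 0 = z" using d unfolding flat_disc_def by auto
    \<comment> \<open>Within time \<epsilon> the leaf covers a distance of r / 2, so from the half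
      disc it stays in the disc of radius r until time T.\<close>
    define \<epsilon> where "\<epsilon> = r / (2 * norm v)"
    have \<epsilon>: "\<epsilon> > 0" using r v unfolding \<epsilon>_def by simp
    have "openin (surf X) (\<psi> ` ball 0 (r / 2))" by (rule flat_disc_open[OF d]) (use r in auto)
    moreover have "z \<in> \<psi> ` ball 0 (r / 2)" using \<psi>0 r by (intro image_eqI[of _ _ 0]) auto
    ultimately obtain s where s: "s \<in> {0..<T}" "T - s < \<epsilon>" "flow X v s p \<in> \<psi> ` ball 0 (r / 2)"
      using z(2) \<epsilon> by blast
    then obtain w where w: "w \<in> ball 0 (r / 2)" "flow X v s p = \<psi> w" by blast
    let ?K = "closed_segment 0 (of_real T * v)" and ?A = "{z. Re (z / v) < T}" and ?B = "ball (of_real s * v) (r / 2)"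
    have KA: "?K \<inter> ?A = (\<lambda>s. of_real s * v) ` {0..<T}"
      using segment_param_iff[of _ 0 T v] v Tpos by (auto simp: closed_segment_eq_real_ivl image_iff)
    have A: "open ?A" using v by (intro open_Collect_less continuous_intros) auto
    have g: "dev X (?K \<inter> ?A) (\<lambda>z. flow X v (Re (z / v)) p)"
      unfolding KA by (rule leaf_dev[OF _ _ v below]) (use Tpos in auto)
    have sh: "dev X ?B (\<lambda>u. \<psi> (u + (w - of_real s * v)))"
    proof (rule dev_shift[OF flat_disc_dev[OF d]])
      fix u assume "u \<in> ?B"
      then show "u + (w - of_real s * v) \<in> ball 0 r"
        using w norm_triangle_ineq[of "u - of_real s * v" w] by (simp add: dist_norm norm_minus_commute algebra_simps)
    qed
    have TB: "of_real T * v \<in> ?B"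
    proof -
      have "norm (of_real s * v - of_real T * v) = \<bar>s - T\<bar> * norm v" by (simp add: norm_mult flip: left_diff_distrib of_real_diff)
      also have "\<dots> < r / 2" using s(1,2) v unfolding \<epsilon>_def by (simp add: field_simps)
      finally show ?thesis by (simp add: dist_norm)
    qed
    have convKAB: "convex (?K \<inter> ?A \<inter> ?B)"
    proof -
      have "convex ((\<lambda>s. of_real s * v) ` {0..<T})"
        by (rule convex_linear_image) (auto intro!: linearI simp: algebra_simps scaleR_conv_of_real)
      then show ?thesis unfolding KA by (intro convex_Int convex_ball)
    qed
    have sv: "of_real s * v \<in> ?K \<inter> ?A \<inter> ?B" using s(1) r KA by auto
    have eq: "flow X v (Re (u / v)) p = \<psi> (u + (w - of_real s * v))" if "u \<in> ?K \<inter> ?A \<inter> ?B" for u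
      by (rule dev_unique[OF dev_subset[OF g] dev_subset[OF sh] convex_connected[OF convKAB] sv _ that])
        (use v w in auto)
    have "dev X ?K (\<lambda>z. if z \<in> ?A then flow X v (Re (z / v)) p else \<psi> (z + (w - of_real s * v)))"
    proof (rule dev_glue[OF A open_ball _ g dev_subset[OF sh] eq])
      show "?K \<subseteq> ?A \<union> ?B"
      proof
        fix u assume "u \<in> ?K"
        then obtain s' where s': "s' \<in> {0..T}" "u = of_real s' * v"
          using segment_param_iff[of u 0 T v] Tpos by (auto simp: closed_segment_eq_real_ivl)
        show "u \<in> ?A \<union> ?B"
        proof (cases "s' = T")
          case True then show ?thesis using TB s' by simp
        next
          case False then show ?thesis using s' v by simp
        qed
      qed
    qed auto
    from flow_dev(1)[OF this, of 0 T v] v Tpos flow_zero[OF p v] nT show False by simp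
  qed
  then show ?thesis using that[OF Tpos Tt below nT] z(2) by blast
qed

end

section \<open>A lower bound for the size of primitives\<close>

context riemann_form begin

lemma param_continuous:
  assumes c: "c \<in> charts X" shows "continuous_map (top_of_set (coord c ` dom_of c)) (surf X) (param c)"
proof -
  have "openin (top_of_set (coord c ` dom_of c)) {z \<in> coord c ` dom_of c. param c z \<in> U}" if U: "openin (surf X) U" for U
  proof -
    have "{z \<in> coord c ` dom_of c. param c z \<in> U} = coord c ` (U \<inter> dom_of c)" using c by auto
    moreover have "open (coord c ` (U \<inter> dom_of c))"
      by (rule coord_open_map[OF c openin_Int[OF U chart_openin[OF c]]]) simp
    ultimately show ?thesis by (metis (no_types, lifting) Int_lower2 image_mono open_openin_trans open_subset)
  qed
  moreover have "param c z \<in> topspace (surf X)" if "z \<in> coord c ` dom_of c" for z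
    using param_in[OF that] openin_subset[OF chart_openin[OF c]] by blast
  ultimately show ?thesis unfolding continuous_map_def by auto
qed

text \<open>
  By compactness of the sublevel set, a path from \<open>p\<close> along which \<open>F\<close> changes by at most \<open>c\<close>
  cannot leave \<open>V\<close>.
\<close>

definition primitive_nbhd :: "'a \<Rightarrow> real \<Rightarrow> 'a set \<Rightarrow> ('a \<Rightarrow> complex) \<Rightarrow> bool" where
  "primitive_nbhd p c V F \<longleftrightarrow> local_primitive X V F \<and> p \<in> V \<and> compactin (surf X) {q \<in> V. cmod (F q - F p) \<le> c} \<and>
     (p \<in> form_zeros X \<longrightarrow> V \<inter> form_zeros X = {p})"

lemma compactin_sublevel:
  assumes F: "local_primitive X V F" and C: "compactin (surf X) {q \<in> V. cmod (F q - a) \<le> c}"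
    and sub: "\<And>q. cmod (F q - b) \<le> d \<Longrightarrow> cmod (F q - a) \<le> c"
  shows "compactin (surf X) {q \<in> V. cmod (F q - b) \<le> d}"
proof -
  let ?C = "{q \<in> V. cmod (F q - a) \<le> c}"
  have o: "open {z. cmod (z - b) > d}" by (intro open_Collect_less continuous_intros)
  have "closedin (surf X) ?C" using C Hausdorff compactin_imp_closedin by blast
  moreover have "openin (surf X) {q \<in> V. F q \<in> {z. cmod (z - b) > d}}" by (rule lp_preimage_open[OF F o])
  ultimately have "closedin (surf X) (?C - {q \<in> V. F q \<in> {z. cmod (z - b) > d}})" by (rule closedin_diff)
  moreover have "?C - {q \<in> V. F q \<in> {z. cmod (z - b) > d}} = {q \<in> V. cmod (F q - b) \<le> d}" using sub by fastforce
  ultimately have "closedin (surf X) {q \<in> V. cmod (F q - b) \<le> d}" by simp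
  moreover have "{q \<in> V. cmod (F q - b) \<le> d} \<subseteq> ?C" using sub by blast
  ultimately show ?thesis using C closed_compactin by blast
qed

lemma primitive_nbhd_mono: "primitive_nbhd p c V F \<Longrightarrow> d \<le> c \<Longrightarrow> primitive_nbhd p d V F"
  unfolding primitive_nbhd_def using compactin_sublevel[of V F "F p" c "F p" d] by force

lemma dev_primitive:
  assumes g: "dev X S g" and S: "connected S" and F: "local_primitive X V F" and V: "g ` S \<subseteq> V"
    and z: "z \<in> S" "w \<in> S"
  shows "F (g w) - F (g z) = w - z"
proof -
  have "\<forall>\<^sub>F y in at w within S. F (g w) - w = F (g y) - y" if w: "w \<in> S" for w
  proof -
    have "g w \<in> V" using V w by blast
    then have "\<forall>\<^sub>F y in at w within S. F (g y) - F (g w) = y - w" using g w F unfolding dev_def by blast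
    then show ?thesis by eventually_elim (simp add: algebra_simps)
  qed
  then have "F (g z) - z = F (g w) - w" by (intro connected_local_const[OF S z, of "\<lambda>w. F (g w) - w"] ballI)
  then show ?thesis by (simp add: algebra_simps)
qed

text \<open>At the infimum of the exit times from C the path is still in C, because C is closed, and
  hence remains in the open set V a little longer. During that time \<open>step\<close> pulls it
  back into C.\<close>

lemma path_trapped:
  fixes \<eta> :: "real \<Rightarrow> 'a"
  assumes \<eta>: "continuous_map (top_of_set {a..b}) (surf X) \<eta>" and V: "openin (surf X) V"
    and C: "closedin (surf X) C" "C \<subseteq> V" and a: "\<eta> a \<in> C"
    and step: "\<And>s. s \<in> {a..b} \<Longrightarrow> (\<And>u. u \<in> {a..s} \<Longrightarrow> \<eta> u \<in> V) \<Longrightarrow> \<eta> s \<in> C"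
    and s: "s \<in> {a..b}"
  shows "\<eta> s \<in> C"
proof (rule ccontr)
  assume ns: "\<eta> s \<notin> C"
  let ?B = "{s \<in> {a..b}. \<eta> s \<notin> C}"
  define m where "m = Inf ?B"
  have bdd: "bdd_below ?B" by (intro bdd_belowI[of _ a]) auto
  have ne: "s \<in> ?B" using s ns by blast
  have m: "m \<in> {a..b}" unfolding m_def using cInf_greatest[of ?B a] cInf_lower[OF ne bdd] ne by fastforce
  have below: "\<eta> u \<in> C" if "u \<in> {a..<m}" for u
  proof (rule ccontr)
    assume "\<eta> u \<notin> C"
    then have "m \<le> u" unfolding m_def using that m bdd by (intro cInf_lower) auto
    then show False using that by simp
  qed
  have mC: "\<eta> m \<in> C"
  proof (rule ccontr)
    assume nm: "\<eta> m \<notin> C"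
    have "\<eta> m \<in> topspace (surf X)" using \<eta> m unfolding continuous_map_def by auto
    then obtain e where e: "e > 0" "\<forall>u\<in>{a..b}. dist u m < e \<longrightarrow> \<eta> u \<in> topspace (surf X) - C"
      using top_of_set_preimage_eventually[OF \<eta> openin_diff[OF openin_topspace C(1)] m] nm by blast
    have "m \<noteq> a" using a nm by auto
    then have "max a (m - e / 2) \<in> {a..<m}" "dist (max a (m - e / 2)) m < e" using m e(1) by (auto simp: dist_real_def)
    then show False using below[of "max a (m - e / 2)"] e(2) m by auto
  qed
  obtain e where e: "e > 0" "\<forall>u\<in>{a..b}. dist u m < e \<longrightarrow> \<eta> u \<in> V"
    using top_of_set_preimage_eventually[OF \<eta> V m] mC C(2) by blast
  have "\<eta> u \<in> C" if u: "u \<in> {a..b}" "u < m + e" for u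
  proof (rule step[OF u(1)])
    fix x assume x: "x \<in> {a..u}"
    show "\<eta> x \<in> V"
    proof (cases "x < m")
      case True then show ?thesis using below[of x] x C(2) by auto
    next
      case False then show ?thesis using e(2) x u by (auto simp: dist_real_def)
    qed
  qed
  then have "m + e \<le> u" if "u \<in> ?B" for u using that by force
  then have "m + e \<le> m" using ne m_def cInf_greatest[of ?B "m + e"] by blast
  then show False using e by simp
qed

text \<open>Along a straight segment the primitive F changes by exactly the displacement while the
  path is in V, so a short displacement keeps it in the compact sublevel set.\<close>

lemma dev_trapped:
  assumes V: "primitive_nbhd p c V F" and g: "dev X S g" and S: "convex S" and z: "z \<in> S" "g z \<in> V"
    and small: "\<And>w. w \<in> S \<Longrightarrow> cmod (F (g z) - F p) + cmod (w - z) \<le> c" and w: "w \<in> S"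
  shows "g w \<in> V \<and> F (g w) = F (g z) + (w - z)"
proof -
  have F: "local_primitive X V F" using V unfolding primitive_nbhd_def by blast
  let ?C = "{q \<in> V. cmod (F q - F p) \<le> c}"
  have C: "closedin (surf X) ?C" using V Hausdorff compactin_imp_closedin unfolding primitive_nbhd_def by blast
  define l where "l = (\<lambda>u. z + of_real u * (w - z))"
  have lS: "l u \<in> S" if "u \<in> {0..1}" for u
  proof -
    have "l u \<in> closed_segment z (z + of_real 1 * (w - z))"
      unfolding l_def by (rule segment_param) (use that in \<open>auto simp: closed_segment_eq_real_ivl\<close>)
    then show ?thesis using closed_segment_subset[OF z(1) w S] by auto
  qed
  have "continuous_map (top_of_set {0..1}) (top_of_set S) l"
    unfolding l_def using lS l_def by (auto simp: continuous_map_in_subtopology intro!: continuous_intros)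
  then have cont: "continuous_map (top_of_set {0..1}) (surf X) (g \<circ> l)"
    using g continuous_map_compose[of _ "top_of_set S" l "surf X" g] unfolding dev_def by blast
  have sub: "F (g (l u)) - F (g z) = l u - z" if u: "u \<in> {0..1}" "\<And>x. x \<in> {0..u} \<Longrightarrow> (g \<circ> l) x \<in> V" for u
  proof -
    have "connected (l ` {0..u})" unfolding l_def by (intro connected_continuous_image continuous_intros) auto
    moreover have "dev X (l ` {0..u}) g" by (rule dev_subset[OF g]) (use lS u in auto)
    moreover have "g ` l ` {0..u} \<subseteq> V" using u(2) by auto
    moreover have "l 0 \<in> l ` {0..u}" "l u \<in> l ` {0..u}" using u(1) by auto
    ultimately have "F (g (l u)) - F (g (l 0)) = l u - l 0" by (metis dev_primitive F)
    then show ?thesis by (simp add: l_def)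
  qed
  have "(g \<circ> l) u \<in> ?C" if u: "u \<in> {0..1}" for u
  proof (rule path_trapped[OF cont _ C _ _ _ u])
    show "openin (surf X) V" by (rule lp_openin[OF F])
    show "(g \<circ> l) 0 \<in> ?C" using z small[OF z(1)] by (simp add: l_def)
    fix s assume s: "s \<in> {0..1::real}" and sV: "\<And>u. u \<in> {0..s} \<Longrightarrow> (g \<circ> l) u \<in> V"
    have "F (g (l s)) - F p = (F (g z) - F p) + (l s - z)" using sub[OF s sV] by (simp add: algebra_simps)
    then have "cmod (F (g (l s)) - F p) \<le> cmod (F (g z) - F p) + cmod (l s - z)"
      by (metis norm_triangle_ineq)
    also have "\<dots> \<le> c" by (rule small[OF lS[OF s]])
    finally show "(g \<circ> l) s \<in> ?C" using sV[of s] s by simp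
  qed auto
  then have "\<And>x. x \<in> {0..1} \<Longrightarrow> (g \<circ> l) x \<in> V" by blast
  then have "(g \<circ> l) 1 \<in> V" "F (g (l 1)) - F (g z) = l 1 - z" using sub[of 1] by auto
  then show ?thesis by (simp add: l_def algebra_simps)
qed

end

section \<open>Trapping neighbourhoods of a uniform size\<close>

locale finite_zeros_form = riemann_form +
  assumes finite_zeros: "finite (form_zeros X)"
begin

text \<open>In a chart F is holomorphic with an isolated zero at the base point, so |F| has a
  positive minimum on a small circle; below that value the sublevel set is compact inside the open
  disc. This works at zeros of the form as well, where F is not injective.\<close>

lemma primitive_nbhd_exists:
  assumes p: "p \<in> topspace (surf X)" obtains c V F where "c > 0" "primitive_nbhd p c V F"
proof -
  obtain ch where ch: "ch \<in> charts X" "p \<in> dom_of ch" using chart_exists[OF p] .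
  define z0 where "z0 = coord ch p"
  obtain r F where r: "r > 0" "ball z0 r \<subseteq> coord ch ` dom_of ch" "F z0 = 0"
    and F: "\<And>z. z \<in> ball z0 r \<Longrightarrow> (F has_field_derivative coef X ch z) (at z)"
    using chart_disc_primitive[OF ch] unfolding z0_def by metis
  have pz0: "param ch z0 = p" using ch z0_def by simp
  let ?Z = "coord ch ` (form_zeros X \<inter> dom_of ch) - {z0}"
  have "open (- ?Z)" using finite_zeros by (intro open_Compl finite_imp_closed) auto
  then obtain r1 where r1: "r1 > 0" "ball z0 r1 \<subseteq> - ?Z" by (meson openE ComplI Diff_iff singletonI)
  have nz: "coef X ch z \<noteq> 0" if "z \<in> ball z0 (min r r1)" "z \<noteq> z0" for z
  proof
    assume e: "coef X ch z = 0"
    have z: "z \<in> coord ch ` dom_of ch" using that r(2) by auto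
    then have "param ch z \<in> form_zeros X" using form_zeros_iff[OF ch(1) param_in[OF z]] e coord_param[OF z] by simp
    then have "z \<in> ?Z" using param_in[OF z] coord_param[OF z] that(2) by (metis DiffI IntI imageI singletonD)
    then show False using r1(2) that(1) by auto
  qed
  have Fh: "F holomorphic_on ball z0 r" using F holomorphic_on_open by blast
  \<comment> \<open>F cannot vanish identically: the form has finitely many zeros, so the derivative
    of F is nonzero close to \<open>z0\<close>.\<close>
  have "\<exists>\<beta>\<in>ball z0 r. F \<beta> \<noteq> 0"
  proof (rule ccontr)
    assume c: "\<not> ?thesis"
    let ?z = "z0 + of_real (min r r1 / 2)"
    have z: "?z \<in> ball z0 (min r r1)" "?z \<noteq> z0" using r r1 by (auto simp: dist_norm)
    then have "(F has_field_derivative coef X ch ?z) (at ?z)" using F by simp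
    moreover have "(F has_field_derivative 0) (at ?z)"
      by (rule has_field_derivative_transform_within_open[of "\<lambda>_. 0" 0 _ "ball z0 r"]) (use c z in auto)
    ultimately show False using nz[OF z] DERIV_unique by blast
  qed
  then obtain r2 where r2: "r2 > 0" "ball z0 r2 \<subseteq> ball z0 r" "\<And>z. z \<in> ball z0 r2 - {z0} \<Longrightarrow> F z \<noteq> 0"
    using isolated_zeros[OF Fh open_ball connected_ball _ r(3)] r(1) by (metis centre_in_ball)
  define R where "R = min r2 r1 / 2"
  have R: "R > 0" "cball z0 R \<subseteq> ball z0 r2" "cball z0 R \<subseteq> ball z0 r1" using r1 r2 unfolding R_def by auto
  have Rr: "cball z0 R \<subseteq> ball z0 r" using R r2 by blast
  have Fc: "continuous_on (cball z0 R) F" using holomorphic_on_imp_continuous_on[OF holomorphic_on_subset[OF Fh Rr]] .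
  have "sphere z0 R \<noteq> {}" using R by simp
  moreover have "continuous_on (sphere z0 R) (\<lambda>z. cmod (F z))"
    by (intro continuous_on_norm continuous_on_subset[OF Fc]) auto
  ultimately have "\<exists>z1\<in>sphere z0 R. \<forall>z\<in>sphere z0 R. cmod (F z1) \<le> cmod (F z)"
    by (intro continuous_attains_inf compact_sphere)
  then obtain z1 where z1: "z1 \<in> sphere z0 R" "\<And>z. z \<in> sphere z0 R \<Longrightarrow> cmod (F z1) \<le> cmod (F z)" by blast
  have "z1 \<in> ball z0 r2 - {z0}" using z1(1) R by auto
  then have Fz1: "cmod (F z1) > 0" using r2(3) by simp
  \<comment> \<open>Half of the minimum: points with |F| at most c then avoid the circle.\<close>
  define c where "c = cmod (F z1) / 2"
  let ?V = "param ch ` ball z0 R" and ?G = "F \<circ> coord ch"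
  have sub: "ball z0 R \<subseteq> coord ch ` dom_of ch" using Rr r(2) ball_subset_cball by blast
  have subc: "cball z0 R \<subseteq> coord ch ` dom_of ch" using Rr r(2) by blast
  show ?thesis
  proof
    show "c > 0" using Fz1 unfolding c_def by simp
    show "primitive_nbhd p c ?V ?G" unfolding primitive_nbhd_def
    proof (intro conjI impI)
      show "local_primitive X ?V ?G"
        by (rule chart_primitive[OF ch(1) open_ball sub]) (rule F, use Rr ball_subset_cball in blast)
      show pV: "p \<in> ?V" using pz0 R(1) by (metis centre_in_ball imageI)
      let ?K = "{z \<in> cball z0 R. cmod (F z) \<le> c}"
      have "closed ?K" using continuous_closed_preimage[OF continuous_on_norm[OF Fc] closed_cball, of "{..c}"]
        by (simp add: vimage_def Int_def)
      then have "compact ?K" using compact_Int_closed[OF compact_cball, of ?K z0 R] by (simp add: inf.absorb2 subset_iff Int_def conj_commute)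
      then have "compactin (top_of_set (coord ch ` dom_of ch)) ?K" using subc by (auto simp: compactin_subtopology)
      then have "compactin (surf X) (param ch ` ?K)" using image_compactin param_continuous[OF ch(1)] by blast
      moreover have "{q \<in> ?V. cmod (?G q - ?G p) \<le> c} = param ch ` ?K"
      proof -
        have "z \<in> ball z0 R" if "z \<in> ?K" for z
        proof -
          have "c < cmod (F z1)" using Fz1 unfolding c_def by simp
          then have "z \<notin> sphere z0 R" using z1(2)[of z] that by force
          then show ?thesis using that by auto
        qed
        moreover have "coord ch (param ch z) = z" if "z \<in> cball z0 R" for z using that subc by (intro coord_param) auto
        ultimately show ?thesis using r(3) z0_def by (auto simp: less_imp_le)
      qed
      ultimately show "compactin (surf X) {q \<in> ?V. cmod (?G q - ?G p) \<le> c}" by simp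
      assume pZ: "p \<in> form_zeros X"
      have "q = p" if "q \<in> ?V" "q \<in> form_zeros X" for q
      proof -
        obtain z where z: "z \<in> ball z0 R" "q = param ch z" using \<open>q \<in> ?V\<close> by blast
        have zc: "z \<in> coord ch ` dom_of ch" using z sub by blast
        have "coef X ch z = 0" using form_zeros_iff[OF ch(1) param_in[OF zc]] that(2) z(2) coord_param[OF zc] by simp
        moreover have "z \<in> ball z0 r" "z \<in> ball z0 r1" using z(1) R Rr ball_subset_cball by blast+
        then have "z \<in> ball z0 (min r r1)" by simp
        ultimately have "z = z0" using nz by blast
        then show ?thesis using z pz0 by simp
      qed
      then show "?V \<inter> form_zeros X = {p}" using pV pZ by blast
    qed
  qed
qed

text \<open>A point near one of finitely many centres takes over the neighbourhood of that centre
  with half the bound. A zero keeps its own neighbourhood, which contains no other zero, so the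
  minimum also runs over the zeros.\<close>

lemma uniform_primitive_nbhd: "\<exists>c>0. \<forall>p\<in>topspace (surf X). \<exists>V F. primitive_nbhd p c V F"
proof -
  have "\<exists>c V F. c > 0 \<and> primitive_nbhd p c V F" if "p \<in> topspace (surf X)" for p
    using primitive_nbhd_exists[OF that] by metis
  then obtain c V F where cVF: "\<And>p. p \<in> topspace (surf X) \<Longrightarrow> c p > 0 \<and> primitive_nbhd p (c p) (V p) (F p)"
    by metis
  define N where "N p = {q \<in> V p. F p q \<in> ball (F p p) (c p / 2)}" for p
  have N: "openin (surf X) (N p)" "p \<in> N p" if "p \<in> topspace (surf X)" for p
    using lp_preimage_open[of "V p" "F p" "ball (F p p) (c p / 2)"] cVF[OF that] unfolding N_def primitive_nbhd_def by auto
  have "\<forall>U\<in>N ` topspace (surf X). openin (surf X) U" "topspace (surf X) \<subseteq> \<Union>(N ` topspace (surf X))"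
    using N by auto
  then have "\<exists>\<G>. finite \<G> \<and> \<G> \<subseteq> N ` topspace (surf X) \<and> topspace (surf X) \<subseteq> \<Union>\<G>"
    using comp unfolding compact_space_alt by meson
  then obtain \<F> where \<F>: "finite \<F>" "\<F> \<subseteq> topspace (surf X)" "topspace (surf X) \<subseteq> \<Union>(N ` \<F>)"
    by (metis finite_subset_image)
  have Zt: "form_zeros X \<subseteq> topspace (surf X)" unfolding form_zeros_def by blast
  define m where "m = Min (insert 1 (c ` (\<F> \<union> form_zeros X)))"
  have fin: "finite (insert 1 (c ` (\<F> \<union> form_zeros X)))" using \<F> finite_zeros by simp
  have m: "m > 0" "\<And>p. p \<in> \<F> \<union> form_zeros X \<Longrightarrow> m \<le> c p"
    using fin cVF \<F>(2) Zt unfolding m_def by (auto simp: subset_iff)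
  show ?thesis
  proof (intro exI[of _ "m / 2"] conjI ballI)
    show "m / 2 > 0" using m by simp
    fix p assume p: "p \<in> topspace (surf X)"
    show "\<exists>V F. primitive_nbhd p (m / 2) V F"
    proof (cases "p \<in> form_zeros X")
      case True
      then have "m / 2 \<le> c p" using m(1) m(2)[of p] by simp
      then show ?thesis using primitive_nbhd_mono cVF[OF p] by blast
    next
      case False
      obtain x where x: "x \<in> \<F>" "p \<in> N x" using \<F>(3) p by blast
      have xt: "x \<in> topspace (surf X)" using x \<F> by blast
      have "compactin (surf X) {q \<in> V x. cmod (F x q - F x p) \<le> m / 2}"
      proof (rule compactin_sublevel)
        show "local_primitive X (V x) (F x)" "compactin (surf X) {q \<in> V x. cmod (F x q - F x x) \<le> c x}"
          using cVF[OF xt] unfolding primitive_nbhd_def by auto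
        fix q assume "cmod (F x q - F x p) \<le> m / 2"
        moreover have "cmod (F x p - F x x) < c x / 2" using x(2) unfolding N_def by (simp add: dist_norm norm_minus_commute)
        moreover have "m / 2 \<le> c x / 2" using m(2)[of x] x by simp
        ultimately show "cmod (F x q - F x x) \<le> c x"
          using norm_triangle_ineq[of "F x q - F x p" "F x p - F x x"] by simp
      qed
      moreover have "p \<in> V x" using x(2) unfolding N_def by blast
      ultimately have "primitive_nbhd p (m / 2) (V x) (F x)"
        using cVF[OF xt] False unfolding primitive_nbhd_def by blast
      then show ?thesis by blast
    qed
  qed
qed

end

section \<open>Minimality of the horizontal flow\<close>

context riemann_form begin

text \<open>
  The zeros at the ends of a saddle connection are only required to be cluster points. This
  weaker condition is what \<open>leaf_end\<close> provides, and it passes to nearby forms without any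
  discussion of limits.
\<close>

definition degenerate :: "complex \<Rightarrow> real \<Rightarrow> bool" where
  "degenerate v l \<longleftrightarrow> l > 0 \<and>
     ((\<exists>g. dev X (closed_segment 0 (of_real l * v)) g \<and> g 0 = g (of_real l * v)) \<or>
      (\<exists>g z z'. dev X (open_segment 0 (of_real l * v)) g \<and> z \<in> form_zeros X \<and> z' \<in> form_zeros X \<and>
         cluster (open_segment 0 (of_real l * v)) g 0 z \<and> cluster (open_segment 0 (of_real l * v)) g (of_real l * v) z'))"

lemma flow_uminus:
  assumes "v \<noteq> 0" "flow_defined X v t p"
  shows "flow_defined X (- v) (- t) p" "flow X (- v) (- t) p = flow X v t p"
proof -
  obtain g where g: "dev X (closed_segment 0 (of_real t * v)) g" "g 0 = p" using flow_defined_dev[OF assms(2,1)] .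
  have s: "closed_segment 0 (0 + of_real (- t) * (- v)) \<subseteq> closed_segment 0 (of_real t * v)"
    "closed_segment 0 (0 + of_real t * v) \<subseteq> closed_segment 0 (of_real t * v)" by auto
  show "flow_defined X (- v) (- t) p" "flow X (- v) (- t) p = flow X v t p"
    using flow_dev[OF g(1) s(1)] flow_dev[OF g(1) s(2)] g(2) assms(1) by auto
qed

text \<open>A leaf that ends in both time directions clusters at a zero at each end and is therefore
  a saddle connection.\<close>

lemma infinite_half_leaf:
  assumes p: "p \<in> regular_points X" and v: "v \<noteq> 0" and nd: "\<And>l. \<not> degenerate v l"
  shows "(\<forall>t\<ge>0. flow_defined X v t p) \<or> (\<forall>t\<ge>0. flow_defined X (- v) t p)"
proof (rule ccontr)
  assume "\<not> ?thesis"
  then obtain t t' where t: "t \<ge> 0" "\<not> flow_defined X v t p" "t' \<ge> 0" "\<not> flow_defined X (- v) t' p" by blast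
  obtain T z where T: "0 < T" "\<And>s. s \<in> {0..<T} \<Longrightarrow> flow_defined X v s p" "z \<in> form_zeros X"
    and cl: "\<And>N e. openin (surf X) N \<Longrightarrow> z \<in> N \<Longrightarrow> e > 0 \<Longrightarrow> \<exists>s\<in>{0..<T}. T - s < e \<and> flow X v s p \<in> N"
    using leaf_end[OF p v t(1,2)] by metis
  have v': "- v \<noteq> 0" using v by simp
  obtain T' z' where T': "0 < T'" "\<And>s. s \<in> {0..<T'} \<Longrightarrow> flow_defined X (- v) s p" "z' \<in> form_zeros X"
    and cl': "\<And>N e. openin (surf X) N \<Longrightarrow> z' \<in> N \<Longrightarrow> e > 0 \<Longrightarrow> \<exists>s\<in>{0..<T'}. T' - s < e \<and> flow X (- v) s p \<in> N"
    using leaf_end[OF p v' t(3,4)] by metis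
  let ?I = "{- T'<..<T}"
  have fd: "flow_defined X v s p" if "s \<in> ?I" for s
  proof (cases "s \<ge> 0")
    case True then show ?thesis using T(2) that by simp
  next
    case False
    then have "flow_defined X (- v) (- s) p" using T'(2)[of "- s"] that by simp
    then show ?thesis using flow_uminus(1)[OF v', of "- s" p] by simp
  qed
  have I: "convex ?I" "0 \<in> ?I" using T(1) T'(1) by auto
  have d: "dev X ((\<lambda>s. of_real s * v) ` ?I) (\<lambda>z. flow X v (Re (z / v)) p)" by (rule leaf_dev[OF I v fd])
  let ?l = "T + T'"
  let ?S = "open_segment 0 (of_real ?l * v)"
  \<comment> \<open>The shift by T' moves the parameter interval from (-T', T) to (0, T + T'), as
    \<open>degenerate\<close> requires.\<close>
  let ?g = "\<lambda>w. flow X v (Re ((w + of_real (- T') * v) / v)) p"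
  have S: "w \<in> ?S \<longleftrightarrow> (\<exists>s\<in>?I. w = of_real (s + T') * v)" for w
  proof
    assume "w \<in> ?S"
    then obtain u where u: "0 < u" "u < 1" "w = of_real (u * ?l) * v"
      using v T T' by (auto simp: in_segment scaleR_conv_of_real)
    then have "u * ?l < ?l" "0 < u * ?l" using T T' by auto
    then show "\<exists>s\<in>?I. w = of_real (s + T') * v" using u(3) by (intro bexI[of _ "u * ?l - T'"]) auto
  next
    assume "\<exists>s\<in>?I. w = of_real (s + T') * v"
    then obtain s where s: "s \<in> ?I" "w = of_real (s + T') * v" by blast
    have "0 < (s + T') / ?l" "(s + T') / ?l < 1" using s T T' by (auto simp: field_simps)
    moreover have "(s + T') / ?l * ?l = s + T'" using T T' by simp
    then have "w = ((s + T') / ?l) *\<^sub>R (of_real ?l * v)"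
      unfolding s(2) scaleR_conv_of_real mult.assoc[symmetric] of_real_mult[symmetric] by simp
    moreover have "of_real ?l * v \<noteq> 0" using v T T' by (simp flip: of_real_add)
    ultimately show "w \<in> ?S" by (auto simp: in_segment intro!: exI[of _ "(s + T') / ?l"])
  qed
  have "dev X ?S ?g"
  proof (rule dev_shift[OF d])
    fix w assume "w \<in> ?S"
    then obtain s where "s \<in> ?I" "w = of_real (s + T') * v" using S by blast
    then show "w + of_real (- T') * v \<in> (\<lambda>s. of_real s * v) ` ?I" by (intro image_eqI[of _ _ s]) (auto simp: algebra_simps)
  qed
  moreover have gS: "?g (of_real (s + T') * v) = flow X v s p" for s using v by (simp add: algebra_simps add_divide_distrib diff_divide_distrib)
  have "cluster ?S ?g (of_real ?l * v) z" unfolding cluster_def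
  proof (intro allI impI, elim conjE)
    fix N e assume N: "openin (surf X) N" "z \<in> N" and e: "(e::real) > 0"
    have "e / norm v > 0" using e v by simp
    then obtain s where s: "s \<in> {0..<T}" "T - s < e / norm v" "flow X v s p \<in> N" using cl N by blast
    have "dist (of_real (s + T') * v) (of_real ?l * v) = (T - s) * norm v"
      using s(1) by (simp add: dist_norm norm_mult flip: left_diff_distrib of_real_diff of_real_add)
    also have "\<dots> < e" using s(2) v by (simp add: field_simps)
    finally show "\<exists>w\<in>?S. dist w (of_real ?l * v) < e \<and> ?g w \<in> N"
      using s gS S T'(1) by (intro bexI[of _ "of_real (s + T') * v"]) (auto intro!: bexI[of _ s])
  qed
  moreover have "cluster ?S ?g 0 z'" unfolding cluster_def
  proof (intro allI impI, elim conjE)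
    fix N e assume N: "openin (surf X) N" "z' \<in> N" and e: "(e::real) > 0"
    have "e / norm v > 0" using e v by simp
    then obtain s where s: "s \<in> {0..<T'}" "T' - s < e / norm v" "flow X (- v) s p \<in> N" using cl' N by blast
    have "flow X v (- s) p = flow X (- v) s p" using flow_uminus(2)[OF v' T'(2)[OF s(1)]] by simp
    moreover have "dist (of_real (- s + T') * v) 0 = (T' - s) * norm v"
      using s(1) by (simp add: norm_mult flip: of_real_diff of_real_add of_real_minus)
    moreover have "(T' - s) * norm v < e" using s(2) v by (simp add: field_simps)
    ultimately show "\<exists>w\<in>?S. dist w 0 < e \<and> ?g w \<in> N"
      using s gS[of "- s"] S T(1) by (intro bexI[of _ "of_real (- s + T') * v"]) (auto intro!: bexI[of _ "- s"])
  qed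
  ultimately have "degenerate v ?l" using T T' unfolding degenerate_def by auto
  then show False using nd by blast
qed

lemma degenerate_closed_leaf:
  assumes v: "v \<noteq> 0" and t: "t > 0" "flow_defined X v t p" "flow X v t p = p"
  shows "degenerate v t"
proof -
  obtain g where g: "dev X (closed_segment 0 (of_real t * v)) g" "g 0 = p" using flow_defined_dev[OF t(2) v] .
  have "closed_segment 0 (0 + of_real t * v) \<subseteq> closed_segment 0 (of_real t * v)" by simp
  from flow_dev(2)[OF g(1) this v] g(2) t(3) have "g (of_real t * v) = p" by simp
  then show ?thesis using g t(1) unfolding degenerate_def by auto
qed

lemma degenerate_uminus_closed_leaf:
  assumes v: "v \<noteq> 0" and t: "t > 0" "flow_defined X (- v) t p" "flow X (- v) t p = p"
  shows "degenerate v t"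
proof (rule degenerate_closed_leaf[OF v t(1)])
  have "flow_defined X v (- t) p" "flow X v (- t) p = p" using flow_uminus[of "- v" t p] v t by auto
  from flow_between[OF this(1) flow_zero[THEN conjunct1, OF flow_defined_topspace[OF this(1) v] v] v] this(2)
    flow_zero[THEN conjunct2, OF flow_defined_topspace[OF this(1) v] v]
  show "flow_defined X v t p" "flow X v t p = p" by auto
qed

end

section \<open>Topology near the zeros and recurrence of infinite half-leaves\<close>

context finite_zeros_form begin

text \<open>Since b is nonzero, the level set avoids z, the only zero in V. At its points F is
  locally injective, so they are isolated, and they all lie in a compact sublevel set.\<close>

lemma leaf_hits_finite_level:
  assumes z: "z \<in> form_zeros X" and V: "primitive_nbhd z c V F" and b: "cmod b \<le> c" "b \<noteq> 0"
  shows "finite {q \<in> V. F q - F z = b}"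
proof (rule ccontr)
  define Q where "Q = {q \<in> V. F q - F z = b}"
  define C where "C = {q \<in> V. cmod (F q - F z) \<le> c}"
  assume "infinite {q \<in> V. F q - F z = b}"
  then have inf: "infinite Q" unfolding Q_def .
  have F: "local_primitive X V F" and C: "compactin (surf X) C" and VZ: "V \<inter> form_zeros X = {z}"
    using V z unfolding primitive_nbhd_def C_def by auto
  have QC: "Q \<subseteq> C" using b unfolding Q_def C_def by auto
  have "\<exists>N. openin (surf X) N \<and> q \<in> N \<and> finite (N \<inter> Q)" if q: "q \<in> C" for q
  proof (cases "q \<in> Q")
    case False
    have "openin (surf X) {q \<in> V. F q \<in> - {F z + b}}" by (rule lp_preimage_open[OF F]) auto
    moreover have "q \<in> {q \<in> V. F q \<in> - {F z + b}}" using False q unfolding Q_def C_def by (auto simp: algebra_simps)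
    moreover have "{q \<in> V. F q \<in> - {F z + b}} \<inter> Q = {}" unfolding Q_def by auto
    ultimately show ?thesis by (metis finite.emptyI)
  next
    case True
    then have "q \<noteq> z" and qV: "q \<in> V" using b unfolding Q_def by auto
    then have "q \<notin> form_zeros X" using VZ by blast
    then have "q \<in> regular_points X" using qV openin_subset[OF lp_openin[OF F]] unfolding regular_points_def by blast
    then obtain r \<psi> G where d: "flat_disc q r \<psi> G" using flat_disc_exists by blast
    have r: "r > 0" "\<psi> 0 = q" and lp: "local_primitive X (\<psi> ` ball 0 r) G" using d unfolding flat_disc_def by auto
    have qd: "q \<in> \<psi> ` ball 0 r" using r by (metis centre_in_ball imageI)
    obtain N where N: "openin (surf X) N" "q \<in> N" "N \<subseteq> V" "N \<subseteq> \<psi> ` ball 0 r"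
      "\<And>x. x \<in> N \<Longrightarrow> F x - F q = G x - G q" using lp_diff_const[OF F lp qV qd] by metis
    have "x = q" if "x \<in> N \<inter> Q" for x
    proof -
      have "F x = F q" using that True unfolding Q_def by (simp add: algebra_simps)
      then have "G x = G q" using N(5)[of x] that by simp
      then show ?thesis using flat_disc_inv[OF d] qd N(4) that by (metis IntD1 subsetD)
    qed
    then have "N \<inter> Q \<subseteq> {q}" by blast
    then have "finite (N \<inter> Q)" by (rule finite_subset) simp
    then show ?thesis using N(1,2) by blast
  qed
  then have "\<forall>q\<in>C. \<exists>N. openin (surf X) N \<and> q \<in> N \<and> finite (N \<inter> Q)" by blast
  from bchoice[OF this] obtain N where N: "\<forall>q\<in>C. openin (surf X) (N q) \<and> q \<in> N q \<and> finite (N q \<inter> Q)" ..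
  have "\<forall>U\<in>N ` C. openin (surf X) U" "C \<subseteq> \<Union>(N ` C)" using N by auto
  then have "\<exists>\<G>. finite \<G> \<and> \<G> \<subseteq> N ` C \<and> C \<subseteq> \<Union>\<G>" using C unfolding compactin_def by meson
  then obtain \<F> where \<F>: "finite \<F>" "\<F> \<subseteq> C" "C \<subseteq> \<Union>(N ` \<F>)" by (metis finite_subset_image)
  have "Q \<subseteq> (\<Union>q\<in>\<F>. N q \<inter> Q)" using QC \<F>(3) by auto
  moreover have "finite (\<Union>q\<in>\<F>. N q \<inter> Q)" using \<F>(1,2) N by (intro finite_UN_I) auto
  ultimately show False using inf finite_subset by blast
qed

text \<open>A punctured disc around a zero is connected and lies on one side, so the zero can be
  added to that side. As the punctured disc is nonempty, the zero does not join both sides, and a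
  separation of the whole surface would result.\<close>

lemma connected_regular:
  assumes O: "openin (surf X) O1" "openin (surf X) O2" and disj: "O1 \<inter> O2 = {}" and un: "O1 \<union> O2 = regular_points X"
  shows "O1 = {} \<or> O2 = {}"
proof -
  have "\<exists>N. openin (surf X) N \<and> z \<in> N \<and> (N - {z} \<subseteq> O1 \<or> N - {z} \<subseteq> O2) \<and> N - {z} \<noteq> {}" if z: "z \<in> form_zeros X" for z
  proof -
    have zt: "z \<in> topspace (surf X)" using z unfolding form_zeros_def by blast
    obtain c V F where V: "primitive_nbhd z c V F" using primitive_nbhd_exists[OF zt] by blast
    then have Vo: "openin (surf X) V" "z \<in> V" and VZ: "V \<inter> form_zeros X = {z}"
      using z lp_openin unfolding primitive_nbhd_def by auto
    obtain ch where ch: "ch \<in> charts X" "z \<in> dom_of ch" using chart_exists[OF zt] .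
    have o: "openin (surf X) (V \<inter> dom_of ch)" using Vo chart_openin ch by blast
    have "open (coord ch ` (V \<inter> dom_of ch))" by (rule coord_open_map[OF ch(1) o]) simp
    moreover have "coord ch z \<in> coord ch ` (V \<inter> dom_of ch)" using Vo ch by blast
    ultimately obtain r where r: "r > 0" "ball (coord ch z) r \<subseteq> coord ch ` (V \<inter> dom_of ch)" by (meson openE)
    let ?B = "ball (coord ch z) r" and ?N = "param ch ` ball (coord ch z) r"
    have sub: "?B \<subseteq> coord ch ` dom_of ch" using r(2) by blast
    have No: "openin (surf X) ?N" by (rule param_open_map[OF ch(1) open_ball sub])
    have cp: "coord ch (param ch w) = w" if "w \<in> ?B" for w using that sub by (intro coord_param) auto
    have NV: "?N \<subseteq> V" using r(2) ch(1) by auto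
    have Nz: "?N - {z} = param ch ` (?B - {coord ch z})"
      using cp ch by (auto simp: image_iff) (metis cp mem_ball)+
    have reg: "?N - {z} \<subseteq> O1 \<union> O2"
      using NV VZ openin_subset[OF Vo(1)] unfolding un regular_points_def by blast
    let ?P = "\<lambda>U. coord ch ` (U \<inter> ?N)"
    have P: "open (?P U)" if "openin (surf X) U" for U
      by (rule coord_open_map[OF ch(1) openin_Int[OF that No]]) (use param_image[OF ch(1) sub] in blast)
    have mem: "w \<in> ?P U \<longleftrightarrow> param ch w \<in> U" if "w \<in> ?B" for w U
    proof
      assume "w \<in> ?P U"
      then obtain q where "q \<in> U" "q \<in> ?N" "w = coord ch q" by blast
      then show "param ch w \<in> U" using cp by auto
    next
      assume "param ch w \<in> U"
      then show "w \<in> ?P U" using cp[OF that] that by (intro image_eqI[of _ _ "param ch w"]) auto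
    qed
    have "connected (?B - {coord ch z})" by (rule connected_punctured_ball) simp
    then have "?P O1 \<inter> (?B - {coord ch z}) = {} \<or> ?P O2 \<inter> (?B - {coord ch z}) = {}"
    proof (rule connectedD[OF _ P[OF O(1)] P[OF O(2)]])
      show "?P O1 \<inter> ?P O2 \<inter> (?B - {coord ch z}) = {}" using disj mem by blast
      show "?B - {coord ch z} \<subseteq> ?P O1 \<union> ?P O2"
      proof
        fix w assume w: "w \<in> ?B - {coord ch z}"
        then have "param ch w \<in> O1 \<union> O2" using reg unfolding Nz by blast
        then show "w \<in> ?P O1 \<union> ?P O2" using mem w by blast
      qed
    qed
    then have "?N - {z} \<subseteq> O1 \<or> ?N - {z} \<subseteq> O2" using reg mem unfolding Nz by blast
    moreover have "z \<in> ?N" using r ch by (metis centre_in_ball imageI param_coord)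
    moreover have "?N - {z} \<noteq> {}"
    proof -
      have "coord ch z + of_real (r / 2) \<in> ?B - {coord ch z}" using r by (auto simp: dist_norm)
      then show ?thesis unfolding Nz by blast
    qed
    ultimately show ?thesis using No by blast
  qed
  then obtain N where N: "\<And>z. z \<in> form_zeros X \<Longrightarrow> openin (surf X) (N z) \<and> z \<in> N z \<and>
     (N z - {z} \<subseteq> O1 \<or> N z - {z} \<subseteq> O2) \<and> N z - {z} \<noteq> {}" by metis
  let ?U = "\<lambda>Q. Q \<union> \<Union>(N ` {z \<in> form_zeros X. N z - {z} \<subseteq> Q})"
  have reg: "O1 \<subseteq> regular_points X" "O2 \<subseteq> regular_points X" using un by auto
  have Zt: "form_zeros X \<subseteq> topspace (surf X)" unfolding form_zeros_def by blast
  have 1: "openin (surf X) (?U O1)" "openin (surf X) (?U O2)" using O N by (auto intro!: openin_Un openin_Union)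
  have 2: "topspace (surf X) \<subseteq> ?U O1 \<union> ?U O2" using un N unfolding regular_points_def by blast
  have U: "?U Q \<subseteq> Q \<union> {z \<in> form_zeros X. N z - {z} \<subseteq> Q}" for Q by blast
  have 3: "?U O1 \<inter> ?U O2 = {}"
  proof -
    define A where "A = (\<lambda>Q. {z \<in> form_zeros X. N z - {z} \<subseteq> Q})"
    have "A O1 \<inter> A O2 = {}" using N disj unfolding A_def by blast
    moreover have "A Q \<subseteq> form_zeros X" for Q unfolding A_def by blast
    moreover have "O1 \<inter> form_zeros X = {}" "O2 \<inter> form_zeros X = {}" using reg unfolding regular_points_def by auto
    ultimately have "(O1 \<union> A O1) \<inter> (O2 \<union> A O2) = {}" using disj by blast
    then show ?thesis using U[of O1] U[of O2] unfolding A_def by blast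
  qed
  have "U1 = {} \<or> U2 = {}" if "openin (surf X) U1" "openin (surf X) U2" "topspace (surf X) \<subseteq> U1 \<union> U2" "U1 \<inter> U2 = {}"
    for U1 U2 using conn that unfolding connected_space_def by blast
  from this[OF 1 2 3] show ?thesis by blast
qed

lemma compactin_cluster:
  fixes f :: "real \<Rightarrow> 'a"
  assumes C: "compactin (surf X) C" and f: "\<And>T. \<exists>t\<ge>T. f t \<in> C"
  obtains x where "x \<in> C" "\<And>N T. openin (surf X) N \<Longrightarrow> x \<in> N \<Longrightarrow> \<exists>t\<ge>T. f t \<in> N"
proof -
  have "\<exists>x\<in>C. \<forall>N T. openin (surf X) N \<and> x \<in> N \<longrightarrow> (\<exists>t\<ge>T. f t \<in> N)"
  proof (rule ccontr)
    assume "\<not> ?thesis"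
    then have "\<forall>x\<in>C. \<exists>N. openin (surf X) N \<and> x \<in> N \<and> (\<exists>T. \<forall>t\<ge>T. f t \<notin> N)" by meson
    from bchoice[OF this] obtain N where N: "\<forall>x\<in>C. openin (surf X) (N x) \<and> x \<in> N x \<and> (\<exists>T. \<forall>t\<ge>T. f t \<notin> N x)" ..
    then have "\<forall>x\<in>C. \<exists>T. \<forall>t\<ge>T. f t \<notin> N x" by blast
    from bchoice[OF this] obtain T where T: "\<forall>x\<in>C. \<forall>t\<ge>T x. f t \<notin> N x" ..
    have "\<forall>U\<in>N ` C. openin (surf X) U" "C \<subseteq> \<Union>(N ` C)" using N by auto
    then have "\<exists>\<G>. finite \<G> \<and> \<G> \<subseteq> N ` C \<and> C \<subseteq> \<Union>\<G>" using C unfolding compactin_def by meson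
    then obtain \<F> where \<F>: "finite \<F>" "\<F> \<subseteq> C" "C \<subseteq> \<Union>(N ` \<F>)" by (metis finite_subset_image)
    obtain t where t: "t \<ge> Max (insert 0 (T ` \<F>))" "f t \<in> C" using f by blast
    then obtain x where x: "x \<in> \<F>" "f t \<in> N x" using \<F> by blast
    have "T x \<le> Max (insert 0 (T ` \<F>))" using \<F>(1) x(1) by (intro Max_ge) auto
    then show False using T x t \<F>(2) by (meson order_trans subsetD)
  qed
  then show ?thesis using that by blast
qed

text \<open>Compactness yields a cluster point for late times, but it may be a zero. In that case
  the leaf keeps crossing a compact annulus around the zero, and a cluster point there is
  regular.\<close>

lemma half_leaf_recurrent:
  assumes v: "cmod v = 1" and p: "\<And>t. t \<ge> 0 \<Longrightarrow> flow_defined X v t p"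
  obtains x where "x \<in> regular_points X" "\<And>N T. openin (surf X) N \<Longrightarrow> x \<in> N \<Longrightarrow> \<exists>t\<ge>T. t \<ge> 0 \<and> flow X v t p \<in> N"
proof -
  have v0: "v \<noteq> 0" using v by auto
  let ?f = "\<lambda>t. flow X v (max 0 t) p"
  have reg: "?f t \<in> regular_points X" for t
    by (rule flow_defined_topspace[OF flow_between(1)[OF p p v0] v0]) auto
  have "compactin (surf X) (topspace (surf X))" using comp by (simp add: compact_space_def)
  then obtain x where x: "x \<in> topspace (surf X)" "\<And>N T. openin (surf X) N \<Longrightarrow> x \<in> N \<Longrightarrow> \<exists>t\<ge>T. ?f t \<in> N"
    using compactin_cluster[of "topspace (surf X)" ?f] reg unfolding regular_points_def by blast
  have "\<exists>y\<in>regular_points X. \<forall>N T. openin (surf X) N \<longrightarrow> y \<in> N \<longrightarrow> (\<exists>t\<ge>T. ?f t \<in> N)"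
  proof (cases "x \<in> form_zeros X")
    case False
    then show ?thesis using x unfolding regular_points_def by blast
  next
    case True
    \<comment> \<open>a leaf passing close to a zero crosses the level set at distance about \<open>c / 2\<close> from it\<close>
    obtain c V F where c: "c > 0" and V: "primitive_nbhd x c V F" using primitive_nbhd_exists[OF x(1)] .
    then have F: "local_primitive X V F" and xV: "x \<in> V" and VZ: "V \<inter> form_zeros X = {x}"
      and C: "compactin (surf X) {q \<in> V. cmod (F q - F x) \<le> c}" using True unfolding primitive_nbhd_def by auto
    let ?C = "{q \<in> V. cmod (F q - F x) \<le> c}" and ?U = "{q \<in> V. F q \<in> ball (F x) (c / 4)}"
    let ?C' = "?C - ?U"
    have U: "openin (surf X) ?U" by (rule lp_preimage_open[OF F]) simp
    have C': "compactin (surf X) ?C'"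
      using closed_compactin[OF C _ closedin_diff[OF compactin_imp_closedin[OF Hausdorff C] U]] by blast
    have "\<exists>t\<ge>T. ?f t \<in> ?C'" for T
    proof -
      \<comment> \<open>Distances are measured by F: from within c / 8 of the zero, a leaf of length
        c / 2 ends between 3 c / 8 and 5 c / 8, inside the annulus from c / 4 to c.\<close>
      have "openin (surf X) {q \<in> V. F q \<in> ball (F x) (c / 8)}" by (rule lp_preimage_open[OF F]) simp
      moreover have "x \<in> {q \<in> V. F q \<in> ball (F x) (c / 8)}" using xV c by simp
      ultimately obtain t where t: "t \<ge> max 0 T" "?f t \<in> {q \<in> V. F q \<in> ball (F x) (c / 8)}" using x(2) by meson
      have t0: "t \<ge> 0" using t by simp
      let ?I = "{0..t + c / 2}"
      have d: "dev X ((\<lambda>s. of_real s * v) ` ?I) (\<lambda>z. flow X v (Re (z / v)) p)"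
        by (rule leaf_dev[OF _ _ v0]) (use t0 c p in auto)
      let ?J = "(\<lambda>s. of_real s * v) ` {t..t + c / 2}"
      have J: "convex ?J" by (rule convex_linear_image) (auto intro!: linearI simp: algebra_simps scaleR_conv_of_real)
      have dJ: "dev X ?J (\<lambda>z. flow X v (Re (z / v)) p)" by (rule dev_subset[OF d]) (use t0 in auto)
      have g: "flow X v (Re (of_real t * v / v)) p = ?f t" using v0 t0 by simp
      have Fz: "cmod (F (?f t) - F x) < c / 8" using t(2) by (simp add: dist_norm norm_minus_commute)
      have "flow X v (Re (of_real (t + c / 2) * v / v)) p \<in> V \<and>
        F (flow X v (Re (of_real (t + c / 2) * v / v)) p) = F (flow X v (Re (of_real t * v / v)) p) + (of_real (t + c / 2) * v - of_real t * v)"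
      proof (rule dev_trapped[OF V dJ J])
        show "of_real t * v \<in> ?J" "of_real (t + c / 2) * v \<in> ?J" using c by (intro imageI; simp)+
        show "flow X v (Re (of_real t * v / v)) p \<in> V" using g t by simp
        fix w assume "w \<in> ?J"
        then obtain s where s: "s \<in> {t..t + c / 2}" "w = of_real s * v" by blast
        have "cmod (w - of_real t * v) = \<bar>s - t\<bar>" unfolding s(2) using v
          by (simp add: norm_mult flip: left_diff_distrib of_real_diff)
        then show "cmod (F (flow X v (Re (of_real t * v / v)) p) - F x) + cmod (w - of_real t * v) \<le> c"
          unfolding g using Fz s(1) by simp
      qed
      moreover have "flow X v (Re (of_real (t + c / 2) * v / v)) p = ?f (t + c / 2)" using v0 t0 c by simp
      ultimately have h: "?f (t + c / 2) \<in> V" "F (?f (t + c / 2)) = F (?f t) + of_real (c / 2) * v"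
        unfolding g by (simp_all add: algebra_simps)
      have n: "cmod (of_real (c / 2) * v) = c / 2" using v c by (simp add: norm_mult)
      have e: "F (?f (t + c / 2)) - F x = of_real (c / 2) * v + (F (?f t) - F x)" using h(2) by simp
      have "cmod (F (?f (t + c / 2)) - F x) \<le> c"
        unfolding e using norm_triangle_ineq[of "of_real (c / 2) * v" "F (?f t) - F x"] n Fz c by linarith
      moreover have "cmod (F (?f (t + c / 2)) - F x) \<ge> c / 4"
        unfolding e using norm_diff_ineq[of "of_real (c / 2) * v" "F (?f t) - F x"] n Fz c by linarith
      ultimately have "?f (t + c / 2) \<in> ?C'" using h(1) by (auto simp: dist_norm norm_minus_commute)
      moreover have "t + c / 2 \<ge> T" using t c by simp
      ultimately show ?thesis by blast
    qed
    from compactin_cluster[OF C' this] obtain y where y: "y \<in> ?C'" "\<And>N T. openin (surf X) N \<Longrightarrow> y \<in> N \<Longrightarrow> \<exists>t\<ge>T. ?f t \<in> N"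
      by blast
    have "y \<noteq> x" using y(1) xV c by auto
    then have "y \<notin> form_zeros X" using VZ y(1) by blast
    moreover have "y \<in> topspace (surf X)" using y(1) openin_subset[OF lp_openin[OF F]] by blast
    ultimately show ?thesis using y(2) unfolding regular_points_def by blast
  qed
  then obtain y where y: "y \<in> regular_points X" "\<forall>N T. openin (surf X) N \<longrightarrow> y \<in> N \<longrightarrow> (\<exists>t\<ge>T. ?f t \<in> N)" by blast
  show ?thesis
  proof (rule that[OF y(1)])
    fix N T assume "openin (surf X) N" "y \<in> N"
    then obtain t where "t \<ge> max 0 T" "?f t \<in> N" using y(2) by meson
    then show "\<exists>t\<ge>T. t \<ge> 0 \<and> flow X v t p \<in> N" by (intro exI[of _ t]) (auto simp: max_def split: if_splits)
  qed
qed

end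

text \<open>
  The situation at the boundary of a horizontally invariant set \<open>A\<close> without degenerate leaves:
  a vertical segment \<open>q\<close> starts outside of \<open>A\<close> and is inside afterwards. The signs \<open>\<sigma>\<close> and \<open>\<eta>\<close>
  are the directions of an infinite half-leaf from \<open>q 0\<close> and of the segment. The locale is
  contradictory.
\<close>

locale gap = finite_zeros_form X for X :: "'a surface_form" +
  fixes A :: "'a set" and q :: "real \<Rightarrow> 'a" and \<sigma> \<eta> \<delta> :: real
  assumes nd: "\<And>l. \<not> degenerate 1 l"
    and invariant: "\<And>x t. x \<in> A \<Longrightarrow> hflow_defined X t x \<Longrightarrow> hflow X t x \<in> A"
    and signs: "\<sigma> = 1 \<or> \<sigma> = -1" "\<eta> = 1 \<or> \<eta> = -1"
    and \<delta>: "\<delta> > 0"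
    and qdev: "dev X ((\<lambda>h. Complex 0 (\<eta> * h)) ` {0..\<delta>}) (\<lambda>z. q (\<eta> * Im z))"
    and q0: "q 0 \<notin> A" and qA: "\<And>h. h \<in> {0<..\<delta>} \<Longrightarrow> q h \<in> A"
    and infinite_leaf: "\<And>t. t \<ge> 0 \<Longrightarrow> flow_defined X (of_real \<sigma>) t (q 0)"
begin

lemma signs_square [simp]: "\<sigma> * \<sigma> = 1" "\<sigma> * (\<sigma> * x) = x" "\<eta> * \<eta> = 1" "\<eta> * (\<eta> * x) = x"
  using signs by auto

lemma sign_nonzero: "complex_of_real \<sigma> \<noteq> 0" using signs by auto

lemma flow_in_A: "x \<in> A \<Longrightarrow> flow_defined X (of_real \<sigma>) t x \<Longrightarrow> flow X (of_real \<sigma>) t x \<in> A"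
  using signs(1) invariant flow_uminus[OF sign_nonzero, of t x] by auto (metis)

lemma flow_in_A_iff:
  assumes "flow_defined X (of_real \<sigma>) t x" shows "flow X (of_real \<sigma>) t x \<in> A \<longleftrightarrow> x \<in> A"
proof
  assume A: "flow X (of_real \<sigma>) t x \<in> A"
  have r: "x \<in> regular_points X" using flow_defined_topspace[OF assms sign_nonzero] .
  have fd: "flow_defined X (of_real \<sigma>) 0 x" and f0: "flow X (of_real \<sigma>) 0 x = x"
    using flow_zero[OF r sign_nonzero] by auto
  show "x \<in> A" using flow_in_A[OF A] flow_between[OF assms fd sign_nonzero] f0 by metis
qed (use flow_in_A assms in blast)

text \<open>A development around the leaf of \<open>q h0\<close> also contains the transversal near
  \<open>q h0\<close>, by uniqueness; hence the leaves from neighbouring heights exist for as long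
  and are its horizontal lines.\<close>

lemma strip_local:
  assumes h0: "h0 \<in> {0..\<delta>}" and t: "t \<ge> 0" "flow_defined X (of_real \<sigma>) t (q h0)"
  obtains e f where "e > 0" "dev X (nbhd (closed_segment 0 (of_real t * of_real \<sigma>)) e) f"
    "\<And>h. h \<in> {0..\<delta>} \<Longrightarrow> \<bar>h - h0\<bar> < e \<Longrightarrow> flow_defined X (of_real \<sigma>) t (q h)"
    "\<And>h s. h \<in> {0..\<delta>} \<Longrightarrow> \<bar>h - h0\<bar> < e \<Longrightarrow> s \<in> {0..t} \<Longrightarrow>
       flow X (of_real \<sigma>) s (q h) = f (Complex (\<sigma> * s) (\<eta> * (h - h0)))"
proof -
  obtain e f where e: "e > 0" and f: "dev X (nbhd (closed_segment 0 (of_real t * of_real \<sigma>)) e) f" and f0: "f 0 = q h0"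
    using flow_defined_extend[OF t(2) sign_nonzero] .
  let ?N = "nbhd (closed_segment 0 (of_real t * of_real \<sigma>)) e"
  have N: "convex ?N" by (simp add: convex_nbhd)
  let ?T = "(\<lambda>k. Complex 0 (\<eta> * k)) ` {k. h0 + k \<in> {0..\<delta>} \<and> \<bar>k\<bar> < e}"
  have lin: "linear (\<lambda>k. Complex 0 (\<eta> * k))" by (rule linearI) (auto simp: complex_eq_iff algebra_simps)
  have T: "convex ?T"
  proof (rule convex_linear_image[OF lin])
    have "{k. h0 + k \<in> {0..\<delta>} \<and> \<bar>k\<bar> < e} = {- h0..\<delta> - h0} \<inter> {- e<..<e}" by auto
    then show "convex {k. h0 + k \<in> {0..\<delta>} \<and> \<bar>k\<bar> < e}" by (simp add: convex_Int)
  qed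
  have TN: "?T \<subseteq> ball 0 e" using signs(2) by (auto simp: cmod_def)
  have 1: "dev X ?T f" by (rule dev_subset[OF f]) (use TN ball_segment_nbhd(1) in blast)
  have 2: "dev X ?T (\<lambda>z. q (\<eta> * Im (z + Complex 0 (\<eta> * h0))))"
  proof (rule dev_shift[OF qdev])
    fix z assume "z \<in> ?T"
    then obtain k where "h0 + k \<in> {0..\<delta>}" "z = Complex 0 (\<eta> * k)" by blast
    then show "z + Complex 0 (\<eta> * h0) \<in> (\<lambda>h. Complex 0 (\<eta> * h)) ` {0..\<delta>}"
      by (intro image_eqI[of _ _ "h0 + k"]) (auto simp: complex_eq_iff algebra_simps)
  qed
  have q: "q h = f (Complex 0 (\<eta> * (h - h0)))" if h: "h \<in> {0..\<delta>}" "\<bar>h - h0\<bar> < e" for h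
  proof -
    have "0 \<in> ?T" using h0 e by (intro image_eqI[of _ _ 0]) (auto simp: complex_eq_iff)
    moreover have "Complex 0 (\<eta> * (h - h0)) \<in> ?T" using h by auto
    moreover have "f 0 = q (\<eta> * Im (0 + Complex 0 (\<eta> * h0)))" using f0 by simp
    ultimately have "f (Complex 0 (\<eta> * (h - h0))) = q (\<eta> * Im (Complex 0 (\<eta> * (h - h0)) + Complex 0 (\<eta> * h0)))"
      using dev_unique[OF 1 2 convex_connected[OF T]] by blast
    also have "\<eta> * Im (Complex 0 (\<eta> * (h - h0)) + Complex 0 (\<eta> * h0)) = h"
      by (simp add: right_diff_distrib)
    finally show ?thesis by simp
  qed
  have fl: "flow_defined X (of_real \<sigma>) s (q h) \<and> flow X (of_real \<sigma>) s (q h) = f (Complex (\<sigma> * s) (\<eta> * (h - h0)))"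
    if h: "h \<in> {0..\<delta>}" "\<bar>h - h0\<bar> < e" and s: "s \<in> {0..t}" for h s
  proof -
    let ?z = "Complex 0 (\<eta> * (h - h0))"
    have zb: "?z \<in> ball 0 e" using h(2) signs(2) by (auto simp: cmod_def)
    have zs: "?z + of_real s * of_real \<sigma> = Complex (\<sigma> * s) (\<eta> * (h - h0))" by (simp add: complex_eq_iff)
    have "of_real s * of_real \<sigma> \<in> closed_segment 0 (0 + of_real t * complex_of_real \<sigma>)"
      using segment_param[of s t 0] s by (auto simp: closed_segment_eq_real_ivl)
    then have "?z + of_real s * of_real \<sigma> \<in> ?N"
      unfolding nbhd_def using zb by (auto simp: dist_norm intro!: bexI[of _ "of_real s * of_real \<sigma>"])
    then have sub: "closed_segment ?z (?z + of_real s * of_real \<sigma>) \<subseteq> ?N"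
      using dev_segment_subset[OF N] ball_segment_nbhd(1)[OF zb] by blast
    from flow_dev[OF f sub sign_nonzero] show ?thesis unfolding zs q[OF h, symmetric] by simp
  qed
  show ?thesis using that[OF e f] fl t(1) by force
qed

text \<open>The signs turn \<sigma> Re z into the time along a leaf and \<eta> Im z into the height
  on the transversal.\<close>

definition strip :: "real \<Rightarrow> real \<Rightarrow> complex set" where
  "strip t H = {z. \<sigma> * Re z \<in> {0..t} \<and> \<eta> * Im z \<in> {0..H}}"

lemma convex_strip: "convex (strip t H)"
proof (rule convexI)
  fix x y :: complex and u v :: real
  assume a: "x \<in> strip t H" "y \<in> strip t H" "0 \<le> u" "0 \<le> v" "u + v = 1"
  have "u *\<^sub>R (\<sigma> * Re x) + v *\<^sub>R (\<sigma> * Re y) \<in> {0..t}" "u *\<^sub>R (\<eta> * Im x) + v *\<^sub>R (\<eta> * Im y) \<in> {0..H}"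
    by (rule convexD[OF convex_real_interval(5)]; use a in \<open>simp add: strip_def\<close>)+
  then show "u *\<^sub>R x + v *\<^sub>R y \<in> strip t H" unfolding strip_def by (simp add: algebra_simps)
qed

lemma in_strip: "s \<in> {0..t} \<Longrightarrow> h \<in> {0..H} \<Longrightarrow> Complex (\<sigma> * s) (\<eta> * h) \<in> strip t H"
  unfolding strip_def by simp

text \<open>The local developments around the single leaves fit together, since each of them is
  given by the flow. The strip may overlap itself on the surface; such overlaps are what the
  contradictions below exploit.\<close>

lemma strip_dev:
  assumes H: "H \<le> \<delta>" and t: "t \<ge> 0" and fd: "\<And>h. h \<in> {0..H} \<Longrightarrow> flow_defined X (of_real \<sigma>) t (q h)"
  shows "dev X (strip t H) (\<lambda>z. flow X (of_real \<sigma>) (\<sigma> * Re z) (q (\<eta> * Im z)))"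
proof (rule dev_local)
  fix z assume z: "z \<in> strip t H"
  let ?h = "\<eta> * Im z"
  have h: "?h \<in> {0..\<delta>}" "?h \<in> {0..H}" using z H unfolding strip_def by auto
  obtain e f where e: "e > 0" and f: "dev X (nbhd (closed_segment 0 (of_real t * of_real \<sigma>)) e) f"
    and fl: "\<And>h s. h \<in> {0..\<delta>} \<Longrightarrow> \<bar>h - ?h\<bar> < e \<Longrightarrow> s \<in> {0..t} \<Longrightarrow>
       flow X (of_real \<sigma>) s (q h) = f (Complex (\<sigma> * s) (\<eta> * (h - ?h)))"
    using strip_local[OF h(1) t fd[OF h(2)]] by metis
  let ?N = "{w. \<bar>\<eta> * Im w - ?h\<bar> < e}"
  have N: "open ?N" by (intro open_Collect_less continuous_intros)
  have "dev X (strip t H \<inter> ?N) (\<lambda>w. f (w + Complex 0 (- Im z)))"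
  proof (rule dev_shift[OF f])
    fix w assume w: "w \<in> strip t H \<inter> ?N"
    have "of_real (\<sigma> * Re w) * of_real \<sigma> \<in> closed_segment 0 (0 + of_real t * complex_of_real \<sigma>)"
      using segment_param[of "\<sigma> * Re w" t 0] w unfolding strip_def by (auto simp: closed_segment_eq_real_ivl)
    moreover have "of_real (\<sigma> * Re w) * complex_of_real \<sigma> = of_real (Re w)" using signs(1) by auto
    moreover have "dist (complex_of_real (Re w)) (w + Complex 0 (- Im z)) < e"
    proof -
      have "\<bar>Im w - Im z\<bar> < e" using w signs(2) by auto
      moreover have "complex_of_real (Re w) - (w + Complex 0 (- Im z)) = Complex 0 (Im z - Im w)" by (simp add: complex_eq_iff)
      ultimately show ?thesis unfolding dist_norm by (simp add: cmod_def)
    qed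
    ultimately show "w + Complex 0 (- Im z) \<in> nbhd (closed_segment 0 (of_real t * of_real \<sigma>)) e"
      unfolding nbhd_def mem_Collect_eq by (metis add_0)
  qed
  moreover have "flow X (of_real \<sigma>) (\<sigma> * Re w) (q (\<eta> * Im w)) = f (w + Complex 0 (- Im z))" if w: "w \<in> strip t H \<inter> ?N" for w
  proof -
    have "flow X (of_real \<sigma>) (\<sigma> * Re w) (q (\<eta> * Im w)) = f (Complex (\<sigma> * (\<sigma> * Re w)) (\<eta> * (\<eta> * Im w - ?h)))"
      by (rule fl) (use w H in \<open>auto simp: strip_def\<close>)
    also have "Complex (\<sigma> * (\<sigma> * Re w)) (\<eta> * (\<eta> * Im w - ?h)) = w + Complex 0 (- Im z)"
      by (simp add: complex_eq_iff right_diff_distrib)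
    finally show ?thesis .
  qed
  moreover have "z \<in> ?N" using e by simp
  ultimately show "\<exists>N g. open N \<and> z \<in> N \<and> dev X (strip t H \<inter> N) g \<and>
      (\<forall>w\<in>strip t H \<inter> N. flow X (of_real \<sigma>) (\<sigma> * Re w) (q (\<eta> * Im w)) = g w)"
    using N by (intro exI[of _ ?N] exI[of _ "\<lambda>w. f (w + Complex 0 (- Im z))"]) auto
qed

text \<open>
  Descending by \<open>H\<close> from the point of return leads both to the leaf of \<open>q 0\<close>, outside of \<open>A\<close>,
  and to \<open>q (h' - H)\<close>, inside of \<open>A\<close>.
\<close>

lemma no_return_above:
  assumes H: "0 < H" "H < h'" "h' \<le> \<delta>" and t: "t \<ge> 0"
    and fd: "\<And>h. h \<in> {0..H} \<Longrightarrow> flow_defined X (of_real \<sigma>) t (q h)"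
    and ret: "flow X (of_real \<sigma>) t (q H) = q h'"
  shows False
proof -
  have H\<delta>: "H \<le> \<delta>" using H by simp
  let ?K = "(\<lambda>u. Complex 0 (- \<eta> * u)) ` {0..H}"
  have lin: "linear (\<lambda>u. Complex 0 (- \<eta> * u))" by (rule linearI) (auto simp: complex_eq_iff algebra_simps)
  have K: "connected ?K" by (intro convex_connected convex_linear_image[OF lin]) simp
  let ?g1 = "\<lambda>z. flow X (of_real \<sigma>) (\<sigma> * Re (z + Complex (\<sigma> * t) (\<eta> * H))) (q (\<eta> * Im (z + Complex (\<sigma> * t) (\<eta> * H))))"
  let ?g2 = "\<lambda>z. q (\<eta> * Im (z + Complex 0 (\<eta> * h')))"
  have eq: "Complex 0 (- \<eta> * u) + Complex (\<sigma> * t) (\<eta> * H) = Complex (\<sigma> * t) (\<eta> * (H - u))"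
    "Complex 0 (- \<eta> * u) + Complex 0 (\<eta> * h') = Complex 0 (\<eta> * (h' - u))" for u
    by (auto simp: complex_eq_iff algebra_simps)
  have 1: "dev X ?K ?g1"
  proof (rule dev_shift[OF strip_dev[OF H\<delta> t fd]])
    fix z assume "z \<in> ?K"
    then obtain u where u: "u \<in> {0..H}" "z = Complex 0 (- \<eta> * u)" by blast
    show "z + Complex (\<sigma> * t) (\<eta> * H) \<in> strip t H" unfolding u(2) eq by (rule in_strip) (use t u in auto)
  qed
  have 2: "dev X ?K ?g2"
  proof (rule dev_shift[OF qdev])
    fix z assume "z \<in> ?K"
    then obtain u where u: "u \<in> {0..H}" "z = Complex 0 (- \<eta> * u)" by blast
    show "z + Complex 0 (\<eta> * h') \<in> (\<lambda>h. Complex 0 (\<eta> * h)) ` {0..\<delta>}"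
      unfolding u(2) eq by (rule imageI) (use u H in auto)
  qed
  have "0 \<in> ?K" using H by (intro image_eqI[of _ _ 0]) (auto simp: complex_eq_iff)
  moreover have "?g1 0 = ?g2 0" using ret by simp
  moreover have "Complex 0 (- \<eta> * H) \<in> ?K" using H by auto
  ultimately have "?g1 (Complex 0 (- \<eta> * H)) = ?g2 (Complex 0 (- \<eta> * H))"
    using dev_unique[OF 1 2 K] by blast
  then have "flow X (of_real \<sigma>) t (q 0) = q (h' - H)"
    unfolding eq by simp
  moreover have "q (h' - H) \<in> A" by (rule qA) (use H in auto)
  ultimately show False using flow_in_A_iff[OF infinite_leaf[OF t]] q0 by simp
qed

text \<open>The leaf of \<open>q 0\<close> returns twice to a small disc. If the returns differ in
  height, pushing the lower one up through the strip reaches the other, so a leaf in A meets one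
  outside of A; if they do not, the leaf is closed.\<close>

lemma no_wide_strip:
  assumes h0: "0 < h0" "h0 \<le> \<delta>"
    and fd: "\<And>t h. t \<ge> 0 \<Longrightarrow> h \<in> {0..h0} \<Longrightarrow> flow_defined X (of_real \<sigma>) t (q h)"
  shows False
proof -
  let ?a = "\<lambda>t. flow X (of_real \<sigma>) t (q 0)"
  have "cmod (of_real \<sigma>) = 1" using signs(1) by auto
  then obtain x where x: "x \<in> regular_points X"
    and rec: "\<And>N T. openin (surf X) N \<Longrightarrow> x \<in> N \<Longrightarrow> \<exists>t\<ge>T. t \<ge> 0 \<and> ?a t \<in> N"
    using half_leaf_recurrent[of "of_real \<sigma>" "q 0"] infinite_leaf by blast
  obtain r \<psi> F where d: "flat_disc x r \<psi> F" using flat_disc_exists[OF x] .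
  \<comment> \<open>The entry h0 / 4 keeps the difference of heights within the strip. The entry 1 /
    4 keeps the horizontal difference below the gap of 1 between the two return times, so that for
    equal heights the period is positive.\<close>
  define r' where "r' = min r (min (h0 / 4) (1 / 4))"
  have r: "r > 0" "\<psi> 0 = x" using d unfolding flat_disc_def by auto
  have r': "r' > 0" "r' \<le> r" "r' \<le> h0 / 4" "r' \<le> 1 / 4" using r h0 unfolding r'_def by auto
  let ?N = "\<psi> ` ball 0 r'"
  have N: "openin (surf X) ?N" by (rule flat_disc_open[OF d]) (use r' in auto)
  have xN: "x \<in> ?N" using r r' by (metis centre_in_ball imageI)
  obtain t1 where t1: "t1 \<ge> 1" "?a t1 \<in> ?N" using rec[OF N xN] by blast
  obtain t2 where t2: "t2 \<ge> t1 + 1" "?a t2 \<in> ?N" using rec[OF N xN] by blast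
  obtain w1 where w1: "w1 \<in> ball 0 r'" "?a t1 = \<psi> w1" using t1 by blast
  obtain w2 where w2: "w2 \<in> ball 0 r'" "?a t2 = \<psi> w2" using t2 by blast
  have dev\<psi>: "dev X (ball 0 r') \<psi>" by (rule dev_subset[OF flat_disc_dev[OF d]]) (use r' in auto)
  \<comment> \<open>two returns of the leaf to a small disc: the strip above the lower one contains the upper one\<close>
  have connect: "flow X (of_real \<sigma>) (s + x) (q y) = ?a s'"
    if x: "x = \<sigma> * Re (w' - w)" and y: "y = \<eta> * Im (w' - w)" and w: "w \<in> ball 0 r'" "?a s = \<psi> w" and w': "w' \<in> ball 0 r'" "?a s' = \<psi> w'"
      and s: "s \<ge> 1" and up: "y \<ge> 0" for w w' s s' x y
  proof -
    let ?T = "s + 1"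
    have dd: "cmod (w' - w) < h0 / 2" "cmod (w' - w) < 1 / 2"
      using w(1) w'(1) r' norm_triangle_ineq4[of w' w] by auto
    have \<sigma>b: "\<bar>\<sigma> * Re (w' - w)\<bar> < 1 / 2" "\<eta> * Im (w' - w) < h0 / 2"
      using dd abs_Re_le_cmod[of "w' - w"] abs_Im_le_cmod[of "w' - w"] signs by (auto simp: abs_mult)
    have sd: "dev X (strip ?T h0) (\<lambda>z. flow X (of_real \<sigma>) (\<sigma> * Re z) (q (\<eta> * Im z)))"
      by (rule strip_dev[OF h0(2)]) (use s fd in auto)
    let ?z0 = "Complex (\<sigma> * s) (\<eta> * 0)"
    have z0: "?z0 \<in> strip ?T h0" by (rule in_strip) (use s h0 in auto)
    have z1: "?z0 + (w' - w) \<in> strip ?T h0"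
    proof -
      have "?z0 + (w' - w) = Complex (\<sigma> * (s + \<sigma> * Re (w' - w))) (\<eta> * (\<eta> * Im (w' - w)))"
        by (simp add: complex_eq_iff distrib_left)
      moreover have "Complex (\<sigma> * (s + \<sigma> * Re (w' - w))) (\<eta> * (\<eta> * Im (w' - w))) \<in> strip ?T h0"
        by (rule in_strip) (use \<sigma>b s h0 up y in auto)
      ultimately show ?thesis by simp
    qed
    let ?K = "closed_segment 0 (w' - w)"
    have K1: "u + ?z0 \<in> strip ?T h0" if "u \<in> ?K" for u
    proof -
      have "?K \<subseteq> {u. u + ?z0 \<in> strip ?T h0}"
        by (rule closed_segment_subset)
            (use z0 z1 convex_translate_preimage[OF convex_strip, of ?z0 ?T h0] in \<open>auto simp only: add.commute mem_Collect_eq add_0\<close>)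
      then show ?thesis using that by blast
    qed
    have K2: "u + w \<in> ball 0 r'" if "u \<in> ?K" for u
    proof -
      have "?K \<subseteq> {u. u + w \<in> ball 0 r'}"
        by (rule closed_segment_subset) (use w w' convex_translate_preimage[OF convex_ball, of w 0 r'] in auto)
      then show ?thesis using that by blast
    qed
    have 1: "dev X ?K (\<lambda>u. flow X (of_real \<sigma>) (\<sigma> * Re (u + ?z0)) (q (\<eta> * Im (u + ?z0))))"
      by (rule dev_shift[OF sd K1])
    have 2: "dev X ?K (\<lambda>u. \<psi> (u + w))" by (rule dev_shift[OF dev\<psi> K2])
    have "flow X (of_real \<sigma>) (\<sigma> * Re ((w' - w) + ?z0)) (q (\<eta> * Im ((w' - w) + ?z0))) = \<psi> ((w' - w) + w)"
      by (rule dev_unique[OF 1 2 connected_segment, of 0]) (use w in auto)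
    then show ?thesis using w'(2) unfolding x y by (simp add: distrib_left add.commute)
  qed
  have notA: "?a t \<notin> A" if "t \<ge> 0" for t using flow_in_A_iff[OF infinite_leaf[OF that]] q0 by simp
  have inA: "flow X (of_real \<sigma>) t (q h) \<in> A" if "t \<ge> 0" "h \<in> {0<..h0}" for t h
    using flow_in_A_iff[OF fd] qA[of h] that h0 by auto
  define x y where "x = \<sigma> * Re (w2 - w1)" and "y = \<eta> * Im (w2 - w1)"
  have small: "\<bar>x\<bar> < 1" "\<bar>y\<bar> \<le> h0"
  proof -
    have "cmod (w2 - w1) < 1 / 2" "cmod (w2 - w1) < h0 / 2" using w1(1) w2(1) r' norm_triangle_ineq4[of w2 w1] by auto
    then show "\<bar>x\<bar> < 1" "\<bar>y\<bar> \<le> h0" unfolding x_def y_def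
      using abs_Re_le_cmod[of "w2 - w1"] abs_Im_le_cmod[of "w2 - w1"] signs h0 by (auto simp: abs_mult)
  qed
  consider "y > 0" | "y < 0" | "y = 0" by linarith
  then show False
  proof cases
    case 1
    then have "flow X (of_real \<sigma>) (t1 + x) (q y) = ?a t2" using connect[OF x_def y_def w1 w2 t1(1)] by simp
    moreover have "flow X (of_real \<sigma>) (t1 + x) (q y) \<in> A" by (rule inA) (use 1 small t1 in auto)
    ultimately show False using notA[of t2] t1(1) t2(1) by simp
  next
    case 2
    have e: "- x = \<sigma> * Re (w1 - w2)" "- y = \<eta> * Im (w1 - w2)" unfolding x_def y_def by (auto simp: algebra_simps)
    have "flow X (of_real \<sigma>) (t2 - x) (q (- y)) = ?a t1"
      using connect[OF e w2 w1] t1(1) t2(1) 2 by simp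
    moreover have "flow X (of_real \<sigma>) (t2 - x) (q (- y)) \<in> A" by (rule inA) (use 2 small t1 t2 in auto)
    ultimately show False using notA[of t1] t1(1) by simp
  next
    case 3
    then have "?a (t1 + x) = ?a t2" using connect[OF x_def y_def w1 w2 t1(1)] by simp
    moreover have nn: "t1 + x \<ge> 0" "t2 \<ge> 0" using small t1 t2 by auto
    ultimately have "flow_defined X (of_real \<sigma>) (t2 - (t1 + x)) (?a t2)" "flow X (of_real \<sigma>) (t2 - (t1 + x)) (?a t2) = ?a t2"
      using flow_between[OF infinite_leaf[OF nn(1)] infinite_leaf[OF nn(2)] sign_nonzero] by auto
    moreover have "t2 - (t1 + x) > 0" using small t2 by simp
    ultimately have "degenerate 1 (t2 - (t1 + x))"
      using signs(1) degenerate_closed_leaf[of 1] degenerate_uminus_closed_leaf[of 1] by auto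
    then show False using nd by blast
  qed
qed

text \<open>The leaf of \<open>q w\<close> runs into a zero exactly at time s, while all leaves from
  lower heights survive this time. The strict order of such heights thus becomes the reverse strict
  order of the end times.\<close>

definition ends :: "real \<Rightarrow> real \<Rightarrow> bool" where
  "ends w s \<longleftrightarrow> w \<in> {0<..\<delta>} \<and> s > 0 \<and> (\<forall>x\<in>{0..<s}. flow_defined X (of_real \<sigma>) x (q w)) \<and>
     \<not> flow_defined X (of_real \<sigma>) s (q w) \<and> (\<forall>h\<in>{0..<w}. flow_defined X (of_real \<sigma>) s (q h)) \<and>
     (\<exists>z\<in>form_zeros X. \<forall>N e. openin (surf X) N \<and> z \<in> N \<and> e > 0 \<longrightarrow>
        (\<exists>x\<in>{0..<s}. s - x < e \<and> flow X (of_real \<sigma>) x (q w) \<in> N))"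

lemma q_regular: "h \<in> {0..\<delta>} \<Longrightarrow> q h \<in> regular_points X"
  using dev_regular[OF qdev imageI[of h]] by simp

text \<open>The lowest height whose leaf does not survive time t is taken. The infimum is attained
  because survival is an open condition, and it is positive because the leaf of \<open>q 0\<close>
  is infinite.\<close>

lemma ends_exists:
  assumes h: "h \<in> {0..\<delta>}" and t: "t \<ge> 0" "\<not> flow_defined X (of_real \<sigma>) t (q h)"
  obtains w s where "ends w s" "w \<le> h" "s \<le> t"
proof -
  let ?W = "{h \<in> {0..\<delta>}. \<not> flow_defined X (of_real \<sigma>) t (q h)}"
  define w where "w = Inf ?W"
  have bdd: "bdd_below ?W" by (intro bdd_belowI[of _ 0]) auto
  have ne: "h \<in> ?W" using h t by blast
  have wh: "w \<le> h" unfolding w_def by (rule cInf_lower[OF ne bdd])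
  have w0: "w \<ge> 0" unfolding w_def by (rule cInf_greatest) (use ne in auto)
  have w\<delta>: "w \<in> {0..\<delta>}" using wh w0 h by auto
  have below: "flow_defined X (of_real \<sigma>) t (q x)" if "x \<in> {0..<w}" for x
  proof (rule ccontr)
    assume "\<not> ?thesis"
    then have "w \<le> x" unfolding w_def using that w\<delta> bdd by (intro cInf_lower) auto
    then show False using that by simp
  qed
  have nw: "\<not> flow_defined X (of_real \<sigma>) t (q w)"
  proof
    assume "flow_defined X (of_real \<sigma>) t (q w)"
    then obtain e where e: "e > 0" "\<And>x. x \<in> {0..\<delta>} \<Longrightarrow> \<bar>x - w\<bar> < e \<Longrightarrow> flow_defined X (of_real \<sigma>) t (q x)"
      using strip_local[OF w\<delta> t(1)] by metis
    have "w + e \<le> x" if "x \<in> ?W" for x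
    proof (rule ccontr)
      assume "\<not> ?thesis"
      moreover have "w \<le> x" unfolding w_def by (rule cInf_lower[OF that bdd])
      ultimately show False using e(2)[of x] that by auto
    qed
    then have "w + e \<le> w" using ne w_def cInf_greatest[of ?W "w + e"] by blast
    then show False using e by simp
  qed
  have wpos: "w > 0" using w0 nw infinite_leaf[OF t(1)] by (cases "w = 0") auto
  obtain T z where T: "0 < T" "T \<le> t" "\<And>s. s \<in> {0..<T} \<Longrightarrow> flow_defined X (of_real \<sigma>) s (q w)" "\<not> flow_defined X (of_real \<sigma>) T (q w)"
    "z \<in> form_zeros X" "\<And>N e. openin (surf X) N \<Longrightarrow> z \<in> N \<Longrightarrow> e > 0 \<Longrightarrow> \<exists>s\<in>{0..<T}. T - s < e \<and> flow X (of_real \<sigma>) s (q w) \<in> N"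
    using leaf_end[OF q_regular[OF w\<delta>] sign_nonzero t(1) nw] by metis
  have "flow_defined X (of_real \<sigma>) T (q x)" if "x \<in> {0..<w}" for x
    by (rule flow_defined_subsegment[OF below[OF that] sign_nonzero]) (use T in \<open>auto simp: closed_segment_eq_real_ivl\<close>)
  moreover have "\<exists>z\<in>form_zeros X. \<forall>N e. openin (surf X) N \<and> z \<in> N \<and> e > 0 \<longrightarrow>
        (\<exists>x\<in>{0..<T}. T - x < e \<and> flow X (of_real \<sigma>) x (q w) \<in> N)"
    using T(5,6) by (intro bexI[of _ z]) auto
  ultimately have "ends w T" unfolding ends_def using T(1,3,4) wpos w\<delta> by auto
  then show ?thesis using that wh T(2) by blast
qed

text \<open>F runs along the leaf at unit speed, so c / 2 before a zero it has the value - \<sigma>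
  c / 2 relative to that zero. As the zero is only a cluster point, the value is first obtained up
  to an arbitrarily small error.\<close>

lemma ends_level:
  assumes e: "ends w s" and c: "c > 0" "s > c" and V: "\<And>z. z \<in> form_zeros X \<Longrightarrow> primitive_nbhd z c (V z) (F z)"
  shows "flow X (of_real \<sigma>) (s - c / 2) (q w) \<in> (\<Union>z\<in>form_zeros X. {x \<in> V z. F z x - F z z = of_real (- \<sigma> * c / 2)})"
proof -
  let ?y = "flow X (of_real \<sigma>) (s - c / 2) (q w)"
  have "\<exists>z\<in>form_zeros X. \<forall>N e. openin (surf X) N \<and> z \<in> N \<and> e > 0 \<longrightarrow>
        (\<exists>x\<in>{0..<s}. s - x < e \<and> flow X (of_real \<sigma>) x (q w) \<in> N)"
    using e unfolding ends_def by (elim conjE)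
  then obtain z where z: "z \<in> form_zeros X" and cl: "\<And>N e. openin (surf X) N \<Longrightarrow> z \<in> N \<Longrightarrow> e > 0 \<Longrightarrow>
        \<exists>x\<in>{0..<s}. s - x < e \<and> flow X (of_real \<sigma>) x (q w) \<in> N"
    by (metis (no_types, lifting))
  have fd: "\<And>x. x \<in> {0..<s} \<Longrightarrow> flow_defined X (of_real \<sigma>) x (q w)" using e unfolding ends_def by blast
  have Vz: "primitive_nbhd z c (V z) (F z)" using V z by blast
  then have F: "local_primitive X (V z) (F z)" and zV: "z \<in> V z" unfolding primitive_nbhd_def by auto
  have \<sigma>n: "cmod (of_real \<sigma>) = 1" using signs(1) by auto
  have approx: "?y \<in> V z \<and> cmod (F z ?y - F z z - of_real (- \<sigma> * c / 2)) < 2 * \<epsilon>" if \<epsilon>: "0 < \<epsilon>" "\<epsilon> \<le> c / 4" for \<epsilon>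
  proof -
    have "openin (surf X) {q \<in> V z. F z q \<in> ball (F z z) \<epsilon>}" by (rule lp_preimage_open[OF F]) simp
    moreover have "z \<in> {q \<in> V z. F z q \<in> ball (F z z) \<epsilon>}" using zV \<epsilon> by simp
    ultimately obtain x where x: "x \<in> {0..<s}" "s - x < \<epsilon>" "flow X (of_real \<sigma>) x (q w) \<in> {q \<in> V z. F z q \<in> ball (F z z) \<epsilon>}"
      using cl \<epsilon>(1) by blast
    let ?g = "\<lambda>u. flow X (of_real \<sigma>) (Re (u / of_real \<sigma>)) (q w)"
    have d: "dev X ((\<lambda>s. of_real s * of_real \<sigma>) ` {0..x}) ?g"
      by (rule leaf_dev[OF _ _ sign_nonzero fd]) (use x in auto)
    let ?J = "(\<lambda>s. of_real s * complex_of_real \<sigma>) ` {s - c / 2..x}"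
    have J: "convex ?J" by (rule convex_linear_image) (auto intro!: linearI simp: algebra_simps scaleR_conv_of_real)
    have dJ: "dev X ?J ?g" by (rule dev_subset[OF d]) (use c in auto)
    have gx: "?g (of_real u * of_real \<sigma>) = flow X (of_real \<sigma>) u (q w)" for u using sign_nonzero by simp
    have Fx: "cmod (F z (flow X (of_real \<sigma>) x (q w)) - F z z) < \<epsilon>" using x(3) by (simp add: dist_norm norm_minus_commute)
    have dd: "cmod (of_real u * of_real \<sigma> - of_real x * of_real \<sigma>) = \<bar>u - x\<bar>" for u
    proof -
      have "cmod (of_real u * of_real \<sigma> - of_real x * of_real \<sigma>) = cmod (of_real (u - x) * of_real \<sigma>)" by (simp add: algebra_simps)
      also have "\<dots> = \<bar>u - x\<bar>" using \<sigma>n unfolding norm_mult by (simp only: norm_of_real) simp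
      finally show ?thesis .
    qed
    have xs: "s - c / 2 \<le> x" using x(2) \<epsilon> by simp
    have "?g (of_real (s - c / 2) * of_real \<sigma>) \<in> V z \<and>
      F z (?g (of_real (s - c / 2) * of_real \<sigma>)) = F z (?g (of_real x * of_real \<sigma>)) + (of_real (s - c / 2) * of_real \<sigma> - of_real x * of_real \<sigma>)"
    proof (rule dev_trapped[OF Vz dJ J])
      show "of_real x * of_real \<sigma> \<in> ?J" "of_real (s - c / 2) * of_real \<sigma> \<in> ?J" using xs by (intro imageI; simp)+
      show "?g (of_real x * of_real \<sigma>) \<in> V z" unfolding gx using x(3) by blast
      fix u assume "u \<in> ?J"
      then obtain u' where u': "u' \<in> {s - c / 2..x}" "u = of_real u' * of_real \<sigma>" by blast
      show "cmod (F z (?g (of_real x * of_real \<sigma>)) - F z z) + cmod (u - of_real x * of_real \<sigma>) \<le> c"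
        unfolding gx u'(2) dd using Fx u'(1) x(1) \<epsilon> by simp
    qed
    then have h: "?y \<in> V z" "F z ?y = F z (flow X (of_real \<sigma>) x (q w)) + (of_real (s - c / 2) * of_real \<sigma> - of_real x * of_real \<sigma>)"
      unfolding gx by auto
    have "F z ?y - F z z - of_real (- \<sigma> * c / 2) = (F z (flow X (of_real \<sigma>) x (q w)) - F z z) + (of_real s * of_real \<sigma> - of_real x * of_real \<sigma>)"
      using h(2) by (simp add: algebra_simps)
    then have "cmod (F z ?y - F z z - of_real (- \<sigma> * c / 2)) \<le> cmod (F z (flow X (of_real \<sigma>) x (q w)) - F z z) + \<bar>s - x\<bar>"
      using dd[of s] norm_triangle_ineq by metis
    then show ?thesis using h(1) Fx x(1,2) by simp
  qed
  have "cmod (F z ?y - F z z - of_real (- \<sigma> * c / 2)) \<le> 0"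
  proof (rule field_le_epsilon)
    fix e :: real assume e: "e > 0"
    have "cmod (F z ?y - F z z - of_real (- \<sigma> * c / 2)) < 2 * min (e / 2) (c / 4)"
      using approx[of "min (e / 2) (c / 4)"] e c by simp
    also have "\<dots> \<le> e" by simp
    finally show "cmod (F z ?y - F z z - of_real (- \<sigma> * c / 2)) \<le> 0 + e" by simp
  qed
  then have "F z ?y - F z z = of_real (- \<sigma> * c / 2)" by (simp only: norm_le_zero_iff right_minus_eq)
  moreover have "?y \<in> V z" using approx[of "c / 4"] c by simp
  ultimately show ?thesis using z by blast
qed

text \<open>
  Infinitely many leaves starting on the segment run into a zero, and shortly before they pass
  through one of finitely many points. Two of them through the same point coincide, and so the
  lower one returns to the starting point of the other.
\<close>

lemma no_narrow_strips:
  assumes narrow: "\<And>h0. h0 \<in> {0<..\<delta>} \<Longrightarrow> \<exists>t\<ge>0. \<exists>h\<in>{0..h0}. \<not> flow_defined X (of_real \<sigma>) t (q h)"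
  shows False
proof -
  obtain c where c: "c > 0" and pn: "\<And>p. p \<in> topspace (surf X) \<Longrightarrow> \<exists>V F. primitive_nbhd p c V F"
    using uniform_primitive_nbhd by blast
  have "\<And>z. z \<in> form_zeros X \<Longrightarrow> \<exists>V F. primitive_nbhd z c V F" by (rule pn) (auto simp: form_zeros_def)
  then obtain V F where VF: "\<And>z. z \<in> form_zeros X \<Longrightarrow> primitive_nbhd z c (V z) (F z)" by metis
  define Q where "Q = (\<Union>z\<in>form_zeros X. {x \<in> V z. F z x - F z z = of_real (- \<sigma> * c / 2)})"
  have b: "cmod (of_real (- \<sigma> * c / 2)) \<le> c" "complex_of_real (- \<sigma> * c / 2) \<noteq> 0"
    unfolding norm_of_real using signs(1) c by auto
  have Q: "finite Q" unfolding Q_def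
    by (intro finite_UN_I finite_zeros leaf_hits_finite_level[OF _ VF b])
  \<comment> \<open>Leaves starting close to \<open>q 0\<close> survive time c, so the end times
    found at small heights exceed c.\<close>
  obtain e where e: "e > 0" "\<And>h. h \<in> {0..\<delta>} \<Longrightarrow> \<bar>h - 0\<bar> < e \<Longrightarrow> flow_defined X (of_real \<sigma>) c (q h)"
    using strip_local[of 0 c] \<delta> c infinite_leaf[of c] by (metis atLeastAtMost_iff less_imp_le order_refl)
  define W where "W = {w. \<exists>s>c. ends w s}"
  have Wex: "\<exists>w\<in>W. w \<le> h0" if h0: "h0 \<in> {0<..\<delta>}" for h0
  proof -
    let ?h = "min h0 (e / 2)"
    have "?h \<in> {0<..\<delta>}" using h0 e by auto
    then obtain t h where t: "t \<ge> 0" "h \<in> {0..?h}" "\<not> flow_defined X (of_real \<sigma>) t (q h)" using narrow by blast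
    have "h \<in> {0..\<delta>}" using t(2) h0 by auto
    then obtain w s where ws: "ends w s" "w \<le> h" using ends_exists t(1,3) by metis
    have "s > c"
    proof (rule ccontr)
      assume "\<not> s > c"
      moreover have w: "w \<in> {0..\<delta>}" "\<bar>w - 0\<bar> < e" "s > 0" using ws t(2) e(1) unfolding ends_def by auto
      ultimately have "flow_defined X (of_real \<sigma>) s (q w)"
        by (intro flow_defined_subsegment[OF e(2)[OF w(1,2)] sign_nonzero]) (auto simp: closed_segment_eq_real_ivl)
      then show False using ws unfolding ends_def by blast
    qed
    then have "w \<in> W" using ws unfolding W_def by blast
    then show ?thesis using ws(2) t(2) by (intro bexI[of _ w]) auto
  qed
  have Wpos: "w \<in> {0<..\<delta>}" if "w \<in> W" for w using that unfolding W_def ends_def by blast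
  have "infinite W"
  proof
    assume fin: "finite W"
    have "W \<noteq> {}" using Wex[of \<delta>] \<delta> by auto
    then have m: "Min W \<in> W" using fin by simp
    then have "Min W / 2 \<in> {0<..\<delta>}" using Wpos[OF m] by auto
    then obtain w where "w \<in> W" "w \<le> Min W / 2" using Wex by blast
    then show False using Min_le[OF fin] Wpos[OF m] by fastforce
  qed
  have "\<forall>w\<in>W. \<exists>s. s > c \<and> ends w s" unfolding W_def by blast
  from bchoice[OF this] obtain sf where sf: "\<And>w. w \<in> W \<Longrightarrow> sf w > c \<and> ends w (sf w)" by blast
  let ?y = "\<lambda>w. flow X (of_real \<sigma>) (sf w - c / 2) (q w)"
  have "?y ` W \<subseteq> Q" using ends_level[OF _ c _ VF] sf unfolding Q_def by blast
  then have "\<not> inj_on ?y W" using \<open>infinite W\<close> Q inj_on_finite by blast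
  then obtain w w' where ww: "w \<in> W" "w' \<in> W" "w' < w" "?y w = ?y w'"
    unfolding inj_on_def by (metis linorder_neqE)
  have s: "sf w > c" "sf w' > c" and en: "ends w (sf w)" "ends w' (sf w')" using sf ww by auto
  have less: "sf w < sf w'"
  proof (rule ccontr)
    assume "\<not> ?thesis"
    moreover have "flow_defined X (of_real \<sigma>) (sf w) (q w')" using en(1) ww(3) Wpos[OF ww(2)] unfolding ends_def by auto
    moreover have "sf w' > 0" using s c by simp
    ultimately have "flow_defined X (of_real \<sigma>) (sf w') (q w')"
      using flow_defined_subsegment[OF _ sign_nonzero, of "sf w" "q w'" "sf w'"] by (simp add: closed_segment_eq_real_ivl)
    then show False using en(2) unfolding ends_def by blast
  qed
  \<comment> \<open>Both leaves pass through the same point c / 2 before their ends, so the lower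
    one is at \<open>q w\<close> when the difference of the end times has elapsed.\<close>
  let ?t = "sf w' - sf w"
  have fd: "flow_defined X (of_real \<sigma>) ?t (q h)" if h: "h \<in> {0..w'}" for h
  proof (cases "h = w'")
    case True
    have "?t \<in> {0..<sf w'}" using less s c by auto
    then show ?thesis using en(2) True unfolding ends_def by blast
  next
    case False
    then have "flow_defined X (of_real \<sigma>) (sf w') (q h)" using en(2) h unfolding ends_def by auto
    moreover have "0 \<le> ?t" "?t \<le> sf w'" "sf w' \<ge> 0" using less s c by auto
    ultimately show ?thesis
      using flow_defined_subsegment[OF _ sign_nonzero, of "sf w'" "q h" ?t] by (simp add: closed_segment_eq_real_ivl)
  qed
  have "flow X (of_real \<sigma>) ?t (q w') = q w"
  proof -
    have 1: "flow_defined X (of_real \<sigma>) (sf w - c / 2) (q w)" "flow_defined X (of_real \<sigma>) (sf w' - c / 2) (q w')"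
      using en s c unfolding ends_def by auto
    have 2: "q w \<in> regular_points X" by (rule q_regular) (use Wpos[OF ww(1)] in auto)
    have "flow X (of_real \<sigma>) (0 - (sf w - c / 2)) (?y w) = q w"
      using flow_between(2)[OF 1(1) conjunct1[OF flow_zero[OF 2 sign_nonzero]] sign_nonzero] flow_zero[OF 2 sign_nonzero] by simp
    moreover have "flow X (of_real \<sigma>) (?t - (sf w' - c / 2)) (?y w') = flow X (of_real \<sigma>) ?t (q w')"
      by (rule flow_between(2)[OF 1(2) fd sign_nonzero]) (use Wpos[OF ww(2)] in auto)
    moreover have "0 - (sf w - c / 2) = ?t - (sf w' - c / 2)" by simp
    ultimately show ?thesis using ww(4) by metis
  qed
  then show False
    using no_return_above[of w' w ?t] Wpos[OF ww(1)] Wpos[OF ww(2)] ww(3) less fd by auto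
qed

lemma contradiction: False
proof (cases "\<exists>h0\<in>{0<..\<delta>}. \<forall>t\<ge>0. \<forall>h\<in>{0..h0}. flow_defined X (of_real \<sigma>) t (q h)")
  case True
  then show False using no_wide_strip by (meson greaterThanAtMost_iff)
next
  case False
  then show False using no_narrow_strips by meson
qed

end

section \<open>Minimality from the impossibility of a gap\<close>

context finite_zeros_form begin

text \<open>Otherwise connectedness of the regular points yields a point p outside of A but in its
  closure. In a flat disc at p the set A is a union of full horizontal segments, so the vertical
  segment through p meets A; beyond its last point outside of A it provides the data of the locale
  \<open>gap\<close>.\<close>

lemma horizontally_minimal:
  assumes nd: "\<And>l. \<not> degenerate 1 l"
    and A: "openin (surf X) A" "A \<subseteq> regular_points X" "A \<noteq> {}"
    and inv: "\<And>x t. x \<in> A \<Longrightarrow> hflow_defined X t x \<Longrightarrow> hflow X t x \<in> A"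
  shows "A = regular_points X"
proof (rule ccontr)
  assume "A \<noteq> regular_points X"
  have "\<not> openin (surf X) (regular_points X - A)"
  proof
    assume "openin (surf X) (regular_points X - A)"
    from connected_regular[OF A(1) this] A(2,3) \<open>A \<noteq> regular_points X\<close> show False by blast
  qed
  then obtain p where p: "p \<in> regular_points X" "p \<notin> A"
    and cl: "\<And>N. openin (surf X) N \<Longrightarrow> p \<in> N \<Longrightarrow> \<not> N \<subseteq> regular_points X - A"
    by (subst (asm) openin_subopen) blast
  obtain r \<psi> F where d: "flat_disc p r \<psi> F" using flat_disc_exists[OF p(1)] .
  have r: "r > 0" "\<psi> 0 = p" using d unfolding flat_disc_def by auto
  have "openin (surf X) (\<psi> ` ball 0 r)" by (rule flat_disc_open[OF d]) auto
  moreover have "p \<in> \<psi> ` ball 0 r" using r by (metis centre_in_ball imageI)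
  ultimately obtain w where w: "w \<in> ball 0 r" "\<psi> w \<in> A"
    using cl flat_disc_regular[OF d] by blast
  have hor: "\<psi> u \<in> A" if u: "u \<in> ball 0 r" "v \<in> ball 0 r" "Im u = Im v" "\<psi> v \<in> A" for u v
  proof -
    have e: "v + of_real (Re u - Re v) * 1 = u" using u(3) by (simp add: complex_eq_iff)
    have "closed_segment v (v + of_real (Re u - Re v) * 1) \<subseteq> ball 0 r"
      unfolding e using u by (intro closed_segment_subset) auto
    from flow_dev[OF flat_disc_dev[OF d] this] have "hflow_defined X (Re u - Re v) (\<psi> v)"
      "hflow X (Re u - Re v) (\<psi> v) = \<psi> u" unfolding e by auto
    then show ?thesis using inv[OF u(4)] by metis
  qed
  have bound: "\<bar>Im w\<bar> < r" using w(1) abs_Im_le_cmod[of w] by simp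
  \<comment> \<open>Horizontal invariance moves the point of A onto the vertical axis of the
    disc.\<close>
  have iA: "\<psi> (Complex 0 (Im w)) \<in> A" by (rule hor[OF _ w(1) _ w(2)]) (use bound in \<open>auto simp: cmod_def\<close>)
  have Imw: "Im w \<noteq> 0"
  proof
    assume "Im w = 0"
    then have "Complex 0 (Im w) = 0" by (simp add: complex_eq_iff)
    then show False using iA r(2) p(2) by simp
  qed
  define \<eta> where "\<eta> = sgn (Im w)"
  have \<eta>: "\<eta> = 1 \<or> \<eta> = -1" "\<eta> * \<bar>Im w\<bar> = Im w" "\<eta> * \<eta> = 1" using Imw unfolding \<eta>_def by (auto simp: sgn_if)
  let ?Y = "{h \<in> {0..\<bar>Im w\<bar>}. \<psi> (Complex 0 (\<eta> * h)) \<notin> A}"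
  have Y0: "0 \<in> ?Y" using r(2) p(2) by (simp flip: Complex_eq_0 add: zero_complex.code[symmetric])
  have cont: "continuous_map (top_of_set {0..\<bar>Im w\<bar>}) (surf X) (\<lambda>h. \<psi> (Complex 0 (\<eta> * h)))"
  proof -
    have "continuous_map (top_of_set {0..\<bar>Im w\<bar>}) (top_of_set (ball 0 r)) (\<lambda>h. Complex 0 (\<eta> * h))"
      using bound \<eta>(1) by (auto simp: continuous_map_in_subtopology cmod_def intro!: continuous_intros)
    from continuous_map_compose[OF this flat_disc_continuous[OF d]] show ?thesis by (simp add: o_def)
  qed
  define m where "m = Sup ?Y"
  have bdd: "bdd_above ?Y" by (intro bdd_aboveI[of _ "\<bar>Im w\<bar>"]) auto
  have m: "m \<in> {0..\<bar>Im w\<bar>}"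
  proof -
    have "Sup ?Y \<le> \<bar>Im w\<bar>" by (rule cSup_least) (use Y0 in blast, simp)
    then show ?thesis unfolding m_def using cSup_upper[OF Y0 bdd] by simp
  qed
  have above: "\<psi> (Complex 0 (\<eta> * h)) \<in> A" if "h \<in> {m<..\<bar>Im w\<bar>}" for h
  proof (rule ccontr)
    assume "\<not> ?thesis"
    then have "h \<le> m" unfolding m_def using that m bdd by (intro cSup_upper) auto
    then show False using that by simp
  qed
  \<comment> \<open>A is open, so the supremum of the heights outside of A is attained.\<close>
  have mA: "\<psi> (Complex 0 (\<eta> * m)) \<notin> A"
  proof
    assume "\<psi> (Complex 0 (\<eta> * m)) \<in> A"
    then obtain e where e: "e > 0" "\<forall>h\<in>{0..\<bar>Im w\<bar>}. dist h m < e \<longrightarrow> \<psi> (Complex 0 (\<eta> * h)) \<in> A"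
      using top_of_set_preimage_eventually[OF cont A(1) m] by blast
    have "h \<le> m - e" if "h \<in> ?Y" for h
    proof (rule ccontr)
      assume "\<not> ?thesis"
      moreover have "h \<le> m" unfolding m_def by (rule cSup_upper[OF that bdd])
      ultimately show False using e(2) that by (auto simp: dist_real_def)
    qed
    then have "m \<le> m - e" using Y0 m_def cSup_least[of ?Y "m - e"] by blast
    then show False using e by simp
  qed
  define \<delta> where "\<delta> = \<bar>Im w\<bar> - m"
  have "m \<noteq> \<bar>Im w\<bar>" using mA iA \<eta>(2) by auto
  then have \<delta>: "\<delta> > 0" using m unfolding \<delta>_def by auto
  define q where "q = (\<lambda>h. \<psi> (Complex 0 (\<eta> * (m + h))))"
  have ball: "Complex 0 (\<eta> * (m + h)) \<in> ball 0 r" if "h \<in> {0..\<delta>}" for h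
    using that bound m \<eta>(1) unfolding \<delta>_def by (auto simp: cmod_def)
  have qdev: "dev X ((\<lambda>h. Complex 0 (\<eta> * h)) ` {0..\<delta>}) (\<lambda>z. q (\<eta> * Im z))"
  proof -
    let ?S = "(\<lambda>h. Complex 0 (\<eta> * h)) ` {0..\<delta>}"
    have "dev X ?S (\<lambda>z. \<psi> (z + Complex 0 (\<eta> * m)))"
    proof (rule dev_shift[OF flat_disc_dev[OF d]])
      fix z assume "z \<in> ?S"
      then obtain h where h: "h \<in> {0..\<delta>}" "z = Complex 0 (\<eta> * h)" by blast
      have "z + Complex 0 (\<eta> * m) = Complex 0 (\<eta> * (m + h))" unfolding h(2) by (simp add: complex_eq_iff algebra_simps)
      then show "z + Complex 0 (\<eta> * m) \<in> ball 0 r" using ball[OF h(1)] by simp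
    qed
    then show ?thesis
    proof (rule dev_cong)
      fix u assume "u \<in> ?S"
      then obtain h where h: "u = Complex 0 (\<eta> * h)" by blast
      have "\<eta> * (m + \<eta> * (\<eta> * h)) = \<eta> * m + \<eta> * h" using \<eta>(1) by auto
      moreover have "u + Complex 0 (\<eta> * m) = Complex 0 (\<eta> * m + \<eta> * h)" unfolding h by (simp add: complex_eq_iff)
      ultimately show "q (\<eta> * Im u) = \<psi> (u + Complex 0 (\<eta> * m))" unfolding q_def h by simp
    qed
  qed
  have q0: "q 0 \<notin> A" using mA unfolding q_def by simp
  have qA: "q h \<in> A" if "h \<in> {0<..\<delta>}" for h
    unfolding q_def by (rule above) (use that in \<open>auto simp: \<delta>_def\<close>)
  have q0r: "q 0 \<in> regular_points X" unfolding q_def using flat_disc_regular[OF d ball[of 0]] \<delta> by simp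
  have "(\<forall>t\<ge>0. flow_defined X 1 t (q 0)) \<or> (\<forall>t\<ge>0. flow_defined X (- 1) t (q 0))"
    by (rule infinite_half_leaf[OF q0r _ nd]) simp
  then obtain \<sigma> :: real where \<sigma>: "\<sigma> = 1 \<or> \<sigma> = -1" "\<And>t. t \<ge> 0 \<Longrightarrow> flow_defined X (of_real \<sigma>) t (q 0)"
    by (metis of_real_1 of_real_minus)
  interpret gap X A q \<sigma> \<eta> \<delta>
    by unfold_locales (use nd inv \<sigma> \<eta> \<delta> qdev q0 qA in auto)
  show False by (rule contradiction)
qed

end

section \<open>A dense set of return times\<close>

context riemann_form begin

lemma flow_add:
  assumes "flow_defined X v s p" "flow_defined X v u (flow X v s p)" "v \<noteq> 0"
  shows "flow_defined X v (s + u) p" "flow X v (s + u) p = flow X v u (flow X v s p)"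
proof -
  have p: "p \<in> regular_points X" using flow_defined_topspace assms by blast
  note z = flow_zero[OF p assms(3)]
  have b: "flow_defined X v (- s) (flow X v s p)" "flow X v (- s) (flow X v s p) = p"
    using flow_between[OF assms(1) conjunct1[OF z] assms(3)] z by auto
  show "flow_defined X v (s + u) p" "flow X v (s + u) p = flow X v u (flow X v s p)"
    using flow_between[OF b(1) assms(2,3)] b(2) by (simp_all add: add.commute)
qed

lemma hflow_saturation_open:
  assumes W: "openin (surf X) W"
  shows "openin (surf X) {z. \<exists>t. hflow_defined X t z \<and> hflow X t z \<in> W}"
proof (subst openin_subopen, safe)
  fix z t assume z: "hflow_defined X t z" "hflow X t z \<in> W"
  obtain e h where e: "e > 0" and h: "dev X (nbhd (closed_segment 0 (of_real t * 1)) e) h" and h0: "h 0 = z"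
    using flow_defined_extend[OF z(1)] by auto
  let ?N = "nbhd (closed_segment 0 (of_real t * 1)) e"
  have N: "convex ?N" by (simp add: convex_nbhd)
  have fl: "hflow_defined X t (h w) \<and> hflow X t (h w) = h (w + of_real t)" if "w \<in> ball 0 e" for w
    using flow_dev[OF h dev_segment_subset[OF N], of w t 1] ball_segment_nbhd[OF that, of "of_real t"] by auto
  have "dev X (ball 0 e) (\<lambda>w. h (w + of_real t))"
    by (rule dev_shift[OF h]) (use ball_segment_nbhd(2)[of _ e "of_real t"] in auto)
  then have "continuous_map (top_of_set (ball 0 e)) (surf X) (\<lambda>w. h (w + of_real t))" unfolding dev_def by blast
  moreover have "h (0 + of_real t) \<in> W" using fl[of 0] e h0 z(2) by simp
  ultimately obtain d where d: "d > 0" "\<forall>w\<in>ball 0 e. dist w 0 < d \<longrightarrow> h (w + of_real t) \<in> W"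
    using top_of_set_preimage_eventually[of "ball 0 e" "\<lambda>w. h (w + of_real t)" W 0] W e by auto
  let ?B = "ball (0::complex) (min d e)"
  have "dev X ?B h" by (rule dev_subset[OF h]) (use ball_segment_nbhd(1)[of _ e "of_real t"] in auto)
  then have "openin (surf X) (h ` ?B)" by (rule dev_open_image) simp
  moreover have "z \<in> h ` ?B" using d e h0 by (intro image_eqI[of _ _ 0]) auto
  moreover have "h ` ?B \<subseteq> {z. \<exists>t. hflow_defined X t z \<and> hflow X t z \<in> W}" using fl d by fastforce
  ultimately show "\<exists>T. openin (surf X) T \<and> z \<in> T \<and> T \<subseteq> {z. \<exists>t. hflow_defined X t z \<and> hflow X t z \<in> W}" by blast
qed

end

context finite_zeros_form begin

text \<open>If the infinite half-leaf runs in the wrong direction, the far end of its arc of length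
  |\<tau>| has an arc of the required sign.\<close>

lemma vertical_arc_exists:
  assumes nd: "\<And>l. \<not> degenerate \<i> l" and ne: "regular_points X \<noteq> {}"
  obtains x where "vflow_defined X \<tau> x"
proof -
  obtain p where p: "p \<in> regular_points X" using ne by blast
  have i: "\<i> \<noteq> 0" by simp
  have reverse: "\<exists>x. vflow_defined X (- t) x" if "vflow_defined X t p" for t
    using flow_between(1)[OF that conjunct1[OF flow_zero[OF p i]] i] by (metis diff_0)
  have "(\<forall>t\<ge>0. vflow_defined X t p) \<or> (\<forall>t\<ge>0. flow_defined X (- \<i>) t p)"
    by (rule infinite_half_leaf[OF p i nd])
  then have "vflow_defined X \<bar>\<tau>\<bar> p \<or> vflow_defined X (- \<bar>\<tau>\<bar>) p"
    using flow_uminus(1)[of "- \<i>" "\<bar>\<tau>\<bar>" p] by auto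
  then have "\<exists>x. vflow_defined X \<tau> x" using reverse[of "\<bar>\<tau>\<bar>"] reverse[of "- \<bar>\<tau>\<bar>"] by (cases "\<tau> \<ge> 0") auto
  then show ?thesis using that by blast
qed

lemma dense_return_times:
  assumes nd: "\<And>l. \<not> degenerate 1 l" "\<And>l. \<not> degenerate \<i> l" and ne: "regular_points X \<noteq> {}"
  shows "\<exists>T :: real set. closure T = UNIV \<and> (\<forall>\<tau>\<in>T. \<exists>W. openin (surf X) W \<and> W \<noteq> {} \<and>
    (\<forall>\<Phi>\<in>cocycles_plus X. \<exists>c. \<forall>y\<in>W. \<Phi> y \<tau> = c))"
proof -
  \<comment> \<open>Vertical arcs of length \<tau> whose end points are joined by a horizontal arc;
    the sign of s is free.\<close>
  define T where "T = {\<tau>. \<exists>g k s. dev X (closed_segment 0 (of_real \<tau> * \<i>)) g \<and> dev X (closed_segment 0 (of_real s)) k \<and>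
     g 0 = k 0 \<and> g (of_real \<tau> * \<i>) = k (of_real s)}"
  have const: "\<exists>W. openin (surf X) W \<and> W \<noteq> {} \<and> (\<forall>\<Phi>\<in>cocycles_plus X. \<exists>c. \<forall>y\<in>W. \<Phi> y \<tau> = c)" if \<tau>: "\<tau> \<in> T" for \<tau>
  proof -
    obtain g k s where gk: "dev X (closed_segment 0 (of_real \<tau> * \<i>)) g" "dev X (closed_segment 0 (of_real s)) k"
      "g 0 = k 0" "g (of_real \<tau> * \<i>) = k (of_real s)" using \<tau> unfolding T_def by blast
    obtain W where "openin (surf X) W" "W \<noteq> {}"
      "\<And>\<Phi>. \<Phi> \<in> cocycles_plus X \<Longrightarrow> \<exists>c. \<forall>y\<in>W. \<Phi> y \<tau> = c"
      using cocycle_constant[OF gk] by blast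
    then show ?thesis by blast
  qed
  have "\<tau>0 \<in> closure T" for \<tau>0
    unfolding closure_approachable
  proof (intro allI impI)
    fix \<epsilon> :: real assume \<epsilon>: "\<epsilon> > 0"
    obtain x where x: "vflow_defined X \<tau>0 x" using vertical_arc_exists[OF nd(2) ne] .
    obtain e g where e: "e > 0" and g: "dev X (nbhd (closed_segment 0 (of_real \<tau>0 * \<i>)) e) g" and g0: "g 0 = x"
      using flow_defined_extend[OF x] by auto
    let ?N = "nbhd (closed_segment 0 (of_real \<tau>0 * \<i>)) e" and ?e = "min e \<epsilon>"
    have N: "convex ?N" by (simp add: convex_nbhd)
    have BN: "ball (of_real \<tau>0 * \<i>) ?e \<subseteq> ?N" unfolding nbhd_def by force
    let ?W = "g ` ball (of_real \<tau>0 * \<i>) ?e"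
    have W: "openin (surf X) ?W" by (rule dev_open_image[OF dev_subset[OF g BN]]) simp
    let ?A = "{z. \<exists>t. hflow_defined X t z \<and> hflow X t z \<in> ?W}"
    have "?A = regular_points X"
    proof (rule horizontally_minimal[OF nd(1) hflow_saturation_open[OF W]])
      show "?A \<subseteq> regular_points X" using flow_defined_topspace[of 1] by auto
      have gr: "g (of_real \<tau>0 * \<i>) \<in> regular_points X"
        by (rule dev_regular[OF g subsetD[OF BN]]) (use e \<epsilon> in simp)
      then have "g (of_real \<tau>0 * \<i>) \<in> ?A" using flow_zero[OF gr, of 1] e \<epsilon> by (auto intro!: exI[of _ 0])
      then show "?A \<noteq> {}" by blast
      fix z u assume "z \<in> ?A" and u: "hflow_defined X u z"
      then obtain t where "hflow_defined X t z" "hflow X t z \<in> ?W" by blast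
      then show "hflow X u z \<in> ?A" using flow_between[OF u] by fastforce
    qed
    then have "x \<in> ?A" using flow_defined_topspace[OF x] by auto
    then obtain t w where t: "hflow_defined X t x" "hflow X t x = g w" and w: "w \<in> ball (of_real \<tau>0 * \<i>) ?e" by blast
    \<comment> \<open>The horizontal leaf hits the thickened vertical arc at w; sliding by - Re w to
      the axis turns the near return into an exact one, at the time Im w.\<close>
    let ?\<tau> = "Im w"
    have ww: "w + of_real (- Re w) * 1 = of_real ?\<tau> * \<i>" by (simp add: complex_eq_iff)
    have close: "cmod (of_real ?\<tau> * \<i> - of_real \<tau>0 * \<i>) < ?e" "\<bar>?\<tau> - \<tau>0\<bar> < \<epsilon>"
    proof -
      have "cmod (of_real ?\<tau> * \<i> - of_real \<tau>0 * \<i>) = \<bar>?\<tau> - \<tau>0\<bar>"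
        by (simp add: norm_mult flip: left_diff_distrib of_real_diff)
      moreover have "\<bar>?\<tau> - \<tau>0\<bar> < ?e" using w abs_Im_le_cmod[of "w - of_real \<tau>0 * \<i>"] by (simp add: dist_norm norm_minus_commute)
      ultimately show "cmod (of_real ?\<tau> * \<i> - of_real \<tau>0 * \<i>) < ?e" "\<bar>?\<tau> - \<tau>0\<bar> < \<epsilon>" by auto
    qed
    have \<tau>N: "of_real ?\<tau> * \<i> \<in> ?N" using BN close(1) by (auto simp: dist_norm norm_minus_commute)
    have 0: "0 \<in> ?N" using subset_nbhd[OF e] by auto
    have "hflow_defined X (- Re w) (g w)" "hflow X (- Re w) (g w) = g (of_real ?\<tau> * \<i>)"
      using flow_dev[OF g dev_segment_subset[OF N], of w "- Re w" 1] BN w \<tau>N unfolding ww by auto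
    then have h: "hflow_defined X (t + - Re w) x" "hflow X (t + - Re w) x = g (of_real ?\<tau> * \<i>)"
      using flow_add[OF t(1), of "- Re w"] t(2) by auto
    obtain k where k: "dev X (closed_segment 0 (of_real (t + - Re w) * 1)) k" "k 0 = x"
      using flow_defined_dev[OF h(1)] by auto
    have "k (of_real (t + - Re w)) = g (of_real ?\<tau> * \<i>)"
      using flow_dev(2)[OF k(1), of 0 "t + - Re w" 1] k(2) h(2) by simp
    moreover have "dev X (closed_segment 0 (of_real ?\<tau> * \<i>)) g"
      by (rule dev_subset[OF g closed_segment_subset[OF 0 \<tau>N N]])
    ultimately have "?\<tau> \<in> T" unfolding T_def using k g0 by (intro CollectI exI[of _ g] exI[of _ k] exI[of _ "t + - Re w"]) auto
    then show "\<exists>y\<in>T. dist y \<tau>0 < \<epsilon>" using close(2) by (auto simp: dist_real_def)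
  qed
  then have "closure T = UNIV" by blast
  with const show ?thesis by blast
qed

end

section \<open>Holomorphic change of variables\<close>

text \<open>Jacobian determinants are taken over real ^ 2, so planar integrals are transported along
  this isomorphism.\<close>

definition plane :: "real ^ 2 \<Rightarrow> complex" where
  "plane x = Complex (x $ 1) (x $ 2)"

definition plane_inv :: "complex \<Rightarrow> real ^ 2" where
  "plane_inv z = vector [Re z, Im z]"

lemma plane_inverse [simp]: "plane (plane_inv z) = z" "plane_inv (plane x) = x"
  unfolding plane_def plane_inv_def by (auto simp: complex_eq_iff vec_eq_iff forall_2)

lemma linear_plane: "linear plane" "linear plane_inv"
  unfolding plane_def plane_inv_def
  by (auto intro!: linearI simp: complex_eq_iff vec_eq_iff forall_2)

lemma bounded_linear_plane: "bounded_linear plane" "bounded_linear plane_inv"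
  using linear_plane linear_conv_bounded_linear by auto

lemma measurable_plane [measurable]: "plane \<in> borel_measurable borel"
  by (intro borel_measurable_continuous_onI bounded_linear.continuous_on[OF bounded_linear_plane(1)] continuous_intros)

lemma lborel_plane: "distr lborel borel plane = lborel"
proof (rule lborel_eqI[symmetric])
  fix l u :: complex assume le: "\<And>b. b \<in> Basis \<Longrightarrow> l \<bullet> b \<le> u \<bullet> b"
  have lu: "Re l \<le> Re u" "Im l \<le> Im u" using le[of 1] le[of \<i>] by (auto simp: Basis_complex_def)
  have "plane -` box l u \<inter> space lborel = box (plane_inv l) (plane_inv u)"
    by (auto simp: plane_def plane_inv_def in_box_complex_iff mem_box_cart forall_2)
  then have "emeasure (distr lborel borel plane) (box l u) = emeasure lborel (box (plane_inv l) (plane_inv u))"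
    by (subst emeasure_distr) auto
  also have "\<dots> = (\<Prod>b\<in>Basis. (plane_inv u - plane_inv l) \<bullet> b)"
    by (rule emeasure_lborel_box) (use lu in \<open>auto simp: Basis_vec_def inner_axis plane_inv_def forall_2 vector_def\<close>)
  also have "(\<Prod>b\<in>Basis. (plane_inv u - plane_inv l) \<bullet> b) = (\<Prod>b\<in>Basis. (u - l) \<bullet> b)"
  proof -
    have "(\<Prod>b\<in>Basis. (plane_inv u - plane_inv l) \<bullet> b) = (\<Prod>i\<in>UNIV. (plane_inv u - plane_inv l) $ i)"
    proof -
      have B: "(Basis :: (real^2) set) = range (\<lambda>i. axis i 1)" by (auto simp: Basis_vec_def)
      show ?thesis unfolding B
        by (subst prod.reindex) (auto simp: inj_on_def axis_eq_axis inner_axis)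
    qed
    also have "\<dots> = (Re u - Re l) * (Im u - Im l)" by (simp add: UNIV_2 plane_inv_def)
    also have "\<dots> = (\<Prod>b\<in>Basis. (u - l) \<bullet> b)" by (simp add: Basis_complex_def)
    finally show ?thesis .
  qed
  finally show "emeasure (distr lborel borel plane) (box l u) = (\<Prod>b\<in>Basis. (u - l) \<bullet> b)" by simp
qed simp

text \<open>The image is the preimage of A under the holomorphic inverse, which is defined on the
  open image of S.\<close>

lemma injective_holomorphic_borel_image:
  assumes f: "f holomorphic_on S" "open S" "inj_on f S" and A: "A \<in> sets borel" "A \<subseteq> S"
  shows "f ` A \<in> sets borel"
proof -
  obtain g where g: "g holomorphic_on f ` S" "\<And>z. z \<in> S \<Longrightarrow> g (f z) = z"
    using holomorphic_has_inverse[OF f] by metis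
  have o: "open (f ` S)" using open_mapping_thm3[OF f] .
  have "g \<in> borel_measurable (restrict_space borel (f ` S))"
    by (rule borel_measurable_continuous_on_restrict[OF holomorphic_on_imp_continuous_on[OF g(1)]])
  then have "g -` A \<inter> space (restrict_space borel (f ` S)) \<in> sets (restrict_space borel (f ` S))"
    using A(1) by (rule measurable_sets)
  moreover have "g -` A \<inter> space (restrict_space borel (f ` S)) = f ` A"
    using A(2) g(2) by (auto simp: space_restrict_space)
  ultimately show ?thesis using o by (auto simp: sets_restrict_space)
qed

text \<open>Multiplication by a complex number a has real determinant |a|^2, so this is the change
  of variables formula with Jacobian |f'|^2.\<close>

lemma emeasure_holomorphic_image:
  assumes f: "f holomorphic_on S" "open S" "inj_on f S" and A: "A \<in> sets borel" "A \<subseteq> S"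
  shows "emeasure lborel (f ` A) = (\<integral>\<^sup>+z. ennreal ((cmod (deriv f z))\<^sup>2) * indicator A z \<partial>lborel)"
proof -
  let ?g = "plane_inv \<circ> f \<circ> plane"
  let ?g' = "\<lambda>x. plane_inv \<circ> (\<lambda>h. deriv f (plane x) * h) \<circ> plane"
  let ?B = "plane -` A"
  let ?D = "\<lambda>x. \<bar>det (matrix (?g' x))\<bar>"
  have B: "?B \<in> sets borel" using measurable_sets[OF measurable_plane A(1)] by simp
  have der: "(?g has_derivative ?g' x) (at x within ?B)" if x: "x \<in> ?B" for x
  proof -
    have "(f has_field_derivative deriv f (plane x)) (at (plane x))"
      using holomorphic_derivI[OF f(1,2)] x A(2) by blast
    then have 1: "(f has_derivative (\<lambda>h. deriv f (plane x) * h)) (at (plane x))"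
      unfolding has_field_derivative_def .
    have "(plane has_derivative plane) (at x)" by (rule bounded_linear_imp_has_derivative[OF bounded_linear_plane(1)])
    from diff_chain_at[OF this 1] have 2: "(f \<circ> plane has_derivative (\<lambda>h. deriv f (plane x) * h) \<circ> plane) (at x)" .
    have "(plane_inv has_derivative plane_inv) (at ((f \<circ> plane) x))"
      by (rule bounded_linear_imp_has_derivative[OF bounded_linear_plane(2)])
    from diff_chain_at[OF 2 this] have "(?g has_derivative ?g' x) (at x)" by (simp only: o_assoc)
    then show ?thesis by (rule has_derivative_at_withinI)
  qed
  have inj: "inj_on ?g ?B"
  proof (rule inj_onI)
    fix x y assume xy: "x \<in> ?B" "y \<in> ?B" "?g x = ?g y"
    then have "f (plane x) = f (plane y)" by (metis comp_apply plane_inverse(1))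
    then have "plane x = plane y" using xy f(3) A(2) by (meson inj_onD subsetD vimageE)
    then show "x = y" by (metis plane_inverse(2))
  qed
  have det: "?D x = (cmod (deriv f (plane x)))\<^sup>2" for x
  proof -
    have "det (matrix (?g' x)) = (Re (deriv f (plane x)))\<^sup>2 + (Im (deriv f (plane x)))\<^sup>2"
      by (simp add: det_2 matrix_def plane_def plane_inv_def axis_def power2_eq_square)
    then show ?thesis by (simp add: cmod_power2)
  qed
  have img: "?g ` ?B = plane -` (f ` A)"
  proof
    show "?g ` ?B \<subseteq> plane -` (f ` A)" by auto
    show "plane -` (f ` A) \<subseteq> ?g ` ?B"
    proof
      fix x assume "x \<in> plane -` (f ` A)"
      then obtain z where z: "plane x = f z" "z \<in> A" by blast
      have "x = plane_inv (f z)" by (metis plane_inverse(2) z(1))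
      then show "x \<in> ?g ` ?B" using z(2) by (intro image_eqI[of _ _ "plane_inv z"]) auto
    qed
  qed
  have fA: "f ` A \<in> sets borel" by (rule injective_holomorphic_borel_image[OF f A])
  have e1: "emeasure lborel (f ` A) = emeasure lebesgue (?g ` ?B)"
  proof -
    have "emeasure lborel (f ` A) = emeasure (distr lborel borel plane) (f ` A)" by (simp add: lborel_plane)
    also have "\<dots> = emeasure lborel (?g ` ?B)" using fA unfolding img by (subst emeasure_distr) auto
    finally show ?thesis using measurable_sets[OF measurable_plane fA] unfolding img by simp
  qed
  let ?h = "\<lambda>z. (cmod (deriv f z))\<^sup>2 * indicat_real A z"
  have "continuous_on S (deriv f)" using holomorphic_deriv[OF f(1,2)] holomorphic_on_imp_continuous_on by blast
  then have "deriv f \<in> borel_measurable (restrict_space borel S)" by (rule borel_measurable_continuous_on_restrict)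
  then have "deriv f \<in> borel_measurable (restrict_space borel A)"
    by (rule measurable_restrict_mono) (use A in auto)
  then have mA: "(\<lambda>z. (cmod (deriv f z))\<^sup>2) \<in> borel_measurable (restrict_space borel A)" by measurable
  have h[measurable]: "?h \<in> borel_measurable borel"
    using mA A(1) by (subst (asm) borel_measurable_restrict_space_iff) (auto simp: mult.commute)
  have e2: "(\<integral>\<^sup>+z. ennreal ((cmod (deriv f z))\<^sup>2) * indicator A z \<partial>lborel) = (\<integral>\<^sup>+x. ennreal (?h (plane x)) \<partial>lborel)"
  proof -
    have "(\<integral>\<^sup>+z. ennreal ((cmod (deriv f z))\<^sup>2) * indicator A z \<partial>lborel) = (\<integral>\<^sup>+z. ennreal (?h z) \<partial>lborel)"
      by (intro nn_integral_cong) (auto simp: indicator_def)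
    also have "\<dots> = (\<integral>\<^sup>+z. ennreal (?h z) \<partial>distr lborel borel plane)" by (simp add: lborel_plane)
    also have "\<dots> = (\<integral>\<^sup>+x. ennreal (?h (plane x)) \<partial>lborel)" by (intro nn_integral_distr) auto
    finally show ?thesis .
  qed
  let ?H = "\<lambda>x. ?h (plane x)"
  have Hm: "?H \<in> borel_measurable lborel" by measurable
  have Hm': "?H \<in> borel_measurable lebesgue" using Hm by (rule measurable_completion)
  have HD: "(?D has_integral m) ?B \<longleftrightarrow> (?H has_integral m) UNIV" for m
  proof -
    have "(?D has_integral m) ?B \<longleftrightarrow> ((\<lambda>x. if x \<in> ?B then ?D x else 0) has_integral m) UNIV"
      by (rule has_integral_restrict_UNIV[symmetric])
    also have "(\<lambda>x. if x \<in> ?B then ?D x else 0) = ?H" using det by (auto simp: indicator_def)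
    finally show ?thesis .
  qed
  have main: "?g ` ?B \<in> lmeasurable \<and> measure lebesgue (?g ` ?B) = m \<longleftrightarrow> (?H has_integral m) UNIV" for m
    using has_measure_differentiable_image[of ?B ?g ?g' m] der inj B HD by auto
  have nnH: "(?H has_integral m) UNIV \<longleftrightarrow> (0 \<le> m \<and> (\<integral>\<^sup>+x. ennreal (?H x) \<partial>lebesgue) = ennreal m)" for m
    using has_integral_iff_nn_integral_lebesgue[of ?H m] Hm' by auto
  have e3: "(\<integral>\<^sup>+x. ennreal (?H x) \<partial>lborel) = (\<integral>\<^sup>+x. ennreal (?H x) \<partial>lebesgue)"
    by (rule nn_integral_completion[symmetric])
  \<comment> \<open>\<open>main\<close> speaks of finite measure, so an infinite integral is handled
    by contraposition.\<close>
  show ?thesis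
  proof (cases "(\<integral>\<^sup>+x. ennreal (?H x) \<partial>lebesgue) = \<infinity>")
    case False
    then obtain m where m: "m \<ge> 0" "(\<integral>\<^sup>+x. ennreal (?H x) \<partial>lebesgue) = ennreal m"
      by (cases "\<integral>\<^sup>+x. ennreal (?H x) \<partial>lebesgue") auto
    then have "?g ` ?B \<in> lmeasurable" "measure lebesgue (?g ` ?B) = m" using main nnH by auto
    then have "emeasure lebesgue (?g ` ?B) = ennreal m" by (metis emeasure_eq_measure2)
    then show ?thesis using e1 e2 e3 m by simp
  next
    case True
    have "?g ` ?B \<notin> lmeasurable"
    proof
      assume "?g ` ?B \<in> lmeasurable"
      then have "(?H has_integral measure lebesgue (?g ` ?B)) UNIV" using main by blast
      then show False using nnH True by simp
    qed
    moreover have "?g ` ?B \<in> sets lebesgue" unfolding img using measurable_sets[OF measurable_plane fA] by simp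
    ultimately have "emeasure lebesgue (?g ` ?B) = \<infinity>"
      by (metis fmeasurableI infinity_ennreal_def top.not_eq_extremum)
    then show ?thesis using e1 e2 e3 True by simp
  qed
qed

text \<open>By \<open>emeasure_holomorphic_image\<close>, f pushes the density |f'|^2 on A forward
  to Lebesgue measure on the image. Integrating \<phi> against both measures gives the
  formula.\<close>

lemma nn_integral_holomorphic_image:
  assumes f: "f holomorphic_on S" "open S" "inj_on f S" and A: "A \<in> sets borel" "A \<subseteq> S"
    and \<phi>: "\<phi> \<in> borel_measurable borel"
  shows "(\<integral>\<^sup>+w. \<phi> w * indicator (f ` A) w \<partial>lborel) =
    (\<integral>\<^sup>+z. \<phi> (f z) * ennreal ((cmod (deriv f z))\<^sup>2) * indicator A z \<partial>lborel)"
proof -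
  let ?D = "\<lambda>z. ennreal ((cmod (deriv f z))\<^sup>2) * indicator A z"
  \<comment> \<open>Off A the density vanishes, so the value 0 is harmless there and gives a
    globally Borel function.\<close>
  let ?f = "\<lambda>z. if z \<in> A then f z else 0"
  have "continuous_on S (deriv f)" "continuous_on S f"
    using f holomorphic_deriv holomorphic_on_imp_continuous_on by blast+
  then have c: "continuous_on A (deriv f)" "continuous_on A f" using continuous_on_subset A(2) by blast+
  have D[measurable]: "?D \<in> borel_measurable borel"
  proof -
    have "deriv f \<in> borel_measurable (restrict_space borel A)" by (rule borel_measurable_continuous_on_restrict[OF c(1)])
    then have "(\<lambda>z. ennreal ((cmod (deriv f z))\<^sup>2)) \<in> borel_measurable (restrict_space borel A)" by measurable
    then show ?thesis using A(1) by (subst (asm) borel_measurable_restrict_space_iff_ennreal) auto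
  qed
  have fm[measurable]: "?f \<in> borel_measurable borel"
  proof -
    have "f \<in> borel_measurable (restrict_space borel A)" by (rule borel_measurable_continuous_on_restrict[OF c(2)])
    then have "(\<lambda>z. indicat_real A z *\<^sub>R f z) \<in> borel_measurable borel"
      using A(1) by (subst (asm) borel_measurable_restrict_space_iff) auto
    moreover have "(\<lambda>z. indicat_real A z *\<^sub>R f z) = ?f" by (auto simp: indicator_def)
    ultimately show ?thesis by simp
  qed
  have fA: "f ` A \<in> sets borel" by (rule injective_holomorphic_borel_image[OF f A])
  have "distr (density lborel ?D) borel ?f = density lborel (indicator (f ` A))"
  proof (rule measure_eqI)
    fix C :: "complex set" assume "C \<in> sets (distr (density lborel ?D) borel ?f)"
    then have C: "C \<in> sets borel" by simp
    let ?B = "A \<inter> ?f -` C"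
    have B: "?B \<in> sets borel" "?B \<subseteq> S" using A measurable_sets[OF fm C] by auto
    have "emeasure (distr (density lborel ?D) borel ?f) C = (\<integral>\<^sup>+z. ?D z * indicator (?f -` C) z \<partial>lborel)"
      using C measurable_sets[OF fm C] by (subst emeasure_distr) (auto simp: emeasure_density)
    also have "\<dots> = (\<integral>\<^sup>+z. ennreal ((cmod (deriv f z))\<^sup>2) * indicator ?B z \<partial>lborel)"
      by (intro nn_integral_cong) (auto simp: indicator_def)
    also have "\<dots> = emeasure lborel (f ` ?B)" by (rule emeasure_holomorphic_image[OF f B, symmetric])
    also have "f ` ?B = f ` A \<inter> C" by auto
    also have "emeasure lborel (f ` A \<inter> C) = emeasure (density lborel (indicator (f ` A))) C"
      using fA C by (subst emeasure_density) (auto simp: indicator_inter_arith[symmetric])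
    finally show "emeasure (distr (density lborel ?D) borel ?f) C = emeasure (density lborel (indicator (f ` A))) C" .
  qed simp
  then have "(\<integral>\<^sup>+w. \<phi> w \<partial>density lborel (indicator (f ` A))) = (\<integral>\<^sup>+w. \<phi> w \<partial>distr (density lborel ?D) borel ?f)" by simp
  also have "\<dots> = (\<integral>\<^sup>+z. ?D z * \<phi> (?f z) \<partial>lborel)"
    using \<phi> by (subst nn_integral_distr) (auto simp: nn_integral_density)
  also have "\<dots> = (\<integral>\<^sup>+z. \<phi> (f z) * ennreal ((cmod (deriv f z))\<^sup>2) * indicator A z \<partial>lborel)"
    by (intro nn_integral_cong) (auto simp: indicator_def mult.commute)
  also have "(\<integral>\<^sup>+w. \<phi> w \<partial>density lborel (indicator (f ` A))) = (\<integral>\<^sup>+w. \<phi> w * indicator (f ` A) w \<partial>lborel)"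
    using \<phi> fA by (subst nn_integral_density) (auto simp: mult.commute)
  finally show ?thesis .
qed

section \<open>The area measure\<close>

context riemann_form begin

definition borel_surf :: "'a measure" where
  "borel_surf = sigma (topspace (surf X)) {U. openin (surf X) U}"

lemma borel_surf: "space borel_surf = topspace (surf X)" "sets borel_surf = sigma_sets (topspace (surf X)) {U. openin (surf X) U}"
  unfolding borel_surf_def using openin_subset by (auto intro!: space_measure_of sets_measure_of)

lemma open_borel_surf: "openin (surf X) U \<Longrightarrow> U \<in> sets borel_surf"
  using borel_surf(2) by auto

lemma param_measurable:
  assumes c: "c \<in> charts X" shows "param c \<in> measurable (restrict_space borel (coord c ` dom_of c)) borel_surf"
  unfolding borel_surf_def
proof (rule measurable_measure_of)
  show "{U. openin (surf X) U} \<subseteq> Pow (topspace (surf X))" using openin_subset by auto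
  show "param c \<in> space (restrict_space borel (coord c ` dom_of c)) \<rightarrow> topspace (surf X)"
    using subsetD[OF openin_subset[OF chart_openin[OF c]] param_in] by (auto simp: space_restrict_space simp del: coord_param)
  fix U assume "U \<in> {U. openin (surf X) U}"
  then have U: "openin (surf X) U" by simp
  have "param c -` U \<inter> space (restrict_space borel (coord c ` dom_of c)) = coord c ` (U \<inter> dom_of c)"
    using c by (auto simp: space_restrict_space)
  moreover have "open (coord c ` (U \<inter> dom_of c))" by (rule coord_open_map[OF c openin_Int[OF U chart_openin[OF c]]]) simp
  ultimately show "param c -` U \<inter> space (restrict_space borel (coord c ` dom_of c)) \<in> sets (restrict_space borel (coord c ` dom_of c))"
    using chart_open_image[OF c] by (auto simp: sets_restrict_space_iff)
qed

lemma coord_borel: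
  assumes c: "c \<in> charts X" and A: "A \<in> sets borel_surf" "A \<subseteq> dom_of c"
  shows "coord c ` A \<in> sets borel"
proof -
  have "param c -` A \<inter> space (restrict_space borel (coord c ` dom_of c)) = coord c ` A"
  proof
    show "coord c ` A \<subseteq> param c -` A \<inter> space (restrict_space borel (coord c ` dom_of c))"
      using c A(2) by (auto simp: space_restrict_space)
    show "param c -` A \<inter> space (restrict_space borel (coord c ` dom_of c)) \<subseteq> coord c ` A"
    proof
      fix z assume "z \<in> param c -` A \<inter> space (restrict_space borel (coord c ` dom_of c))"
      then have "param c z \<in> A" "z \<in> coord c ` dom_of c" by (auto simp: space_restrict_space)
      then show "z \<in> coord c ` A" using coord_param[of z c] by (metis imageI)
    qed
  qed
  then have "coord c ` A \<in> sets (restrict_space borel (coord c ` dom_of c))"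
    using measurable_sets[OF param_measurable[OF c] A(1)] by simp
  then show ?thesis using chart_open_image[OF c] by (auto simp: sets_restrict_space_iff)
qed

definition chart_area :: "'a chart \<Rightarrow> 'a set \<Rightarrow> ennreal" where
  "chart_area c A = (\<integral>\<^sup>+ z. ennreal ((cmod (coef X c z))\<^sup>2) * indicator (coord c ` A) z \<partial>lborel)"

lemma chart_density_measurable:
  assumes c: "c \<in> charts X"
  shows "(\<lambda>z. ennreal ((cmod (coef X c z))\<^sup>2) * indicator (coord c ` dom_of c) z) \<in> borel_measurable borel"
proof -
  have "continuous_on (coord c ` dom_of c) (coef X c)" by (rule holomorphic_on_imp_continuous_on[OF coef_holo[OF c]])
  then have "coef X c \<in> borel_measurable (restrict_space borel (coord c ` dom_of c))" by (rule borel_measurable_continuous_on_restrict)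
  then have "(\<lambda>z. ennreal ((cmod (coef X c z))\<^sup>2)) \<in> borel_measurable (restrict_space borel (coord c ` dom_of c))" by measurable
  then show ?thesis using chart_open_image[OF c] by (subst (asm) borel_measurable_restrict_space_iff_ennreal) auto
qed

lemma chart_area_alt:
  assumes "c \<in> charts X" "A \<subseteq> dom_of c"
  shows "chart_area c A = (\<integral>\<^sup>+ z. (ennreal ((cmod (coef X c z))\<^sup>2) * indicator (coord c ` dom_of c) z) * indicator (coord c ` A) z \<partial>lborel)"
  unfolding chart_area_def using assms by (intro nn_integral_cong) (auto simp: indicator_def)

text \<open>The coefficients differ by the derivative of the transition map, and the square of its
  modulus is the Jacobian.\<close>

lemma chart_area_transition:
  assumes c: "c \<in> charts X" and d: "d \<in> charts X" and A: "A \<in> sets borel_surf" "A \<subseteq> dom_of c" "A \<subseteq> dom_of d"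
  shows "chart_area c A = chart_area d A"
proof -
  let ?h = "coord d \<circ> param c" and ?S = "coord c ` (dom_of c \<inter> dom_of d)"
  have inj: "inj_on ?h ?S"
  proof (rule inj_onI)
    fix x y assume "x \<in> ?S" "y \<in> ?S" and e: "?h x = ?h y"
    then obtain p q where p: "p \<in> dom_of c" "p \<in> dom_of d" "x = coord c p" and q: "q \<in> dom_of c" "q \<in> dom_of d" "y = coord c q" by blast
    then have "coord d p = coord d q" using e c by simp
    then show "x = y" using inj_onD[OF chart_inj[OF d]] p q by metis
  qed
  have cA: "coord c ` A \<in> sets borel" "coord c ` A \<subseteq> ?S" using coord_borel[OF c A(1,2)] A by auto
  have hA: "?h ` coord c ` A = coord d ` A" using A(2) c by (force simp: image_iff)
  let ?\<phi> = "\<lambda>z. ennreal ((cmod (coef X d z))\<^sup>2) * indicator (coord d ` dom_of d) z"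
  have "chart_area d A = (\<integral>\<^sup>+ w. ?\<phi> w * indicator (?h ` coord c ` A) w \<partial>lborel)"
    unfolding hA by (rule chart_area_alt[OF d A(3)])
  also have "\<dots> = (\<integral>\<^sup>+ z. ?\<phi> (?h z) * ennreal ((cmod (deriv ?h z))\<^sup>2) * indicator (coord c ` A) z \<partial>lborel)"
    by (rule nn_integral_holomorphic_image[OF transition_holo[OF c d] overlap_open[OF c d] inj cA chart_density_measurable[OF d]])
  also have "\<dots> = chart_area c A"
    unfolding chart_area_def
  proof (rule nn_integral_cong)
    fix z
    show "?\<phi> (?h z) * ennreal ((cmod (deriv ?h z))\<^sup>2) * indicator (coord c ` A) z = ennreal ((cmod (coef X c z))\<^sup>2) * indicator (coord c ` A) z"
    proof (cases "z \<in> coord c ` A")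
      case True
      then obtain p where p: "p \<in> A" "z = coord c p" by blast
      then have pc: "p \<in> dom_of c" "p \<in> dom_of d" using A by auto
      have "coef X c z = coef X d (?h z) * deriv ?h z" using coef_transition[OF c d pc] p c pc by simp
      moreover have "?h z \<in> coord d ` dom_of d" using p pc c by simp
      ultimately show ?thesis by (simp add: norm_mult power_mult_distrib ennreal_mult)
    qed simp
  qed
  finally show ?thesis by simp
qed

lemma chart_area_countably_additive:
  assumes c: "c \<in> charts X" and A: "range A \<subseteq> sets borel_surf" "disjoint_family A" "\<And>i::nat. A i \<subseteq> dom_of c"
  shows "suminf (\<lambda>i. chart_area c (A i)) = chart_area c (\<Union>(range A))"
proof -
  let ?\<phi> = "\<lambda>z. ennreal ((cmod (coef X c z))\<^sup>2) * indicator (coord c ` dom_of c) z"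
  let ?M = "density lborel ?\<phi>"
  have e: "chart_area c B = emeasure ?M (coord c ` B)" if "B \<in> sets borel_surf" "B \<subseteq> dom_of c" for B
    using chart_area_alt[OF c that(2)] coord_borel[OF c that] chart_density_measurable[OF c] by (simp add: emeasure_density)
  have s: "range (\<lambda>i. coord c ` A i) \<subseteq> sets ?M" using coord_borel[OF c] A by auto
  have d: "disjoint_family (\<lambda>i. coord c ` A i)"
    using A(2,3) inj_on_image_Int[OF chart_inj[OF c]] unfolding disjoint_family_on_def by (metis image_empty)
  have "suminf (\<lambda>i. chart_area c (A i)) = suminf (\<lambda>i. emeasure ?M (coord c ` A i))"
    using e A by (intro suminf_cong) auto
  also have "\<dots> = emeasure ?M (\<Union>i. coord c ` A i)" by (rule suminf_emeasure[OF s d])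
  also have "(\<Union>i. coord c ` A i) = coord c ` (\<Union>(range A))" by auto
  also have "emeasure ?M \<dots> = chart_area c (\<Union>(range A))" by (rule e[symmetric]) (use A in auto)
  finally show ?thesis .
qed

text \<open>The condition under the definite description in \<open>area_measure\<close>, which has
  to be shown to have exactly one solution.\<close>

definition is_area :: "'a measure \<Rightarrow> bool" where
  "is_area \<nu> \<longleftrightarrow> space \<nu> = topspace (surf X) \<and>
     sets \<nu> = sigma_sets (topspace (surf X)) {U. openin (surf X) U} \<and>
     (\<forall>c\<in>charts X. \<forall>A\<in>sets \<nu>. A \<subseteq> dom_of c \<longrightarrow> emeasure \<nu> A = chart_area c A)"

lemma is_area_sets: "is_area \<nu> \<Longrightarrow> sets \<nu> = sets borel_surf"
  unfolding is_area_def borel_surf(2) by blast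

text \<open>A measure prescribed only inside charts is determined, and can be built, by cutting the
  surface into finitely many Borel pieces that each lie in a chart.\<close>

lemma chart_partition:
  obtains c :: "nat \<Rightarrow> 'a chart" and n D where "\<forall>i<n. c i \<in> charts X \<and> D i \<subseteq> dom_of (c i) \<and> D i \<in> sets borel_surf"
    "disjoint_family_on D {..<n}" "(\<Union>i<n. D i) = topspace (surf X)"
proof -
  have "\<forall>U\<in>dom_of ` charts X. openin (surf X) U" "topspace (surf X) \<subseteq> \<Union>(dom_of ` charts X)"
    using charts_cover chart_openin by auto
  then have "\<exists>\<G>. finite \<G> \<and> \<G> \<subseteq> dom_of ` charts X \<and> topspace (surf X) \<subseteq> \<Union>\<G>"
    using comp unfolding compact_space_alt by meson
  then obtain C where C: "finite C" "C \<subseteq> charts X" "topspace (surf X) \<subseteq> \<Union>(dom_of ` C)" by (metis finite_subset_image)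
  obtain cs where cs: "set cs = C" using finite_list[OF C(1)] by blast
  let ?c = "\<lambda>i. cs ! i" and ?n = "length cs"
  have inC: "?c i \<in> charts X" if "i < ?n" for i using that cs C(2) nth_mem by blast
  let ?D = "disjointed (\<lambda>i. dom_of (?c i))"
  have sub: "?D i \<subseteq> dom_of (?c i)" for i by (rule disjointed_subset)
  have "?D i \<in> sets borel_surf" if "i < ?n" for i
    unfolding disjointed_def using that inC by (intro sets.Diff sets.finite_UN) (auto intro!: open_borel_surf chart_openin)
  moreover have "disjoint_family_on ?D {..<?n}"
    using disjoint_family_disjointed[of "\<lambda>i. dom_of (?c i)"] by (auto simp: disjoint_family_on_def)
  moreover have "(\<Union>i<?n. ?D i) = topspace (surf X)"
  proof -
    have "(\<Union>i<?n. ?D i) = (\<Union>i<?n. dom_of (?c i))"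
      using finite_UN_disjointed_eq[of "\<lambda>i. dom_of (?c i)" ?n] by (simp add: atLeast0LessThan)
    also have "\<dots> = \<Union>(dom_of ` C)"
    proof -
      have "(\<lambda>i. cs ! i) ` {..<?n} = C" using cs by (auto simp: set_conv_nth)
      then show ?thesis by (metis image_image)
    qed
    also have "\<dots> = topspace (surf X)" using C openin_subset[OF chart_openin] by blast
    finally show ?thesis .
  qed
  ultimately show ?thesis using that[of ?n ?c ?D] inC sub by simp
qed

lemma is_area_unique:
  assumes "is_area \<mu>" "is_area \<nu>" shows "\<mu> = \<nu>"
proof (rule measure_eqI)
  show "sets \<mu> = sets \<nu>" using assms is_area_sets by metis
  fix A assume A: "A \<in> sets \<mu>"
  obtain c :: "nat \<Rightarrow> 'a chart" and n D
    where cD: "\<forall>i<n. c i \<in> charts X \<and> D i \<subseteq> dom_of (c i) \<and> D i \<in> sets borel_surf"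
      and disj: "disjoint_family_on D {..<n}" and cover: "(\<Union>i<n. D i) = topspace (surf X)"
    using chart_partition .
  then have c: "\<And>i. i < n \<Longrightarrow> c i \<in> charts X" "\<And>i. i < n \<Longrightarrow> D i \<subseteq> dom_of (c i)"
    and D: "\<And>i. i < n \<Longrightarrow> D i \<in> sets borel_surf" "disjoint_family_on D {..<n}" "(\<Union>i<n. D i) = topspace (surf X)"
    by auto
  have Ab: "A \<in> sets borel_surf" using A is_area_sets[OF assms(1)] by simp
  then have Asub: "A \<subseteq> topspace (surf X)" using sets.sets_into_space borel_surf(1) by blast
  have "emeasure \<xi> A = (\<Sum>i<n. chart_area (c i) (A \<inter> D i))" if \<xi>: "is_area \<xi>" for \<xi>
  proof -
    have s: "A \<inter> D i \<in> sets \<xi>" if "i < n" for i using Ab D(1)[OF that] is_area_sets[OF \<xi>] by auto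
    have "emeasure \<xi> A = emeasure \<xi> (\<Union>i<n. A \<inter> D i)" using Asub D(3) by (intro arg_cong[of _ _ "emeasure \<xi>"]) auto
    also have "\<dots> = (\<Sum>i<n. emeasure \<xi> (A \<inter> D i))"
      by (rule sum_emeasure[symmetric]) (use s D(2) in \<open>auto simp: disjoint_family_on_def\<close>)
    also have "\<dots> = (\<Sum>i<n. chart_area (c i) (A \<inter> D i))"
    proof (rule sum.cong[OF refl])
      fix i assume "i \<in> {..<n}"
      then have i: "i < n" by simp
      show "emeasure \<xi> (A \<inter> D i) = chart_area (c i) (A \<inter> D i)"
        using \<xi> c(1)[OF i] c(2)[OF i] s[OF i] unfolding is_area_def by (meson inf.coboundedI2)
    qed
    finally show ?thesis .
  qed
  then show "emeasure \<mu> A = emeasure \<nu> A" using assms by simp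
qed

text \<open>The areas of the pieces, each taken in its own chart, are added up. In any other chart
  the result is the prescribed one because areas agree on overlaps.\<close>

lemma is_area_exists: "\<exists>\<nu>. is_area \<nu>"
proof -
  obtain c :: "nat \<Rightarrow> 'a chart" and n D
    where cD: "\<forall>i<n. c i \<in> charts X \<and> D i \<subseteq> dom_of (c i) \<and> D i \<in> sets borel_surf"
      and disj: "disjoint_family_on D {..<n}" and cover: "(\<Union>i<n. D i) = topspace (surf X)"
    using chart_partition .
  then have c: "\<And>i. i < n \<Longrightarrow> c i \<in> charts X" "\<And>i. i < n \<Longrightarrow> D i \<subseteq> dom_of (c i)"
    and D: "\<And>i. i < n \<Longrightarrow> D i \<in> sets borel_surf" "disjoint_family_on D {..<n}" "(\<Union>i<n. D i) = topspace (surf X)"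
    by auto
  define m where "m A = (\<Sum>i<n. chart_area (c i) (A \<inter> D i))" for A
  define \<nu> where "\<nu> = measure_of (topspace (surf X)) {U. openin (surf X) U} m"
  have sub: "{U. openin (surf X) U} \<subseteq> Pow (topspace (surf X))" using openin_subset by auto
  have sp: "space \<nu> = topspace (surf X)" "sets \<nu> = sets borel_surf"
    unfolding \<nu>_def borel_surf_def using sub by (auto simp: space_measure_of sets_measure_of)
  have em: "emeasure \<nu> A = m A" if "A \<in> sets \<nu>" for A
  proof (rule emeasure_measure_of[OF \<nu>_def sub _ _ that])
    show "positive (sets \<nu>) m" unfolding positive_def m_def chart_area_def by simp
    show "countably_additive (sets \<nu>) m" unfolding countably_additive_def
    proof (intro allI impI)
      fix A :: "nat \<Rightarrow> 'a set" assume A: "range A \<subseteq> sets \<nu>" "disjoint_family A" "\<Union>(range A) \<in> sets \<nu>"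
      have "suminf (\<lambda>k. m (A k)) = (\<Sum>i<n. suminf (\<lambda>k. chart_area (c i) (A k \<inter> D i)))"
        unfolding m_def by (rule suminf_sum) simp
      also have "\<dots> = (\<Sum>i<n. chart_area (c i) ((\<Union>(range A)) \<inter> D i))"
      proof (rule sum.cong[OF refl])
        fix i assume "i \<in> {..<n}"
        then have i: "i < n" by simp
        have "suminf (\<lambda>k. chart_area (c i) (A k \<inter> D i)) = chart_area (c i) (\<Union>(range (\<lambda>k. A k \<inter> D i)))"
          by (rule chart_area_countably_additive[OF c(1)[OF i]])
            (use A sp D(1)[OF i] c(2)[OF i] in \<open>auto simp: disjoint_family_on_def\<close>)
        then show "suminf (\<lambda>k. chart_area (c i) (A k \<inter> D i)) = chart_area (c i) ((\<Union>(range A)) \<inter> D i)" by simp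
      qed
      finally show "suminf (\<lambda>k. m (A k)) = m (\<Union>(range A))" unfolding m_def .
    qed
  qed
  have "emeasure \<nu> A = chart_area d A" if d: "d \<in> charts X" and A: "A \<in> sets \<nu>" "A \<subseteq> dom_of d" for d A
  proof -
    have AD: "A \<inter> D i \<in> sets borel_surf" if "i < n" for i using A sp D(1)[OF that] by auto
    have "emeasure \<nu> A = (\<Sum>i<n. chart_area d (A \<inter> D i))"
      unfolding em[OF A(1)] m_def
    proof (rule sum.cong[OF refl])
      fix i assume "i \<in> {..<n}"
      then have i: "i < n" by simp
      show "chart_area (c i) (A \<inter> D i) = chart_area d (A \<inter> D i)"
        by (rule chart_area_transition[OF c(1)[OF i] d AD[OF i]]) (use c(2)[OF i] A in auto)
    qed
    \<comment> \<open>Padding with empty sets reduces finite to countable additivity.\<close>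
    also have "\<dots> = suminf (\<lambda>k. chart_area d (if k < n then A \<inter> D k else {}))"
      by (subst suminf_finite[of "{..<n}"]) (auto simp: chart_area_def)
    also have "\<dots> = chart_area d (\<Union>(range (\<lambda>k. if k < n then A \<inter> D k else {})))"
    proof (rule chart_area_countably_additive[OF d])
      show "disjoint_family (\<lambda>k. if k < n then A \<inter> D k else {})"
        unfolding disjoint_family_on_def
      proof (intro ballI impI)
        fix k l :: nat assume "k \<noteq> l"
        then show "(if k < n then A \<inter> D k else {}) \<inter> (if l < n then A \<inter> D l else {}) = {}"
          using disjoint_family_onD[OF D(2), of k l] by auto
      qed
    qed (use AD A in auto)
    also have "\<Union>(range (\<lambda>k. if k < n then A \<inter> D k else {})) = A"
    proof -
      have "A \<subseteq> topspace (surf X)" using A(1) sets.sets_into_space sp(1) by blast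
      then show ?thesis using D(3) by (auto split: if_splits)
    qed
    finally show ?thesis .
  qed
  then have "is_area \<nu>" unfolding is_area_def using sp borel_surf by auto
  then show ?thesis by blast
qed

lemma area_measure_is_area: "is_area (area_measure X)"
proof -
  have "\<exists>!\<nu>. is_area \<nu>" using is_area_exists is_area_unique by blast
  then have "is_area (THE \<nu>. is_area \<nu>)" by (rule theI')
  then show ?thesis unfolding area_measure_def is_area_def chart_area_def by simp
qed

lemmas area_measure_space = area_measure_is_area[unfolded is_area_def, THEN conjunct1]
lemmas area_measure_sets = area_measure_is_area[unfolded is_area_def, THEN conjunct2, THEN conjunct1]

text \<open>In a chart the density vanishes only at finitely many points, whereas a nonempty open
  subset of the plane is not a null set.\<close>

lemma area_open_pos:
  assumes W: "openin (surf X) W" "W \<noteq> {}" and fin: "finite (form_zeros X)"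
  shows "emeasure (area_measure X) W > 0"
proof -
  obtain p where p: "p \<in> W" using W by blast
  then obtain c where c: "c \<in> charts X" "p \<in> dom_of c" using chart_exists openin_subset[OF W(1)] by blast
  let ?A = "W \<inter> dom_of c"
  have Ao: "openin (surf X) ?A" using W chart_openin[OF c(1)] by blast
  have o: "open (coord c ` ?A)" by (rule coord_open_map[OF c(1) Ao]) simp
  have As: "?A \<in> sets (area_measure X)" using open_borel_surf[OF Ao] is_area_sets[OF area_measure_is_area] by simp
  let ?Z = "coord c ` (form_zeros X \<inter> dom_of c)"
  let ?\<phi> = "\<lambda>z. ennreal ((cmod (coef X c z))\<^sup>2) * indicator (coord c ` dom_of c) z"
  have "emeasure (area_measure X) ?A = chart_area c ?A" using area_measure_is_area c As unfolding is_area_def by blast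
  moreover have "chart_area c ?A \<noteq> 0"
  proof
    assume "chart_area c ?A = 0"
    then have "(\<integral>\<^sup>+ z. ?\<phi> z * indicator (coord c ` ?A) z \<partial>lborel) = 0" using chart_area_alt[OF c(1), of ?A] by simp
    then have "AE z in lborel. ?\<phi> z * indicator (coord c ` ?A) z = 0"
      using chart_density_measurable[OF c(1)] o by (subst (asm) nn_integral_0_iff_AE) auto
    moreover have "AE z in lborel. z \<notin> ?Z"
      using fin by (intro AE_not_in countable_imp_null_set_lborel countable_finite) auto
    ultimately have "AE z in lborel. z \<notin> coord c ` ?A"
    proof eventually_elim
      case (elim z)
      show ?case
      proof
        assume z: "z \<in> coord c ` ?A"
        then obtain q where q: "q \<in> ?A" "z = coord c q" by blast
        then have "coef X c z \<noteq> 0" using elim(2) form_zeros_iff[OF c(1), of q] by blast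
        then show False using elim(1) z q by (auto simp: indicator_def)
      qed
    qed
    then have "coord c ` ?A \<in> null_sets lborel" using o by (intro AE_iff_null_sets[THEN iffD2]) auto
    then have "emeasure lborel (coord c ` ?A) = 0" by auto
    moreover have "coord c ` ?A \<noteq> {}" using p c by blast
    ultimately show False using o open_not_negligible negligible_iff_null_sets null_sets_completionI by (metis \<open>coord c ` ?A \<in> null_sets lborel\<close>)
  qed
  ultimately have "emeasure (area_measure X) ?A > 0" by (simp add: zero_less_iff_neq_zero)
  also have "emeasure (area_measure X) ?A \<le> emeasure (area_measure X) W"
    using open_borel_surf[OF W(1)] is_area_sets[OF area_measure_is_area] by (intro emeasure_mono) auto
  finally show ?thesis .
qed

end

context finite_zeros_form begin

lemma dense_atoms:
  assumes nd: "\<And>l. \<not> degenerate 1 l" "\<And>l. \<not> degenerate \<i> l" and nz: "nonzero_form X"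
  shows "\<exists>T :: real set. closure T = UNIV \<and>
    (\<forall>\<tau>\<in>T. \<forall>\<Phi>\<in>cocycles_plus X. admits_atoms (normalized_distribution X \<Phi> \<tau>))"
proof -
  obtain c p where c: "c \<in> charts X" "p \<in> dom_of c" "coef X c (coord c p) \<noteq> 0"
    using nz unfolding nonzero_form_def by blast
  then have "p \<in> regular_points X"
    using form_zeros_iff[OF c(1,2)] openin_subset[OF chart_openin[OF c(1)]] unfolding regular_points_def by blast
  then have ne: "regular_points X \<noteq> {}" by blast
  obtain T :: "real set" where T: "closure T = UNIV" and W: "\<forall>\<tau>\<in>T. \<exists>W. openin (surf X) W \<and> W \<noteq> {} \<and>
    (\<forall>\<Phi>\<in>cocycles_plus X. \<exists>c. \<forall>y\<in>W. \<Phi> y \<tau> = c)"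
    using dense_return_times[OF nd ne] by blast
  have "admits_atoms (normalized_distribution X \<Phi> \<tau>)" if \<tau>: "\<tau> \<in> T" and \<Phi>: "\<Phi> \<in> cocycles_plus X" for \<tau> \<Phi>
  proof -
    let ?\<nu> = "area_measure X"
    obtain W where W: "openin (surf X) W" "W \<noteq> {}" "\<forall>\<Phi>\<in>cocycles_plus X. \<exists>c. \<forall>y\<in>W. \<Phi> y \<tau> = c"
      using bspec[OF W \<tau>] by blast
    from bspec[OF W(3) \<Phi>] obtain c where c: "\<forall>y\<in>W. \<Phi> y \<tau> = c" ..
    \<comment> \<open>If the variance is zero then k = 0, and both the normalized function and c / k
      are 0, so the argument covers this case as well.\<close>
    define k where "k = sqrt (prob_space.variance ?\<nu> (\<lambda>y. \<Phi> y \<tau>))"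
    have m: "(\<lambda>x. \<Phi> x \<tau>) \<in> borel_measurable ?\<nu>"
      by (rule cocycle_measurable[OF \<Phi> area_measure_space area_measure_sets])
    have mk: "(\<lambda>x. \<Phi> x \<tau> / k) \<in> measurable ?\<nu> borel" using m by measurable
    have "W \<subseteq> (\<lambda>x. \<Phi> x \<tau> / k) -` {c / k} \<inter> space ?\<nu>"
      using c openin_subset[OF W(1)] area_measure_space by auto
    then have "emeasure ?\<nu> W \<le> emeasure ?\<nu> ((\<lambda>x. \<Phi> x \<tau> / k) -` {c / k} \<inter> space ?\<nu>)"
      by (rule emeasure_mono) (rule measurable_sets[OF mk], simp)
    then have "0 < emeasure (distr ?\<nu> borel (\<lambda>x. \<Phi> x \<tau> / k)) {c / k}"
      using area_open_pos[OF W(1,2) finite_zeros] by (subst emeasure_distr[OF mk]) auto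
    then show ?thesis unfolding admits_atoms_def normalized_distribution_def k_def by blast
  qed
  then show ?thesis using T by blast
qed

end

section \<open>Nearby forms\<close>

lemma abelian_riemann_form: "abelian_differential \<rho> X \<Longrightarrow> riemann_form X"
  unfolding abelian_differential_def riemann_form_def by blast

definition near_at :: "real \<Rightarrow> 'a surface_form \<Rightarrow> 'a surface_form \<Rightarrow> ('a \<Rightarrow> 'a) \<Rightarrow> 'a \<Rightarrow> bool" where
  "near_at \<epsilon> X Y f p \<longleftrightarrow> (\<exists>U V F G.
        p \<in> U \<and> local_primitive X U F \<and> f ` U \<subseteq> V \<and> local_primitive Y V G \<and>
        (\<forall>q\<in>U. \<forall>r\<in>U.
           cmod ((G (f q) - G (f r)) - (F q - F r)) \<le> \<epsilon> * cmod (F q - F r)))"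

lemma form_near_iff:
  "form_near \<epsilon> X Y \<longleftrightarrow> (\<exists>f. homeomorphic_map (surf X) (surf Y) f \<and> f ` form_zeros X = form_zeros Y \<and>
     (\<forall>p\<in>topspace (surf X) - form_zeros X. near_at \<epsilon> X Y f p))"
  unfolding form_near_def near_at_def ..

lemma near_atI:
  assumes "p \<in> U" "local_primitive X U F" "f ` U \<subseteq> V" "local_primitive Y V G"
    "\<And>q r. q \<in> U \<Longrightarrow> r \<in> U \<Longrightarrow> cmod ((G (f q) - G (f r)) - (F q - F r)) \<le> \<epsilon> * cmod (F q - F r)"
  shows "near_at \<epsilon> X Y f p"
  unfolding near_at_def using assms by (intro exI[of _ U] exI[of _ V] exI[of _ F] exI[of _ G]) simp

lemma near_atE:
  assumes "near_at \<epsilon> X Y f p"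
  obtains U V F G where "p \<in> U" "local_primitive X U F" "f ` U \<subseteq> V" "local_primitive Y V G"
    "\<forall>q\<in>U. \<forall>r\<in>U. cmod ((G (f q) - G (f r)) - (F q - F r)) \<le> \<epsilon> * cmod (F q - F r)"
  using assms unfolding near_at_def by (elim exE conjE) (rule that)

lemma form_near_refl:
  assumes "riemann_form X" shows "form_near 0 X X"
proof -
  interpret riemann_form X by fact
  have "near_at 0 X X id p" if p: "p \<in> topspace (surf X)" for p
  proof -
    obtain U F where "local_primitive X U F" "p \<in> U" using lp_exists[OF p] .
    then show ?thesis by (intro near_atI[of p U X F _ U X F]) auto
  qed
  then show ?thesis unfolding form_near_iff by (intro exI[of _ id]) auto
qed

text \<open>With tolerance 0 the estimate says that the increments of the two primitives are equal,
  a condition symmetric in both forms.\<close>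

lemma form_near_sym:
  assumes X: "riemann_form X" and Y: "riemann_form Y" and near: "form_near 0 X Y"
  shows "form_near 0 Y X"
proof -
  interpret X: riemann_form X by fact
  interpret Y: riemann_form Y by fact
  obtain f where f: "homeomorphic_map (surf X) (surf Y) f" "f ` form_zeros X = form_zeros Y"
    and loc: "\<And>p. p \<in> topspace (surf X) - form_zeros X \<Longrightarrow> near_at 0 X Y f p"
    using near unfolding form_near_iff by blast
  obtain g where g: "homeomorphic_maps (surf X) (surf Y) f g" using f(1) homeomorphic_map_maps by blast
  have gf: "g (f p) = p" if "p \<in> topspace (surf X)" for p using g that unfolding homeomorphic_maps_def by blast
  have fg: "f (g p) = p" if "p \<in> topspace (surf Y)" for p using g that unfolding homeomorphic_maps_def by blast
  have gX: "g p \<in> topspace (surf X)" if "p \<in> topspace (surf Y)" for p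
    using g that unfolding homeomorphic_maps_def continuous_map_def by blast
  have ZX: "form_zeros X \<subseteq> topspace (surf X)" unfolding form_zeros_def by blast
  show ?thesis unfolding form_near_iff
  proof (intro exI[of _ g] conjI ballI)
    show "homeomorphic_map (surf Y) (surf X) g" using g homeomorphic_maps_map by blast
    have "g ` form_zeros Y = g ` f ` form_zeros X" using f(2) by simp
    also have "\<dots> = form_zeros X" using gf ZX by (force simp: image_iff)
    finally show "g ` form_zeros Y = form_zeros X" .
    fix p assume p: "p \<in> topspace (surf Y) - form_zeros Y"
    have gp: "g p \<in> topspace (surf X) - form_zeros X" using f(2) fg gX p by (metis DiffD1 DiffD2 DiffI imageI)
    obtain U V F G where U: "g p \<in> U" "local_primitive X U F" "f ` U \<subseteq> V" "local_primitive Y V G"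
      and est: "\<forall>q\<in>U. \<forall>r\<in>U. cmod ((G (f q) - G (f r)) - (F q - F r)) \<le> 0 * cmod (F q - F r)"
      using near_atE[OF loc[OF gp]] .
    have Us: "U \<subseteq> topspace (surf X)" using openin_subset[OF X.lp_openin[OF U(2)]] .
    have "openin (surf Y) (f ` U)"
      using homeomorphic_imp_open_map[OF f(1)] X.lp_openin[OF U(2)] unfolding open_map_def by blast
    then have "local_primitive Y (f ` U) G" using Y.lp_subset[OF U(4) _ U(3)] by blast
    moreover have "p \<in> f ` U" using fg p U(1) by (metis DiffE imageI)
    moreover have "g ` f ` U \<subseteq> U" using gf Us by auto
    moreover have "cmod ((F (g q) - F (g r)) - (G q - G r)) \<le> 0 * cmod (G q - G r)" if qr: "q \<in> f ` U" "r \<in> f ` U" for q r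
    proof -
      obtain a b where ab: "a \<in> U" "b \<in> U" "q = f a" "r = f b" using qr by blast
      then have "g q = a" "g r = b" using gf Us by auto
      moreover have "G (f a) - G (f b) = F a - F b" using est ab by force
      ultimately show ?thesis using ab by simp
    qed
    ultimately show "near_at 0 Y X g p" using U(2) by (intro near_atI[of p "f ` U" Y G _ U X F]) auto
  qed
qed

text \<open>Relative errors compose like factors: (1 + a) (1 + b) = 1 + (a + b + a b).\<close>

lemma form_near_trans:
  assumes Y: "riemann_form Y" and XY: "form_near a X Y" and YZ: "form_near b Y Z"
    and ab: "0 \<le> a" "0 \<le> b"
  shows "form_near (a + b + a * b) X Z"
proof -
  interpret Y: riemann_form Y by fact
  obtain f where f: "homeomorphic_map (surf X) (surf Y) f" "f ` form_zeros X = form_zeros Y"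
    and locf: "\<And>p. p \<in> topspace (surf X) - form_zeros X \<Longrightarrow> near_at a X Y f p"
    using XY unfolding form_near_iff by blast
  obtain g where g: "homeomorphic_map (surf Y) (surf Z) g" "g ` form_zeros Y = form_zeros Z"
    and locg: "\<And>p. p \<in> topspace (surf Y) - form_zeros Y \<Longrightarrow> near_at b Y Z g p"
    using YZ unfolding form_near_iff by blast
  have finj: "inj_on f (topspace (surf X))" using f(1) homeomorphic_imp_injective_map by blast
  have fY: "f p \<in> topspace (surf Y)" if "p \<in> topspace (surf X)" for p
    using homeomorphic_imp_continuous_map[OF f(1)] that unfolding continuous_map_def by blast
  have ZX: "form_zeros X \<subseteq> topspace (surf X)" unfolding form_zeros_def by blast
  show ?thesis unfolding form_near_iff
  proof (intro exI[of _ "g \<circ> f"] conjI ballI)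
    show "homeomorphic_map (surf X) (surf Z) (g \<circ> f)" using f(1) g(1) homeomorphic_map_compose by blast
    show "(g \<circ> f) ` form_zeros X = form_zeros Z" using f(2) g(2) by (metis image_comp)
    fix p assume p: "p \<in> topspace (surf X) - form_zeros X"
    have fp: "f p \<in> topspace (surf Y) - form_zeros Y"
    proof -
      have "f p \<notin> f ` form_zeros X" using p finj ZX by (meson DiffE inj_on_image_mem_iff)
      then show ?thesis using f(2) fY p by auto
    qed
    obtain U1 V1 F1 G1 where 1: "p \<in> U1" "local_primitive X U1 F1" "f ` U1 \<subseteq> V1" "local_primitive Y V1 G1"
      and e1: "\<forall>q\<in>U1. \<forall>r\<in>U1. cmod ((G1 (f q) - G1 (f r)) - (F1 q - F1 r)) \<le> a * cmod (F1 q - F1 r)"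
      using near_atE[OF locf[OF p]] .
    obtain U2 V2 F2 G2 where 2: "f p \<in> U2" "local_primitive Y U2 F2" "g ` U2 \<subseteq> V2" "local_primitive Z V2 G2"
      and e2: "\<forall>q\<in>U2. \<forall>r\<in>U2. cmod ((G2 (g q) - G2 (g r)) - (F2 q - F2 r)) \<le> b * cmod (F2 q - F2 r)"
      using near_atE[OF locg[OF fp]] .
    have fV: "f p \<in> V1" using 1 by blast
    \<comment> \<open>The two hypotheses supply different primitives on Y; on N they have the same
      increments.\<close>
    obtain N where N: "openin (surf Y) N" "f p \<in> N" "N \<subseteq> V1" "N \<subseteq> U2"
      "\<And>q. q \<in> N \<Longrightarrow> G1 q - G1 (f p) = F2 q - F2 (f p)"
      using Y.lp_diff_const[OF 1(4) 2(2) fV 2(1)] by metis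
    let ?U = "{q \<in> U1. f q \<in> N}"
    have U1: "openin (surf X) U1" using 1(2) unfolding local_primitive_def by blast
    have "?U = U1 \<inter> {q \<in> topspace (surf X). f q \<in> N}" using openin_subset[OF U1] by blast
    then have Uo: "openin (surf X) ?U"
      using openin_Int[OF U1 openin_continuous_map_preimage[OF homeomorphic_imp_continuous_map[OF f(1)] N(1)]] by simp
    have "local_primitive X ?U F1" using 1(2) Uo unfolding local_primitive_def by blast
    moreover have "p \<in> ?U" using 1 N by blast
    moreover have "(g \<circ> f) ` ?U \<subseteq> V2" using 2(3) N(4) by auto
    moreover have "cmod ((G2 ((g \<circ> f) q) - G2 ((g \<circ> f) r)) - (F1 q - F1 r)) \<le> (a + b + a * b) * cmod (F1 q - F1 r)"
      if qr: "q \<in> ?U" "r \<in> ?U" for q r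
    proof -
      have d: "G1 (f q) - G1 (f r) = F2 (f q) - F2 (f r)"
      proof -
        have "G1 (f q) - G1 (f p) = F2 (f q) - F2 (f p)" "G1 (f r) - G1 (f p) = F2 (f r) - F2 (f p)" using N(5) qr by auto
        then show ?thesis by (metis diff_diff_eq2 diff_add_cancel)
      qed
      have i1: "cmod ((F2 (f q) - F2 (f r)) - (F1 q - F1 r)) \<le> a * cmod (F1 q - F1 r)"
        unfolding d[symmetric] using e1 qr by blast
      have i2: "cmod ((G2 (g (f q)) - G2 (g (f r))) - (F2 (f q) - F2 (f r))) \<le> b * cmod (F2 (f q) - F2 (f r))"
        using e2 qr N(4) by blast
      let ?u = "G2 (g (f q)) - G2 (g (f r))" and ?v = "F2 (f q) - F2 (f r)" and ?w = "F1 q - F1 r"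
      have "cmod ?v \<le> cmod ?w + a * cmod ?w" using i1 norm_triangle_sub[of ?v ?w] by linarith
      then have "b * cmod ?v \<le> b * (cmod ?w + a * cmod ?w)" using ab by (intro mult_left_mono) auto
      moreover have "cmod (?u - ?w) \<le> cmod (?u - ?v) + cmod (?v - ?w)"
      proof -
        have "?u - ?w = (?u - ?v) + (?v - ?w)" by simp
        then show ?thesis by (metis norm_triangle_ineq)
      qed
      ultimately have "cmod (?u - ?w) \<le> b * (cmod ?w + a * cmod ?w) + a * cmod ?w" using i1 i2 by linarith
      then show ?thesis by (simp add: algebra_simps)
    qed
    ultimately show "near_at (a + b + a * b) X Z (g \<circ> f) p" using 2(4) by (intro near_atI[of p ?U X F1 _ V2 Z G2]) auto
  qed
qed

text \<open>Pulling a primitive back along the isomorphism gives a primitive, with no error at all.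
  Zeros correspond because the chart expression of f is injective and holomorphic and so has nonzero
  derivative.\<close>

lemma isomorphic_form_near:
  assumes X: "riemann_form X" and Y: "riemann_form Y" and iso: "form_isomorphic X Y"
  shows "form_near 0 X Y"
proof -
  interpret X: riemann_form X by fact
  interpret Y: riemann_form Y by fact
  obtain f where f: "homeomorphic_map (surf X) (surf Y) f"
    and hol: "\<And>c d. c \<in> charts X \<Longrightarrow> d \<in> charts Y \<Longrightarrow>
        (coord d \<circ> f \<circ> param c) holomorphic_on (coord c ` {p \<in> dom_of c. f p \<in> dom_of d})"
    and co: "\<And>c d z. c \<in> charts X \<Longrightarrow> d \<in> charts Y \<Longrightarrow> z\<in>coord c ` {p \<in> dom_of c. f p \<in> dom_of d} \<Longrightarrow>
           coef Y d ((coord d \<circ> f \<circ> param c) z) * deriv (coord d \<circ> f \<circ> param c) z = coef X c z"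
    using iso unfolding form_isomorphic_def by blast
  have finj: "inj_on f (topspace (surf X))" using f homeomorphic_imp_injective_map by blast
  have fc: "continuous_map (surf X) (surf Y) f" by (rule homeomorphic_imp_continuous_map[OF f])
  have fim: "f ` topspace (surf X) = topspace (surf Y)" by (rule homeomorphic_imp_surjective_map[OF f])
  have ov: "open (coord c ` {p \<in> dom_of c. f p \<in> dom_of d})" if cd: "c \<in> charts X" "d \<in> charts Y" for c d
  proof (rule X.coord_open_map[OF cd(1)])
    have "{p \<in> dom_of c. f p \<in> dom_of d} = dom_of c \<inter> {p \<in> topspace (surf X). f p \<in> dom_of d}"
      using openin_subset[OF X.chart_openin[OF cd(1)]] by blast
    then show "openin (surf X) {p \<in> dom_of c. f p \<in> dom_of d}"
      using openin_Int[OF X.chart_openin[OF cd(1)] openin_continuous_map_preimage[OF fc Y.chart_openin[OF cd(2)]]] by simp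
  qed blast
  have zeros: "f p \<in> form_zeros Y \<longleftrightarrow> p \<in> form_zeros X" if p: "p \<in> topspace (surf X)" for p
  proof -
    obtain c where c: "c \<in> charts X" "p \<in> dom_of c" using X.chart_exists[OF p] .
    obtain d where d: "d \<in> charts Y" "f p \<in> dom_of d" using Y.chart_exists[of "f p"] fim p by blast
    let ?h = "coord d \<circ> f \<circ> param c" and ?O = "coord c ` {p \<in> dom_of c. f p \<in> dom_of d}"
    have z: "coord c p \<in> ?O" using c d by blast
    have "inj_on ?h ?O"
    proof (rule inj_onI)
      fix x y assume "x \<in> ?O" "y \<in> ?O" and e: "?h x = ?h y"
      then obtain q r where q: "q \<in> dom_of c" "f q \<in> dom_of d" "x = coord c q" and r: "r \<in> dom_of c" "f r \<in> dom_of d" "y = coord c r" by blast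
      then have "coord d (f q) = coord d (f r)" using e c(1) by simp
      then have "f q = f r" using inj_onD[OF Y.chart_inj[OF d(1)]] q r by blast
      moreover have "q \<in> topspace (surf X)" "r \<in> topspace (surf X)"
        using q r openin_subset[OF X.chart_openin[OF c(1)]] by auto
      ultimately have "q = r" using inj_onD[OF finj] by blast
      then show "x = y" using q r by simp
    qed
    from holomorphic_injective_imp_regular[OF hol[OF c(1) d(1)] ov[OF c(1) d(1)] this z]
    have "deriv ?h (coord c p) \<noteq> 0" .
    moreover have "coef Y d (coord d (f p)) * deriv ?h (coord c p) = coef X c (coord c p)"
      using co[OF c(1) d(1) z] c by simp
    ultimately show ?thesis using X.form_zeros_iff[OF c] Y.form_zeros_iff[OF d] by auto
  qed
  have Zs: "form_zeros X \<subseteq> topspace (surf X)" "form_zeros Y \<subseteq> topspace (surf Y)" unfolding form_zeros_def by auto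
  show ?thesis unfolding form_near_iff
  proof (intro exI[of _ f] conjI ballI)
    show "homeomorphic_map (surf X) (surf Y) f" by fact
    show "f ` form_zeros X = form_zeros Y"
    proof
      show "f ` form_zeros X \<subseteq> form_zeros Y" using zeros Zs by blast
      show "form_zeros Y \<subseteq> f ` form_zeros X"
      proof
        fix q assume q: "q \<in> form_zeros Y"
        then obtain p where "p \<in> topspace (surf X)" "q = f p" using fim Zs by blast
        then show "q \<in> f ` form_zeros X" using zeros q by blast
      qed
    qed
    fix p assume p: "p \<in> topspace (surf X) - form_zeros X"
    then obtain V G where V: "local_primitive Y V G" "f p \<in> V" using Y.lp_exists[of "f p"] fim by blast
    let ?U = "{q \<in> topspace (surf X). f q \<in> V}"
    have "local_primitive X ?U (G \<circ> f)" unfolding local_primitive_def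
    proof (intro conjI ballI)
      show "openin (surf X) ?U" by (rule openin_continuous_map_preimage[OF fc Y.lp_openin[OF V(1)]])
      fix c q assume c: "c \<in> charts X" and q: "q \<in> ?U \<inter> dom_of c"
      then obtain d where d: "d \<in> charts Y" "f q \<in> dom_of d" using Y.chart_exists[of "f q"] fim by blast
      let ?h = "coord d \<circ> f \<circ> param c" and ?O = "coord c ` {p \<in> dom_of c. f p \<in> dom_of d}"
      have z: "coord c q \<in> ?O" using q d by blast
      have hq: "?h (coord c q) = coord d (f q)" using c q by simp
      have "(G \<circ> param d has_field_derivative coef Y d (coord d (f q))) (at (?h (coord c q)))"
        using V(1) d q unfolding local_primitive_def hq by blast
      from DERIV_chain[OF this holomorphic_derivI[OF hol[OF c d(1)] ov[OF c d(1)] z]]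
      have "(G \<circ> param d \<circ> ?h has_field_derivative coef X c (coord c q)) (at (coord c q))"
        using co[OF c d(1) z] hq by (metis (no_types, lifting))
      then show "(G \<circ> f \<circ> param c has_field_derivative coef X c (coord c q)) (at (coord c q))"
      proof (rule has_field_derivative_transform_within_open[OF _ ov[OF c d(1)] z])
        fix x assume "x \<in> ?O"
        then show "(G \<circ> param d \<circ> ?h) x = (G \<circ> f \<circ> param c) x" using c d by auto
      qed
    qed
    then show "near_at 0 X Y f p" using V p by (intro near_atI[of p ?U X "G \<circ> f" _ V Y G]) auto
  qed
qed

text \<open>A bound near each point t, with t as one of the two arguments, is enough: a short
  interval around t is split at t, and bisection does the rest.\<close>

lemma local_lipschitz_interval:
  fixes \<phi> :: "real \<Rightarrow> complex"
  assumes ab: "a \<le> b" and loc: "\<And>t. t \<in> {a..b} \<Longrightarrow> \<exists>e>0. \<forall>s\<in>{a..b}. \<bar>s - t\<bar> < e \<longrightarrow> cmod (\<phi> s - \<phi> t) \<le> L * \<bar>s - t\<bar>"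
  shows "cmod (\<phi> b - \<phi> a) \<le> L * (b - a)"
proof -
  let ?P = "\<lambda>x y. a \<le> x \<and> y \<le> b \<longrightarrow> cmod (\<phi> y - \<phi> x) \<le> L * (y - x)"
  have "?P a b"
  proof (rule Bolzano[OF ab, of ?P])
    fix x y z assume "?P x y" "?P y z" "x \<le> y" "y \<le> z"
    then show "?P x z" using norm_triangle_ineq[of "\<phi> z - \<phi> y" "\<phi> y - \<phi> x"] by (auto simp: algebra_simps)
  next
    fix t assume t: "a \<le> t" "t \<le> b"
    then obtain e where e: "e > 0" "\<forall>s\<in>{a..b}. \<bar>s - t\<bar> < e \<longrightarrow> cmod (\<phi> s - \<phi> t) \<le> L * \<bar>s - t\<bar>" using loc[of t] by auto
    have "?P x y" if xy: "x \<le> t \<and> t \<le> y \<and> y - x < e" for x y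
    proof
      assume "a \<le> x \<and> y \<le> b"
      then have "cmod (\<phi> y - \<phi> t) \<le> L * (y - t)" "cmod (\<phi> x - \<phi> t) \<le> L * (t - x)"
        using e(2)[rule_format, of y] e(2)[rule_format, of x] xy t by auto
      then show "cmod (\<phi> y - \<phi> x) \<le> L * (y - x)"
        using norm_triangle_ineq[of "\<phi> y - \<phi> t" "\<phi> t - \<phi> x"] by (simp add: algebra_simps norm_minus_commute)
    qed
    then show "\<exists>d>0. \<forall>x y. x \<le> t \<and> t \<le> y \<and> y - x < d \<longrightarrow> ?P x y" using e(1) by blast
  qed
  then show ?thesis by simp
qed

section \<open>Short degenerate leaves are excluded near a given form\<close>

abbreviation degenerate :: "'a surface_form \<Rightarrow> complex \<Rightarrow> real \<Rightarrow> bool" where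
  "degenerate X \<equiv> riemann_form.degenerate X"

lemma degenerateE:
  assumes Y: "riemann_form Y" and d: "degenerate Y v l"
  obtains g where "l > 0" "dev Y (closed_segment 0 (of_real l * v)) g" "g 0 = g (of_real l * v)"
  | g z z' where "l > 0" "dev Y (open_segment 0 (of_real l * v)) g" "z \<in> form_zeros Y" "z' \<in> form_zeros Y"
    "\<And>N e. openin (surf Y) N \<Longrightarrow> z \<in> N \<Longrightarrow> e > 0 \<Longrightarrow> \<exists>w\<in>open_segment 0 (of_real l * v). dist w 0 < e \<and> g w \<in> N"
    "\<And>N e. openin (surf Y) N \<Longrightarrow> z' \<in> N \<Longrightarrow> e > 0 \<Longrightarrow> \<exists>w\<in>open_segment 0 (of_real l * v). dist w (of_real l * v) < e \<and> g w \<in> N"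
  using d unfolding riemann_form.degenerate_def[OF Y] riemann_form.cluster_def[OF Y] by metis

lemma degenerateI_closed:
  assumes "riemann_form Y" "l > 0" "dev Y (closed_segment 0 (of_real l * v)) g" "g 0 = g (of_real l * v)"
  shows "degenerate Y v l"
  unfolding riemann_form.degenerate_def[OF assms(1)] using assms by blast

lemma degenerateI_open:
  assumes Y: "riemann_form Y" and "l > 0" "dev Y (open_segment 0 (of_real l * v)) g" "z \<in> form_zeros Y" "z' \<in> form_zeros Y"
    "\<And>N e. openin (surf Y) N \<Longrightarrow> z \<in> N \<Longrightarrow> e > 0 \<Longrightarrow> \<exists>w\<in>open_segment 0 (of_real l * v). dist w 0 < e \<and> g w \<in> N"
    "\<And>N e. openin (surf Y) N \<Longrightarrow> z' \<in> N \<Longrightarrow> e > 0 \<Longrightarrow> \<exists>w\<in>open_segment 0 (of_real l * v). dist w (of_real l * v) < e \<and> g w \<in> N"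
  shows "degenerate Y v l"
  unfolding riemann_form.degenerate_def[OF Y] riemann_form.cluster_def[OF Y] using assms by blast

text \<open>Let a be the increment of F and d = w - z. Nearness gives |d - a| at most |a| / 4, hence
  |a| at most 4 |d| / 3, and the error is at most |d| / 3. This is the origin of the constants 1/3
  and 4/3 below.\<close>

lemma near_dev_estimate:
  assumes X: "riemann_form X" and Y: "riemann_form Y"
    and hom: "homeomorphic_maps (surf X) (surf Y) f k" and zeros: "f ` form_zeros X = form_zeros Y"
    and near: "\<And>p. p \<in> topspace (surf X) - form_zeros X \<Longrightarrow> near_at (1/4) X Y f p"
    and g: "dev Y S g" and z: "z \<in> S" and F: "local_primitive X V F" "k (g z) \<in> V"
  shows "\<exists>e>0. \<forall>w\<in>S. dist w z < e \<longrightarrow> cmod ((F (k (g w)) - F (k (g z))) - (w - z)) \<le> cmod (w - z) / 3"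
proof -
  interpret X: riemann_form X by fact
  interpret Y: riemann_form Y by fact
  have kc: "continuous_map (surf Y) (surf X) k" using hom unfolding homeomorphic_maps_def by blast
  have fk: "f (k q) = q" if "q \<in> topspace (surf Y)" for q using hom that unfolding homeomorphic_maps_def by blast
  have gc: "continuous_map (top_of_set S) (surf Y) g" using g unfolding dev_def by blast
  have kgc: "continuous_map (top_of_set S) (surf X) (\<lambda>w. k (g w))"
    using continuous_map_compose[OF gc kc] by (simp add: o_def)
  have gz: "g z \<in> topspace (surf Y)" "g z \<notin> form_zeros Y" using Y.dev_regular[OF g z] unfolding regular_points_def by auto
  have "k (g z) \<in> topspace (surf X) - form_zeros X"
  proof -
    have "k (g z) \<in> topspace (surf X)" using kc gz unfolding continuous_map_def by blast
    moreover have "k (g z) \<notin> form_zeros X" using zeros fk[OF gz(1)] gz(2) by (metis imageI)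
    ultimately show ?thesis by blast
  qed
  from near_atE[OF near[OF this]] obtain U V' F0 G where U: "k (g z) \<in> U" "local_primitive X U F0" "f ` U \<subseteq> V'" "local_primitive Y V' G"
    and est: "\<forall>q\<in>U. \<forall>r\<in>U. cmod ((G (f q) - G (f r)) - (F0 q - F0 r)) \<le> 1 / 4 * cmod (F0 q - F0 r)" .
  obtain N where N: "openin (surf X) N" "k (g z) \<in> N" "N \<subseteq> U" "N \<subseteq> V"
    "\<And>q. q \<in> N \<Longrightarrow> F0 q - F0 (k (g z)) = F q - F (k (g z))"
    using X.lp_diff_const[OF U(2) F(1) U(1) F(2)] by metis
  obtain e1 where e1: "e1 > 0" "\<forall>w\<in>S. dist w z < e1 \<longrightarrow> k (g w) \<in> N"
    using X.top_of_set_preimage_eventually[OF kgc N(1) z N(2)] by blast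
  have "f (k (g z)) \<in> V'" using U by blast
  then have "g z \<in> V'" using fk[OF gz(1)] by simp
  then have "\<forall>\<^sub>F w in at z within S. G (g w) - G (g z) = w - z" using g z U(4) unfolding dev_def by blast
  then obtain e2 where e2: "e2 > 0" "\<And>w. w \<in> S \<Longrightarrow> w \<noteq> z \<Longrightarrow> dist w z < e2 \<Longrightarrow> G (g w) - G (g z) = w - z"
    unfolding eventually_at by blast
  show ?thesis
  proof (intro exI[of _ "min e1 e2"] conjI ballI impI)
    show "min e1 e2 > 0" using e1 e2 by simp
    fix w assume w: "w \<in> S" "dist w z < min e1 e2"
    have kw: "k (g w) \<in> N" using e1(2) w by simp
    have gw: "g w \<in> topspace (surf Y)" using Y.dev_topspace[OF g w(1)] .
    let ?a = "F (k (g w)) - F (k (g z))"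
    have a: "F0 (k (g w)) - F0 (k (g z)) = ?a" using N(5)[OF kw] .
    have G: "G (g w) - G (g z) = w - z" using e2(2)[OF w(1)] w(2) by (cases "w = z") auto
    have "cmod ((G (f (k (g w))) - G (f (k (g z)))) - (F0 (k (g w)) - F0 (k (g z)))) \<le> 1 / 4 * cmod (F0 (k (g w)) - F0 (k (g z)))"
      using est kw N(3) U(1) by blast
    then have i: "cmod ((w - z) - ?a) \<le> 1 / 4 * cmod ?a" unfolding a fk[OF gw] fk[OF gz(1)] G .
    have "cmod ?a \<le> cmod (w - z) + cmod (?a - (w - z))" using norm_triangle_sub[of ?a "w - z"] by simp
    then show "cmod (?a - (w - z)) \<le> cmod (w - z) / 3" using i norm_minus_commute[of ?a "w - z"] by simp
  qed
qed

text \<open>While the pulled back leaf is in V, the local errors add up to at most a third of its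
  length, so F moves by at most 4/3 of the length. With this much room in the sublevel set,
  \<open>path_trapped\<close> applies.\<close>

lemma short_leaf_stays:
  assumes X: "riemann_form X" and Y: "riemann_form Y" and v: "cmod v = 1"
    and hom: "homeomorphic_maps (surf X) (surf Y) f k" and zeros: "f ` form_zeros X = form_zeros Y"
    and near: "\<And>p. p \<in> topspace (surf X) - form_zeros X \<Longrightarrow> near_at (1/4) X Y f p"
    and ab: "a \<le> b" and g: "dev Y ((\<lambda>s. of_real s * v) ` {a..b}) g"
    and V: "riemann_form.primitive_nbhd X p c V F" and a: "k (g (of_real a * v)) \<in> V"
    and small: "cmod (F (k (g (of_real a * v))) - F p) + 4 / 3 * (b - a) \<le> c"
  shows "k (g (of_real b * v)) \<in> V" "cmod (F (k (g (of_real b * v))) - F p) \<le> c"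
    "cmod ((F (k (g (of_real b * v))) - F (k (g (of_real a * v)))) - of_real (b - a) * v) \<le> (b - a) / 3"
proof -
  interpret X: riemann_form X by fact
  interpret Y: riemann_form Y by fact
  have F: "local_primitive X V F" using V unfolding X.primitive_nbhd_def by blast
  let ?S = "(\<lambda>s. of_real s * v) ` {a..b}" and ?\<eta> = "\<lambda>s. k (g (of_real s * v))"
  let ?C = "{q \<in> V. cmod (F q - F p) \<le> c}"
  have C: "closedin (surf X) ?C" using V X.Hausdorff compactin_imp_closedin unfolding X.primitive_nbhd_def by blast
  have kc: "continuous_map (surf Y) (surf X) k" using hom unfolding homeomorphic_maps_def by blast
  have gc: "continuous_map (top_of_set ?S) (surf Y) g" using g unfolding dev_def by blast
  have lc: "continuous_map (top_of_set {a..b}) (top_of_set ?S) (\<lambda>s. of_real s * v)"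
    by (auto simp: continuous_map_in_subtopology intro!: continuous_intros)
  have cont: "continuous_map (top_of_set {a..b}) (surf X) ?\<eta>"
    using continuous_map_compose[OF continuous_map_compose[OF lc gc] kc] by (simp add: o_def)
  have nm: "cmod (of_real s * v - of_real t * v) = \<bar>s - t\<bar>" for s t
  proof -
    have "of_real s * v - of_real t * v = of_real (s - t) * v" by (simp add: algebra_simps)
    then show ?thesis using v by (simp only: norm_mult norm_of_real mult_1_right)
  qed
  have lip: "cmod ((F (?\<eta> u) - F (?\<eta> a)) - of_real (u - a) * v) \<le> (u - a) / 3"
    if u: "u \<in> {a..b}" "\<And>x. x \<in> {a..u} \<Longrightarrow> ?\<eta> x \<in> V" for u
  proof -
    let ?\<phi> = "\<lambda>s. F (?\<eta> s) - of_real s * v"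
    have "cmod (?\<phi> u - ?\<phi> a) \<le> 1 / 3 * (u - a)"
    proof (rule local_lipschitz_interval)
      show "a \<le> u" using u by simp
      fix t assume t: "t \<in> {a..u}"
      have tS: "of_real t * v \<in> ?S" using t u by auto
      obtain e where e: "e > 0" "\<forall>w\<in>?S. dist w (of_real t * v) < e \<longrightarrow>
          cmod ((F (k (g w)) - F (?\<eta> t)) - (w - of_real t * v)) \<le> cmod (w - of_real t * v) / 3"
        using near_dev_estimate[OF X Y hom zeros near g tS F u(2)[OF t]] by blast
      show "\<exists>e>0. \<forall>s\<in>{a..u}. \<bar>s - t\<bar> < e \<longrightarrow> cmod (?\<phi> s - ?\<phi> t) \<le> 1 / 3 * \<bar>s - t\<bar>"
      proof (intro exI[of _ e] conjI ballI impI e(1))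
        fix s assume s: "s \<in> {a..u}" "\<bar>s - t\<bar> < e"
        then have sS: "of_real s * v \<in> ?S" using u by auto
        have "dist (of_real s * v) (of_real t * v) < e" using s(2) unfolding dist_norm nm .
        from e(2)[rule_format, OF sS this]
        have "cmod ((F (?\<eta> s) - F (?\<eta> t)) - (of_real s * v - of_real t * v)) \<le> \<bar>s - t\<bar> / 3" unfolding nm .
        moreover have eq: "?\<phi> s - ?\<phi> t = (F (?\<eta> s) - F (?\<eta> t)) - (of_real s * v - of_real t * v)" by simp
        ultimately show "cmod (?\<phi> s - ?\<phi> t) \<le> 1 / 3 * \<bar>s - t\<bar>" unfolding eq by linarith
      qed
    qed
    moreover have "?\<phi> u - ?\<phi> a = (F (?\<eta> u) - F (?\<eta> a)) - of_real (u - a) * v" by (simp add: algebra_simps)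
    ultimately show ?thesis by simp
  qed
  have inC: "?\<eta> s \<in> ?C" if s: "s \<in> {a..b}" for s
  proof (rule X.path_trapped[OF cont X.lp_openin[OF F] C _ _ _ s])
    show "?C \<subseteq> V" by blast
    have "0 \<le> 4 / 3 * (b - a)" using ab by simp
    then have "cmod (F (?\<eta> a) - F p) \<le> c" using small by linarith
    then show "?\<eta> a \<in> ?C" using a by blast
    fix u assume u: "u \<in> {a..b}" and uV: "\<And>x. x \<in> {a..u} \<Longrightarrow> ?\<eta> x \<in> V"
    let ?d = "F (?\<eta> u) - F (?\<eta> a)"
    have "cmod (of_real (u - a) * v) = u - a" using v u by (simp add: norm_mult del: of_real_diff)
    then have "cmod ?d \<le> 4 / 3 * (u - a)"
      using lip[OF u uV] norm_triangle_sub[of ?d "of_real (u - a) * v"] by simp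
    moreover have "cmod (F (?\<eta> u) - F p) \<le> cmod (F (?\<eta> a) - F p) + cmod ?d"
      using norm_triangle_ineq[of "F (?\<eta> a) - F p" ?d] by simp
    moreover have "u \<le> b" using u by simp
    ultimately have "cmod (F (?\<eta> u) - F p) \<le> c" using small by argo
    then show "?\<eta> u \<in> ?C" using uV[of u] u by simp
  qed
  have bb: "b \<in> {a..b}" using ab by simp
  show "?\<eta> b \<in> V" "cmod (F (?\<eta> b) - F p) \<le> c" using inC[OF bb] by auto
  show "cmod ((F (?\<eta> b) - F (?\<eta> a)) - of_real (b - a) * v) \<le> (b - a) / 3" by (rule lip[OF bb]) (use inC in auto)
qed

text \<open>On a leaf of length at most c / 2 the pulled back primitive would move by at least 2/3
  of the length. A closed leaf moves it by 0. A saddle connection is trapped in a set V with a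
  single zero, so both ends approach the same zero and the movement is again too small.\<close>

lemma degenerate_length_bound:
  assumes X: "riemann_form X" and Y: "riemann_form Y" and v: "cmod v = 1" and near: "form_near (1/4) X Y"
    and c: "c > 0" "\<And>p. p \<in> topspace (surf X) \<Longrightarrow> \<exists>V F. riemann_form.primitive_nbhd X p c V F"
    and d: "degenerate Y v l"
  shows "l > c / 2"
proof (rule ccontr)
  assume "\<not> l > c / 2"
  then have lc: "l \<le> c / 2" by simp
  interpret X: riemann_form X by fact
  interpret Y: riemann_form Y by fact
  obtain f where f: "homeomorphic_map (surf X) (surf Y) f" and zeros: "f ` form_zeros X = form_zeros Y"
    and nr: "\<And>p. p \<in> topspace (surf X) - form_zeros X \<Longrightarrow> near_at (1/4) X Y f p"
    using near unfolding form_near_iff by blast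
  obtain k where hom: "homeomorphic_maps (surf X) (surf Y) f k" using f homeomorphic_map_maps by blast
  have kX: "k q \<in> topspace (surf X)" if "q \<in> topspace (surf Y)" for q
    using hom that unfolding homeomorphic_maps_def continuous_map_def by blast
  have kf: "k (f q) = q" if "q \<in> topspace (surf X)" for q using hom that unfolding homeomorphic_maps_def by blast
  have kc: "continuous_map (surf Y) (surf X) k" using hom unfolding homeomorphic_maps_def by blast
  have ZX: "form_zeros X \<subseteq> topspace (surf X)" "form_zeros Y \<subseteq> topspace (surf Y)" unfolding form_zeros_def by auto
  have kZ: "k q \<in> form_zeros X" if "q \<in> form_zeros Y" for q
    using that zeros kf ZX by (metis imageE subsetD)
  have v0: "v \<noteq> 0" using v by auto
  from Y d show False
  proof (cases rule: degenerateE)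
    case (1 g)
    have seg: "closed_segment 0 (of_real l * v) = (\<lambda>s. of_real s * v) ` {0..l}"
      using segment_param_iff[of _ 0 l v] 1(1) by (auto simp: closed_segment_eq_real_ivl image_iff)
    let ?p = "k (g 0)"
    have "?p \<in> topspace (surf X)" using kX Y.dev_topspace[OF 1(2), of 0] by simp
    then obtain V F where V: "X.primitive_nbhd ?p c V F" using c(2) by blast
    then have pV: "?p \<in> V" unfolding X.primitive_nbhd_def by blast
    have "cmod ((F (k (g (of_real l * v))) - F (k (g (of_real 0 * v)))) - of_real (l - 0) * v) \<le> (l - 0) / 3"
      by (rule short_leaf_stays(3)[OF X Y v hom zeros nr _ _ V]) (use 1(1,2) seg pV lc c in auto)
    then have "cmod (of_real l * v) \<le> l / 3" using 1(3) by simp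
    then show False using v 1(1) by (simp add: norm_mult)
  next
    case (2 g z z')
    have seg: "open_segment 0 (of_real l * v) = (\<lambda>s. of_real s * v) ` {0<..<l}"
    proof -
      have "0 \<noteq> of_real l * v" using v0 2(1) by simp
      then have "open_segment 0 (of_real l * v) = (\<lambda>u. u *\<^sub>R (of_real l * v)) ` {0<..<1}"
        by (auto simp: in_segment image_iff)
      also have "\<dots> = (\<lambda>s. of_real s * v) ` (\<lambda>u. u * l) ` {0<..<1}"
        by (simp add: image_image scaleR_conv_of_real mult.assoc)
      also have "(\<lambda>u. u * l) ` {0<..<1} = {0<..<l}"
        using 2(1) by (auto simp: image_iff intro!: bexI[of _ "_ / l"])
      finally show ?thesis .
    qed
    \<comment> \<open>Cutting off less than l / 8 at either end leaves more than 3 l / 4, so F moves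
      by more than l / 2, against less than 2 \<delta> \<le> l / 4. The bound c / 4 leaves room for
      4/3 times c / 2 inside the sublevel set.\<close>
    define \<delta> where "\<delta> = min (l / 8) (c / 4)"
    have \<delta>: "\<delta> > 0" "\<delta> \<le> l / 8" "\<delta> \<le> c / 4" using 2(1) c unfolding \<delta>_def by auto
    let ?p = "k z"
    have pZ: "?p \<in> form_zeros X" using kZ 2(3) by blast
    then have pX: "?p \<in> topspace (surf X)" using ZX by blast
    then obtain V F where V: "X.primitive_nbhd ?p c V F" using c(2) by blast
    then have F: "local_primitive X V F" and pV: "?p \<in> V" and VZ: "V \<inter> form_zeros X = {?p}"
      and C: "compactin (surf X) {q \<in> V. cmod (F q - F ?p) \<le> c}"
      using pZ unfolding X.primitive_nbhd_def by auto
    let ?N = "{q \<in> V. F q \<in> ball (F ?p) \<delta>}" and ?C = "{q \<in> V. cmod (F q - F ?p) \<le> c}"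
    have N: "openin (surf X) ?N" by (rule X.lp_preimage_open[OF F]) simp
    have pre: "openin (surf Y) {q \<in> topspace (surf Y). k q \<in> M}" if "openin (surf X) M" for M
      by (rule openin_continuous_map_preimage[OF kc that])
    have "z \<in> {q \<in> topspace (surf Y). k q \<in> ?N}" using 2(3) ZX pV \<delta> by auto
    then obtain w where w: "w \<in> open_segment 0 (of_real l * v)" "dist w 0 < \<delta>" "k (g w) \<in> ?N"
      using 2(5)[OF pre[OF N]] \<delta>(1) by blast
    then obtain s0 where s0: "s0 \<in> {0<..<l}" "w = of_real s0 * v" unfolding seg by blast
    have s0\<delta>: "s0 < \<delta>" using w(2) s0 v by (simp add: norm_mult)
    have start: "k (g (of_real s0 * v)) \<in> V" "cmod (F (k (g (of_real s0 * v))) - F ?p) < \<delta>"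
      using w(3) s0(2) by (auto simp: dist_norm norm_minus_commute)
    have reach: "\<exists>s1\<in>{s0<..<l}. l - s1 < \<delta> \<and> k (g (of_real s1 * v)) \<in> M" if M: "openin (surf X) M" "k z' \<in> M" for M
    proof -
      have "z' \<in> {q \<in> topspace (surf Y). k q \<in> M}" using 2(4) ZX M by auto
      then obtain w' where w': "w' \<in> open_segment 0 (of_real l * v)" "dist w' (of_real l * v) < \<delta>" "k (g w') \<in> M"
        using 2(6)[OF pre[OF M(1)]] \<delta>(1) by blast
      then obtain s1 where s1: "s1 \<in> {0<..<l}" "w' = of_real s1 * v" unfolding seg by blast
      have "of_real s1 * v - of_real l * v = of_real (s1 - l) * v" by (simp add: algebra_simps)
      then have "dist w' (of_real l * v) = \<bar>s1 - l\<bar>" unfolding s1(2) dist_norm using v by (simp only: norm_mult norm_of_real mult_1_right)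
      then have "l - s1 < \<delta>" using w'(2) s1 by simp
      then show ?thesis using s0\<delta> \<delta> s1 w'(3) by (intro bexI[of _ s1]) auto
    qed
    have stay: "k (g (of_real s1 * v)) \<in> ?C"
      "cmod ((F (k (g (of_real s1 * v))) - F (k (g (of_real s0 * v)))) - of_real (s1 - s0) * v) \<le> (s1 - s0) / 3"
      if s1: "s1 \<in> {s0<..<l}" for s1
    proof -
      have "(\<lambda>s. of_real s * v) ` {s0..s1} \<subseteq> open_segment 0 (of_real l * v)" unfolding seg using s0 s1 by auto
      then have dv: "dev Y ((\<lambda>s. of_real s * v) ` {s0..s1}) g" using dev_subset[OF 2(2)] by blast
      have sm: "cmod (F (k (g (of_real s0 * v))) - F ?p) + 4 / 3 * (s1 - s0) \<le> c"
      proof -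
        have "s1 < l" "0 < s0" using s1 s0(1) by auto
        then show ?thesis using start(2) \<delta>(3) lc c(1) by argo
      qed
      have le: "s0 \<le> s1" using s1 by simp
      show "k (g (of_real s1 * v)) \<in> ?C"
        "cmod ((F (k (g (of_real s1 * v))) - F (k (g (of_real s0 * v)))) - of_real (s1 - s0) * v) \<le> (s1 - s0) / 3"
        using short_leaf_stays[OF X Y v hom zeros nr le dv V start(1) sm] by auto
    qed
    \<comment> \<open>The cluster point at the far end stays in the closed set that contains the
      leaf; being a zero in V, it must then be \<open>k z\<close>.\<close>
    have "k z' \<in> ?C"
    proof (rule ccontr)
      assume "k z' \<notin> ?C"
      moreover have "k z' \<in> topspace (surf X)" using kX 2(4) ZX by blast
      moreover have "openin (surf X) (topspace (surf X) - ?C)"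
        using compactin_imp_closedin[OF X.Hausdorff C] by (simp add: closedin_def)
      ultimately show False using reach[of "topspace (surf X) - ?C"] stay(1) by blast
    qed
    then have "k z' = ?p" using VZ kZ[OF 2(4)] by blast
    then obtain s1 where s1: "s1 \<in> {s0<..<l}" "l - s1 < \<delta>" "k (g (of_real s1 * v)) \<in> ?N"
      using reach[OF N] pV \<delta> by auto
    let ?d = "F (k (g (of_real s1 * v))) - F (k (g (of_real s0 * v)))"
    have "cmod (F (k (g (of_real s1 * v))) - F ?p) < \<delta>" using s1(3) by (simp add: dist_norm norm_minus_commute)
    then have "cmod ?d < 2 * \<delta>"
      using start(2) norm_triangle_ineq4[of "F (k (g (of_real s1 * v))) - F ?p" "F (k (g (of_real s0 * v))) - F ?p"] by simp
    moreover have "cmod (of_real (s1 - s0) * v) = s1 - s0" using v s1 by (simp add: norm_mult del: of_real_diff)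
    then have "s1 - s0 \<le> cmod ?d + (s1 - s0) / 3"
      using stay(2)[OF s1(1)] norm_triangle_sub[of "of_real (s1 - s0) * v" ?d]
        norm_minus_commute[of ?d "of_real (s1 - s0) * v"] by linarith
    ultimately show False using s1(2) s0\<delta> \<delta>(1,2) 2(1) by argo
  qed
qed

text \<open>With tolerance 0 the homeomorphism preserves increments of primitives, so it carries
  developments to developments and clustering at zeros to clustering at zeros. This permits a change
  of the representative of a class.\<close>

lemma degenerate_transfer:
  assumes X: "riemann_form X" and Y: "riemann_form Y" and near: "form_near 0 X Y" and d: "degenerate X v l"
  shows "degenerate Y v l"
proof -
  interpret X: riemann_form X by fact
  interpret Y: riemann_form Y by fact
  obtain f where f: "homeomorphic_map (surf X) (surf Y) f" and zeros: "f ` form_zeros X = form_zeros Y"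
    and nr: "\<And>p. p \<in> topspace (surf X) - form_zeros X \<Longrightarrow> near_at 0 X Y f p"
    using near unfolding form_near_iff by blast
  have fc: "continuous_map (surf X) (surf Y) f" by (rule homeomorphic_imp_continuous_map[OF f])
  have finj: "inj_on f (topspace (surf X))" using f homeomorphic_imp_injective_map by blast
  have ZX: "form_zeros X \<subseteq> topspace (surf X)" unfolding form_zeros_def by auto
  have dv: "dev Y S (f \<circ> g)" if g: "dev X S g" for S g
  proof (rule Y.devI)
    have gc: "continuous_map (top_of_set S) (surf X) g" using g unfolding dev_def by blast
    show "continuous_map (top_of_set S) (surf Y) (f \<circ> g)" using continuous_map_compose[OF gc fc] .
    have r: "g z \<in> topspace (surf X) - form_zeros X" if "z \<in> S" for z
      using X.dev_regular[OF g that] unfolding regular_points_def .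
    show "(f \<circ> g) ` S \<subseteq> regular_points Y"
    proof safe
      fix z assume z: "z \<in> S"
      have "f (g z) \<notin> f ` form_zeros X" using r[OF z] finj ZX by (meson DiffE inj_on_image_mem_iff)
      moreover have "f (g z) \<in> topspace (surf Y)" using fc r[OF z] unfolding continuous_map_def by blast
      ultimately show "(f \<circ> g) z \<in> regular_points Y" using zeros unfolding regular_points_def by auto
    qed
    fix z assume z: "z \<in> S"
    obtain U V F G where U: "g z \<in> U" "local_primitive X U F" "f ` U \<subseteq> V" "local_primitive Y V G"
      and e: "\<forall>q\<in>U. \<forall>r\<in>U. cmod ((G (f q) - G (f r)) - (F q - F r)) \<le> 0 * cmod (F q - F r)"
      using near_atE[OF nr[OF r[OF z]]] .
    have "\<forall>\<^sub>F w in at z within S. F (g w) - F (g z) = w - z" using g z U(1,2) unfolding dev_def by blast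
    moreover have "\<forall>\<^sub>F w in at z within S. g w \<in> U"
      using X.top_of_set_preimage_eventually[OF gc X.lp_openin[OF U(2)] z U(1)] unfolding eventually_at by blast
    ultimately have "\<forall>\<^sub>F w in at z within S. G ((f \<circ> g) w) - G ((f \<circ> g) z) = w - z"
    proof eventually_elim
      case (elim w)
      have "G (f (g w)) - G (f (g z)) = F (g w) - F (g z)" using e elim(2) U(1) by force
      then show ?case using elim(1) by simp
    qed
    then show "\<exists>U F. local_primitive Y U F \<and> (f \<circ> g) z \<in> U \<and>
       (\<forall>\<^sub>F w in at z within S. F ((f \<circ> g) w) - F ((f \<circ> g) z) = w - z)"
      using U by (intro exI[of _ V] exI[of _ G]) auto
  qed
  have pre: "openin (surf X) {q \<in> topspace (surf X). f q \<in> N}" if "openin (surf Y) N" for N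
    by (rule openin_continuous_map_preimage[OF fc that])
  from X d show ?thesis
  proof (cases rule: degenerateE)
    case (1 g)
    then show ?thesis using degenerateI_closed[OF Y 1(1) dv[OF 1(2)]] by simp
  next
    case (2 g z z')
    have in0: "\<exists>w\<in>open_segment 0 (of_real l * v). dist w 0 < e \<and> (f \<circ> g) w \<in> N" if "openin (surf Y) N" "f z \<in> N" "e > 0" for N e
      using 2(5)[OF pre[OF that(1)] _ that(3)] 2(3) ZX that(2) by auto
    have in1: "\<exists>w\<in>open_segment 0 (of_real l * v). dist w (of_real l * v) < e \<and> (f \<circ> g) w \<in> N" if "openin (surf Y) N" "f z' \<in> N" "e > 0" for N e
      using 2(6)[OF pre[OF that(1)] _ that(3)] 2(4) ZX that(2) by auto
    show ?thesis
      by (rule degenerateI_open[OF Y 2(1) dv[OF 2(2)] _ _ in0 in1]) (use 2(3,4) zeros in auto)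
  qed
qed

section \<open>The Teichmueller flow and recurrence\<close>

context riemann_form begin

text \<open>An injective holomorphic function has nonzero derivative. Regular points are thus
  recognized through primitives alone, the terms in which \<open>teich_deformation\<close> is
  stated.\<close>

lemma injective_primitive_regular:
  assumes F: "local_primitive X U F" "inj_on F U" and p: "p \<in> U"
  shows "p \<notin> form_zeros X"
proof -
  have Uo: "openin (surf X) U" by (rule lp_openin[OF F(1)])
  obtain c where c: "c \<in> charts X" "p \<in> dom_of c" using chart_exists openin_subset[OF Uo] p by blast
  let ?O = "coord c ` (U \<inter> dom_of c)"
  have o: "open ?O" by (rule coord_open_map[OF c(1) openin_Int[OF Uo chart_openin[OF c(1)]]]) simp
  have d: "((F \<circ> param c) has_field_derivative coef X c z) (at z)" if z: "z \<in> ?O" for z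
  proof -
    obtain q where "q \<in> U \<inter> dom_of c" "z = coord c q" using z by blast
    then show ?thesis using F c unfolding local_primitive_def by auto
  qed
  then have h: "(F \<circ> param c) holomorphic_on ?O" using holomorphic_on_open[OF o] by blast
  have "inj_on (F \<circ> param c) ?O"
  proof (rule inj_onI)
    fix x y assume "x \<in> ?O" "y \<in> ?O" and e: "(F \<circ> param c) x = (F \<circ> param c) y"
    then obtain a b where ab: "a \<in> U" "a \<in> dom_of c" "x = coord c a" "b \<in> U" "b \<in> dom_of c" "y = coord c b" by blast
    then have "F a = F b" using e c by simp
    then show "x = y" using inj_onD[OF F(2)] ab by blast
  qed
  moreover have z: "coord c p \<in> ?O" using p c by blast
  ultimately have "deriv (F \<circ> param c) (coord c p) \<noteq> 0"
    using holomorphic_injective_imp_regular[OF h o] by blast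
  then show ?thesis using DERIV_imp_deriv[OF d[OF z]] form_zeros_iff[OF c] by simp
qed

lemma regular_injective_primitive:
  assumes "p \<in> regular_points X"
  obtains U F where "local_primitive X U F" "inj_on F U" "p \<in> U"
proof -
  obtain r \<psi> F where d: "flat_disc p r \<psi> F" using flat_disc_exists[OF assms] .
  then have r: "r > 0" "\<psi> 0 = p" "local_primitive X (\<psi> ` ball 0 r) F" unfolding flat_disc_def by auto
  moreover have "inj_on F (\<psi> ` ball 0 r)" using flat_disc_inv[OF d] by (metis inj_onI)
  moreover have "p \<in> \<psi> ` ball 0 r" using r by (metis centre_in_ball imageI)
  ultimately show ?thesis using that by blast
qed

end

lemma teich_stretch_diff: "teich_stretch s z - teich_stretch s w = teich_stretch s (z - w)"
  unfolding teich_stretch_def by (simp add: complex_eq_iff right_diff_distrib)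

lemma teich_stretch_inj: "teich_stretch s z = teich_stretch s w \<Longrightarrow> z = w"
  unfolding teich_stretch_def by (simp add: complex_eq_iff)

text \<open>The stretch is injective on the plane, so it preserves local injectivity of primitives,
  which characterizes regular points.\<close>

lemma teich_zeros:
  assumes X: "riemann_form X" and Y: "riemann_form Y" and t: "teich_deformation s X Y"
  shows "form_zeros Y = form_zeros X"
proof -
  interpret X: riemann_form X by fact
  interpret Y: riemann_form Y by fact
  have sf: "surf Y = surf X" and lp: "\<And>U F. local_primitive X U F \<Longrightarrow> local_primitive Y U (teich_stretch s \<circ> F)"
    using t unfolding teich_deformation_def by auto
  have "p \<notin> form_zeros Y" if p: "p \<in> topspace (surf X)" "p \<notin> form_zeros X" for p
  proof -
    have "p \<in> regular_points X" using p unfolding regular_points_def by blast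
    then obtain U F where U: "local_primitive X U F" "inj_on F U" "p \<in> U" using X.regular_injective_primitive by blast
    have "inj_on (teich_stretch s \<circ> F) U"
      using U(2) teich_stretch_inj by (auto simp: inj_on_def)
    then show ?thesis using Y.injective_primitive_regular[OF lp[OF U(1)]] U(3) by blast
  qed
  moreover have "p \<notin> form_zeros X" if p: "p \<in> topspace (surf X)" "p \<notin> form_zeros Y" for p
  proof -
    have "p \<in> regular_points Y" using p sf unfolding regular_points_def by simp
    then obtain V G where V: "local_primitive Y V G" "inj_on G V" "p \<in> V" using Y.regular_injective_primitive by blast
    obtain U F where U: "local_primitive X U F" "p \<in> U" using X.lp_exists[OF p(1)] .
    obtain N where N: "openin (surf Y) N" "p \<in> N" "N \<subseteq> U" "N \<subseteq> V"
      "\<And>q. q \<in> N \<Longrightarrow> (teich_stretch s \<circ> F) q - (teich_stretch s \<circ> F) p = G q - G p"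
      using Y.lp_diff_const[OF lp[OF U(1)] V(1) U(2) V(3)] by metis
    have "inj_on F N"
    proof (rule inj_onI)
      fix x y assume xy: "x \<in> N" "y \<in> N" "F x = F y"
      then have "G x = G y" using N(5)[of x] N(5)[of y] by simp
      then show "x = y" using inj_onD[OF V(2)] xy N(4) by blast
    qed
    moreover have "local_primitive X N F" using X.lp_subset[OF U(1)] N(1,3) sf by simp
    ultimately show ?thesis using X.injective_primitive_regular N(2) by blast
  qed
  ultimately show ?thesis unfolding form_zeros_def[of X] form_zeros_def[of Y] using sf
    by (smt (verit, best) Collect_cong form_zeros_def mem_Collect_eq)
qed

text \<open>The hypothesis on k says that the stretch scales the line through v by k. On this line a
  development of X, run at speed 1 / k, is one of Y.\<close>

lemma degenerate_teich:
  assumes X: "riemann_form X" and Y: "riemann_form Y" and t: "teich_deformation s X Y"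
    and k: "k > 0" "\<And>t. teich_stretch s (of_real t * v) = of_real (k * t) * v" and d: "degenerate X v l"
  shows "degenerate Y v (k * l)"
proof -
  interpret X: riemann_form X by fact
  interpret Y: riemann_form Y by fact
  have sf: "surf Y = surf X" and lp: "\<And>U F. local_primitive X U F \<Longrightarrow> local_primitive Y U (teich_stretch s \<circ> F)"
    using t unfolding teich_deformation_def by auto
  have zeros: "form_zeros Y = form_zeros X" by (rule teich_zeros[OF X Y t])
  have reg: "regular_points Y = regular_points X" unfolding regular_points_def zeros sf ..
  have k0: "complex_of_real k \<noteq> 0" using k(1) by simp
  have dv: "dev Y T (\<lambda>z. g (z / of_real k))" if g: "dev X S g" and S: "S \<subseteq> range (\<lambda>t. of_real t * v)"
    and T: "\<And>z. z \<in> T \<Longrightarrow> z / of_real k \<in> S" for S T g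
  proof (rule Y.devI)
    have "continuous_map (top_of_set T) (top_of_set S) (\<lambda>z. z / of_real k)"
      using T k0 by (auto simp: continuous_map_in_subtopology intro!: continuous_intros)
    from continuous_map_compose[OF this] g
    show "continuous_map (top_of_set T) (surf Y) (\<lambda>z. g (z / of_real k))" unfolding dev_def o_def sf by blast
    show "(\<lambda>z. g (z / of_real k)) ` T \<subseteq> regular_points Y" using X.dev_regular[OF g] T reg by blast
    fix z assume z: "z \<in> T"
    let ?z = "z / of_real k"
    obtain U F where U: "local_primitive X U F" "g ?z \<in> U" using X.lp_exists[OF X.dev_topspace[OF g T[OF z]]] .
    have "\<forall>\<^sub>F w in at ?z within S. F (g w) - F (g ?z) = w - ?z" using g T[OF z] U unfolding dev_def by blast
    then obtain e where e: "e > 0" "\<And>w. w \<in> S \<Longrightarrow> w \<noteq> ?z \<Longrightarrow> dist w ?z < e \<Longrightarrow> F (g w) - F (g ?z) = w - ?z"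
      unfolding eventually_at by blast
    have "\<forall>\<^sub>F w in at z within T. (teich_stretch s \<circ> F) (g (w / of_real k)) - (teich_stretch s \<circ> F) (g ?z) = w - z"
      unfolding eventually_at
    proof (intro exI[of _ "k * e"] conjI ballI impI)
      show "k * e > 0" using k e by simp
      fix w assume w: "w \<in> T" "w \<noteq> z \<and> dist w z < k * e"
      have "dist (w / of_real k) ?z = dist w z / k"
        using k(1) by (simp add: dist_norm norm_divide flip: diff_divide_distrib)
      also have "\<dots> < e" using w k(1) by (simp add: field_simps)
      finally have F: "F (g (w / of_real k)) - F (g ?z) = w / of_real k - ?z"
        using e(2)[OF T[OF w(1)]] w(2) k0 by simp
      obtain a b where ab: "w / of_real k = of_real a * v" "?z = of_real b * v" using T[OF w(1)] T[OF z] S by blast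
      have "teich_stretch s (w / of_real k - ?z) = teich_stretch s (of_real (a - b) * v)"
        unfolding ab by (simp add: algebra_simps)
      also have "\<dots> = of_real k * (of_real a * v - of_real b * v)" unfolding k(2) by (simp add: algebra_simps)
      also have "\<dots> = w - z" unfolding ab[symmetric] using k0 by (simp add: right_diff_distrib)
      finally show "(teich_stretch s \<circ> F) (g (w / of_real k)) - (teich_stretch s \<circ> F) (g ?z) = w - z"
        unfolding o_def teich_stretch_diff F .
    qed
    then show "\<exists>U F. local_primitive Y U F \<and> g ?z \<in> U \<and>
       (\<forall>\<^sub>F w in at z within T. F (g (w / of_real k)) - F (g ?z) = w - z)"
      using lp[OF U(1)] U(2) by blast
  qed
  have kl: "of_real (k * l) * v = of_real k * (of_real l * v)" by simp
  from X d show ?thesis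
  proof (cases rule: degenerateE)
    case (1 g)
    have "dev Y (closed_segment 0 (of_real (k * l) * v)) (\<lambda>z. g (z / of_real k))"
    proof (rule dv[OF 1(2)])
      show "closed_segment 0 (of_real l * v) \<subseteq> range (\<lambda>t. of_real t * v)" using segment_param_iff[of _ 0 l v] by auto
      fix z assume "z \<in> closed_segment 0 (of_real (k * l) * v)"
      then show "z / of_real k \<in> closed_segment 0 (of_real l * v)"
        using k0 by (auto simp: in_segment scaleR_conv_of_real)
    qed
    moreover have "of_real (k * l) * v / of_real k = of_real l * v" using k0 by simp
    ultimately show ?thesis using 1(1,3) k by (intro degenerateI_closed[OF Y, of _ _ "\<lambda>z. g (z / of_real k)"]) auto
  next
    case (2 g z z')
    have seg: "z / of_real k \<in> open_segment 0 (of_real l * v) \<longleftrightarrow> z \<in> open_segment 0 (of_real (k * l) * v)" for z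
    proof -
      have "(z / of_real k = u *\<^sub>R (of_real l * v)) \<longleftrightarrow> (z = u *\<^sub>R (of_real (k * l) * v))" for u
        using k0 by (auto simp: scaleR_conv_of_real field_simps)
      then show ?thesis using k0 unfolding in_segment by auto
    qed
    have gd: "dev Y (open_segment 0 (of_real (k * l) * v)) (\<lambda>z. g (z / of_real k))"
    proof (rule dv[OF 2(2)])
      show "open_segment 0 (of_real l * v) \<subseteq> range (\<lambda>t. of_real t * v)"
        using segment_param_iff[of _ 0 l v] segment_open_subset_closed by fastforce
    qed (use seg in blast)
    have scale: "\<exists>w\<in>open_segment 0 (of_real (k * l) * v). dist w (of_real k * a) < e \<and> g (w / of_real k) \<in> N"
      if ex: "\<exists>w\<in>open_segment 0 (of_real l * v). dist w a < e / k \<and> g w \<in> N" for a e N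
    proof -
      obtain w where w: "w \<in> open_segment 0 (of_real l * v)" "dist w a < e / k" "g w \<in> N" using ex by blast
      have "dist (of_real k * w) (of_real k * a) = k * dist w a"
        using k(1) by (simp add: dist_norm norm_mult flip: right_diff_distrib)
      then have "dist (of_real k * w) (of_real k * a) < e" using w(2) k(1) by (simp add: field_simps)
      then show ?thesis using w seg[of "of_real k * w"] k0 by (intro bexI[of _ "of_real k * w"]) auto
    qed
    show ?thesis
    proof (rule degenerateI_open[OF Y _ gd])
      show "k * l > 0" using k 2(1) by simp
      show "z \<in> form_zeros Y" "z' \<in> form_zeros Y" using 2 zeros by auto
      fix N and e :: real assume N: "openin (surf Y) N" and e: "e > 0"
      have ek: "e / k > 0" using e k by simp
      show "\<exists>w\<in>open_segment 0 (of_real (k * l) * v). dist w 0 < e \<and> g (w / of_real k) \<in> N" if "z \<in> N"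
        using scale[of 0 e N] 2(5)[OF _ that ek] N sf by simp
      show "\<exists>w\<in>open_segment 0 (of_real (k * l) * v). dist w (of_real (k * l) * v) < e \<and> g (w / of_real k) \<in> N" if "z' \<in> N"
        using scale[of "of_real l * v" e N, folded kl] 2(6)[OF _ that ek] N sf by simp
    qed
  qed
qed

text \<open>For each j the event that \<open>T j x\<close> lies in \<open>B n\<close> has the
  probability of \<open>B n\<close>, so it happens infinitely often with at least that probability,
  which tends to 1 as n grows.\<close>

lemma (in prob_space) recurrence:
  fixes T :: "nat \<Rightarrow> 'a \<Rightarrow> 'a" and B :: "nat \<Rightarrow> 'a set"
  assumes T: "\<And>j. T j \<in> measurable M M" "\<And>j. distr M M (T j) = M"
    and B: "\<And>n. B n \<in> sets M" "incseq B" "(\<Union>n. B n) = space M"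
  shows "AE x in M. \<exists>n. \<forall>m. \<exists>j\<ge>m. T j x \<in> B n"
proof -
  let ?A = "\<lambda>n j. T j -` B n \<inter> space M"
  have A: "?A n j \<in> events" for n j using measurable_sets[OF T(1) B(1)] .
  have pA: "prob (?A n j) = prob (B n)" for n j
    using measure_distr[OF T(1)[of j] B(1)[of n]] T(2) by simp
  define E where "E n = (\<Inter>m. \<Union>j\<in>{m..}. ?A n j)" for n
  have U: "(\<Union>j\<in>{m..}. ?A n j) \<in> events" for n m using A by (intro sets.countable_UN') auto
  have E: "E n \<in> events" for n unfolding E_def using U by (intro sets.countable_INT) auto
  have pE: "prob (B n) \<le> prob (E n)" for n
    unfolding E_def
  proof (rule LIMSEQ_le_const[OF finite_Lim_measure_decseq])
    show "range (\<lambda>m. \<Union>j\<in>{m..}. ?A n j) \<subseteq> events" using U by auto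
    show "decseq (\<lambda>m. \<Union>j\<in>{m..}. ?A n j)" unfolding decseq_def by (intro allI impI UN_mono) auto
    show "\<exists>N. \<forall>m\<ge>N. prob (B n) \<le> prob (\<Union>j\<in>{m..}. ?A n j)"
    proof (intro exI allI impI)
      fix m :: nat
      have "?A n m \<subseteq> (\<Union>j\<in>{m..}. ?A n j)" by auto
      from finite_measure_mono[OF this U] show "prob (B n) \<le> prob (\<Union>j\<in>{m..}. ?A n j)" using pA by simp
    qed
  qed
  have "(\<lambda>n. prob (B n)) \<longlonglongrightarrow> prob (\<Union>n. B n)"
    by (rule finite_Lim_measure_incseq) (use B in auto)
  then have lim: "(\<lambda>n. prob (B n)) \<longlonglongrightarrow> 1" using B(3) prob_space by simp
  have EU: "(\<Union>n. E n) \<in> events" using E by auto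
  have "1 \<le> prob (\<Union>n. E n)"
  proof (rule LIMSEQ_le_const2[OF lim])
    show "\<exists>N. \<forall>n\<ge>N. prob (B n) \<le> prob (\<Union>n. E n)"
    proof (intro exI allI impI)
      fix n :: nat
      have "prob (E n) \<le> prob (\<Union>n. E n)" by (rule finite_measure_mono[OF _ EU]) blast
      then show "prob (B n) \<le> prob (\<Union>n. E n)" using pE[of n] by simp
    qed
  qed
  then have "prob (\<Union>n. E n) = 1" using prob_le_1 by (simp add: antisym)
  then have "AE x in M. x \<in> (\<Union>n. E n)" using prob_eq_1[OF EU] by simp
  then show ?thesis
  proof eventually_elim
    case (elim x)
    then obtain n where "x \<in> E n" by blast
    then have "\<exists>j\<ge>m. T j x \<in> B n" for m unfolding E_def by blast
    then show ?case by blast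
  qed
qed

section \<open>Strata\<close>

lemma form_isomorphic_refl:
  assumes "riemann_form X" shows "form_isomorphic X X"
proof -
  interpret riemann_form X by fact
  have e: "{p \<in> dom_of c. id p \<in> dom_of d} = dom_of c \<inter> dom_of d" for c d :: "'a chart" by auto
  show ?thesis unfolding form_isomorphic_def
  proof (intro exI[of _ id] conjI ballI)
    show "homeomorphic_map (surf X) (surf X) id" by simp
    fix c d assume cd: "c \<in> charts X" "d \<in> charts X"
    show "(coord d \<circ> id \<circ> param c) holomorphic_on coord c ` {p \<in> dom_of c. id p \<in> dom_of d}"
      unfolding e using transition_holo[OF cd] by simp
    fix z assume "z \<in> coord c ` {p \<in> dom_of c. id p \<in> dom_of d}"
    then show "coef X d ((coord d \<circ> id \<circ> param c) z) * deriv (coord d \<circ> id \<circ> param c) z = coef X c z"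
      using coef_transition[OF cd] cd(1) by auto
  qed
qed

lemma stratum_iso_class:
  assumes "C \<in> stratum \<rho> \<kappa>"
  obtains X where "X \<in> C" "C = iso_class \<rho> X" "abelian_differential \<rho> X" "has_zero_orders X \<kappa>"
  using assms form_isomorphic_refl[OF abelian_riemann_form] unfolding stratum_def iso_class_def by blast

text \<open>Any two members are isomorphic to the same defining form, and near-isometries with
  tolerance 0 can be inverted and composed.\<close>

lemma stratum_class_near:
  assumes C: "C \<in> stratum \<rho> \<kappa>" and XY: "X \<in> C" "Y \<in> C"
  shows "abelian_differential \<rho> X" "form_near 0 X Y" "finite (form_zeros X)"
proof -
  obtain Z where Z: "C = iso_class \<rho> Z" "abelian_differential \<rho> Z" "has_zero_orders Z \<kappa>" using stratum_iso_class[OF C] .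
  have ab: "abelian_differential \<rho> X" "abelian_differential \<rho> Y" and iso: "form_isomorphic Z X" "form_isomorphic Z Y"
    using XY unfolding Z(1) iso_class_def by auto
  note r = abelian_riemann_form[OF Z(2)] abelian_riemann_form[OF ab(1)] abelian_riemann_form[OF ab(2)]
  have n: "form_near 0 Z X" "form_near 0 Z Y"
    using isomorphic_form_near[OF r(1,2) iso(1)] isomorphic_form_near[OF r(1,3) iso(2)] by auto
  show "abelian_differential \<rho> X" by fact
  show "form_near 0 X Y" using form_near_trans[OF r(1) form_near_sym[OF r(1,2) n(1)] n(2)] by simp
  have "finite (form_zeros Z)" using Z(3) unfolding has_zero_orders_def using bij_betw_finite by blast
  moreover obtain f where "f ` form_zeros Z = form_zeros X" using n(1) unfolding form_near_iff by blast
  ultimately show "finite (form_zeros X)" by (metis finite_imageI)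
qed

text \<open>W is a ball of radius 1/4 around a representative of C. The strict inequality leaves
  room for composing tolerances, which makes W open; representatives of one class are at distance 0,
  so the length bound passes to each of them.\<close>

lemma neighbourhood_without_short_leaves:
  assumes C: "C \<in> stratum \<rho> \<kappa>"
  obtains W c where "stratum_open \<rho> \<kappa> W" "C \<in> W" "c > 0"
    "\<And>D Y v l. D \<in> W \<Longrightarrow> Y \<in> D \<Longrightarrow> cmod v = 1 \<Longrightarrow> degenerate Y v l \<Longrightarrow> l > c"
proof -
  obtain X where X: "X \<in> C" using stratum_iso_class[OF C] by metis
  note sX = stratum_class_near[OF C X X]
  have rX: "riemann_form X" by (rule abelian_riemann_form[OF sX(1)])
  interpret X: finite_zeros_form X using rX sX(3) by (simp add: finite_zeros_form_def finite_zeros_form_axioms_def)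
  obtain c where c: "c > 0" "\<forall>p\<in>topspace (surf X). \<exists>V F. X.primitive_nbhd p c V F"
    using X.uniform_primitive_nbhd by blast
  define W where "W = {D \<in> stratum \<rho> \<kappa>. \<exists>\<epsilon>. 0 \<le> \<epsilon> \<and> \<epsilon> < 1/4 \<and> (\<exists>Y\<in>D. form_near \<epsilon> X Y)}"
  show ?thesis
  proof (rule that[of W "c / 2"])
    show "C \<in> W" unfolding W_def using C X form_near_refl[OF rX] by (auto intro!: exI[of _ 0])
    show "c / 2 > 0" using c by simp
    show "stratum_open \<rho> \<kappa> W" unfolding stratum_open_def
    proof (intro conjI ballI)
      show "W \<subseteq> stratum \<rho> \<kappa>" unfolding W_def by blast
      fix D assume "D \<in> W"
      then obtain \<epsilon> Y where D: "D \<in> stratum \<rho> \<kappa>" and \<epsilon>: "0 \<le> \<epsilon>" "\<epsilon> < 1/4" and Y: "Y \<in> D" "form_near \<epsilon> X Y"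
        unfolding W_def by blast
      \<comment> \<open>The composed tolerance \<epsilon> + \<delta> + \<epsilon> \<delta> is at
        most \<epsilon> + 2 \<delta>, which stays below 1/4 if \<delta> is a quarter of the
        remaining distance.\<close>
      define \<delta> where "\<delta> = (1/4 - \<epsilon>) / 4"
      have \<delta>: "\<delta> > 0" using \<epsilon> unfolding \<delta>_def by simp
      have "\<epsilon> * \<delta> \<le> 1 * \<delta>" by (rule mult_right_mono) (use \<epsilon> \<delta> in auto)
      moreover have "\<epsilon> + 2 * \<delta> < 1/4" using \<epsilon> unfolding \<delta>_def by (simp add: field_simps)
      ultimately have sum: "\<epsilon> + \<delta> + \<epsilon> * \<delta> < 1/4" by linarith
      show "\<exists>\<epsilon>>0. \<forall>E\<in>stratum \<rho> \<kappa>. class_near \<epsilon> D E \<longrightarrow> E \<in> W"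
      proof (intro exI[of _ \<delta>] conjI ballI impI \<delta>)
        fix E assume E: "E \<in> stratum \<rho> \<kappa>" and "class_near \<delta> D E"
        then obtain Y' Z where Z: "Y' \<in> D" "Z \<in> E" "form_near \<delta> Y' Z" unfolding class_near_def by blast
        have "form_near (\<epsilon> + 0 + \<epsilon> * 0) X Y'"
          by (rule form_near_trans[OF _ Y(2) stratum_class_near(2)[OF D Y(1) Z(1)] \<epsilon>(1)])
            (use abelian_riemann_form[OF stratum_class_near(1)[OF D Y(1) Y(1)]] in auto)
        then have "form_near (\<epsilon> + \<delta> + \<epsilon> * \<delta>) X Z"
          by (intro form_near_trans[OF _ _ Z(3) \<epsilon>(1)])
            (use \<delta> abelian_riemann_form[OF stratum_class_near(1)[OF D Z(1) Z(1)]] in auto)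
        moreover have "0 \<le> \<epsilon> + \<delta> + \<epsilon> * \<delta>" using \<epsilon> \<delta> by simp
        ultimately show "E \<in> W" unfolding W_def using E Z(2) sum by blast
      qed
    qed
    fix D Y v l assume "D \<in> W" and Y: "Y \<in> D" and v: "cmod v = 1" and d: "degenerate Y v l"
    then obtain \<epsilon> Y0 where D: "D \<in> stratum \<rho> \<kappa>" and \<epsilon>: "0 \<le> \<epsilon>" "\<epsilon> < 1/4" and Y0: "Y0 \<in> D" "form_near \<epsilon> X Y0"
      unfolding W_def by blast
    have "form_near (\<epsilon> + 0 + \<epsilon> * 0) X Y"
      by (rule form_near_trans[OF _ Y0(2) stratum_class_near(2)[OF D Y0(1) Y] \<epsilon>(1)])
        (use abelian_riemann_form[OF stratum_class_near(1)[OF D Y0(1) Y0(1)]] in auto)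
    then have "form_near (1/4) X Y" using \<epsilon> form_near_mono[of \<epsilon> X Y "1/4"] by simp
    moreover have "riemann_form Y" by (rule abelian_riemann_form[OF stratum_class_near(1)[OF D Y Y]])
    ultimately show "l > c / 2" using degenerate_length_bound[OF rX _ v _ c(1) _ d] c(2) by blast
  qed
qed

text \<open>At the times \<open>s j\<close> the flow scales lengths in direction v by
  \<open>k j\<close>, so a degenerate leaf becomes arbitrarily short. Yet almost every class returns
  infinitely often to a set \<open>B n\<close> on which such leaves are longer than a fixed
  bound.\<close>

lemma almost_no_degenerate:
  fixes P :: "'a surface_form set measure"
  assumes P: "borel_probability_on (subtopology (stratum_topology \<rho> \<kappa>) \<H>) P"
    and inv: "invariant_ergodic P (teich_flow \<rho>)" and v: "cmod v = 1"
    and k: "\<And>j::nat. k j > 0" "k \<longlonglongrightarrow> 0" "\<And>j t. teich_stretch (s j) (of_real t * v) = of_real (k j * t) * v"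
  shows "AE C in P. \<forall>X\<in>C. \<forall>l. \<not> degenerate X v l"
proof -
  let ?T = "stratum_topology \<rho> \<kappa> :: 'a surface_form set topology"
  have pr: "prob_space P" and sp: "space P = topspace (subtopology ?T \<H>)"
    and st: "sets P = sigma_sets (topspace (subtopology ?T \<H>)) {U. openin (subtopology ?T \<H>) U}"
    using P unfolding borel_probability_on_def by auto
  interpret prob_space P by (rule pr)
  have g: "teich_flow \<rho> t \<in> measurable P P" "distr P P (teich_flow \<rho> t) = P" for t
    using inv unfolding invariant_ergodic_def by auto
  have spS: "C \<in> stratum \<rho> \<kappa>" if "C \<in> space P" for C
  proof -
    have "C \<in> topspace ?T" using that sp by simp
    then obtain U where "openin ?T U" "C \<in> U" using openin_topspace by blast
    then show ?thesis unfolding openin_stratum_topology stratum_open_def by blast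
  qed
  \<comment> \<open>Only unions of open sets enter below, hence Borel sets; the length of a shortest
    degenerate leaf is never treated as a measurable function.\<close>
  define long :: "real \<Rightarrow> 'a surface_form set set \<Rightarrow> bool"
    where "long c W \<longleftrightarrow> stratum_open \<rho> \<kappa> W \<and> (\<forall>D\<in>W. \<forall>Y\<in>D. \<forall>l. degenerate Y v l \<longrightarrow> l > c)" for c W
  define B where "B n = \<Union>{W. long (inverse (real (Suc n))) W} \<inter> space P" for n
  have Bm: "B n \<in> sets P" for n
  proof -
    have "openin ?T (\<Union>{W. long (inverse (real (Suc n))) W})"
      by (rule openin_Union) (auto simp: openin_stratum_topology long_def)
    then have "openin (subtopology ?T \<H>) (\<Union>{W. long (inverse (real (Suc n))) W} \<inter> \<H>)"
      by (auto simp: openin_subtopology)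
    moreover have "B n = \<Union>{W. long (inverse (real (Suc n))) W} \<inter> \<H>"
      using openin_subset[OF \<open>openin ?T _\<close>] unfolding B_def sp by auto
    ultimately show ?thesis unfolding st by auto
  qed
  have Binc: "incseq B"
  proof (rule incseq_SucI)
    fix n
    have "inverse (real (Suc (Suc n))) \<le> inverse (real (Suc n))" by (intro le_imp_inverse_le) auto
    then have "long (inverse (real (Suc n))) W \<Longrightarrow> long (inverse (real (Suc (Suc n)))) W" for W
      unfolding long_def by (meson le_less_trans)
    then show "B n \<le> B (Suc n)" unfolding B_def by auto
  qed
  have Bun: "(\<Union>n. B n) = space P"
  proof
    show "space P \<subseteq> (\<Union>n. B n)"
    proof
      fix C assume C: "C \<in> space P"
      obtain W c where W: "stratum_open \<rho> \<kappa> W" "C \<in> W" "c > 0"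
        "\<And>D Y v l. D \<in> W \<Longrightarrow> Y \<in> D \<Longrightarrow> cmod v = 1 \<Longrightarrow> degenerate Y v l \<Longrightarrow> l > c"
        using neighbourhood_without_short_leaves[OF spS[OF C]] by metis
      obtain n where n: "inverse (real (Suc n)) < c" using reals_Archimedean[OF W(3)] by auto
      have "long (inverse (real (Suc n))) W" unfolding long_def using W(1,4) v n by (meson less_trans)
      then show "C \<in> (\<Union>n. B n)" unfolding B_def using W(2) C by blast
    qed
  qed (auto simp: B_def)
  have "AE C in P. \<exists>n. \<forall>m. \<exists>j\<ge>m. teich_flow \<rho> (s j) C \<in> B n"
    by (rule recurrence[OF g Bm Binc Bun])
  moreover have "AE C in P. C \<in> space P" by (rule AE_space)
  ultimately show ?thesis
  proof eventually_elim
    case (elim C)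
    then obtain n where n: "\<forall>m. \<exists>j\<ge>m. teich_flow \<rho> (s j) C \<in> B n" by blast
    show ?case
    proof (intro ballI allI notI)
      fix X l assume X: "X \<in> C" and d: "degenerate X v l"
      have C: "C \<in> stratum \<rho> \<kappa>" using spS elim by blast
      have "(\<lambda>j. k j * l) \<longlonglongrightarrow> 0 * l" by (intro tendsto_intros k)
      then have "\<forall>\<^sub>F j in sequentially. k j * l < inverse (real (Suc n))"
        by (rule order_tendstoD) simp
      then obtain m where m: "\<And>j. j \<ge> m \<Longrightarrow> k j * l < inverse (real (Suc n))" unfolding eventually_sequentially by blast
      obtain j where j: "j \<ge> m" "teich_flow \<rho> (s j) C \<in> B n" using n by blast
      then obtain W where W: "long (inverse (real (Suc n))) W" "teich_flow \<rho> (s j) C \<in> W" unfolding B_def by blast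
      then have D: "teich_flow \<rho> (s j) C \<in> stratum \<rho> \<kappa>" unfolding long_def stratum_open_def by blast
      obtain Y where Y: "Y \<in> teich_flow \<rho> (s j) C" using stratum_iso_class[OF D] by metis
      then obtain X' where X': "X' \<in> C" "teich_deformation (s j) X' Y" and aY: "abelian_differential \<rho> Y"
        unfolding teich_flow_def by blast
      have r: "riemann_form X" "riemann_form X'" "riemann_form Y"
        using abelian_riemann_form stratum_class_near(1)[OF C X X] stratum_class_near(1)[OF C X'(1) X'(1)] aY by auto
      \<comment> \<open>\<open>teich_flow\<close> deforms some representative of the class, possibly
        another one than X.\<close>
      have "degenerate X' v l" by (rule degenerate_transfer[OF r(1,2) stratum_class_near(2)[OF C X X'(1)] d])
      then have "degenerate Y v (k j * l)" using degenerate_teich[OF r(2,3) X'(2) k(1) k(3)] by blast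
      then have "k j * l > inverse (real (Suc n))" using W Y unfolding long_def by blast
      then show False using m[OF j(1)] by simp
    qed
  qed
qed

theorem proposition1p18:
  fixes \<rho> :: nat and \<kappa> :: "nat list"
    and \<H> :: "'a surface_form set set" and P :: "'a surface_form set measure"
  assumes "2 \<le> \<rho>" and "sum_list \<kappa> = 2 * \<rho> - 2"
    and "\<H> \<in> connected_components_of (stratum_topology \<rho> \<kappa>)"
    and "borel_probability_on (subtopology (stratum_topology \<rho> \<kappa>) \<H>) P"
    and "invariant_ergodic P (teich_flow \<rho>)"
  shows "AE C in P. \<forall>X\<in>C. \<exists>T\<^sub>a\<^sub>t\<^sub>o\<^sub>m :: real set. closure T\<^sub>a\<^sub>t\<^sub>o\<^sub>m = UNIV \<and>
           (\<forall>\<tau>\<in>T\<^sub>a\<^sub>t\<^sub>o\<^sub>m. \<forall>\<Phi>\<in>cocycles_plus X. \<Phi> \<noteq> (\<lambda>_ _. 0) \<longrightarrow>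
              admits_atoms (normalized_distribution X \<Phi> \<tau>))"
proof -
  have lim: "(\<lambda>j::nat. exp (- real j)) \<longlonglongrightarrow> 0"
    by (intro filterlim_compose[OF exp_at_bot] filterlim_compose[OF filterlim_uminus_at_bot_at_top] filterlim_real_sequentially)
  \<comment> \<open>Time - j multiplies horizontal lengths by exp (- j), and time j does the same to
    vertical lengths.\<close>
  have h: "AE C in P. \<forall>X\<in>C. \<forall>l. \<not> degenerate X 1 l"
    by (rule almost_no_degenerate[OF assms(4,5) _ _ lim, of 1 "\<lambda>j. - real j"])
      (auto simp: teich_stretch_def complex_eq_iff)
  have w: "AE C in P. \<forall>X\<in>C. \<forall>l. \<not> degenerate X \<i> l"
    by (rule almost_no_degenerate[OF assms(4,5) _ _ lim, of \<i> "\<lambda>j. real j"])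
      (auto simp: teich_stretch_def complex_eq_iff)
  have "AE C in P. C \<in> space P" by (rule AE_space)
  with h w show ?thesis
  proof eventually_elim
    case (elim C)
    have "C \<in> topspace (stratum_topology \<rho> \<kappa>)" using elim(3) assms(4) unfolding borel_probability_on_def by simp
    then obtain U where "stratum_open \<rho> \<kappa> U" "C \<in> U" using openin_topspace openin_stratum_topology by metis
    then have C: "C \<in> stratum \<rho> \<kappa>" unfolding stratum_open_def by blast
    show ?case
    proof
      fix X assume X: "X \<in> C"
      note sX = stratum_class_near[OF C X X]
      interpret finite_zeros_form X
        using abelian_riemann_form[OF sX(1)] sX(3) by (simp add: finite_zeros_form_def finite_zeros_form_axioms_def)
      have "nonzero_form X" using sX(1) unfolding abelian_differential_def by blast
      from dense_atoms[OF _ _ this] elim(1,2) X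
      show "\<exists>T\<^sub>a\<^sub>t\<^sub>o\<^sub>m :: real set. closure T\<^sub>a\<^sub>t\<^sub>o\<^sub>m = UNIV \<and>
           (\<forall>\<tau>\<in>T\<^sub>a\<^sub>t\<^sub>o\<^sub>m. \<forall>\<Phi>\<in>cocycles_plus X. \<Phi> \<noteq> (\<lambda>_ _. 0) \<longrightarrow>
              admits_atoms (normalized_distribution X \<Phi> \<tau>))" by blast
    qed
  qed
qed

end
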